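(* Let $m\geq 2$ be an integer, let $\Gamma(m)=\ker\big(SL_2(\mathbb{Z})\to SL_2(\mathbb{Z}/m)\big)$, let $\lambda:B_3\to SL_2(\mathbb{Z})$ be the natural surjection from the braid group on three strands, and let $B_{\Gamma(m)}=\lambda^{-1}(\Gamma(m))\subset B_3$. Let $M=\mathbb{Z}[x,y]=\bigoplus_{n\ge0}M_n$ with $M_n$ the homogeneous polynomials of degree $n$, and write $\mathbb{Z}_2=\mathbb{Z}/2$. The cohomology of $B_{\Gamma(m)}$ with coefficients in $M$ is given, up to isomorphism of abelian groups, as follows. (a) For $m=2$ and $n=0$: $H^0(B_{\Gamma(2)};M_0)=\mathbb{Z}$, $H^1(B_{\Gamma(2)};M_0)=\mathbb{Z}^3$, $H^2(B_{\Gamma(2)};M_0)=\mathbb{Z}^2$, and all other cohomology groups are zero. (b) For $m=2$ and even $n>0$: $H^0(B_{\Gamma(2)};M_n)=H^0(\Gamma(2);M_n)$, $H^1(B_{\Gamma(2)};M_n)=H^2(B_{\Gamma(2)};M_n)=H^1(\Gamma(2);M_n)$, and all other cohomology groups are zero. (c) For $m=2$ and odd $n$: $H^1(B_{\Gamma(2)};M_n)=H^1(\Gamma(2);M_n)=M_n\otimes\mathbb{Z}_2$, $H^2(B_{\Gamma(2)};M_n)=H^2(\Gamma(2);M_n)=(M_n\oplus M_n)\otimes\mathbb{Z}_2$, and all other cohomology groups $H^i(B_{\Gamma(2)};M_n)$ are zero. (d) For any $m>2$ (and any $n\ge 0$): $H^*(B_{\Gamma(m)};M_n)=H^*(\Gamma(m);M_n)\otimes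 H^*(\mathbb{Z};\mathbb{Z})$ as graded abelian groups.
   Context: $SL_2(\mathbb{Z})$ is generated by $s_1=\begin{pmatrix}1&0\\-1&1\end{pmatrix}$ and $s_2=\begin{pmatrix}1&1\\0&1\end{pmatrix}$. It acts on $M=\mathbb{Z}[x,y]$ by ring automorphisms with $s_1:x\mapsto x-y,\ y\mapsto y$ and $s_2:x\mapsto x,\ y\mapsto x+y$ (the natural action on $\mathbb{Z}^2$ extended to the symmetric algebra); each $M_n$ is a submodule. The homomorphism $\lambda:B_3\to SL_2(\mathbb{Z})$ sends the standard generators $\sigma_1,\sigma_2$ of $B_3$ to $s_1,s_2$ respectively. Its kernel is infinite cyclic, namely the subgroup of squares of elements of the center of $B_3$. $B_3$ and its subgroups act on $M$ through $\lambda$. $H^*(G;N)$ denotes group cohomology with coefficients in the $G$-module $N$; $H^*(\mathbb{Z};\mathbb{Z})$ is the cohomology of the infinite cyclic group with trivial coefficients; the tensor product in (d) is the graded tensor product over $\mathbb{Z}$. *)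

theory Defs
  imports
    "HOL-Analysis.Determinants"
    "HOL-Algebra.Free_Abelian_Groups"
    "HOL-Library.Poly_Mapping"
    "HOL-Library.Product_Plus"
begin

section \<open>Group cohomology\<close>

text \<open>
  Cohomology of \<open>G\<close> with coefficients in a \<open>G\<close>-module, computed by the inhomogeneous bar
  complex.  The module is an abelian group \<open>N\<close>, written multiplicatively as usual in HOL-Algebra,
  with a left action \<open>act\<close> of \<open>G\<close>.  An \<open>n\<close>-cochain is a function on \<open>n\<close>-tuples of elements of
  \<open>G\<close> (lists of length \<open>n\<close>), and cochains are multiplied pointwise.
\<close>

definition tuples :: "('g, 'c) monoid_scheme \<Rightarrow> nat \<Rightarrow> 'g list set" where
  "tuples G n = {gs. length gs = n \<and> set gs \<subseteq> carrier G}"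

definition cochains ::
  "('g, 'c) monoid_scheme \<Rightarrow> ('n, 'd) monoid_scheme \<Rightarrow> nat \<Rightarrow> ('g list \<Rightarrow> 'n) monoid" where
  "cochains G N n = product_group (tuples G n) (\<lambda>_. N)"

definition merge_at :: "('g, 'c) monoid_scheme \<Rightarrow> nat \<Rightarrow> 'g list \<Rightarrow> 'g list" where
  "merge_at G i gs = take i gs @ (gs ! i \<otimes>\<^bsub>G\<^esub> gs ! Suc i) # drop (Suc (Suc i)) gs"

text \<open>
  In additive notation \<open>(d f)(g\<^sub>0, \<dots>, g\<^sub>n)\<close> is
  \<open>g\<^sub>0 \<cdot> f(g\<^sub>1, \<dots>, g\<^sub>n) + (\<Sum>i<n. (-1)\<^bsup>i+1\<^esup> f(\<dots>, g\<^sub>i g\<^bsub>i+1\<^esub>, \<dots>)) + (-1)\<^bsup>n+1\<^esup> f(g\<^sub>0, \<dots>, g\<^bsub>n-1\<^esub>)\<close>.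
\<close>

definition coboundary ::
  "('g, 'c) monoid_scheme \<Rightarrow> ('n, 'd) monoid_scheme \<Rightarrow> ('g \<Rightarrow> 'n \<Rightarrow> 'n) \<Rightarrow> nat
    \<Rightarrow> ('g list \<Rightarrow> 'n) \<Rightarrow> ('g list \<Rightarrow> 'n)" where
  "coboundary G N act n f =
     (\<lambda>gs \<in> tuples G (Suc n).
        act (hd gs) (f (tl gs))
        \<otimes>\<^bsub>N\<^esub> finprod N (\<lambda>i. f (merge_at G i gs) [^]\<^bsub>N\<^esub> ((-1) ^ Suc i :: int)) {..<n}
        \<otimes>\<^bsub>N\<^esub> f (butlast gs) [^]\<^bsub>N\<^esub> ((-1) ^ Suc n :: int))"

definition cocycles ::
  "('g, 'c) monoid_scheme \<Rightarrow> ('n, 'd) monoid_scheme \<Rightarrow> ('g \<Rightarrow> 'n \<Rightarrow> 'n) \<Rightarrow> nat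
    \<Rightarrow> ('g list \<Rightarrow> 'n) set" where
  "cocycles G N act n = kernel (cochains G N n) (cochains G N (Suc n)) (coboundary G N act n)"

fun coboundaries ::
  "('g, 'c) monoid_scheme \<Rightarrow> ('n, 'd) monoid_scheme \<Rightarrow> ('g \<Rightarrow> 'n \<Rightarrow> 'n) \<Rightarrow> nat
    \<Rightarrow> ('g list \<Rightarrow> 'n) set" where
  "coboundaries G N act 0 = {\<one>\<^bsub>cochains G N 0\<^esub>}"
| "coboundaries G N act (Suc n) = coboundary G N act n ` carrier (cochains G N n)"

definition group_cohomology ::
  "('g, 'c) monoid_scheme \<Rightarrow> ('n, 'd) monoid_scheme \<Rightarrow> ('g \<Rightarrow> 'n \<Rightarrow> 'n) \<Rightarrow> nat
    \<Rightarrow> ('g list \<Rightarrow> 'n) set monoid" where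
  "group_cohomology G N act n =
     (cochains G N n)\<lparr>carrier := cocycles G N act n\<rparr> Mod coboundaries G N act n"


section \<open>Tensor products of abelian groups\<close>

definition bilinear_relations ::
  "('a, 'c) monoid_scheme \<Rightarrow> ('b, 'd) monoid_scheme \<Rightarrow> ('a \<times> 'b \<Rightarrow>\<^sub>0 int) set" where
  "bilinear_relations A B =
     {frag_of (a \<otimes>\<^bsub>A\<^esub> a', b) - frag_of (a, b) - frag_of (a', b) | a a' b.
        a \<in> carrier A \<and> a' \<in> carrier A \<and> b \<in> carrier B} \<union>
     {frag_of (a, b \<otimes>\<^bsub>B\<^esub> b') - frag_of (a, b) - frag_of (a, b') | a b b'.
        a \<in> carrier A \<and> b \<in> carrier B \<and> b' \<in> carrier B}"

definition tensor_group ::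
  "('a, 'c) monoid_scheme \<Rightarrow> ('b, 'd) monoid_scheme \<Rightarrow> ('a \<times> 'b \<Rightarrow>\<^sub>0 int) set monoid" where
  "tensor_group A B =
     (let F = free_Abelian_group (carrier A \<times> carrier B)
      in F Mod generate F (bilinear_relations A B))"

text \<open>Degree \<open>k\<close> part of the tensor product of two non-negatively graded abelian groups.\<close>

definition graded_tensor ::
  "(nat \<Rightarrow> ('a, 'c) monoid_scheme) \<Rightarrow> (nat \<Rightarrow> ('b, 'd) monoid_scheme) \<Rightarrow> nat
    \<Rightarrow> (nat \<times> nat \<Rightarrow> ('a \<times> 'b \<Rightarrow>\<^sub>0 int) set) monoid" where
  "graded_tensor A B k =
     sum_group {(i, j). i + j = k} (\<lambda>(i, j). tensor_group (A i) (B j))"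


section \<open>The modular group and its principal congruence subgroups\<close>

definition SL2Z :: "(int^2^2) monoid" where
  "SL2Z = \<lparr>carrier = {A. det A = 1}, monoid.mult = (**), one = mat 1\<rparr>"

definition mat2 :: "int \<Rightarrow> int \<Rightarrow> int \<Rightarrow> int \<Rightarrow> int^2^2" where
  "mat2 a b c d = vector [vector [a, b], vector [c, d]]"

lemma mat2_nth [simp]:
  "mat2 a b c d $ 1 $ 1 = a" "mat2 a b c d $ 1 $ 2 = b"
  "mat2 a b c d $ 2 $ 1 = c" "mat2 a b c d $ 2 $ 2 = d"
  by (simp_all add: mat2_def)

lemma mat2_eqI:
  fixes A B :: "int^2^2"
  assumes "A$1$1 = B$1$1" "A$1$2 = B$1$2" "A$2$1 = B$2$1" "A$2$2 = B$2$2"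
  shows "A = B"
  using assms by (simp add: vec_eq_iff forall_2)

lemma matrix_mult_nth_2:
  fixes A B :: "int^2^2"
  shows "(A ** B) $ i $ j = A$i$1 * B$1$j + A$i$2 * B$2$j"
  by (simp add: matrix_matrix_mult_def sum_2)

lemma SL2Z_simps [simp]:
  "A \<in> carrier SL2Z \<longleftrightarrow> det A = 1" "A \<otimes>\<^bsub>SL2Z\<^esub> B = A ** B" "\<one>\<^bsub>SL2Z\<^esub> = mat 1"
  by (simp_all add: SL2Z_def)

lemma group_SL2Z: "group SL2Z"
proof (rule groupI)
  fix A :: "int^2^2" assume "A \<in> carrier SL2Z"
  then have A: "A$1$1 * A$2$2 - A$1$2 * A$2$1 = 1" by (simp add: det_2)
  define B where "B = mat2 (A$2$2) (- A$1$2) (- A$2$1) (A$1$1)"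
  have "det B = 1" using A by (simp add: B_def det_2 mult.commute)
  moreover have "B ** A = mat 1"
    using A by (intro mat2_eqI) (simp_all add: B_def matrix_mult_nth_2 mat_def algebra_simps)
  ultimately show "\<exists>B \<in> carrier SL2Z. B \<otimes>\<^bsub>SL2Z\<^esub> A = \<one>\<^bsub>SL2Z\<^esub>" by auto
qed (auto simp: det_mul matrix_mul_assoc)

text \<open>Residue classes modulo \<open>m\<close> are represented by their representatives in \<open>{0..<m}\<close>.\<close>

definition mat_mod :: "int \<Rightarrow> int^2^2 \<Rightarrow> int^2^2" where
  "mat_mod m A = (\<chi> i j. A $ i $ j mod m)"

definition SL2_mod :: "int \<Rightarrow> (int^2^2) monoid" where
  "SL2_mod m =
     \<lparr>carrier = {A. (\<forall>i j. A $ i $ j \<in> {0..<m}) \<and> det A mod m = 1 mod m},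
      monoid.mult = (\<lambda>A B. mat_mod m (A ** B)),
      one = mat_mod m (mat 1)\<rparr>"

definition Gamma :: "int \<Rightarrow> (int^2^2) monoid" where
  "Gamma m = SL2Z\<lparr>carrier := kernel SL2Z (SL2_mod m) (mat_mod m)\<rparr>"


section \<open>The braid group on three strands\<close>

text \<open>
  Artin presentation \<open>\<langle>\<sigma>\<^sub>1, \<sigma>\<^sub>2 | \<sigma>\<^sub>1 \<sigma>\<^sub>2 \<sigma>\<^sub>1 = \<sigma>\<^sub>2 \<sigma>\<^sub>1 \<sigma>\<^sub>2\<rangle>\<close>.  The letter \<open>(g, True)\<close> stands for the generator
  \<open>g\<close> and \<open>(g, False)\<close> for its inverse.
\<close>

datatype artin_gen = Sigma1 | Sigma2

type_synonym braid_word = "(artin_gen \<times> bool) list"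

inductive braid_eq :: "braid_word \<Rightarrow> braid_word \<Rightarrow> bool" where
  refl: "braid_eq u u"
| sym: "braid_eq u v \<Longrightarrow> braid_eq v u"
| trans: "braid_eq u v \<Longrightarrow> braid_eq v w \<Longrightarrow> braid_eq u w"
| append: "braid_eq u u' \<Longrightarrow> braid_eq v v' \<Longrightarrow> braid_eq (u @ v) (u' @ v')"
| cancel: "braid_eq [(g, e), (g, \<not> e)] []"
| braid: "braid_eq [(Sigma1, True), (Sigma2, True), (Sigma1, True)]
                   [(Sigma2, True), (Sigma1, True), (Sigma2, True)]"

quotient_type braid3 = braid_word / braid_eq
  by (intro equivpI reflpI sympI transpI) (blast intro: braid_eq.intros)+

lift_definition braid_mult :: "braid3 \<Rightarrow> braid3 \<Rightarrow> braid3" is "(@)"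
  by (rule braid_eq.append)

lift_definition braid_one :: braid3 is "[]" .

definition B3 :: "braid3 monoid" where
  "B3 = \<lparr>carrier = UNIV, monoid.mult = braid_mult, one = braid_one\<rparr>"

lemma B3_simps [simp]:
  "b \<in> carrier B3" "x \<otimes>\<^bsub>B3\<^esub> y = braid_mult x y" "\<one>\<^bsub>B3\<^esub> = braid_one"
  by (simp_all add: B3_def)

lemma braid_eq_inverse:
  "braid_eq (map (\<lambda>(g, e). (g, \<not> e)) (rev w) @ w) []"
proof (induction w)
  case Nil
  show ?case by (simp add: braid_eq.refl)
next
  case (Cons l w)
  obtain g e where l: "l = (g, e)" by (cases l)
  let ?v = "map (\<lambda>(g, e). (g, \<not> e)) (rev w)"
  have "braid_eq ([(g, \<not> e), (g, e)] @ w) ([] @ w)"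
    using braid_eq.append[OF braid_eq.cancel[of g "\<not> e"] braid_eq.refl[of w]] by simp
  then have "braid_eq (?v @ [(g, \<not> e), (g, e)] @ w) (?v @ [] @ w)"
    by (rule braid_eq.append[OF braid_eq.refl])
  then show ?case using Cons by (auto simp: l intro: braid_eq.trans)
qed

lemma group_B3: "group B3"
proof (rule groupI)
  fix x
  have "\<exists>y. braid_mult y x = braid_one" by transfer (rule exI, rule braid_eq_inverse)
  then show "\<exists>y \<in> carrier B3. y \<otimes>\<^bsub>B3\<^esub> x = \<one>\<^bsub>B3\<^esub>" by (simp add: Bex_def)
qed (simp_all, (transfer, simp add: braid_eq.refl)+)

fun gen_matrix :: "artin_gen \<Rightarrow> int^2^2" where
  "gen_matrix Sigma1 = mat2 1 0 (-1) 1"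
| "gen_matrix Sigma2 = mat2 1 1 0 1"

fun letter_matrix :: "artin_gen \<times> bool \<Rightarrow> int^2^2" where
  "letter_matrix (g, e) = (if e then gen_matrix g else inv\<^bsub>SL2Z\<^esub> gen_matrix g)"

fun word_matrix :: "braid_word \<Rightarrow> int^2^2" where
  "word_matrix [] = mat 1"
| "word_matrix (l # w) = letter_matrix l ** word_matrix w"

lemma word_matrix_append: "word_matrix (u @ v) = word_matrix u ** word_matrix v"
  by (induction u) (simp_all add: matrix_mul_assoc)

lemma det_gen_matrix: "det (gen_matrix g) = 1"
  by (cases g) (simp_all add: det_2)

lemma det_letter_matrix: "det (letter_matrix l) = 1"
proof -
  obtain g e where l: "l = (g, e)" by (cases l)
  have "inv\<^bsub>SL2Z\<^esub> gen_matrix g \<in> carrier SL2Z"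
    by (rule group.inv_closed[OF group_SL2Z]) (simp add: det_gen_matrix)
  then show ?thesis by (simp add: l det_gen_matrix)
qed

lemma letter_matrix_cancel: "letter_matrix (g, e) ** letter_matrix (g, \<not> e) = mat 1"
  using group.r_inv[OF group_SL2Z, of "gen_matrix g"] group.l_inv[OF group_SL2Z, of "gen_matrix g"]
  by (simp add: det_gen_matrix)

lift_definition lam :: "braid3 \<Rightarrow> int^2^2" is word_matrix
proof -
  fix u v assume "braid_eq u v"
  then show "word_matrix u = word_matrix v"
  proof induction
    case (cancel g e)
    then show ?case using letter_matrix_cancel[of g e] by simp
  next
    case braid
    show ?case by (intro mat2_eqI) (simp_all add: matrix_mult_nth_2 mat_def)
  qed (simp_all add: word_matrix_append)
qed

lemma lam_hom: "lam \<in> hom B3 SL2Z"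
proof -
  have "det (word_matrix w) = 1" for w
    by (induction w) (simp_all add: det_mul det_letter_matrix)
  then have "det (lam b) = 1" for b by transfer
  moreover have "lam (braid_mult x y) = lam x ** lam y" for x y
    by transfer (rule word_matrix_append)
  ultimately show ?thesis by (auto simp: hom_def)
qed

definition B_Gamma :: "int \<Rightarrow> braid3 monoid" where
  "B_Gamma m = B3\<lparr>carrier := {b \<in> carrier B3. lam b \<in> carrier (Gamma m)}\<rparr>"


section \<open>The action on integral polynomials in two variables\<close>

text \<open>The exponent \<open>(i, j)\<close> stands for the monomial \<open>x\<^sup>i y\<^sup>j\<close>.\<close>

type_synonym poly2 = "(nat \<times> nat) \<Rightarrow>\<^sub>0 int"

definition poly_x :: poly2 where "poly_x = Poly_Mapping.single (1, 0) 1"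
definition poly_y :: poly2 where "poly_y = Poly_Mapping.single (0, 1) 1"

definition subst2 :: "poly2 \<Rightarrow> poly2 \<Rightarrow> poly2 \<Rightarrow> poly2" where
  "subst2 p q f =
     (\<Sum>k \<in> Poly_Mapping.keys f.
        of_int (Poly_Mapping.lookup f k) * p ^ fst k * q ^ snd k)"

text \<open>
  \<open>x\<close> and \<open>y\<close> are the standard basis vectors of \<open>\<int>\<^sup>2\<close>, so their images are the columns
  of the matrix.
\<close>

definition SL2_act :: "int^2^2 \<Rightarrow> poly2 \<Rightarrow> poly2" where
  "SL2_act A =
     subst2 (of_int (A$1$1) * poly_x + of_int (A$2$1) * poly_y)
            (of_int (A$1$2) * poly_x + of_int (A$2$2) * poly_y)"

lemma subst2_x: "subst2 p q poly_x = p" and subst2_y: "subst2 p q poly_y = q"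
  by (simp_all add: subst2_def poly_x_def poly_y_def)

lemma SL2_act_generators:
  "SL2_act (gen_matrix Sigma1) poly_x = poly_x - poly_y"
  "SL2_act (gen_matrix Sigma1) poly_y = poly_y"
  "SL2_act (gen_matrix Sigma2) poly_x = poly_x"
  "SL2_act (gen_matrix Sigma2) poly_y = poly_x + poly_y"
  by (simp_all add: SL2_act_def subst2_x subst2_y)

definition M_deg :: "nat \<Rightarrow> poly2 monoid" where
  "M_deg n = \<lparr>carrier = {f. \<forall>(i, j) \<in> Poly_Mapping.keys f. i + j = n},
              monoid.mult = (+), one = 0\<rparr>"


section \<open>The cohomology groups\<close>

definition H_Gamma :: "int \<Rightarrow> nat \<Rightarrow> nat \<Rightarrow> ((int^2^2) list \<Rightarrow> poly2) set monoid" where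
  "H_Gamma m n i = group_cohomology (Gamma m) (M_deg n) SL2_act i"

definition H_B_Gamma :: "int \<Rightarrow> nat \<Rightarrow> nat \<Rightarrow> (braid3 list \<Rightarrow> poly2) set monoid" where
  "H_B_Gamma m n i = group_cohomology (B_Gamma m) (M_deg n) (\<lambda>b. SL2_act (lam b)) i"

definition H_Z :: "nat \<Rightarrow> (int list \<Rightarrow> int) set monoid" where
  "H_Z i = group_cohomology integer_group integer_group (\<lambda>_ z. z) i"

end

theory Submission
  imports Defs "HOL-Library.Function_Algebras" "HOL-Algebra.Bij"
begin

text \<open>
  If a group \<open>E\<close> has a homomorphism \<open>\<rho>\<close> onto \<open>\<int>\<close> with \<open>\<rho> t = 1\<close> for a central \<open>t\<close>, then
  \<open>E = G \<times> \<langle>t\<rangle>\<close> with \<open>G = ker \<rho>\<close>, and the cohomology of \<open>E\<close> is that of the mapping cone of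
  \<open>t - 1\<close> on the cochains of \<open>G\<close>: this is checked by hand in degrees 0 and 1 and extended by dimension
  shifting, the cohomology of coinduced modules being trivial.

  For \<open>m > 2\<close> such a \<open>\<rho>\<close> exists on \<open>B_Gamma m\<close>, with \<open>t\<close> a generator of the kernel of
  \<open>\<lambda>\<close>, because \<open>-1\<close> has no fixed points on \<open>SL\<^sub>2(\<int>/m)\<close>: the group
  \<open>B\<^sub>3 = \<langle>a, b | a\<^sup>2 = b\<^sup>3\<rangle>\<close> then acts on \<open>SL\<^sub>2(\<int>/m) \<times> \<int>\<close> with \<open>t\<close> shifting the
  second factor by one.  Hence \<open>G\<close> is isomorphic to \<open>\<Gamma>(m)\<close> and \<open>t\<close> acts trivially.

  For \<open>m = 2\<close> the group is the pure braid group \<open>F\<^sub>2 \<times> \<langle>z\<rangle>\<close>, where \<open>z\<close> acts by \<open>(-1)\<^sup>n\<close>, and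
  the second cohomology of \<open>F\<^sub>2\<close> vanishes since extensions of a free group split.  For odd \<open>n\<close> every
  cocycle \<open>f\<close> satisfies \<open>2f = \<plusminus>d\<kappa>\<close>, with \<open>\<kappa>\<close> obtained from \<open>f\<close> by inserting \<open>z\<close>, both for
  the pure braid group and for \<open>\<Gamma>(2)\<close>.  As both act trivially on \<open>M\<^sub>n\<close> modulo 2, the class of \<open>f\<close>
  is determined by \<open>\<kappa>\<close> modulo 2.
\<close>

section \<open>Quotients of additive subgroups\<close>

text \<open>Dimension shifting quantifies over all coefficient modules, so passing to a cokernel
  must not change the type of the coefficients: this is why modules are made of functions on lists
  of group elements and why polynomials enter through \<open>emb0\<close>. It is carried out for
  cones as well as for bar complexes. The extra input for cones is that t - 1 is onto on the
  G-invariants of a coinduced module, which amounts to summation over the integers. When t acts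
  trivially the cone splits, and H^k(E) becomes the sum of H^k(G) and H^(k-1)(G). For even n > 0 at
  level 2, the absence of invariants in M_n is used twice: it kills H^0 of F_2, and it forces every
  1-cocycle of the pure braid group to vanish at z, so that the cocycle comes from \<Gamma>(2). Here
  a = sigma_1 sigma_2 sigma_1 and b = sigma_1 sigma_2. Words are avoided because an action of B_3
  needs only two bijections with a^2 = b^3. The kernel of \<lambda> is found from a normal form in a
  and b whose positive part is sent to matrices with non-negative entries.\<close>

definition addsub :: "'a::ab_group_add set \<Rightarrow> bool" where
  "addsub A \<longleftrightarrow> 0 \<in> A \<and> (\<forall>x\<in>A. \<forall>y\<in>A. x - y \<in> A)"

lemma addsub_zero: "addsub A \<Longrightarrow> 0 \<in> A"
  and addsub_diff: "addsub A \<Longrightarrow> x \<in> A \<Longrightarrow> y \<in> A \<Longrightarrow> x - y \<in> A"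
  by (auto simp: addsub_def)

lemma addsub_neg: "addsub A \<Longrightarrow> x \<in> A \<Longrightarrow> - x \<in> A"
  using addsub_diff[of A 0 x] by (simp add: addsub_zero)

lemma addsub_add: "addsub A \<Longrightarrow> x \<in> A \<Longrightarrow> y \<in> A \<Longrightarrow> x + y \<in> A"
  using addsub_diff[of A x "- y"] by (simp add: addsub_neg)

lemma addsubI:
  assumes "0 \<in> A" "\<And>x y. x \<in> A \<Longrightarrow> y \<in> A \<Longrightarrow> x - y \<in> A"
  shows "addsub A"
  using assms by (auto simp: addsub_def)

lemma addsub_UNIV: "addsub UNIV" and addsub_singleton: "addsub {0}"
  by (auto simp: addsub_def)

lemma addsub_Times: "addsub A \<Longrightarrow> addsub B \<Longrightarrow> addsub (A \<times> B)"
  by (auto simp: addsub_def zero_prod_def)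

definition add_on :: "'a::ab_group_add set \<Rightarrow> ('a \<Rightarrow> 'b::ab_group_add) \<Rightarrow> bool" where
  "add_on A f \<longleftrightarrow> (\<forall>x\<in>A. \<forall>y\<in>A. f (x - y) = f x - f y)"

lemma add_onI: "(\<And>x y. x \<in> A \<Longrightarrow> y \<in> A \<Longrightarrow> f (x - y) = f x - f y) \<Longrightarrow> add_on A f"
  by (simp add: add_on_def)

lemma add_on_diff: "add_on A f \<Longrightarrow> x \<in> A \<Longrightarrow> y \<in> A \<Longrightarrow> f (x - y) = f x - f y"
  by (simp add: add_on_def)

lemma add_on_zero: "add_on A f \<Longrightarrow> addsub A \<Longrightarrow> f 0 = 0"
  using add_on_diff[of A f 0 0] by (simp add: addsub_zero)

lemma add_on_neg: "add_on A f \<Longrightarrow> addsub A \<Longrightarrow> x \<in> A \<Longrightarrow> f (- x) = - f x"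
  using add_on_diff[of A f 0 x] by (simp add: addsub_zero add_on_zero)

lemma add_on_add: "add_on A f \<Longrightarrow> addsub A \<Longrightarrow> x \<in> A \<Longrightarrow> y \<in> A \<Longrightarrow> f (x + y) = f x + f y"
  using add_on_diff[of A f x "- y"] by (simp add: addsub_neg add_on_neg)

lemma addsub_image: "addsub A \<Longrightarrow> add_on A f \<Longrightarrow> addsub (f ` A)"
  by (rule addsubI) (use addsub_zero add_on_zero in fastforce,
      auto simp: add_on_diff[symmetric] addsub_diff)

text \<open>The bridge to HOL-Algebra: \<open>M_deg n\<close> and \<open>integer_group\<close> are
  equal to groups of this form, so they can be rewritten into it.\<close>

definition addgrp :: "'a::ab_group_add set \<Rightarrow> 'a monoid" where
  "addgrp A = \<lparr>carrier = A, monoid.mult = (+), one = 0\<rparr>"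

lemma addgrp_simps [simp]:
  "carrier (addgrp A) = A" "x \<otimes>\<^bsub>addgrp A\<^esub> y = x + y" "\<one>\<^bsub>addgrp A\<^esub> = 0"
  by (simp_all add: addgrp_def)

lemma comm_group_addgrp: "addsub A \<Longrightarrow> comm_group (addgrp A)"
  by (rule comm_groupI) (auto simp: addsub_add addsub_zero algebra_simps
      intro!: bexI[of _ "- _"] addsub_neg)

lemma group_addgrp: "addsub A \<Longrightarrow> group (addgrp A)"
  by (simp add: comm_group_addgrp comm_group.axioms)

lemma inv_addgrp: "addsub A \<Longrightarrow> x \<in> A \<Longrightarrow> inv\<^bsub>addgrp A\<^esub> x = - x"
  by (rule group.inv_equality[OF group_addgrp]) (auto simp: addsub_neg)

lemma hom_addgrpI:
  assumes "\<And>x. x \<in> A \<Longrightarrow> f x \<in> carrier H"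
    and "\<And>x y. x \<in> A \<Longrightarrow> y \<in> A \<Longrightarrow> f (x + y) = f x \<otimes>\<^bsub>H\<^esub> f y"
  shows "f \<in> hom (addgrp A) H"
  using assms by (auto simp: hom_def)

definition Quot :: "'a::ab_group_add set \<Rightarrow> 'a set \<Rightarrow> 'a set monoid" where
  "Quot Z B = addgrp Z Mod B"

lemma normal_addgrp:
  assumes "addsub Z" "addsub B" "B \<subseteq> Z"
  shows "normal B (addgrp Z)"
proof -
  have "subgroup B (addgrp Z)"
    by (rule group.subgroupI[OF group_addgrp[OF assms(1)]])
      (use assms addsub_zero[OF assms(2)] addsub_neg[OF assms(2)] addsub_add[OF assms(2)]
        in \<open>auto simp: inv_addgrp subset_iff\<close>)
  then show ?thesis
    by (simp add: comm_group.subgroup_imp_normal comm_group_addgrp assms(1))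
qed

lemma comm_group_Quot:
  assumes "addsub Z" "addsub B" "B \<subseteq> Z"
  shows "comm_group (Quot Z B)"
  unfolding Quot_def
  by (rule comm_group.abelian_FactGroup[OF comm_group_addgrp[OF assms(1)]])
    (simp add: normal_addgrp[OF assms] normal_imp_subgroup)

lemma group_Quot: "addsub Z \<Longrightarrow> addsub B \<Longrightarrow> B \<subseteq> Z \<Longrightarrow> group (Quot Z B)"
  by (simp add: comm_group_Quot comm_group.axioms)

text \<open>The first isomorphism theorem with the kernel given elementwise; concrete quotients are
  identified through it without handling cosets.\<close>

lemma Quot_iso_hom:
  assumes "addsub Z" "group H" "f \<in> hom (addgrp Z) H" "f ` Z = carrier H"
    and "\<And>x. x \<in> Z \<Longrightarrow> f x = \<one>\<^bsub>H\<^esub> \<longleftrightarrow> x \<in> B" "B \<subseteq> Z"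
  shows "Quot Z B \<cong> H"
proof -
  interpret group_hom "addgrp Z" H f
    by (simp add: group_hom_def group_hom_axioms_def assms group_addgrp)
  have "kernel (addgrp Z) H f = B"
    using assms(5,6) by (auto simp: kernel_def)
  then show ?thesis
    using FactGroup_iso assms(4) by (simp add: Quot_def)
qed

text \<open>Hides the coset construction behind a surjective homomorphism with kernel
  \<open>B\<close>, which is all that later arguments use.\<close>

lemma Quot_proj:
  assumes "addsub Z" "addsub B" "B \<subseteq> Z"
  obtains q where "q \<in> hom (addgrp Z) (Quot Z B)" "q ` Z = carrier (Quot Z B)"
    "\<And>x. x \<in> Z \<Longrightarrow> q x = \<one>\<^bsub>Quot Z B\<^esub> \<longleftrightarrow> x \<in> B"
proof
  interpret normal B "addgrp Z" by (rule normal_addgrp[OF assms])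
  show "(\<lambda>x. B #>\<^bsub>addgrp Z\<^esub> x) \<in> hom (addgrp Z) (Quot Z B)"
    using r_coset_hom_Mod by (simp add: Quot_def)
  show "(\<lambda>x. B #>\<^bsub>addgrp Z\<^esub> x) ` Z = carrier (Quot Z B)"
    by (simp add: Quot_def carrier_FactGroup)
  show "\<And>x. x \<in> Z \<Longrightarrow> B #>\<^bsub>addgrp Z\<^esub> x = \<one>\<^bsub>Quot Z B\<^esub> \<longleftrightarrow> x \<in> B"
    by (metis Quot_def addgrp_simps(1) coset_join1 coset_join2 one_FactGroup subgroup_axioms subset)
qed

text \<open>
  A correspondence between \<open>Z\<close> and \<open>Z'\<close> that identifies \<open>Z / B\<close> with \<open>Z' / B'\<close>.  Unlike an
  isomorphism of quotients it composes and inverts without choosing representatives.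
\<close>

definition qiso ::
  "'a::ab_group_add set \<Rightarrow> 'a set \<Rightarrow> 'b::ab_group_add set \<Rightarrow> 'b set \<Rightarrow> bool" where
  "qiso Z B Z' B' \<longleftrightarrow>
     (\<exists>R \<subseteq> Z \<times> Z'. addsub R \<and> fst ` R = Z \<and> snd ` R = Z' \<and>
        (\<forall>(x, y) \<in> R. x \<in> B \<longleftrightarrow> y \<in> B'))"

lemma qisoI:
  assumes "\<And>x y. R x y \<Longrightarrow> x \<in> Z \<and> y \<in> Z'"
    and "R 0 0" "\<And>x y x' y'. R x y \<Longrightarrow> R x' y' \<Longrightarrow> R (x - x') (y - y')"
    and "\<And>x. x \<in> Z \<Longrightarrow> \<exists>y. R x y" "\<And>y. y \<in> Z' \<Longrightarrow> \<exists>x. R x y"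
    and "\<And>x y. R x y \<Longrightarrow> x \<in> B \<Longrightarrow> y \<in> B'" "\<And>x y. R x y \<Longrightarrow> y \<in> B' \<Longrightarrow> x \<in> B"
  shows "qiso Z B Z' B'"
  unfolding qiso_def
proof (intro exI[of _ "{(x, y). R x y}"] conjI)
  show "addsub {(x, y). R x y}"
    using assms(2,3) by (auto simp: addsub_def zero_prod_def)
  show "fst ` {(x, y). R x y} = Z"
    using assms(1,4) by force
  show "snd ` {(x, y). R x y} = Z'"
    using assms(1,5) by force
qed (use assms in auto)

lemma qisoE:
  assumes "qiso Z B Z' B'"
  obtains R where "\<And>x y. R x y \<Longrightarrow> x \<in> Z \<and> y \<in> Z'"
    and "R 0 0" "\<And>x y x' y'. R x y \<Longrightarrow> R x' y' \<Longrightarrow> R (x - x') (y - y')"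
    and "\<And>x. x \<in> Z \<Longrightarrow> \<exists>y. R x y" "\<And>y. y \<in> Z' \<Longrightarrow> \<exists>x. R x y"
    and "\<And>x y. R x y \<Longrightarrow> x \<in> B \<longleftrightarrow> y \<in> B'"
proof -
  obtain R where R: "R \<subseteq> Z \<times> Z'" "addsub R" "fst ` R = Z" "snd ` R = Z'"
    "\<And>x y. (x, y) \<in> R \<Longrightarrow> x \<in> B \<longleftrightarrow> y \<in> B'"
    using assms unfolding qiso_def by blast
  show ?thesis
  proof (rule that[of "\<lambda>x y. (x, y) \<in> R"])
    show "(0, 0) \<in> R" using addsub_zero[OF R(2)] by (simp add: zero_prod_def)
    show "(x - x', y - y') \<in> R" if "(x, y) \<in> R" "(x', y') \<in> R" for x y x' y'
      using addsub_diff[OF R(2) that] by simp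
  qed (use R in force)+
qed

lemma qiso_sym: "qiso Z B Z' B' \<Longrightarrow> qiso Z' B' Z B"
  by (erule qisoE, rule_tac R = "\<lambda>x y. R y x" in qisoI) auto

lemma qiso_trans:
  assumes "qiso Z B Z' B'" "qiso Z' B' Z'' B''"
  shows "qiso Z B Z'' B''"
  using assms
proof (elim qisoE)
  fix R S
  assume R: "\<And>x y. R x y \<Longrightarrow> x \<in> Z \<and> y \<in> Z'" "R 0 0"
    "\<And>x y x' y'. R x y \<Longrightarrow> R x' y' \<Longrightarrow> R (x - x') (y - y')"
    "\<And>x. x \<in> Z \<Longrightarrow> \<exists>y. R x y" "\<And>y. y \<in> Z' \<Longrightarrow> \<exists>x. R x y"
    "\<And>x y. R x y \<Longrightarrow> x \<in> B \<longleftrightarrow> y \<in> B'"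
  assume S: "\<And>x y. S x y \<Longrightarrow> x \<in> Z' \<and> y \<in> Z''" "S 0 0"
    "\<And>x y x' y'. S x y \<Longrightarrow> S x' y' \<Longrightarrow> S (x - x') (y - y')"
    "\<And>x. x \<in> Z' \<Longrightarrow> \<exists>y. S x y" "\<And>y. y \<in> Z'' \<Longrightarrow> \<exists>x. S x y"
    "\<And>x y. S x y \<Longrightarrow> x \<in> B' \<longleftrightarrow> y \<in> B''"
  show ?thesis
  proof (rule qisoI[of "\<lambda>x z. \<exists>y. R x y \<and> S y z"])
    show "\<exists>y. R (x - x') y \<and> S y (z - z')"
      if "\<exists>y. R x y \<and> S y z" "\<exists>y. R x' y \<and> S y z'" for x z x' z'
      using that R(3) S(3) by blast
    show "\<exists>z y. R x y \<and> S y z" if "x \<in> Z" for x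
      using R(4)[OF that] R(1) S(4) by blast
    show "\<exists>x y. R x y \<and> S y z" if "z \<in> Z''" for z
      using S(5)[OF that] S(1) R(5) by blast
  qed (use R(1,2,6) S(1,2,6) in blast)+
qed

lemma qiso_map:
  assumes "addsub Z" "add_on Z f" "f ` Z = Z'"
    and "\<And>x. x \<in> Z \<Longrightarrow> f x \<in> B' \<longleftrightarrow> x \<in> B"
  shows "qiso Z B Z' B'"
proof (rule qisoI[of "\<lambda>x y. x \<in> Z \<and> y = f x"])
  show "0 \<in> Z \<and> 0 = f 0" using assms(1,2) by (simp add: add_on_zero addsub_zero)
  show "x - x' \<in> Z \<and> y - y' = f (x - x')" if "x \<in> Z \<and> y = f x" "x' \<in> Z \<and> y' = f x'" for x y x' y'
    using assms(1,2) that by (simp add: addsub_diff add_on_diff)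
qed (use assms(3,4) in blast)+

lemma qiso_Times:
  assumes "qiso Z1 B1 Z1' B1'" "qiso Z2 B2 Z2' B2'"
  shows "qiso (Z1 \<times> Z2) (B1 \<times> B2) (Z1' \<times> Z2') (B1' \<times> B2')"
  using assms
proof (elim qisoE)
  fix R S
  assume R: "\<And>x y. R x y \<Longrightarrow> x \<in> Z1 \<and> y \<in> Z1'" "R 0 0"
    "\<And>x y x' y'. R x y \<Longrightarrow> R x' y' \<Longrightarrow> R (x - x') (y - y')"
    "\<And>x. x \<in> Z1 \<Longrightarrow> \<exists>y. R x y" "\<And>y. y \<in> Z1' \<Longrightarrow> \<exists>x. R x y"
    "\<And>x y. R x y \<Longrightarrow> x \<in> B1 \<longleftrightarrow> y \<in> B1'"
  assume S: "\<And>x y. S x y \<Longrightarrow> x \<in> Z2 \<and> y \<in> Z2'" "S 0 0"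
    "\<And>x y x' y'. S x y \<Longrightarrow> S x' y' \<Longrightarrow> S (x - x') (y - y')"
    "\<And>x. x \<in> Z2 \<Longrightarrow> \<exists>y. S x y" "\<And>y. y \<in> Z2' \<Longrightarrow> \<exists>x. S x y"
    "\<And>x y. S x y \<Longrightarrow> x \<in> B2 \<longleftrightarrow> y \<in> B2'"
  show ?thesis
  proof (rule qisoI[of "\<lambda>x y. R (fst x) (fst y) \<and> S (snd x) (snd y)"])
    show "\<exists>y. R (fst x) (fst y) \<and> S (snd x) (snd y)" if "x \<in> Z1 \<times> Z2" for x
      using that R(4)[of "fst x"] S(4)[of "snd x"] by auto
    show "\<exists>x. R (fst x) (fst y) \<and> S (snd x) (snd y)" if "y \<in> Z1' \<times> Z2'" for y
      using that R(5)[of "fst y"] S(5)[of "snd y"] by auto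
  qed (use R(1,2,3,6) S(1,2,3,6) in \<open>auto simp: mem_Times_iff\<close>)
qed

lemma qiso_trivial: "qiso Z B Z' B' \<Longrightarrow> Z' \<subseteq> B' \<Longrightarrow> Z \<subseteq> B"
  by (erule qisoE) blast

text \<open>Any choice of a partner \<open>s x\<close> for each \<open>x\<close> induces the
  isomorphism. Two partners of the same element differ by a partner of 0, which lies in
  \<open>B'\<close>, so the class of \<open>s x\<close> does not depend on the choice and is
  additive.\<close>

lemma qiso_Quot:
  assumes "qiso Z B Z' B'" and Z: "addsub Z" "B \<subseteq> Z"
    and Z': "addsub Z'" "addsub B'" "B' \<subseteq> Z'"
  shows "Quot Z B \<cong> Quot Z' B'"
  using assms(1)
proof (rule qisoE)
  fix R assume R: "\<And>x y. R x y \<Longrightarrow> x \<in> Z \<and> y \<in> Z'"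
    and R0: "R 0 0" and Rd: "\<And>x y x' y'. R x y \<Longrightarrow> R x' y' \<Longrightarrow> R (x - x') (y - y')"
    and Rt: "\<And>x. x \<in> Z \<Longrightarrow> \<exists>y. R x y" and Ro: "\<And>y. y \<in> Z' \<Longrightarrow> \<exists>x. R x y"
    and RB: "\<And>x y. R x y \<Longrightarrow> x \<in> B \<longleftrightarrow> y \<in> B'"
  obtain q where q: "q \<in> hom (addgrp Z') (Quot Z' B')" "q ` Z' = carrier (Quot Z' B')"
    "\<And>x. x \<in> Z' \<Longrightarrow> q x = \<one>\<^bsub>Quot Z' B'\<^esub> \<longleftrightarrow> x \<in> B'"
    using Quot_proj[OF Z'] by blast
  interpret q: group_hom "addgrp Z'" "Quot Z' B'" q
    by (simp add: group_hom_def group_hom_axioms_def group_addgrp group_Quot Z' q)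
  have qeq: "q y = q y'" if "y \<in> Z'" "y' \<in> Z'" "y - y' \<in> B'" for y y'
  proof -
    have d: "y - y' \<in> Z'" using that Z' by (simp add: addsub_diff)
    have "q ((y - y') + y') = q (y - y') \<otimes>\<^bsub>Quot Z' B'\<^esub> q y'"
      using q.hom_mult[of "y - y'" y'] d that by simp
    then show ?thesis
      using q(3)[OF d] that(3) q.hom_closed[of y'] that by simp
  qed
  define s where "s x = (SOME y. R x y)" for x
  have s: "R x (s x)" if "x \<in> Z" for x
    using Rt[OF that] unfolding s_def by (rule someI_ex)
  have qs: "q (s x) = q y" if "R x y" for x y
  proof -
    have "R (x - x) (s x - y)" using that Rd s R by metis
    then have "s x - y \<in> B'" using RB R0 addsub_zero[OF Z'(2)] by (metis diff_self)
    then show ?thesis using qeq that s R by metis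
  qed
  show ?thesis
  proof (rule Quot_iso_hom[where f = "\<lambda>x. q (s x)"])
    show "(\<lambda>x. q (s x)) \<in> hom (addgrp Z) (Quot Z' B')"
    proof (rule hom_addgrpI)
      show "q (s x) \<in> carrier (Quot Z' B')" if "x \<in> Z" for x
        using s[OF that] R q.hom_closed by auto
      fix x y assume xy: "x \<in> Z" "y \<in> Z"
      have "R (x - (0 - y)) (s x - (0 - s y))" using xy s Rd R0 by blast
      then have "q (s (x + y)) = q (s x + s y)" using qs by simp
      then show "q (s (x + y)) = q (s x) \<otimes>\<^bsub>Quot Z' B'\<^esub> q (s y)"
        using q.hom_mult[of "s x" "s y"] xy s[THEN R] by simp
    qed
    show "(\<lambda>x. q (s x)) ` Z = carrier (Quot Z' B')"
    proof -
      have "q y \<in> (\<lambda>x. q (s x)) ` Z" if "y \<in> Z'" for y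
        using Ro[OF that] qs R by (metis imageI)
      moreover have "q (s x) \<in> q ` Z'" if "x \<in> Z" for x
        using s[OF that] R by blast
      ultimately show ?thesis unfolding q(2)[symmetric] by blast
    qed
    show "q (s x) = \<one>\<^bsub>Quot Z' B'\<^esub> \<longleftrightarrow> x \<in> B" if "x \<in> Z" for x
      using q(3) s[OF that] R RB by blast
  qed (use Z Z' group_Quot in auto)
qed

lemma Quot_Times:
  assumes "addsub Z1" "addsub B1" "B1 \<subseteq> Z1" "addsub Z2" "addsub B2" "B2 \<subseteq> Z2"
  shows "Quot (Z1 \<times> Z2) (B1 \<times> B2) \<cong> Quot Z1 B1 \<times>\<times> Quot Z2 B2"
proof -
  obtain q1 where q1: "q1 \<in> hom (addgrp Z1) (Quot Z1 B1)" "q1 ` Z1 = carrier (Quot Z1 B1)"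
    "\<And>x. x \<in> Z1 \<Longrightarrow> q1 x = \<one>\<^bsub>Quot Z1 B1\<^esub> \<longleftrightarrow> x \<in> B1"
    using Quot_proj[OF assms(1-3)] by blast
  obtain q2 where q2: "q2 \<in> hom (addgrp Z2) (Quot Z2 B2)" "q2 ` Z2 = carrier (Quot Z2 B2)"
    "\<And>x. x \<in> Z2 \<Longrightarrow> q2 x = \<one>\<^bsub>Quot Z2 B2\<^esub> \<longleftrightarrow> x \<in> B2"
    using Quot_proj[OF assms(4-6)] by blast
  show ?thesis
  proof (rule Quot_iso_hom[where f = "\<lambda>(x, y). (q1 x, q2 y)"])
    show "(\<lambda>(x, y). (q1 x, q2 y)) \<in> hom (addgrp (Z1 \<times> Z2)) (Quot Z1 B1 \<times>\<times> Quot Z2 B2)"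
      using q1(1) q2(1) by (intro hom_addgrpI) (auto simp: hom_def DirProd_def)
    show "(\<lambda>(x, y). (q1 x, q2 y)) ` (Z1 \<times> Z2) = carrier (Quot Z1 B1 \<times>\<times> Quot Z2 B2)"
      unfolding DirProd_def q1(2)[symmetric] q2(2)[symmetric]
      by (auto intro!: rev_image_eqI)
    show "(case x of (x, y) \<Rightarrow> (q1 x, q2 y)) = \<one>\<^bsub>Quot Z1 B1 \<times>\<times> Quot Z2 B2\<^esub> \<longleftrightarrow> x \<in> B1 \<times> B2"
      if "x \<in> Z1 \<times> Z2" for x
      using that by (cases x) (simp add: q1(3) q2(3))
    show "B1 \<times> B2 \<subseteq> Z1 \<times> Z2" using assms by blast
  qed (simp_all add: assms addsub_Times DirProd_group group_Quot)
qed

lemma trivial_Quot: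
  assumes "addsub Z" "addsub B" "B \<subseteq> Z" "Z \<subseteq> B"
  shows "trivial_group (Quot Z B)"
proof -
  obtain q where q: "q ` Z = carrier (Quot Z B)"
    "\<And>x. x \<in> Z \<Longrightarrow> q x = \<one>\<^bsub>Quot Z B\<^esub> \<longleftrightarrow> x \<in> B"
    using Quot_proj[OF assms(1-3)] by metis
  have "carrier (Quot Z B) = {\<one>\<^bsub>Quot Z B\<^esub>}"
    unfolding q(1)[symmetric] using q(2) assms(4) addsub_zero[OF assms(1)] by blast
  then show ?thesis
    using group_Quot[OF assms(1-3)] by (simp add: trivial_group_def)
qed

lemma integer_group_eq: "integer_group = addgrp UNIV"
  by (simp add: integer_group_def addgrp_def)

section \<open>Cochain complexes\<close>

text \<open>All terms of a complex lie in one type, and \<open>d k\<close> is a total function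
  constrained on \<open>X k\<close> alone. This suits bar cochains, since tuples of every length are
  lists of the same type.\<close>

definition cplx :: "(nat \<Rightarrow> 'a::ab_group_add set) \<Rightarrow> (nat \<Rightarrow> 'a \<Rightarrow> 'a) \<Rightarrow> bool" where
  "cplx X d \<longleftrightarrow> (\<forall>k. addsub (X k) \<and> add_on (X k) (d k) \<and> d k ` X k \<subseteq> X (Suc k) \<and>
     (\<forall>x\<in>X k. d (Suc k) (d k x) = 0))"

lemma cplxD:
  assumes "cplx X d"
  shows "addsub (X k)" "add_on (X k) (d k)" "x \<in> X k \<Longrightarrow> d k x \<in> X (Suc k)"
    "x \<in> X k \<Longrightarrow> d (Suc k) (d k x) = 0"
    "x \<in> X k \<Longrightarrow> y \<in> X k \<Longrightarrow> d k (x - y) = d k x - d k y"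
    "x \<in> X k \<Longrightarrow> y \<in> X k \<Longrightarrow> d k (x + y) = d k x + d k y"
    "x \<in> X k \<Longrightarrow> d k (- x) = - d k x" "d k 0 = 0" "0 \<in> X k"
    "x \<in> X k \<Longrightarrow> y \<in> X k \<Longrightarrow> x - y \<in> X k" "x \<in> X k \<Longrightarrow> y \<in> X k \<Longrightarrow> x + y \<in> X k"
    "x \<in> X k \<Longrightarrow> - x \<in> X k"
proof -
  show 1: "addsub (X k)" and 2: "add_on (X k) (d k)" and "x \<in> X k \<Longrightarrow> d k x \<in> X (Suc k)"
    "x \<in> X k \<Longrightarrow> d (Suc k) (d k x) = 0"
    using assms by (auto simp: cplx_def)
  show "x \<in> X k \<Longrightarrow> y \<in> X k \<Longrightarrow> d k (x - y) = d k x - d k y"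
    "x \<in> X k \<Longrightarrow> y \<in> X k \<Longrightarrow> d k (x + y) = d k x + d k y"
    "x \<in> X k \<Longrightarrow> d k (- x) = - d k x" "d k 0 = 0" "0 \<in> X k"
    "x \<in> X k \<Longrightarrow> y \<in> X k \<Longrightarrow> x - y \<in> X k" "x \<in> X k \<Longrightarrow> y \<in> X k \<Longrightarrow> x + y \<in> X k"
    "x \<in> X k \<Longrightarrow> - x \<in> X k"
    using 1 2 by (simp_all add: add_on_diff add_on_add add_on_neg add_on_zero addsub_zero
        addsub_diff addsub_add addsub_neg)
qed

definition Zc :: "(nat \<Rightarrow> 'a::ab_group_add set) \<Rightarrow> (nat \<Rightarrow> 'a \<Rightarrow> 'a) \<Rightarrow> nat \<Rightarrow> 'a set" where
  "Zc X d k = {x \<in> X k. d k x = 0}"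

fun Bc :: "(nat \<Rightarrow> 'a::ab_group_add set) \<Rightarrow> (nat \<Rightarrow> 'a \<Rightarrow> 'a) \<Rightarrow> nat \<Rightarrow> 'a set" where
  "Bc X d 0 = {0}"
| "Bc X d (Suc k) = d k ` X k"

lemma addsub_Zc: "cplx X d \<Longrightarrow> addsub (Zc X d k)"
  by (rule addsubI) (auto simp: Zc_def cplxD)

lemma addsub_Bc: "cplx X d \<Longrightarrow> addsub (Bc X d k)"
  by (cases k) (auto simp: addsub_singleton cplxD intro!: addsub_image)

lemma Bc_subset_Zc: "cplx X d \<Longrightarrow> Bc X d k \<subseteq> Zc X d k"
  by (cases k) (auto simp: Zc_def cplxD)

definition HH :: "(nat \<Rightarrow> 'a::ab_group_add set) \<Rightarrow> (nat \<Rightarrow> 'a \<Rightarrow> 'a) \<Rightarrow> nat \<Rightarrow> 'a set monoid" where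
  "HH X d k = Quot (Zc X d k) (Bc X d k)"

lemma group_HH: "cplx X d \<Longrightarrow> group (HH X d k)"
  and comm_group_HH: "cplx X d \<Longrightarrow> comm_group (HH X d k)"
  by (simp_all add: HH_def group_Quot comm_group_Quot addsub_Zc addsub_Bc Bc_subset_Zc)

definition hiso where
  "hiso X d k X' d' k' \<longleftrightarrow> qiso (Zc X d k) (Bc X d k) (Zc X' d' k') (Bc X' d' k')"

lemma hiso_HH:
  "hiso X d k X' d' k' \<Longrightarrow> cplx X d \<Longrightarrow> cplx X' d' \<Longrightarrow> HH X d k \<cong> HH X' d' k'"
  by (simp add: hiso_def HH_def qiso_Quot addsub_Zc addsub_Bc Bc_subset_Zc)

lemma hiso_sym: "hiso X d k X' d' k' \<Longrightarrow> hiso X' d' k' X d k"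
  by (simp add: hiso_def qiso_sym)

lemma hiso_trans: "hiso X d k X' d' k' \<Longrightarrow> hiso X' d' k' Y e l \<Longrightarrow> hiso X d k Y e l"
  unfolding hiso_def by (rule qiso_trans)

lemma hiso_chain_map:
  assumes X: "cplx X d"
    and e: "\<And>k. add_on (X k) (e k)" "\<And>k. bij_betw (e k) (X k) (Y k)"
    and ch: "\<And>k x. x \<in> X k \<Longrightarrow> d' k (e k x) = e (Suc k) (d k x)"
  shows "hiso X d k Y d' k"
  unfolding hiso_def
proof (rule qiso_map[where f = "e k"])
  have e0: "e k 0 = 0" for k
    using add_on_zero[OF e(1)] X by (simp add: cplxD)
  have inj: "e k x = e k y \<longleftrightarrow> x = y" if "x \<in> X k" "y \<in> X k" for k x y
    using e(2)[of k] that by (auto simp: bij_betw_def inj_on_def)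
  have inj0: "e k x = 0 \<longleftrightarrow> x = 0" if "x \<in> X k" for k x
    using inj[OF that, of 0] e0 X by (simp add: cplxD)
  have im: "e k ` X k = Y k" for k using e(2) by (simp add: bij_betw_def)
  show "addsub (Zc X d k)" using X by (rule addsub_Zc)
  show "add_on (Zc X d k) (e k)" using e(1)[of k] by (auto simp: add_on_def Zc_def)
  have *: "d' k (e k x) = 0 \<longleftrightarrow> d k x = 0" if "x \<in> X k" for x
    using ch[OF that] inj0 cplxD(3)[OF X that] by simp
  show "e k ` Zc X d k = Zc Y d' k"
    unfolding Zc_def im[symmetric] using * by auto
  show "e k x \<in> Bc Y d' k \<longleftrightarrow> x \<in> Bc X d k" if "x \<in> Zc X d k" for x
  proof (cases k)
    case 0
    then show ?thesis using inj0 that by (simp add: Zc_def)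
  next
    case (Suc j)
    have "e k x \<in> d' j ` Y j \<longleftrightarrow> (\<exists>y\<in>X j. e k x = e k (d j y))"
      using ch by (auto simp: im[symmetric] Suc image_iff)
    also have "\<dots> \<longleftrightarrow> x \<in> d j ` X j"
      using inj that cplxD(3)[OF X] by (auto simp: Zc_def Suc)
    finally show ?thesis by (simp add: Suc)
  qed
qed

text \<open>The connecting homomorphism of a short exact sequence whose middle complex is acyclic in
  positive degrees. It is built as a relation, in which \<open>c\<close> corresponds to
  \<open>a\<close> if some lift \<open>b\<close> of \<open>c\<close> has coboundary
  \<open>i a\<close>; thus no lift is chosen, and independence of the lift is part of the usual
  diagram chase. For k > 0 the middle complex has no cohomology in degrees k and k + 1.\<close>

lemma hiso_connecting:
  assumes A: "cplx A dA" and B: "cplx B dB" and C: "cplx C dC"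
    and i: "\<And>k. add_on (A k) (i k)" "\<And>k x. x \<in> A k \<Longrightarrow> i k x \<in> B k"
      "\<And>k x. x \<in> A k \<Longrightarrow> i k x = 0 \<Longrightarrow> x = 0"
      "\<And>k x. x \<in> A k \<Longrightarrow> dB k (i k x) = i (Suc k) (dA k x)"
    and p: "\<And>k. add_on (B k) (p k)" "\<And>k. p k ` B k = C k"
      "\<And>k x. x \<in> B k \<Longrightarrow> dC k (p k x) = p (Suc k) (dB k x)"
    and exact: "\<And>k x. x \<in> B k \<Longrightarrow> p k x = 0 \<longleftrightarrow> x \<in> i k ` A k"
    and vanish: "\<And>k. k > 0 \<Longrightarrow> Zc B dB k \<subseteq> Bc B dB k"
    and "k > 0"
  shows "hiso C dC k A dA (Suc k)"
proof -
  obtain j where j: "k = Suc j" using \<open>k > 0\<close> by (cases k) auto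
  have i0: "i k 0 = 0" and p0: "p k 0 = 0" for k
    using add_on_zero[OF i(1)] add_on_zero[OF p(1)] A B by (simp_all add: cplxD)
  have inj: "x = y" if "i k x = i k y" "x \<in> A k" "y \<in> A k" for k x y
    using i(3)[of "x - y" k] that add_on_diff[OF i(1) that(2,3)] A by (auto simp: cplxD)
  have pB: "x \<in> B k \<Longrightarrow> p k x \<in> C k" for k x using p(2) by blast
  show ?thesis
    unfolding hiso_def
  proof (rule qisoI[of "\<lambda>c a. c \<in> C k \<and> a \<in> A (Suc k) \<and> (\<exists>b\<in>B k. p k b = c \<and> dB k b = i (Suc k) a)"])
    fix c a
    assume "c \<in> C k \<and> a \<in> A (Suc k) \<and> (\<exists>b\<in>B k. p k b = c \<and> dB k b = i (Suc k) a)"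
    then obtain b where ca: "c \<in> C k" "a \<in> A (Suc k)"
      and b: "b \<in> B k" "p k b = c" "dB k b = i (Suc k) a" by blast
    have "dC k c = p (Suc k) (i (Suc k) a)" using p(3)[OF b(1)] b by simp
    also have "\<dots> = 0" using exact[OF i(2)[OF ca(2)]] ca by blast
    finally have 1: "dC k c = 0" .
    have "i (Suc (Suc k)) (dA (Suc k) a) = 0"
      using i(4)[OF ca(2)] b cplxD(4)[OF B b(1)] by simp
    then have 2: "dA (Suc k) a = 0" using i(3) cplxD(3)[OF A ca(2)] by blast
    show "c \<in> Zc C dC k \<and> a \<in> Zc A dA (Suc k)" using 1 2 ca by (simp add: Zc_def)
    show "a \<in> Bc A dA (Suc k)" if cB: "c \<in> Bc C dC k"
    proof -
      obtain c' where c': "c' \<in> C j" "c = dC j c'" using cB unfolding j by auto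
      obtain b' where b': "b' \<in> B j" "c' = p j b'" using c'(1) p(2)[of j] by blast
      have db': "dB j b' \<in> B k" using cplxD(3)[OF B b'(1)] j by simp
      have "p k (b - dB j b') = 0"
        using add_on_diff[OF p(1) b(1) db'] b c' b' p(3)[OF b'(1)] j by simp
      then obtain a' where a': "a' \<in> A k" "b - dB j b' = i k a'"
        using exact cplxD(10)[OF B b(1) db'] by blast
      have "i (Suc k) a = dB k (b - dB j b')"
        using cplxD(5)[OF B b(1) db'] cplxD(4)[OF B b'(1)] b j by simp
      also have "\<dots> = i (Suc k) (dA k a')" using a' i(4) by simp
      finally have "a = dA k a'" using inj ca(2) cplxD(3)[OF A a'(1)] by blast
      then show ?thesis using a' by simp
    qed
    show "c \<in> Bc C dC k" if aB: "a \<in> Bc A dA (Suc k)"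
    proof -
      obtain a' where a': "a' \<in> A k" "a = dA k a'" using aB by auto
      have "b - i k a' \<in> Zc B dB k"
        using b a' i(2,4) cplxD(5,10)[OF B b(1) i(2)[OF a'(1)]] by (simp add: Zc_def)
      then obtain b' where b': "b' \<in> B j" "b - i k a' = dB j b'" using vanish[of k] j by auto
      have "c = p k (b - i k a')"
        using add_on_diff[OF p(1) b(1) i(2)[OF a'(1)]] exact[OF i(2)[OF a'(1)]] a' b by simp
      also have "\<dots> = dC j (p j b')" using b' p(3) j by simp
      finally show ?thesis using j pB b' by simp
    qed
  next
    show "0 \<in> C k \<and> 0 \<in> A (Suc k) \<and> (\<exists>b\<in>B k. p k b = 0 \<and> dB k b = i (Suc k) 0)"
      using A B C i0 p0 by (auto simp: cplxD intro!: bexI[of _ 0])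
  next
    fix x y x' y'
    assume 1: "x \<in> C k \<and> y \<in> A (Suc k) \<and> (\<exists>b\<in>B k. p k b = x \<and> dB k b = i (Suc k) y)"
      and 2: "x' \<in> C k \<and> y' \<in> A (Suc k) \<and> (\<exists>b\<in>B k. p k b = x' \<and> dB k b = i (Suc k) y')"
    then obtain b b' where "b \<in> B k" "p k b = x" "dB k b = i (Suc k) y"
      "b' \<in> B k" "p k b' = x'" "dB k b' = i (Suc k) y'" by blast
    then show "x - x' \<in> C k \<and> y - y' \<in> A (Suc k) \<and>
        (\<exists>b\<in>B k. p k b = x - x' \<and> dB k b = i (Suc k) (y - y'))"
      using 1 2 A B C add_on_diff[OF p(1)] add_on_diff[OF i(1)]
      by (auto simp: cplxD intro!: bexI[of _ "b - b'"])
  next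
    fix c assume "c \<in> Zc C dC k"
    then have c: "c \<in> C k" "dC k c = 0" by (auto simp: Zc_def)
    then have "c \<in> p k ` B k" using p(2) by simp
    then obtain b where b: "c \<in> C k" "b \<in> B k" "p k b = c" "dC k c = 0"
      using c by blast
    then have "p (Suc k) (dB k b) = 0" using p(3) by metis
    then show "\<exists>a. c \<in> C k \<and> a \<in> A (Suc k) \<and> (\<exists>b\<in>B k. p k b = c \<and> dB k b = i (Suc k) a)"
      using exact cplxD(3)[OF B b(2)] b by blast
  next
    fix a assume a: "a \<in> Zc A dA (Suc k)"
    then have "i (Suc k) a \<in> Zc B dB (Suc k)"
      using i(2,4) i0 by (auto simp: Zc_def)
    then obtain b where "b \<in> B k" "i (Suc k) a = dB k b" using vanish[of "Suc k"] by auto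
    then show "\<exists>c. c \<in> C k \<and> a \<in> A (Suc k) \<and> (\<exists>b\<in>B k. p k b = c \<and> dB k b = i (Suc k) a)"
      using a pB by (auto simp: Zc_def)
  qed
qed

section \<open>The bar complex\<close>

text \<open>The alternating sum of all terms of the bar differential except the one involving the
  action. Splitting off the first entry reverses the sign of the rest, so proofs go by induction on
  the list and need no signs or index shifts.\<close>

fun bar :: "('e, 'c) monoid_scheme \<Rightarrow> ('e list \<Rightarrow> 'n::ab_group_add) \<Rightarrow> 'e list \<Rightarrow> 'n" where
  "bar G f [] = 0"
| "bar G f [g] = f []"
| "bar G f (g # h # l) = f ((g \<otimes>\<^bsub>G\<^esub> h) # l) - bar G (\<lambda>l. f (g # l)) (h # l)"

definition dB :: "('e, 'c) monoid_scheme \<Rightarrow> ('e \<Rightarrow> 'n \<Rightarrow> 'n) \<Rightarrow> nat \<Rightarrow>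
    ('e list \<Rightarrow> 'n::ab_group_add) \<Rightarrow> 'e list \<Rightarrow> 'n" where
  "dB G act k f = (\<lambda>l. if l \<in> tuples G (Suc k) then act (hd l) (f (tl l)) - bar G f l else 0)"

text \<open>Cochains are 0 off the tuples of the right length, not \<open>undefined\<close>, so that
  they form a subgroup of the pointwise additive group of all functions on lists.\<close>

definition CC :: "('e, 'c) monoid_scheme \<Rightarrow> 'n::ab_group_add set \<Rightarrow> nat \<Rightarrow> ('e list \<Rightarrow> 'n) set" where
  "CC G N k = {f. (\<forall>l\<in>tuples G k. f l \<in> N) \<and> (\<forall>l. l \<notin> tuples G k \<longrightarrow> f l = 0)}"

definition gmod :: "('e, 'c) monoid_scheme \<Rightarrow> 'n::ab_group_add set \<Rightarrow> ('e \<Rightarrow> 'n \<Rightarrow> 'n) \<Rightarrow> bool" where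
  "gmod G N act \<longleftrightarrow> addsub N \<and> (\<forall>g\<in>carrier G. add_on N (act g) \<and> act g ` N \<subseteq> N) \<and>
     (\<forall>g\<in>carrier G. \<forall>h\<in>carrier G. \<forall>n\<in>N. act (g \<otimes>\<^bsub>G\<^esub> h) n = act g (act h n)) \<and>
     (\<forall>n\<in>N. act \<one>\<^bsub>G\<^esub> n = n)"

lemma gmodD:
  assumes "gmod G N act"
  shows "addsub N" "g \<in> carrier G \<Longrightarrow> add_on N (act g)"
    "g \<in> carrier G \<Longrightarrow> n \<in> N \<Longrightarrow> act g n \<in> N"
    "g \<in> carrier G \<Longrightarrow> h \<in> carrier G \<Longrightarrow> n \<in> N \<Longrightarrow> act (g \<otimes>\<^bsub>G\<^esub> h) n = act g (act h n)"
    "n \<in> N \<Longrightarrow> act \<one>\<^bsub>G\<^esub> n = n"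
    "g \<in> carrier G \<Longrightarrow> n \<in> N \<Longrightarrow> n' \<in> N \<Longrightarrow> act g (n - n') = act g n - act g n'"
    "g \<in> carrier G \<Longrightarrow> n \<in> N \<Longrightarrow> n' \<in> N \<Longrightarrow> act g (n + n') = act g n + act g n'"
    "g \<in> carrier G \<Longrightarrow> n \<in> N \<Longrightarrow> act g (- n) = - act g n"
    "g \<in> carrier G \<Longrightarrow> act g 0 = 0"
proof -
  show 1: "addsub N" "g \<in> carrier G \<Longrightarrow> add_on N (act g)"
    "g \<in> carrier G \<Longrightarrow> n \<in> N \<Longrightarrow> act g n \<in> N"
    "g \<in> carrier G \<Longrightarrow> h \<in> carrier G \<Longrightarrow> n \<in> N \<Longrightarrow> act (g \<otimes>\<^bsub>G\<^esub> h) n = act g (act h n)"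
    "n \<in> N \<Longrightarrow> act \<one>\<^bsub>G\<^esub> n = n" for g h n
    using assms by (auto simp: gmod_def)
  show "g \<in> carrier G \<Longrightarrow> n \<in> N \<Longrightarrow> n' \<in> N \<Longrightarrow> act g (n - n') = act g n - act g n'"
    "g \<in> carrier G \<Longrightarrow> n \<in> N \<Longrightarrow> n' \<in> N \<Longrightarrow> act g (n + n') = act g n + act g n'"
    "g \<in> carrier G \<Longrightarrow> n \<in> N \<Longrightarrow> act g (- n) = - act g n"
    "g \<in> carrier G \<Longrightarrow> act g 0 = 0"
    using add_on_diff[OF 1(2)] add_on_add[OF 1(2) 1(1)] add_on_neg[OF 1(2) 1(1)]
      add_on_zero[OF 1(2) 1(1)] by simp_all
qed

lemma tuples_simps [simp]:
  "[] \<in> tuples G k \<longleftrightarrow> k = 0"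
  "g # l \<in> tuples G k \<longleftrightarrow> g \<in> carrier G \<and> (\<exists>j. k = Suc j \<and> l \<in> tuples G j)"
  by (auto simp: tuples_def)

lemma tuples_0 [simp]: "l \<in> tuples G 0 \<longleftrightarrow> l = []"
  by (auto simp: tuples_def)

lemma tuples_SucE:
  assumes "l \<in> tuples G (Suc k)"
  obtains g l' where "l = g # l'" "g \<in> carrier G" "l' \<in> tuples G k"
  using assms by (cases l) auto

lemma bar_cong:
  assumes "group G" "l \<in> tuples G (Suc k)" "\<And>l'. l' \<in> tuples G k \<Longrightarrow> f l' = f' l'"
  shows "bar G f l = bar G f' l"
  using assms(2,3)
proof (induction l arbitrary: k f f' rule: induct_list012)
  case (3 g h l)
  then obtain j where j: "k = Suc j" "l \<in> tuples G j" "g \<in> carrier G" "h \<in> carrier G" by auto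
  have "bar G (\<lambda>l. f (g # l)) (h # l) = bar G (\<lambda>l. f' (g # l)) (h # l)"
    by (rule "3.IH"(2)[of j]) (use j "3.prems" in auto)
  then show ?case
    using j "3.prems"(2) monoid.m_closed[OF group.is_monoid[OF assms(1)]] by simp
qed auto

lemma bar_mem:
  assumes "group G" "addsub N" "l \<in> tuples G (Suc k)" "\<And>l'. l' \<in> tuples G k \<Longrightarrow> f l' \<in> N"
  shows "bar G f l \<in> N"
  using assms(3,4)
proof (induction l arbitrary: k f rule: induct_list012)
  case (3 g h l)
  then obtain j where j: "k = Suc j" "l \<in> tuples G j" "g \<in> carrier G" "h \<in> carrier G" by auto
  have "bar G (\<lambda>l. f (g # l)) (h # l) \<in> N"
    by (rule "3.IH"(2)[of j]) (use j "3.prems" in auto)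
  then show ?case
    using j "3.prems"(2) monoid.m_closed[OF group.is_monoid[OF assms(1)]] assms(2)
    by (simp add: addsub_diff)
qed auto

lemma bar_additive:
  assumes "group G" "addsub N" "add_on N e" "l \<in> tuples G (Suc k)"
    "\<And>l'. l' \<in> tuples G k \<Longrightarrow> f l' \<in> N"
  shows "e (bar G f l) = bar G (\<lambda>l. e (f l)) l"
  using assms(4,5)
proof (induction l arbitrary: k f rule: induct_list012)
  case (3 g h l)
  then obtain j where j: "k = Suc j" "l \<in> tuples G j" "g \<in> carrier G" "h \<in> carrier G" by auto
  have "e (bar G (\<lambda>l. f (g # l)) (h # l)) = bar G (\<lambda>l. e (f (g # l))) (h # l)"
    by (rule "3.IH"(2)[of j]) (use j "3.prems" in auto)
  moreover have "bar G (\<lambda>l. f (g # l)) (h # l) \<in> N"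
    by (rule bar_mem[OF assms(1,2), of _ j]) (use j "3.prems" in auto)
  ultimately show ?case
    using j "3.prems"(2) monoid.m_closed[OF group.is_monoid[OF assms(1)]] assms(3)
    by (simp add: add_on_diff)
qed auto

lemma bar_diff: "bar G (\<lambda>l. f l - f' l) l = bar G f l - bar G f' l"
  by (induction l arbitrary: f f' rule: induct_list012) auto

text \<open>After splitting off the first entry \<open>g\<close>, the inner \<open>bar\<close> is a
  merged term minus a \<open>bar\<close> of the slice at \<open>g\<close>. The double
  \<open>bar\<close> of the slice vanishes by induction, and the merged terms cancel by
  associativity.\<close>

lemma bar_bar:
  assumes "group G" "l \<in> tuples G (Suc (Suc k))"
  shows "bar G (bar G f) l = 0"
  using assms(2)
proof (induction l arbitrary: k f rule: induct_list012)
  case (3 g h l)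
  interpret group G by (rule assms(1))
  show ?case
  proof (cases l)
    case (Cons x r)
    then obtain j where j: "k = Suc j" "r \<in> tuples G j"
      "g \<in> carrier G" "h \<in> carrier G" "x \<in> carrier G"
      using "3.prems" by auto
    have "bar G (\<lambda>l. bar G f (g # l)) (h # x # r) =
      bar G (\<lambda>l. f ((g \<otimes>\<^bsub>G\<^esub> hd l) # tl l) - bar G (\<lambda>l. f (g # l)) l) (h # x # r)"
      by (rule bar_cong[OF assms(1), of _ "Suc j"]) (use j in \<open>auto elim!: tuples_SucE\<close>)
    also have "\<dots> = bar G (\<lambda>l. f ((g \<otimes>\<^bsub>G\<^esub> hd l) # tl l)) (h # x # r)"
      using "3.IH"(2)[of j "\<lambda>l. f (g # l)"] j Cons by (simp add: bar_diff)
    finally show ?thesis using j by (simp add: Cons m_assoc)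
  qed simp
qed auto

lemma cplx_bar:
  assumes G: "group G" and M: "gmod G N act"
  shows "cplx (CC G N) (dB G act)"
  unfolding cplx_def
proof (intro allI conjI)
  interpret group G by (rule G)
  fix k
  show "addsub (CC G N k)"
    using gmodD(1)[OF M] by (intro addsubI) (auto simp: CC_def addsub_zero addsub_diff)
  show "add_on (CC G N k) (dB G act k)"
  proof (rule add_onI, rule ext)
    fix x y :: "'a list \<Rightarrow> 'c" and l assume "x \<in> CC G N k" "y \<in> CC G N k"
    moreover have "bar G (x - y) l = bar G x l - bar G y l"
      using bar_diff[of G x y l] by (simp add: fun_diff_def)
    ultimately show "dB G act k (x - y) l = (dB G act k x - dB G act k y) l"
      by (auto simp: dB_def CC_def gmodD[OF M] elim!: tuples_SucE)
  qed
  show "dB G act k ` CC G N k \<subseteq> CC G N (Suc k)"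
  proof (clarify)
    fix f assume f: "f \<in> CC G N k"
    have "bar G f l \<in> N" if "l \<in> tuples G (Suc k)" for l
      using bar_mem[OF G gmodD(1)[OF M] that] f by (auto simp: CC_def)
    then show "dB G act k f \<in> CC G N (Suc k)"
      using f gmodD(3)[OF M] addsub_diff[OF gmodD(1)[OF M]]
      by (auto simp: CC_def dB_def elim!: tuples_SucE)
  qed
  show "\<forall>f\<in>CC G N k. dB G act (Suc k) (dB G act k f) = 0"
  proof (intro ballI ext)
    fix f l assume f: "f \<in> CC G N k"
    show "dB G act (Suc k) (dB G act k f) l = 0 l"
    proof (cases "l \<in> tuples G (Suc (Suc k))")
      case True
      then obtain g h r where l: "l = g # h # r" and g: "g \<in> carrier G" "h \<in> carrier G"
        and r: "r \<in> tuples G k" by (auto elim!: tuples_SucE)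
      have b: "bar G f (h # r) \<in> N"
        using bar_mem[OF G gmodD(1)[OF M], of "h # r" k f] f g r by (auto simp: CC_def)
      have fr: "f r \<in> N" using f r by (simp add: CC_def)
      have "bar G (\<lambda>l. dB G act k f (g # l)) (h # r) =
        bar G (\<lambda>l. act g (f l) - bar G f (g # l)) (h # r)"
        by (rule bar_cong[OF G, of _ k]) (use g r in \<open>auto simp: dB_def\<close>)
      also have "\<dots> = act g (bar G f (h # r)) - bar G (\<lambda>l. bar G f (g # l)) (h # r)"
        using bar_additive[OF G gmodD(1)[OF M] gmodD(2)[OF M g(1)], of "h # r" k f] f g r
        by (simp add: bar_diff CC_def)
      \<comment> \<open>This is \<open>bar_bar\<close> for the tuple g, h, r, unfolded once.\<close>
      also have "bar G (\<lambda>l. bar G f (g # l)) (h # r) = bar G f ((g \<otimes>\<^bsub>G\<^esub> h) # r)"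
        using bar_bar[OF G True[unfolded l], of f] by simp
      finally show ?thesis
        using g r b fr by (simp add: l dB_def gmodD[OF M])
    qed (simp add: dB_def)
  qed
qed

section \<open>Group cohomology as an additive quotient\<close>

lemma finprod_addgrp:
  assumes "addsub A" "finite I" "\<And>i. i \<in> I \<Longrightarrow> f i \<in> A"
  shows "finprod (addgrp A) f I = sum f I"
proof -
  interpret comm_group "addgrp A" by (rule comm_group_addgrp[OF assms(1)])
  show ?thesis using assms(2,3) by (induction) (simp_all add: Pi_def)
qed

lemma pow_sign_addgrp:
  assumes "addsub A" "x \<in> A"
  shows "x [^]\<^bsub>addgrp A\<^esub> ((-1) ^ Suc i :: int) = (if even i then - x else x)"
proof -
  interpret comm_group "addgrp A" by (rule comm_group_addgrp[OF assms(1)])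
  have "x [^]\<^bsub>addgrp A\<^esub> (- 1 :: int) = - x"
    using int_pow_neg[of x 1] int_pow_1[of x] assms by (simp add: inv_addgrp)
  moreover have "x [^]\<^bsub>addgrp A\<^esub> (1 :: int) = x"
    using int_pow_1[of x] assms by simp
  ultimately show ?thesis by simp
qed

lemma bar_alternating_sum:
  assumes "length gs = Suc n"
  shows "(\<Sum>i<n. if even i then f (merge_at G i gs) else - f (merge_at G i gs)) +
     (if even n then f (butlast gs) else - f (butlast gs)) = bar G f gs"
  using assms
proof (induction gs arbitrary: n f rule: induct_list012)
  case (3 g h l)
  then obtain m where n: "n = Suc m" and m: "length (h # l) = Suc m" by auto
  have ms: "merge_at G (Suc i) (g # h # l) = g # merge_at G i (h # l)" for i
    by (simp add: merge_at_def)
  have "bar G (\<lambda>l. f (g # l)) (h # l) =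
    (\<Sum>i<m. if even i then f (g # merge_at G i (h # l)) else - f (g # merge_at G i (h # l))) +
     (if even m then f (g # butlast (h # l)) else - f (g # butlast (h # l)))"
    using "3.IH"(2)[OF m, of "\<lambda>l. f (g # l)"] by simp
  moreover have "(\<Sum>i<n. if even i then f (merge_at G i (g # h # l)) else - f (merge_at G i (g # h # l)))
    = f ((g \<otimes>\<^bsub>G\<^esub> h) # l) -
      (\<Sum>i<m. if even i then f (g # merge_at G i (h # l)) else - f (g # merge_at G i (h # l)))"
    unfolding n sum.lessThan_Suc_shift sum_negf[symmetric] diff_conv_add_uminus
    by (intro arg_cong2[where f = "(+)"] sum.cong) (auto simp: ms, simp add: merge_at_def)
  ultimately show ?case by (simp add: n)
qed auto

lemma butlast_tuples: "gs \<in> tuples G (Suc k) \<Longrightarrow> butlast gs \<in> tuples G k"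
  by (auto simp: tuples_def dest: in_set_butlastD)

lemma merge_at_tuples:
  assumes "group G" "gs \<in> tuples G (Suc k)" "i < k"
  shows "merge_at G i gs \<in> tuples G k"
proof -
  interpret group G by (rule assms(1))
  have "gs ! i \<in> carrier G" "gs ! Suc i \<in> carrier G"
    using assms(2,3) by (auto simp: tuples_def subset_iff)
  then show ?thesis
    using assms(2,3) by (auto simp: tuples_def merge_at_def subset_iff dest: in_set_takeD in_set_dropD)
qed

lemma coboundary_eq:
  assumes G: "group G" and M: "gmod G A act" and f: "f \<in> CC G A k"
    and l: "gs \<in> tuples G (Suc k)"
    and f': "\<And>l. l \<in> tuples G k \<Longrightarrow> f' l = f l"
  shows "coboundary G (addgrp A) act k f' gs = dB G act k f gs"
proof -
  have A: "addsub A" by (rule gmodD(1)[OF M])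
  have fA: "f l \<in> A" if "l \<in> tuples G k" for l using f that by (simp add: CC_def)
  have mem: "f' (merge_at G i gs) = f (merge_at G i gs)" "f (merge_at G i gs) \<in> A" if "i < k" for i
    using fA f' merge_at_tuples[OF G l that] by auto
  have bm: "f' (butlast gs) = f (butlast gs)" "f (butlast gs) \<in> A"
    using fA f' butlast_tuples[OF l] by auto
  have tm: "f' (tl gs) = f (tl gs)" using l f' by (auto elim!: tuples_SucE)
  have "finprod (addgrp A) (\<lambda>i. f' (merge_at G i gs) [^]\<^bsub>addgrp A\<^esub> ((-1) ^ Suc i :: int)) {..<k}
    = (\<Sum>i<k. f' (merge_at G i gs) [^]\<^bsub>addgrp A\<^esub> ((-1) ^ Suc i :: int))"
    by (rule finprod_addgrp[OF A])
      (simp_all only: finite_lessThan lessThan_iff mem pow_sign_addgrp[OF A], simp add: addsub_neg[OF A] mem)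
  also have "\<dots> = (\<Sum>i<k. if even i then - f (merge_at G i gs) else f (merge_at G i gs))"
    by (rule sum.cong) (simp_all only: lessThan_iff mem pow_sign_addgrp[OF A])
  also have "\<dots> = - (\<Sum>i<k. if even i then f (merge_at G i gs) else - f (merge_at G i gs))"
    unfolding sum_negf[symmetric] by (rule sum.cong) auto
  finally have "coboundary G (addgrp A) act k f' gs = act (hd gs) (f (tl gs))
      - ((\<Sum>i<k. if even i then f (merge_at G i gs) else - f (merge_at G i gs)) +
      (if even k then f (butlast gs) else - f (butlast gs)))"
    using l by (simp only: coboundary_def restrict_apply' addgrp_simps pow_sign_addgrp[OF A bm(2)] bm(1) tm) simp
  also have "\<dots> = act (hd gs) (f (tl gs)) - bar G f gs"
    by (subst bar_alternating_sum) (use l in \<open>simp_all add: tuples_def\<close>)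
  finally show ?thesis using l by (simp add: dB_def)
qed

text \<open>The two models differ off the tuples: cochains of the product group are extensional
  there, whereas those in \<open>CC\<close> are 0. \<open>rs\<close> and \<open>ex\<close> pass
  between the two normalisations and match cocycles and coboundaries.\<close>

lemma group_cohomology_iso:
  assumes G: "group G" and M: "gmod G A act"
  shows "group_cohomology G (addgrp A) act k \<cong> HH (CC G A) (dB G act) k"
    and "group (group_cohomology G (addgrp A) act k)"
proof -
  note cx = cplx_bar[OF G M]
  have A: "addsub A" by (rule gmodD(1)[OF M])
  define rs :: "nat \<Rightarrow> ('a list \<Rightarrow> 'c) \<Rightarrow> 'a list \<Rightarrow> 'c" where "rs k f = restrict f (tuples G k)" for k f
  define ex where "ex f = (\<lambda>l. if l \<in> tuples G k then f l else 0)" for f :: "'a list \<Rightarrow> 'c"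
  have carr: "carrier (cochains G (addgrp A) k) = rs k ` CC G A k" for k
  proof
    show "carrier (cochains G (addgrp A) k) \<subseteq> rs k ` CC G A k"
    proof
      fix f assume f: "f \<in> carrier (cochains G (addgrp A) k)"
      let ?g = "\<lambda>l. if l \<in> tuples G k then f l else 0"
      have "f = rs k ?g" "?g \<in> CC G A k"
        using f by (auto simp: cochains_def rs_def CC_def PiE_iff extensional_def restrict_def fun_eq_iff)
      then show "f \<in> rs k ` CC G A k" by blast
    qed
  qed (auto simp: cochains_def rs_def CC_def)
  have cob: "coboundary G (addgrp A) act k (rs k f) = rs (Suc k) (dB G act k f)"
    if "f \<in> CC G A k" for f k
    using coboundary_eq[OF G M that, of _ "rs k f"]
    by (auto simp: rs_def fun_eq_iff coboundary_def restrict_def)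
  have rs_eq: "rs k f = rs k g \<longleftrightarrow> f = g" if "f \<in> CC G A k" "g \<in> CC G A k" for f g k
    using that by (auto simp: rs_def CC_def fun_eq_iff restrict_def) metis
  have one: "\<one>\<^bsub>cochains G (addgrp A) k\<^esub> = rs k 0" for k
    by (auto simp: cochains_def rs_def restrict_def)
  have cyc: "cocycles G (addgrp A) act k = rs k ` Zc (CC G A) (dB G act) k"
    unfolding cocycles_def kernel_def carr one Zc_def
    using cob rs_eq cplxD(3,9)[OF cx] by auto
  have bou: "coboundaries G (addgrp A) act k = rs k ` Bc (CC G A) (dB G act) k"
    by (cases k) (auto simp: one carr image_image cob intro!: image_cong)
  have exrs: "ex (rs k f) = f" if "f \<in> CC G A k" for f
    using that by (auto simp: ex_def rs_def CC_def fun_eq_iff)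
  let ?P = "(cochains G (addgrp A) k)\<lparr>carrier := cocycles G (addgrp A) act k\<rparr>"
  have mul: "rs k f \<otimes>\<^bsub>?P\<^esub> rs k g = rs k (f + g)" for f g
    by (auto simp: cochains_def rs_def fun_eq_iff restrict_def)
  have "rs k \<in> hom (addgrp (Zc (CC G A) (dB G act) k)) ?P"
    by (rule hom_addgrpI) (simp add: cyc, simp only: mul)
  from group.hom_imp_img_group[OF group_addgrp[OF addsub_Zc[OF cx]] this]
  have grP: "group ?P"
    by (simp add: cyc[symmetric] one[symmetric])
  obtain q where q: "q \<in> hom (addgrp (Zc (CC G A) (dB G act) k)) (HH (CC G A) (dB G act) k)"
    "q ` Zc (CC G A) (dB G act) k = carrier (HH (CC G A) (dB G act) k)"
    "\<And>x. x \<in> Zc (CC G A) (dB G act) k \<Longrightarrow>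
      q x = \<one>\<^bsub>HH (CC G A) (dB G act) k\<^esub> \<longleftrightarrow> x \<in> Bc (CC G A) (dB G act) k"
    using Quot_proj[OF addsub_Zc addsub_Bc Bc_subset_Zc, OF cx cx cx] unfolding HH_def by blast
  have ZC: "x \<in> CC G A k" if "x \<in> Zc (CC G A) (dB G act) k" for x
    using that by (simp add: Zc_def)
  have qh: "(\<lambda>x. q (ex x)) \<in> hom ?P (HH (CC G A) (dB G act) k)"
  proof (rule homI)
    fix x y assume "x \<in> carrier ?P" "y \<in> carrier ?P"
    then obtain f g where fg: "f \<in> Zc (CC G A) (dB G act) k" "g \<in> Zc (CC G A) (dB G act) k"
      "x = rs k f" "y = rs k g" by (auto simp: cyc)
    then have "f + g \<in> Zc (CC G A) (dB G act) k" using addsub_add[OF addsub_Zc[OF cx]] by blast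
    then show "q (ex (x \<otimes>\<^bsub>?P\<^esub> y)) = q (ex x) \<otimes>\<^bsub>HH (CC G A) (dB G act) k\<^esub> q (ex y)"
      using hom_mult[OF q(1), of f g] fg by (simp only: mul fg exrs ZC addgrp_simps)
  qed (use q(1) in \<open>auto simp: cyc exrs ZC hom_def\<close>)
  interpret group_hom ?P "HH (CC G A) (dB G act) k" "\<lambda>x. q (ex x)"
    by (simp add: group_hom_def group_hom_axioms_def grP group_HH[OF cx] qh)
  have "(\<lambda>x. q (ex x)) ` carrier ?P = carrier (HH (CC G A) (dB G act) k)"
    using q(2) by (simp add: cyc image_image exrs ZC cong: image_cong)
  moreover have ker: "kernel ?P (HH (CC G A) (dB G act) k) (\<lambda>x. q (ex x)) = coboundaries G (addgrp A) act k"
  proof -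
    have "{f \<in> Zc (CC G A) (dB G act) k. q (ex (rs k f)) = \<one>\<^bsub>HH (CC G A) (dB G act) k\<^esub>} =
        {f \<in> Zc (CC G A) (dB G act) k. f \<in> Bc (CC G A) (dB G act) k}"
      by (rule Collect_cong, rule conj_cong[OF HOL.refl]) (simp only: exrs[OF ZC] q(3))
    also have "\<dots> = Bc (CC G A) (dB G act) k" using Bc_subset_Zc[OF cx] by blast
    finally have "{f \<in> Zc (CC G A) (dB G act) k. q (ex (rs k f)) = \<one>\<^bsub>HH (CC G A) (dB G act) k\<^esub>} =
        Bc (CC G A) (dB G act) k" .
    then show ?thesis unfolding kernel_def bou by (simp add: cyc) blast
  qed
  ultimately show "group_cohomology G (addgrp A) act k \<cong> HH (CC G A) (dB G act) k"
    using FactGroup_iso by (simp add: group_cohomology_def)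
  show "group (group_cohomology G (addgrp A) act k)"
    unfolding group_cohomology_def ker[symmetric]
    by (rule normal.factorgroup_is_group[OF normal_kernel])
qed

section \<open>Coinduced modules and dimension shifting\<close>

text \<open>
  Functions \<open>E \<rightarrow> N\<close> are packed into the type \<open>'e list \<Rightarrow> 'n\<close> whenever \<open>N\<close> lives in it, so that
  passing from \<open>N\<close> to a coinduced module does not leave the type and dimension shifting can be
  iterated.
\<close>

definition pk :: "('e \<Rightarrow> 'e list \<Rightarrow> 'n::ab_group_add) \<Rightarrow> 'e list \<Rightarrow> 'n" where
  "pk \<phi> = (\<lambda>l. case l of [] \<Rightarrow> 0 | x # l \<Rightarrow> \<phi> x l)"

definition unp :: "('e list \<Rightarrow> 'n::ab_group_add) \<Rightarrow> 'e \<Rightarrow> 'e list \<Rightarrow> 'n" where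
  "unp \<psi> x = (\<lambda>l. \<psi> (x # l))"

lemma unp_simps [simp]:
  "unp (pk \<phi>) x = \<phi> x" "unp (\<psi> - \<psi>') x = unp \<psi> x - unp \<psi>' x"
  "unp 0 x = 0" "pk \<phi> [] = 0"
  by (auto simp: pk_def unp_def)

lemma unp_eqI: "\<psi> [] = \<psi>' [] \<Longrightarrow> (\<And>x. unp \<psi> x = unp \<psi>' x) \<Longrightarrow> \<psi> = \<psi>'"
  unfolding unp_def fun_eq_iff by (metis list.exhaust)

text \<open>A function on \<open>E\<close> is stored on nonempty lists, the head being its argument.
  The value at the empty list carries no information and is normalised to 0, as are the values
  outside the carrier.\<close>

definition Coind :: "('e, 'c) monoid_scheme \<Rightarrow> ('e list \<Rightarrow> 'n::ab_group_add) set \<Rightarrow>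
    ('e list \<Rightarrow> 'n) set" where
  "Coind E N = {\<psi>. \<psi> [] = 0 \<and> (\<forall>x\<in>carrier E. unp \<psi> x \<in> N) \<and> (\<forall>x. x \<notin> carrier E \<longrightarrow> unp \<psi> x = 0)}"

definition cact :: "('e, 'c) monoid_scheme \<Rightarrow> 'e \<Rightarrow> ('e list \<Rightarrow> 'n::ab_group_add) \<Rightarrow> 'e list \<Rightarrow> 'n" where
  "cact E g \<psi> = pk (\<lambda>x. if x \<in> carrier E then unp \<psi> (x \<otimes>\<^bsub>E\<^esub> g) else 0)"

text \<open>The canonical map from N to its coinduced module. It is equivariant for right
  translation, because evaluating the image of gm at x gives xgm.\<close>

definition emb :: "('e, 'c) monoid_scheme \<Rightarrow> ('e \<Rightarrow> ('e list \<Rightarrow> 'n) \<Rightarrow> 'e list \<Rightarrow> 'n) \<Rightarrow>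
    ('e list \<Rightarrow> 'n::ab_group_add) \<Rightarrow> 'e list \<Rightarrow> 'n" where
  "emb E act m = pk (\<lambda>x. if x \<in> carrier E then act x m else 0)"

text \<open>Evaluation at the identity splits \<open>emb\<close> additively but not equivariantly.
  Subtracting the embedded value at the identity therefore picks a canonical representative modulo
  the image of \<open>emb\<close>.\<close>

definition proj :: "('e, 'c) monoid_scheme \<Rightarrow> ('e \<Rightarrow> ('e list \<Rightarrow> 'n) \<Rightarrow> 'e list \<Rightarrow> 'n) \<Rightarrow>
    ('e list \<Rightarrow> 'n::ab_group_add) \<Rightarrow> 'e list \<Rightarrow> 'n" where
  "proj E act \<psi> = \<psi> - emb E act (unp \<psi> \<one>\<^bsub>E\<^esub>)"

text \<open>The cokernel of \<open>emb\<close>, realised as the functions vanishing at the identity.\<close>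

definition QM :: "('e, 'c) monoid_scheme \<Rightarrow> ('e list \<Rightarrow> 'n::ab_group_add) set \<Rightarrow> ('e list \<Rightarrow> 'n) set" where
  "QM E N = {\<psi> \<in> Coind E N. unp \<psi> \<one>\<^bsub>E\<^esub> = 0}"

definition qact :: "('e, 'c) monoid_scheme \<Rightarrow> ('e \<Rightarrow> ('e list \<Rightarrow> 'n) \<Rightarrow> 'e list \<Rightarrow> 'n) \<Rightarrow>
    'e \<Rightarrow> ('e list \<Rightarrow> 'n::ab_group_add) \<Rightarrow> 'e list \<Rightarrow> 'n" where
  "qact E act g \<psi> = proj E act (cact E g \<psi>)"

lemma gmod_subset:
  assumes "gmod E N act" "H \<subseteq> carrier E"
  shows "gmod (E\<lparr>carrier := H\<rparr>) N act"
  using assms unfolding gmod_def by (auto simp: image_subset_iff subset_iff)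

definition equivar where
  "equivar G N act act' e \<longleftrightarrow> add_on N e \<and> (\<forall>g\<in>carrier G. \<forall>n\<in>N. e (act g n) = act' g (e n))"

lemma equivar_subset:
  "equivar E N act act' e \<Longrightarrow> H \<subseteq> carrier E \<Longrightarrow> equivar (E\<lparr>carrier := H\<rparr>) N act act' e"
  by (auto simp: equivar_def)

lemma dB_map:
  assumes G: "group G" and M: "gmod G N act" and e: "equivar G N act act' e" and f: "f \<in> CC G N k"
  shows "dB G act' k (e \<circ> f) = e \<circ> dB G act k f"
proof
  fix l
  have e1: "add_on N e" and e2: "\<And>g n. g \<in> carrier G \<Longrightarrow> n \<in> N \<Longrightarrow> e (act g n) = act' g (e n)"
    using e by (auto simp: equivar_def)
  have e0: "e 0 = 0" by (rule add_on_zero[OF e1 gmodD(1)[OF M]])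
  show "dB G act' k (e \<circ> f) l = (e \<circ> dB G act k f) l"
  proof (cases "l \<in> tuples G (Suc k)")
    case True
    then obtain g r where l: "l = g # r" "g \<in> carrier G" "r \<in> tuples G k" by (rule tuples_SucE)
    have fN: "\<And>r. r \<in> tuples G k \<Longrightarrow> f r \<in> N" using f by (simp add: CC_def)
    have b: "e (bar G f l) = bar G (\<lambda>l. e (f l)) l" "bar G f l \<in> N"
      using bar_additive[OF G gmodD(1)[OF M] e1 True] bar_mem[OF G gmodD(1)[OF M] True] fN by auto
    show ?thesis
      using True b e2[OF l(2) fN[OF l(3)]] add_on_diff[OF e1 gmodD(3)[OF M l(2) fN[OF l(3)]] b(2)] l
      by (simp add: dB_def comp_def)
  qed (simp add: dB_def e0)
qed

lemma CC_map:
  assumes "f \<in> CC G N k" "e 0 = 0" "\<And>n. n \<in> N \<Longrightarrow> e n \<in> N'"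
  shows "e \<circ> f \<in> CC G N' k"
  using assms by (auto simp: CC_def)

lemma add_on_CC_map:
  assumes "add_on N e" "addsub N"
  shows "add_on (CC G N k) ((\<circ>) e)"
proof (rule add_onI, rule ext)
  fix x y l
  assume "x \<in> CC G N k" "y \<in> CC G N k"
  then have "x l \<in> N" "y l \<in> N" using addsub_zero[OF assms(2)] by (auto simp: CC_def)
  then show "(e \<circ> (x - y)) l = ((e \<circ> x) - (e \<circ> y)) l" using assms(1) by (simp add: add_on_diff)
qed

locale gmodule = group E for E (structure) +
  fixes N :: "('e list \<Rightarrow> 'n::ab_group_add) set" and act :: "'e \<Rightarrow> ('e list \<Rightarrow> 'n) \<Rightarrow> 'e list \<Rightarrow> 'n"
  constrains E :: "('e, 'c) monoid_scheme"
  assumes M: "gmod E N act"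
begin

lemma addsub_Coind: "addsub (Coind E N)"
  using gmodD(1)[OF M] by (intro addsubI) (auto simp: Coind_def addsub_zero addsub_diff)

lemma gmod_Coind: "gmod E (Coind E N) (cact E)"
  unfolding gmod_def
proof (intro conjI ballI)
  show "addsub (Coind E N)" by (rule addsub_Coind)
  show "add_on (Coind E N) (cact E g)" if "g \<in> carrier E" for g
    by (rule add_onI, rule unp_eqI) (simp_all add: cact_def)
  show "cact E g ` Coind E N \<subseteq> Coind E N" if "g \<in> carrier E" for g
    using that by (auto simp: Coind_def cact_def)
  show "cact E (g \<otimes> h) n = cact E g (cact E h n)"
    if "g \<in> carrier E" "h \<in> carrier E" "n \<in> Coind E N" for g h n
    by (rule unp_eqI) (use that in \<open>simp_all add: cact_def m_assoc zero_fun_def\<close>)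
  show "cact E \<one> n = n" if "n \<in> Coind E N" for n
    by (rule unp_eqI) (use that in \<open>auto simp: cact_def Coind_def\<close>)
qed

lemma emb_mem: "n \<in> N \<Longrightarrow> emb E act n \<in> Coind E N"
  by (auto simp: emb_def Coind_def gmodD[OF M])

lemma add_on_emb: "add_on N (emb E act)"
  by (rule add_onI, rule unp_eqI) (simp_all add: emb_def gmodD[OF M])

lemma emb_0: "emb E act 0 = 0"
  by (rule add_on_zero[OF add_on_emb gmodD(1)[OF M]])

lemma unp_emb_one: "n \<in> N \<Longrightarrow> unp (emb E act n) \<one> = n"
  by (simp add: emb_def gmodD[OF M])

lemma equivar_emb: "equivar E N act (cact E) (emb E act)"
  unfolding equivar_def
proof (intro conjI ballI add_on_emb)
  fix g n assume gn: "g \<in> carrier E" "n \<in> N"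
  show "emb E act (act g n) = cact E g (emb E act n)"
    by (rule unp_eqI) (simp_all add: emb_def cact_def gmodD[OF M] gn zero_fun_def)
qed

lemma CoindD: "\<psi> \<in> Coind E N \<Longrightarrow> x \<in> carrier E \<Longrightarrow> unp \<psi> x \<in> N"
  by (simp add: Coind_def)

lemma proj_mem: "\<psi> \<in> Coind E N \<Longrightarrow> proj E act \<psi> \<in> QM E N"
  using emb_mem addsub_diff[OF addsub_Coind] by (simp add: QM_def proj_def CoindD unp_emb_one)

lemma add_on_proj: "add_on (Coind E N) (proj E act)"
  by (rule add_onI) (simp add: proj_def add_on_diff[OF add_on_emb] CoindD)

lemma proj_0: "proj E act 0 = 0"
  by (simp add: proj_def emb_0)

lemma proj_QM: "\<psi> \<in> QM E N \<Longrightarrow> proj E act \<psi> = \<psi>"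
  by (simp add: QM_def proj_def emb_0)

lemma proj_eq_0: "\<psi> \<in> Coind E N \<Longrightarrow> proj E act \<psi> = 0 \<longleftrightarrow> \<psi> = emb E act (unp \<psi> \<one>)"
  by (simp add: proj_def)

lemma proj_emb: "n \<in> N \<Longrightarrow> proj E act (emb E act n) = 0"
  by (simp add: proj_def unp_emb_one)

lemma cact_mem: "g \<in> carrier E \<Longrightarrow> \<psi> \<in> Coind E N \<Longrightarrow> cact E g \<psi> \<in> Coind E N"
  by (rule gmodD(3)[OF gmod_Coind])

lemma equivar_proj: "equivar E (Coind E N) (cact E) (qact E act) (proj E act)"
  unfolding equivar_def
proof (intro conjI ballI add_on_proj)
  fix g \<psi> assume g: "g \<in> carrier E" and \<psi>: "\<psi> \<in> Coind E N"
  let ?e = "emb E act (unp \<psi> \<one>)"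
  have e: "?e \<in> Coind E N" using emb_mem CoindD[OF \<psi>] by simp
  have ge: "cact E g ?e = emb E act (act g (unp \<psi> \<one>))"
    using equivar_emb g CoindD[OF \<psi>] by (simp add: equivar_def)
  have "qact E act g (proj E act \<psi>) = proj E act (cact E g \<psi> - cact E g ?e)"
    unfolding qact_def proj_def[of _ _ \<psi>] using gmodD(6)[OF gmod_Coind g \<psi> e] by simp
  also have "\<dots> = proj E act (cact E g \<psi>)"
    using add_on_diff[OF add_on_proj cact_mem[OF g \<psi>] cact_mem[OF g e]] ge
      proj_emb[OF gmodD(3)[OF M g CoindD[OF \<psi>]]] by simp
  finally show "proj E act (cact E g \<psi>) = qact E act g (proj E act \<psi>)" by simp
qed

lemma QM_Coind: "\<psi> \<in> QM E N \<Longrightarrow> \<psi> \<in> Coind E N"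
  by (simp add: QM_def)

text \<open>The laws of the action are inherited from the coinduced module, because
  \<open>proj\<close> is equivariant and is the identity on \<open>QM E N\<close>.\<close>

lemma gmod_QM: "gmod E (QM E N) (qact E act)"
  unfolding gmod_def
proof (intro conjI ballI)
  have eq: "g \<in> carrier E \<Longrightarrow> \<psi> \<in> Coind E N \<Longrightarrow> proj E act (cact E g \<psi>) = qact E act g (proj E act \<psi>)" for g \<psi>
    using equivar_proj by (simp add: equivar_def)
  show "addsub (QM E N)"
    using addsub_zero[OF addsub_Coind] addsub_diff[OF addsub_Coind]
    by (intro addsubI) (auto simp: QM_def)
  show "add_on (QM E N) (qact E act g)" if "g \<in> carrier E" for g
  proof (rule add_onI)
    fix x y assume "x \<in> QM E N" "y \<in> QM E N"
    then show "qact E act g (x - y) = qact E act g x - qact E act g y"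
      using gmodD(6)[OF gmod_Coind that] add_on_diff[OF add_on_proj] that
      by (simp add: qact_def QM_Coind cact_mem)
  qed
  show "qact E act g ` QM E N \<subseteq> QM E N" if "g \<in> carrier E" for g
    using that by (auto simp: qact_def QM_Coind cact_mem proj_mem)
  show "qact E act (g \<otimes> h) \<psi> = qact E act g (qact E act h \<psi>)"
    if "g \<in> carrier E" "h \<in> carrier E" "\<psi> \<in> QM E N" for g h \<psi>
  proof -
    have "qact E act g (qact E act h \<psi>) = proj E act (cact E g (cact E h \<psi>))"
      using that eq by (simp add: qact_def[of _ _ h] cact_mem QM_Coind)
    then show ?thesis using that gmodD(4)[OF gmod_Coind] by (simp add: qact_def QM_Coind)
  qed
  show "qact E act \<one> \<psi> = \<psi>" if "\<psi> \<in> QM E N" for \<psi>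
    using that gmodD(5)[OF gmod_Coind] by (simp add: qact_def QM_Coind proj_QM)
qed

text \<open>Shapiro's lemma for a subgroup, with an explicit homotopy. Evaluating the cocycle
  identity for the tuple \<open>p x # l\<close> at \<open>r x\<close> expresses the value of
  \<open>f l\<close> at \<open>x\<close> by the other terms, because \<open>p x\<close> translates
  \<open>r x\<close> to \<open>x\<close>.\<close>

lemma Coind_acyclic:
  assumes H: "subgroup H E"
    and r: "\<And>x. x \<in> carrier E \<Longrightarrow> r x \<in> carrier E" and p: "\<And>x. x \<in> carrier E \<Longrightarrow> p x \<in> H"
    and rp: "\<And>x. x \<in> carrier E \<Longrightarrow> r x \<otimes> p x = x"
    and rg: "\<And>x g. x \<in> carrier E \<Longrightarrow> g \<in> H \<Longrightarrow> r (x \<otimes> g) = r x"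
    and pg: "\<And>x g. x \<in> carrier E \<Longrightarrow> g \<in> H \<Longrightarrow> p (x \<otimes> g) = p x \<otimes> g"
    and k: "k > 0"
  defines "G \<equiv> E\<lparr>carrier := H\<rparr>"
  shows "Zc (CC G (Coind E N)) (dB G (cact E)) k \<subseteq> Bc (CC G (Coind E N)) (dB G (cact E)) k"
proof
  fix f assume f: "f \<in> Zc (CC G (Coind E N)) (dB G (cact E)) k"
  obtain j where j: "k = Suc j" using k by (cases k) auto
  have G: "group G" unfolding G_def by (rule subgroup_imp_group[OF H])
  have HE: "H \<subseteq> carrier E" by (rule subgroup.subset[OF H])
  have MG: "gmod G (Coind E N) (cact E)"
    unfolding G_def by (rule gmod_subset[OF gmod_Coind HE])
  note cx = cplx_bar[OF G MG]
  have fC: "f l \<in> Coind E N" if "l \<in> tuples G (Suc j)" for l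
    using f that by (simp add: Zc_def CC_def j)
  have df: "dB G (cact E) k f l = 0" for l using f by (simp add: Zc_def fun_eq_iff)
  \<comment> \<open>The contracting homotopy: the H-part of \<open>x\<close> is prepended to the
    tuple and the result is evaluated at the coset representative.\<close>
  define u where "u l = (if l \<in> tuples G j then
     pk (\<lambda>x. if x \<in> carrier E then unp (f (p x # l)) (r x) else 0) else 0)" for l
  have u: "u \<in> CC G (Coind E N) j"
    using fC p r by (auto simp: CC_def u_def Coind_def G_def)
  have du: "dB G (cact E) j u \<in> CC G (Coind E N) k" using cplxD(3)[OF cx u] j by simp
  have "dB G (cact E) j u = f"
  proof
    fix l
    show "dB G (cact E) j u l = f l"
    proof (cases "l \<in> tuples G k")
      case True
      then obtain g l' where l: "l = g # l'" "g \<in> H" "l' \<in> tuples G j"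
        unfolding j by (auto elim!: tuples_SucE simp: G_def)
      have duC: "dB G (cact E) j u l \<in> Coind E N" using du True by (simp add: CC_def)
      have fl: "f l \<in> Coind E N" using fC True j by simp
      show ?thesis
      proof (rule unp_eqI)
        show "dB G (cact E) j u l [] = f l []" using duC fl by (simp add: Coind_def)
        fix x
        show "unp (dB G (cact E) j u l) x = unp (f l) x"
        proof (cases "x \<in> carrier E")
          case x: True
          have ad: "add_on UNIV (\<lambda>\<psi>. unp \<psi> y)" for y :: 'a by (rule add_onI) simp
          have px: "p x # l \<in> tuples G (Suc k)" using p[OF x] True by (simp add: G_def)
          have "unp (bar G u l) x = bar G (\<lambda>l. unp (u l) x) l"
            by (rule bar_additive[OF G addsub_UNIV ad]) (use True j in auto)
          also have "\<dots> = bar G (\<lambda>l. unp (f (p x # l)) (r x)) l"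
            by (rule bar_cong[OF G, of _ j]) (use True j x in \<open>auto simp: u_def\<close>)
          also have "\<dots> = unp (bar G (\<lambda>l. f (p x # l)) l) (r x)"
            by (rule bar_additive[OF G addsub_UNIV ad, symmetric]) (use True j in auto)
          finally have 1: "unp (bar G u l) x = unp (bar G (\<lambda>l. f (p x # l)) l) (r x)" .
          have 2: "unp (cact E g (u l')) x = unp (f ((p x \<otimes> g) # l')) (r x)"
            using l x HE by (auto simp: cact_def u_def pg rg)
          have "unp (dB G (cact E) k f (p x # l)) (r x) = 0" by (simp add: df)
          then have "unp (f l) x = unp (f ((p x \<otimes> g) # l')) (r x) - unp (bar G (\<lambda>l. f (p x # l)) l) (r x)"
            using px r[OF x] rp[OF x] by (simp add: dB_def l cact_def G_def)
          then show ?thesis using 1 2 True by (simp add: dB_def j l)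
        qed (use duC fl in \<open>auto simp: Coind_def\<close>)
      qed
    next
      case False
      then show ?thesis using f j by (auto simp: dB_def Zc_def CC_def)
    qed
  qed
  then show "f \<in> Bc (CC G (Coind E N)) (dB G (cact E)) k" using u j by auto
qed

end

section \<open>Mapping cones\<close>

text \<open>The total complex of \<tau> : X \<rightarrow> X with the second copy of X placed one
  degree higher. Its cohomology in degree k sits between the cokernel of \<tau> on H^(k-1)(X) and
  the kernel of \<tau> on H^k(X). In degree 0 the second component is forced to be 0.\<close>

definition KK :: "(nat \<Rightarrow> 'a::ab_group_add set) \<Rightarrow> nat \<Rightarrow> ('a \<times> 'a) set" where
  "KK X k = X k \<times> (case k of 0 \<Rightarrow> {0} | Suc j \<Rightarrow> X j)"

definition dK :: "(nat \<Rightarrow> 'a \<Rightarrow> 'a) \<Rightarrow> ('a \<Rightarrow> 'a) \<Rightarrow> nat \<Rightarrow> 'a \<times> 'a \<Rightarrow> 'a \<times> ('a::ab_group_add)" where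
  "dK d \<tau> k = (\<lambda>(f, h). (d k f, \<tau> f - (case k of 0 \<Rightarrow> 0 | Suc j \<Rightarrow> d j h)))"

definition chain_endo where
  "chain_endo X d \<tau> \<longleftrightarrow> (\<forall>k. add_on (X k) \<tau> \<and> \<tau> ` X k \<subseteq> X k \<and> (\<forall>x\<in>X k. d k (\<tau> x) = \<tau> (d k x)))"

lemma chain_endoD:
  assumes "chain_endo X d \<tau>"
  shows "add_on (X k) \<tau>" "x \<in> X k \<Longrightarrow> \<tau> x \<in> X k" "x \<in> X k \<Longrightarrow> d k (\<tau> x) = \<tau> (d k x)"
  using assms by (auto simp: chain_endo_def)

lemma cplx_cone:
  assumes X: "cplx X d" and \<tau>: "chain_endo X d \<tau>"
  shows "cplx (KK X) (dK d \<tau>)"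
  unfolding cplx_def
proof (intro allI conjI)
  fix k
  have t: "\<tau> (x - y) = \<tau> x - \<tau> y" if "x \<in> X k" "y \<in> X k" for x y
    using add_on_diff[OF chain_endoD(1)[OF \<tau>] that] .
  show "addsub (KK X k)"
    using cplxD(1)[OF X] by (auto simp: KK_def addsub_singleton intro!: addsub_Times split: nat.split)
  show "add_on (KK X k) (dK d \<tau> k)"
    by (rule add_onI) (auto simp: KK_def dK_def t cplxD[OF X] split: nat.splits)
  show "dK d \<tau> k ` KK X k \<subseteq> KK X (Suc k)"
    by (auto simp: KK_def dK_def cplxD[OF X] chain_endoD[OF \<tau>] split: nat.splits)
  show "\<forall>x\<in>KK X k. dK d \<tau> (Suc k) (dK d \<tau> k x) = 0"
    by (auto simp: KK_def dK_def cplxD[OF X] chain_endoD[OF \<tau>] zero_prod_def split: nat.splits)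
qed

lemma cone_acyclic:
  assumes X: "cplx X d" and \<tau>: "chain_endo X d \<tau>"
    and van: "\<And>k. k > 0 \<Longrightarrow> Zc X d k \<subseteq> Bc X d k"
    and sur: "\<And>h. h \<in> Zc X d 0 \<Longrightarrow> \<exists>u\<in>Zc X d 0. \<tau> u = h" and k: "k > 0"
  shows "Zc (KK X) (dK d \<tau>) k \<subseteq> Bc (KK X) (dK d \<tau>) k"
proof
  fix fh assume fh: "fh \<in> Zc (KK X) (dK d \<tau>) k"
  obtain j where j: "k = Suc j" using k by (cases k) auto
  obtain f h where fh': "fh = (f, h)" by (cases fh)
  have f: "f \<in> X (Suc j)" "d (Suc j) f = 0" and h: "h \<in> X j" "\<tau> f = d j h"
    using fh by (auto simp: fh' j Zc_def KK_def dK_def zero_prod_def)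
  then obtain u where u: "u \<in> X j" "f = d j u" using van[of "Suc j"] by (auto simp: Zc_def)
  have tu: "\<tau> u \<in> X j" "d j (\<tau> u) = \<tau> (d j u)" using chain_endoD[OF \<tau>] u by auto
  have "h - \<tau> u \<in> Zc X d j"
    using h u tu by (simp add: Zc_def cplxD[OF X])
  \<comment> \<open>Once \<open>u\<close> accounts for the first component, the cocycle
    \<open>h - \<tau> u\<close> remains. In degree 0 it is \<tau> of another cocycle
    \<open>v\<close> by \<open>sur\<close>; in higher degrees it is a coboundary, and
    \<open>w\<close> absorbs it with the sign of the cone differential.\<close>
  have "\<exists>v w. v \<in> X j \<and> d j v = 0 \<and> (case j of 0 \<Rightarrow> w = 0 | Suc i \<Rightarrow> w \<in> X i) \<and>
      h - \<tau> u = \<tau> v - (case j of 0 \<Rightarrow> 0 | Suc i \<Rightarrow> d i w)"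
  proof (cases j)
    case 0
    then show ?thesis using sur[of "h - \<tau> u"] \<open>h - \<tau> u \<in> Zc X d j\<close> by (auto simp: Zc_def)
  next
    case (Suc i)
    then obtain w where "w \<in> X i" "h - \<tau> u = d i w"
      using van[of j] \<open>h - \<tau> u \<in> Zc X d j\<close> by auto
    then show ?thesis
      using Suc add_on_zero[OF chain_endoD(1)[OF \<tau>] cplxD(1)[OF X]]
      by (intro exI[of _ 0] exI[of _ "- w"]) (auto simp: cplxD[OF X])
  qed
  then obtain v w where vw: "v \<in> X j" "d j v = 0" "case j of 0 \<Rightarrow> w = 0 | Suc i \<Rightarrow> w \<in> X i"
    "h - \<tau> u = \<tau> v - (case j of 0 \<Rightarrow> 0 | Suc i \<Rightarrow> d i w)" by blast
  have "dK d \<tau> j (u + v, w) = fh"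
    using u vw fh' add_on_add[OF chain_endoD(1)[OF \<tau>] cplxD(1)[OF X] u(1) vw(1)]
    by (simp add: dK_def cplxD[OF X] algebra_simps)
  moreover have "(u + v, w) \<in> KK X j"
    using u vw cplxD[OF X] by (auto simp: KK_def split: nat.splits)
  ultimately show "fh \<in> Bc (KK X) (dK d \<tau>) k" using j by force
qed

text \<open>A short exact sequence compatible with the endomorphisms stays exact on cones, so
  \<open>hiso_connecting\<close> applies with the cone of \<open>B\<close> as middle term; that cone
  is acyclic in positive degrees by \<open>cone_acyclic\<close>.\<close>

lemma hiso_cone_connecting:
  assumes A: "cplx A eA" and B: "cplx B eB" and C: "cplx C eC"
    and tA: "chain_endo A eA \<tau>A" and tB: "chain_endo B eB \<tau>B" and tC: "chain_endo C eC \<tau>C"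
    and i: "\<And>k. add_on (A k) i" "\<And>k x. x \<in> A k \<Longrightarrow> i x \<in> B k"
      "\<And>k x. x \<in> A k \<Longrightarrow> i x = 0 \<Longrightarrow> x = 0"
      "\<And>k x. x \<in> A k \<Longrightarrow> eB k (i x) = i (eA k x)" "\<And>k x. x \<in> A k \<Longrightarrow> \<tau>B (i x) = i (\<tau>A x)"
    and p: "\<And>k. add_on (B k) p" "\<And>k. p ` B k = C k"
      "\<And>k x. x \<in> B k \<Longrightarrow> eC k (p x) = p (eB k x)" "\<And>k x. x \<in> B k \<Longrightarrow> \<tau>C (p x) = p (\<tau>B x)"
    and exact: "\<And>k x. x \<in> B k \<Longrightarrow> p x = 0 \<longleftrightarrow> x \<in> i ` A k"
    and van: "\<And>k. k > 0 \<Longrightarrow> Zc B eB k \<subseteq> Bc B eB k"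
    and sur: "\<And>h. h \<in> Zc B eB 0 \<Longrightarrow> \<exists>u\<in>Zc B eB 0. \<tau>B u = h"
    and k: "k > 0"
  shows "hiso (KK C) (dK eC \<tau>C) k (KK A) (dK eA \<tau>A) (Suc k)"
proof (rule hiso_connecting[where B = "KK B" and dB = "dK eB \<tau>B"
        and i = "\<lambda>_. map_prod i i" and p = "\<lambda>_. map_prod p p"])
  have i0: "i 0 = 0" and p0: "p 0 = 0"
    using add_on_zero[OF i(1)] add_on_zero[OF p(1)] A B by (auto simp: cplxD)
  have im: "i (x - y) = i x - i y" if "x \<in> A k" "y \<in> A k" for x y k
    using add_on_diff[OF i(1) that] .
  have pm: "p (x - y) = p x - p y" if "x \<in> B k" "y \<in> B k" for x y k
    using add_on_diff[OF p(1) that] .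
  show "cplx (KK A) (dK eA \<tau>A)" "cplx (KK B) (dK eB \<tau>B)" "cplx (KK C) (dK eC \<tau>C)"
    using cplx_cone A B C tA tB tC by auto
  show "add_on (KK A k) (map_prod i i)" for k
    by (rule add_onI) (auto simp: KK_def im i0 split: nat.splits)
  show "add_on (KK B k) (map_prod p p)" for k
    by (rule add_onI) (auto simp: KK_def pm p0 split: nat.splits)
  show "map_prod i i x \<in> KK B k" if "x \<in> KK A k" for k x
    using that i(2) i0 by (auto simp: KK_def split: nat.splits)
  show "x = 0" if "x \<in> KK A k" "map_prod i i x = 0" for k x
    using that i(3) by (auto simp: KK_def zero_prod_def split: nat.splits)
  show "dK eB \<tau>B k (map_prod i i x) = map_prod i i (dK eA \<tau>A k x)" if "x \<in> KK A k" for k x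
  proof (cases k)
    case 0
    then show ?thesis using that i(4,5) by (auto simp: KK_def dK_def)
  next
    case (Suc j)
    then show ?thesis
      using that i(4,5) im[OF chain_endoD(2)[OF tA] cplxD(3)[OF A], of _ j]
      by (auto simp: KK_def dK_def)
  qed
  show "dK eC \<tau>C k (map_prod p p x) = map_prod p p (dK eB \<tau>B k x)" if "x \<in> KK B k" for k x
  proof (cases k)
    case 0
    then show ?thesis using that p(3,4) by (auto simp: KK_def dK_def)
  next
    case (Suc j)
    then show ?thesis
      using that p(3,4) pm[OF chain_endoD(2)[OF tB] cplxD(3)[OF B], of _ j]
      by (auto simp: KK_def dK_def)
  qed
  show "map_prod p p ` KK B k = KK C k" for k
    unfolding KK_def map_prod_surj_on[OF p(2) p(2)]
    by (cases k) (auto simp: p0 p(2) map_prod_surj_on)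
  show "map_prod p p x = 0 \<longleftrightarrow> x \<in> map_prod i i ` KK A k" if "x \<in> KK B k" for k x
  proof -
    have "map_prod i i ` KK A k = i ` A k \<times> (case k of 0 \<Rightarrow> {0} | Suc j \<Rightarrow> i ` A j)"
      unfolding KK_def by (cases k) (auto simp: i0 map_prod_surj_on)
    then show ?thesis using that exact p0 by (cases k) (auto simp: KK_def zero_prod_def)
  qed
  show "Zc (KK B) (dK eB \<tau>B) k \<subseteq> Bc (KK B) (dK eB \<tau>B) k" if "k > 0" for k
    using cone_acyclic[OF B tB van sur that] by blast
qed (use k in auto)

section \<open>Restriction to subgroups and dimension shifting for bar complexes and cones\<close>

definition transversal :: "('e, 'c) monoid_scheme \<Rightarrow> 'e set \<Rightarrow> ('e \<Rightarrow> 'e) \<Rightarrow> ('e \<Rightarrow> 'e) \<Rightarrow> bool" where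
  "transversal E H r p \<longleftrightarrow> subgroup H E \<and> (\<forall>x\<in>carrier E. r x \<in> carrier E \<and> p x \<in> H \<and> r x \<otimes>\<^bsub>E\<^esub> p x = x \<and>
     (\<forall>g\<in>H. r (x \<otimes>\<^bsub>E\<^esub> g) = r x \<and> p (x \<otimes>\<^bsub>E\<^esub> g) = p x \<otimes>\<^bsub>E\<^esub> g))"

definition tw :: "('e \<Rightarrow> 'n \<Rightarrow> 'n) \<Rightarrow> 'e \<Rightarrow> 'n \<Rightarrow> 'n::ab_group_add" where
  "tw act t n = act t n - n"

lemma CC_nth: "f \<in> CC G N k \<Longrightarrow> addsub N \<Longrightarrow> f l \<in> N"
  by (cases "l \<in> tuples G k") (auto simp: CC_def addsub_zero)

text \<open>As \<open>t\<close> is central, t - 1 commutes with the action, so applying it to values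
  commutes with the bar differential.\<close>

lemma chain_endo_tw:
  assumes E: "group E" and M: "gmod E N act" and t: "t \<in> carrier E"
    and c: "\<And>x. x \<in> carrier E \<Longrightarrow> x \<otimes>\<^bsub>E\<^esub> t = t \<otimes>\<^bsub>E\<^esub> x" and H: "subgroup H E"
  defines "G \<equiv> E\<lparr>carrier := H\<rparr>"
  shows "chain_endo (CC G N) (dB G act) ((\<circ>) (tw act t))"
proof -
  have HE: "H \<subseteq> carrier E" by (rule subgroup.subset[OF H])
  have G: "group G" unfolding G_def by (rule group.subgroup_imp_group[OF E H])
  have MG: "gmod G N act" unfolding G_def by (rule gmod_subset[OF M HE])
  note A = gmodD(1)[OF M]
  have ad: "add_on N (tw act t)"
    by (rule add_onI) (simp add: tw_def gmodD[OF M] t)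
  have eq: "equivar G N act act (tw act t)"
    unfolding equivar_def
  proof (intro conjI ballI ad)
    fix g n assume "g \<in> carrier G" "n \<in> N"
    then have g: "g \<in> carrier E" "n \<in> N" using HE by (auto simp: G_def)
    have "act t (act g n) = act g (act t n)"
      using gmodD(4)[OF M g(1) t g(2)] gmodD(4)[OF M t g(1) g(2)] c[OF g(1)] by simp
    then show "tw act t (act g n) = act g (tw act t n)"
      using g by (simp add: tw_def gmodD[OF M] t)
  qed
  have z: "tw act t 0 = 0" by (rule add_on_zero[OF ad A])
  have mem: "n \<in> N \<Longrightarrow> tw act t n \<in> N" for n
    by (simp add: tw_def gmodD[OF M] t addsub_diff)
  show ?thesis
    unfolding chain_endo_def
    by (auto simp: add_on_CC_map[OF ad A] dB_map[OF G MG eq]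
        CC_map[where e = "tw act t" and N = N and N' = N, OF _ z mem])
qed

context gmodule
begin

text \<open>The cochain-level exactness of 0 \<rightarrow> N \<rightarrow> Coind \<rightarrow> QM
  \<rightarrow> 0 over a subgroup. Surjectivity requires no choice: a cochain with values in
  \<open>QM E N\<close> is its own preimage, because \<open>proj\<close> fixes those values.\<close>

lemma ses_facts:
  assumes H: "subgroup H E"
  defines "G \<equiv> E\<lparr>carrier := H\<rparr>"
  shows "group G" "gmod G N act" "gmod G (Coind E N) (cact E)" "gmod G (QM E N) (qact E act)"
    "\<And>k. add_on (CC G N k) ((\<circ>) (emb E act))"
    "\<And>k x. x \<in> CC G N k \<Longrightarrow> emb E act \<circ> x \<in> CC G (Coind E N) k"
    "\<And>k x. x \<in> CC G N k \<Longrightarrow> emb E act \<circ> x = 0 \<Longrightarrow> x = 0"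
    "\<And>k x. x \<in> CC G N k \<Longrightarrow> dB G (cact E) k (emb E act \<circ> x) = emb E act \<circ> dB G act k x"
    "\<And>k. add_on (CC G (Coind E N) k) ((\<circ>) (proj E act))"
    "\<And>k. (\<circ>) (proj E act) ` CC G (Coind E N) k = CC G (QM E N) k"
    "\<And>k x. x \<in> CC G (Coind E N) k \<Longrightarrow>
      dB G (qact E act) k (proj E act \<circ> x) = proj E act \<circ> dB G (cact E) k x"
    "\<And>k x. x \<in> CC G (Coind E N) k \<Longrightarrow>
      proj E act \<circ> x = 0 \<longleftrightarrow> x \<in> (\<circ>) (emb E act) ` CC G N k"
proof -
  have HE: "H \<subseteq> carrier E" by (rule subgroup.subset[OF H])
  note A = gmodD(1)[OF M]
  show G: "group G" unfolding G_def by (rule subgroup_imp_group[OF H])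
  show MN: "gmod G N act" and MC: "gmod G (Coind E N) (cact E)" and MQ: "gmod G (QM E N) (qact E act)"
    unfolding G_def using gmod_subset[OF _ HE] M gmod_Coind gmod_QM by auto
  show "add_on (CC G N k) ((\<circ>) (emb E act))" for k
    by (rule add_on_CC_map[OF add_on_emb A])
  show "emb E act \<circ> x \<in> CC G (Coind E N) k" if "x \<in> CC G N k" for k x
    by (rule CC_map[where e = "emb E act", OF that emb_0 emb_mem])
  show "x = 0" if "x \<in> CC G N k" "emb E act \<circ> x = 0" for k x
  proof
    fix l
    have "emb E act (x l) = 0" using that(2) by (simp add: fun_eq_iff)
    then show "x l = 0 l" using unp_emb_one[OF CC_nth[OF that(1) A]] by (metis unp_simps(3) zero_fun_apply)
  qed
  show "dB G (cact E) k (emb E act \<circ> x) = emb E act \<circ> dB G act k x" if "x \<in> CC G N k" for k x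
    unfolding G_def by (rule dB_map[OF _ _ _ that[unfolded G_def]])
      (use G MN equivar_subset[OF equivar_emb HE] in \<open>simp_all add: G_def\<close>)
  show "add_on (CC G (Coind E N) k) ((\<circ>) (proj E act))" for k
    by (rule add_on_CC_map[OF add_on_proj addsub_Coind])
  show "(\<circ>) (proj E act) ` CC G (Coind E N) k = CC G (QM E N) k" for k
  proof
    show "(\<circ>) (proj E act) ` CC G (Coind E N) k \<subseteq> CC G (QM E N) k"
      using CC_map[where e = "proj E act", OF _ proj_0 proj_mem] by blast
    show "CC G (QM E N) k \<subseteq> (\<circ>) (proj E act) ` CC G (Coind E N) k"
    proof
      fix f assume f: "f \<in> CC G (QM E N) k"
      then have "f \<in> CC G (Coind E N) k" using QM_Coind by (auto simp: CC_def)
      moreover have "proj E act \<circ> f = f"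
        using proj_QM CC_nth[OF f gmodD(1)[OF MQ]] by (simp add: fun_eq_iff)
      ultimately show "f \<in> (\<circ>) (proj E act) ` CC G (Coind E N) k" by (metis imageI)
    qed
  qed
  show "dB G (qact E act) k (proj E act \<circ> x) = proj E act \<circ> dB G (cact E) k x"
    if "x \<in> CC G (Coind E N) k" for k x
    unfolding G_def by (rule dB_map[OF _ _ _ that[unfolded G_def]])
      (use G MC equivar_subset[OF equivar_proj HE] in \<open>simp_all add: G_def\<close>)
  show "proj E act \<circ> x = 0 \<longleftrightarrow> x \<in> (\<circ>) (emb E act) ` CC G N k" if x: "x \<in> CC G (Coind E N) k" for k x
  proof
    note xC = CC_nth[OF x addsub_Coind]
    assume "proj E act \<circ> x = 0"
    then have "x l = emb E act (unp (x l) \<one>)" for l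
      using proj_eq_0[OF xC] by (metis comp_apply zero_fun_apply)
    then have "x = emb E act \<circ> (\<lambda>l. unp (x l) \<one>)" by (simp add: fun_eq_iff)
    moreover have "(\<lambda>l. unp (x l) \<one>) \<in> CC G N k"
      using x CoindD[OF xC] by (auto simp: CC_def)
    ultimately show "x \<in> (\<circ>) (emb E act) ` CC G N k" by blast
  next
    assume "x \<in> (\<circ>) (emb E act) ` CC G N k"
    then obtain f where f: "f \<in> CC G N k" "x = emb E act \<circ> f" by blast
    have "proj E act (x l) = 0" for l
      using proj_emb[OF CC_nth[OF f(1) A]] f(2) by simp
    then show "proj E act \<circ> x = 0" by (simp add: fun_eq_iff)
  qed
qed

lemma Coind_vanish:
  assumes "transversal E H r p" "k > 0"
  shows "Zc (CC (E\<lparr>carrier := H\<rparr>) (Coind E N)) (dB (E\<lparr>carrier := H\<rparr>) (cact E)) k \<subseteq>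
    Bc (CC (E\<lparr>carrier := H\<rparr>) (Coind E N)) (dB (E\<lparr>carrier := H\<rparr>) (cact E)) k"
  by (rule Coind_acyclic[where r = r and p = p]) (use assms in \<open>auto simp: transversal_def\<close>)

lemma shift_bar:
  assumes tr: "transversal E H r p" and k: "k > 0"
  defines "G \<equiv> E\<lparr>carrier := H\<rparr>"
  shows "hiso (CC G (QM E N)) (dB G (qact E act)) k (CC G N) (dB G act) (Suc k)"
proof -
  have H: "subgroup H E" using tr by (simp add: transversal_def)
  note s = ses_facts[OF H, folded G_def]
  show ?thesis
    by (rule hiso_connecting[where B = "CC G (Coind E N)" and dB = "dB G (cact E)" and
          i = "\<lambda>_. (\<circ>) (emb E act)" and p = "\<lambda>_. (\<circ>) (proj E act)"])
      (use s(5-) cplx_bar[OF s(1)] s(2-4) Coind_vanish[OF tr, folded G_def] k in auto)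
qed

text \<open>Here the coinduced module must have an acyclic cone. In degree 1 this is the assumption
  \<open>sur\<close>, because a cone turns the cokernel of t - 1 on invariants into first
  cohomology.\<close>

lemma shift_cone:
  assumes tr: "transversal E H r p" and k: "k > 0"
    and t: "t \<in> carrier E" and c: "\<And>x. x \<in> carrier E \<Longrightarrow> x \<otimes> t = t \<otimes> x"
  defines "G \<equiv> E\<lparr>carrier := H\<rparr>"
  assumes sur: "\<And>h. h \<in> Zc (CC G (Coind E N)) (dB G (cact E)) 0 \<Longrightarrow>
     \<exists>u\<in>Zc (CC G (Coind E N)) (dB G (cact E)) 0. tw (cact E) t \<circ> u = h"
  shows "hiso (KK (CC G (QM E N))) (dK (dB G (qact E act)) ((\<circ>) (tw (qact E act) t))) k
    (KK (CC G N)) (dK (dB G act) ((\<circ>) (tw act t))) (Suc k)"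
proof -
  have H: "subgroup H E" using tr by (simp add: transversal_def)
  note s = ses_facts[OF H, folded G_def]
  note ce = chain_endo_tw[OF is_group _ t c H, folded G_def]
  have ti: "tw (cact E) t \<circ> (emb E act \<circ> x) = emb E act \<circ> (tw act t \<circ> x)" if "x \<in> CC G N k" for x k
  proof
    fix l
    have xl: "x l \<in> N" by (rule CC_nth[OF that gmodD(1)[OF M]])
    show "(tw (cact E) t \<circ> (emb E act \<circ> x)) l = (emb E act \<circ> (tw act t \<circ> x)) l"
      using equivar_emb t xl add_on_diff[OF add_on_emb gmodD(3)[OF M t xl] xl]
      by (simp add: tw_def equivar_def)
  qed
  have tp: "tw (qact E act) t \<circ> (proj E act \<circ> x) = proj E act \<circ> (tw (cact E) t \<circ> x)"
    if "x \<in> CC G (Coind E N) k" for x k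
  proof
    fix l
    have xl: "x l \<in> Coind E N" by (rule CC_nth[OF that addsub_Coind])
    show "(tw (qact E act) t \<circ> (proj E act \<circ> x)) l = (proj E act \<circ> (tw (cact E) t \<circ> x)) l"
      using equivar_proj t xl add_on_diff[OF add_on_proj cact_mem[OF t xl] xl]
      by (simp add: tw_def equivar_def)
  qed
  show ?thesis
    by (rule hiso_cone_connecting[where B = "CC G (Coind E N)" and eB = "dB G (cact E)" and
          i = "(\<circ>) (emb E act)" and p = "(\<circ>) (proj E act)" and \<tau>B = "(\<circ>) (tw (cact E) t)"])
      (use s(5-) cplx_bar[OF s(1)] s(2-4) Coind_vanish[OF tr, folded G_def] k ti tp
        ce[OF M] ce[OF gmod_Coind] ce[OF gmod_QM] sur in auto)
qed

end

section \<open>Group extensions defined by 2-cocycles\<close>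

text \<open>The extension of G by N with factor set F. The cocycle is not assumed to be normalised,
  which is why the unit has first component -F(1,1).\<close>

definition ext_group :: "('e, 'c) monoid_scheme \<Rightarrow> 'n::ab_group_add set \<Rightarrow> ('e \<Rightarrow> 'n \<Rightarrow> 'n) \<Rightarrow>
    ('e \<Rightarrow> 'e \<Rightarrow> 'n) \<Rightarrow> ('n \<times> 'e) monoid" where
  "ext_group G N act F = \<lparr>carrier = N \<times> carrier G,
     monoid.mult = (\<lambda>(m, x) (n, y). (m + act x n + F x y, x \<otimes>\<^bsub>G\<^esub> y)),
     one = (- F \<one>\<^bsub>G\<^esub> \<one>\<^bsub>G\<^esub>, \<one>\<^bsub>G\<^esub>)\<rparr>"

lemma ext_group_simps [simp]:
  "carrier (ext_group G N act F) = N \<times> carrier G"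
  "(m, x) \<otimes>\<^bsub>ext_group G N act F\<^esub> (n, y) = (m + act x n + F x y, x \<otimes>\<^bsub>G\<^esub> y)"
  "\<one>\<^bsub>ext_group G N act F\<^esub> = (- F \<one>\<^bsub>G\<^esub> \<one>\<^bsub>G\<^esub>, \<one>\<^bsub>G\<^esub>)"
  by (simp_all add: ext_group_def)

lemma group_ext_group:
  assumes G: "group G" and M: "gmod G N act"
    and F: "\<And>x y. x \<in> carrier G \<Longrightarrow> y \<in> carrier G \<Longrightarrow> F x y \<in> N"
    and coc: "\<And>x y z. x \<in> carrier G \<Longrightarrow> y \<in> carrier G \<Longrightarrow> z \<in> carrier G \<Longrightarrow>
      act x (F y z) + F x (y \<otimes>\<^bsub>G\<^esub> z) = F (x \<otimes>\<^bsub>G\<^esub> y) z + F x y"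
  shows "group (ext_group G N act F)"
proof (rule groupI)
  interpret group G by (rule G)
  note A = gmodD(1)[OF M]
  note cl = addsub_add[OF A] addsub_neg[OF A]
  let ?W = "ext_group G N act F"
  show "x \<otimes>\<^bsub>?W\<^esub> y \<in> carrier ?W" if "x \<in> carrier ?W" "y \<in> carrier ?W" for x y
    using that by (auto simp: cl F gmodD[OF M])
  show "\<one>\<^bsub>?W\<^esub> \<in> carrier ?W" by (simp add: cl F)
  show "x \<otimes>\<^bsub>?W\<^esub> y \<otimes>\<^bsub>?W\<^esub> z = x \<otimes>\<^bsub>?W\<^esub> (y \<otimes>\<^bsub>?W\<^esub> z)"
    if xyz: "x \<in> carrier ?W" "y \<in> carrier ?W" "z \<in> carrier ?W" for x y z
  proof -
    obtain m a n b l c where e: "x = (m, a)" "y = (n, b)" "z = (l, c)" by (metis surj_pair)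
    then have "m \<in> N" "n \<in> N" "l \<in> N" and abc: "a \<in> carrier G" "b \<in> carrier G" "c \<in> carrier G"
      using xyz by auto
    then show ?thesis
      using coc[OF abc] by (simp add: e gmodD[OF M] F cl m_assoc algebra_simps)
  qed
  show "\<one>\<^bsub>?W\<^esub> \<otimes>\<^bsub>?W\<^esub> x = x" if xW: "x \<in> carrier ?W" for x
  proof -
    obtain n y where x: "x = (n, y)" "n \<in> N" "y \<in> carrier G" using xW by auto
    \<comment> \<open>The cocycle identity at (1, 1, y); it replaces the normalisation of
      \<open>F\<close>.\<close>
    have "F \<one>\<^bsub>G\<^esub> y = F \<one>\<^bsub>G\<^esub> \<one>\<^bsub>G\<^esub>" using coc[of "\<one>\<^bsub>G\<^esub>" "\<one>\<^bsub>G\<^esub>" y] x by (simp add: gmodD[OF M] F)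
    then show ?thesis using x by (simp add: gmodD[OF M])
  qed
  show "\<exists>y\<in>carrier ?W. y \<otimes>\<^bsub>?W\<^esub> x = \<one>\<^bsub>?W\<^esub>" if xW: "x \<in> carrier ?W" for x
  proof -
    obtain n y where x: "x = (n, y)" "n \<in> N" "y \<in> carrier G" using xW by auto
    \<comment> \<open>Obtained by solving for the first component in the equation that the product
      with \<open>(n, y)\<close> be the unit.\<close>
    let ?m = "- F \<one>\<^bsub>G\<^esub> \<one>\<^bsub>G\<^esub> - F (inv\<^bsub>G\<^esub> y) y - act (inv\<^bsub>G\<^esub> y) n"
    have "?m \<in> N" using x by (simp add: cl F gmodD[OF M] addsub_diff[OF A])
    then show ?thesis using x by (intro bexI[of _ "(?m, inv\<^bsub>G\<^esub> y)"]) auto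
  qed
qed

lemma (in group) commute_int_pow:
  assumes x: "x \<in> carrier G" and w: "w \<in> carrier G" and c: "x \<otimes> w = w \<otimes> x"
  shows "x \<otimes> w [^] (j::int) = w [^] j \<otimes> x"
proof -
  have "subgroup {y \<in> carrier G. x \<otimes> y = y \<otimes> x} G"
  proof (rule subgroupI)
    fix y assume "y \<in> {y \<in> carrier G. x \<otimes> y = y \<otimes> x}"
    then have y: "y \<in> carrier G" and yx: "x \<otimes> y = y \<otimes> x" by auto
    have "inv y \<otimes> x = inv y \<otimes> (x \<otimes> y) \<otimes> inv y" using x y by (simp add: m_assoc)
    also have "\<dots> = inv y \<otimes> (y \<otimes> x) \<otimes> inv y" by (simp only: yx)
    also have "\<dots> = x \<otimes> inv y" using x y by (simp add: m_assoc[symmetric])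
    finally show "inv y \<in> {y \<in> carrier G. x \<otimes> y = y \<otimes> x}" using y by simp
  next
    fix y z assume "y \<in> {y \<in> carrier G. x \<otimes> y = y \<otimes> x}" "z \<in> {y \<in> carrier G. x \<otimes> y = y \<otimes> x}"
    then have yz: "y \<in> carrier G" "z \<in> carrier G" "x \<otimes> y = y \<otimes> x" "x \<otimes> z = z \<otimes> x" by auto
    have "x \<otimes> (y \<otimes> z) = (y \<otimes> x) \<otimes> z" using x yz by (simp add: m_assoc[symmetric])
    also have "\<dots> = (y \<otimes> z) \<otimes> x" using x yz by (simp add: m_assoc)
    finally show "y \<otimes> z \<in> {y \<in> carrier G. x \<otimes> y = y \<otimes> x}" using yz by simp
  qed (use x in auto)
  then show ?thesis using subgroup_int_pow_closed[of _ w j] w c by auto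
qed

section \<open>Central extensions by the integers\<close>

text \<open>Discrete integration over all integers, with the opposite sign on the negative side. It
  is what makes t - 1 onto on the invariants of a coinduced module.\<close>

lemma int_antiderivative:
  fixes s :: "int \<Rightarrow> 'a::ab_group_add"
  assumes "addsub N" "\<And>j. s j \<in> N"
  obtains S where "\<And>j. S (j + 1) - S j = s j" "\<And>j. S j \<in> N"
proof
  define S where "S j = (if j \<ge> 0 then (\<Sum>i\<in>{0..<j}. s i) else - (\<Sum>i\<in>{j..<0}. s i))" for j :: int
  have sums: "finite I \<Longrightarrow> sum s I \<in> N" for I
    by (induction I rule: finite_induct) (use assms in \<open>auto simp: addsub_zero addsub_add\<close>)
  show "S j \<in> N" for j
    by (simp add: S_def sums addsub_neg[OF assms(1)])
  show "S (j + 1) - S j = s j" for j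
  proof (cases "j \<ge> 0")
    case True
    then have "{0..<j + 1} = insert j {0..<j}" by auto
    then show ?thesis using True by (simp add: S_def)
  next
    case False
    then have "{j..<0} = insert j {j + 1..<0}" by auto
    then show ?thesis using False by (cases "j = -1") (auto simp: S_def)
  qed
qed

locale central_ext = group E for E (structure) +
  fixes \<rho> :: "'e \<Rightarrow> int" and t :: 'e
  constrains E :: "('e, 'c) monoid_scheme"
  assumes rho_hom: "\<rho> \<in> hom E integer_group"
    and t [simp]: "t \<in> carrier E" and rho_t: "\<rho> t = 1"
    and central: "\<And>x. x \<in> carrier E \<Longrightarrow> x \<otimes> t = t \<otimes> x"
begin

definition "H = {x \<in> carrier E. \<rho> x = 0}"
definition "G = E\<lparr>carrier := H\<rparr>"
definition "rr x = t [^] \<rho> x"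
definition "pp x = inv (t [^] \<rho> x) \<otimes> x"

lemma rho_mult: "x \<in> carrier E \<Longrightarrow> y \<in> carrier E \<Longrightarrow> \<rho> (x \<otimes> y) = \<rho> x + \<rho> y"
  using rho_hom by (simp add: hom_def integer_group_def)

lemma rho_one: "\<rho> \<one> = 0" using rho_mult[of \<one> \<one>] by simp

lemma rho_inv: "x \<in> carrier E \<Longrightarrow> \<rho> (inv x) = - \<rho> x"
  using rho_mult[of "inv x" x] by (simp add: rho_one)

lemma rho_pow: "\<rho> (t [^] (j::int)) = j"
proof -
  interpret r: group_hom E integer_group \<rho>
    by (simp add: group_hom_def group_hom_axioms_def rho_hom)
  show ?thesis using r.hom_int_pow[of t j] by (simp add: rho_t)
qed

lemma subgroup_H: "subgroup H E"
  by (rule subgroupI) (auto simp: H_def rho_mult rho_inv intro: rho_one exI[of _ \<one>])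

lemma H_subset: "H \<subseteq> carrier E" by (auto simp: H_def)

lemma group_G: "group G" unfolding G_def by (rule subgroup_imp_group[OF subgroup_H])

lemma G_simps [simp]: "carrier G = H" "x \<otimes>\<^bsub>G\<^esub> y = x \<otimes> y" "\<one>\<^bsub>G\<^esub> = \<one>"
  by (simp_all add: G_def)

lemma central_pow: "x \<in> carrier E \<Longrightarrow> x \<otimes> t [^] (j::int) = t [^] j \<otimes> x"
  by (rule commute_int_pow) (simp_all add: central)

lemma pp_H: "x \<in> carrier E \<Longrightarrow> pp x \<in> H"
  by (simp add: pp_def H_def rho_mult rho_inv rho_pow)

lemma rr_pp: "x \<in> carrier E \<Longrightarrow> rr x \<otimes> pp x = x"
  by (simp add: rr_def pp_def m_assoc[symmetric])

lemma transversal: "transversal E H rr pp"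
  unfolding transversal_def
proof (intro conjI ballI)
  fix x g assume x: "x \<in> carrier E" and g: "g \<in> H"
  then have "\<rho> (x \<otimes> g) = \<rho> x" by (simp add: H_def rho_mult)
  then show "rr (x \<otimes> g) = rr x" "pp (x \<otimes> g) = pp x \<otimes> g"
    using x g by (auto simp: rr_def pp_def m_assoc H_def)
qed (simp_all add: subgroup_H pp_H rr_pp, simp add: rr_def)

end

section \<open>Cocycles and cones in degrees 0 and 1\<close>

lemma tuples_1: "l \<in> tuples G (Suc 0) \<longleftrightarrow> (\<exists>x\<in>carrier G. l = [x])"
  by (cases l) auto

lemma Zc0_iff:
  "f \<in> Zc (CC G N) (dB G act) 0 \<longleftrightarrow> f \<in> CC G N 0 \<and> (\<forall>x\<in>carrier G. act x (f []) = f [])"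
  by (auto simp: Zc_def dB_def fun_eq_iff tuples_1)

lemma Zc1_iff:
  assumes "group G"
  shows "f \<in> Zc (CC G N) (dB G act) (Suc 0) \<longleftrightarrow> f \<in> CC G N (Suc 0) \<and>
     (\<forall>x\<in>carrier G. \<forall>y\<in>carrier G. f [x \<otimes>\<^bsub>G\<^esub> y] = f [x] + act x (f [y]))"
proof -
  interpret group G by (rule assms)
  have "dB G act (Suc 0) f = 0 \<longleftrightarrow>
    (\<forall>x\<in>carrier G. \<forall>y\<in>carrier G. act x (f [y]) - (f [x \<otimes>\<^bsub>G\<^esub> y] - f [x]) = 0)"
  proof
    assume d0: "dB G act (Suc 0) f = 0"
    show "\<forall>x\<in>carrier G. \<forall>y\<in>carrier G. act x (f [y]) - (f [x \<otimes>\<^bsub>G\<^esub> y] - f [x]) = 0"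
    proof (intro ballI)
      fix x y assume "x \<in> carrier G" "y \<in> carrier G"
      then show "act x (f [y]) - (f [x \<otimes>\<^bsub>G\<^esub> y] - f [x]) = 0"
        using fun_cong[OF d0, of "[x, y]"] by (simp add: dB_def)
    qed
  qed (auto simp: dB_def fun_eq_iff elim!: tuples_SucE)
  then show ?thesis by (auto simp: Zc_def algebra_simps)
qed

lemma CC0_eqI: "f \<in> CC G N 0 \<Longrightarrow> g \<in> CC G' N' 0 \<Longrightarrow> f [] = g [] \<Longrightarrow> f = g"
  by (rule ext, rename_tac l, case_tac l) (auto simp: CC_def)

lemma CC1_eqI:
  "f \<in> CC G N (Suc 0) \<Longrightarrow> g \<in> CC G N' (Suc 0) \<Longrightarrow> (\<And>x. x \<in> carrier G \<Longrightarrow> f [x] = g [x]) \<Longrightarrow> f = g"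
  by (rule ext, rename_tac l, case_tac "l \<in> tuples G (Suc 0)") (auto simp: CC_def tuples_1)

lemma CC_Suc0_nth: "f \<in> CC G N (Suc 0) \<Longrightarrow> x \<in> carrier G \<Longrightarrow> f [x] \<in> N"
  and CC_0_nth: "f \<in> CC G N 0 \<Longrightarrow> f [] \<in> N"
  by (auto simp: CC_def)

lemma dB0_nth: "x \<in> carrier G \<Longrightarrow> dB G act 0 f [x] = act x (f []) - f []"
  by (simp add: dB_def)

lemma crossed_one_inv:
  assumes "group G" "gmod G N act" "f \<in> Zc (CC G N) (dB G act) (Suc 0)"
  shows "f [\<one>\<^bsub>G\<^esub>] = 0" "x \<in> carrier G \<Longrightarrow> f [x] = 0 \<Longrightarrow> f [inv\<^bsub>G\<^esub> x] = 0"
proof -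
  interpret group G by (rule assms)
  have f: "f \<in> CC G N (Suc 0)" "\<And>x y. x \<in> carrier G \<Longrightarrow> y \<in> carrier G \<Longrightarrow> f [x \<otimes>\<^bsub>G\<^esub> y] = f [x] + act x (f [y])"
    using assms(3) by (auto simp: Zc1_iff[OF assms(1)])
  show 1: "f [\<one>\<^bsub>G\<^esub>] = 0"
    using f(2)[OF one_closed one_closed] gmodD(5)[OF assms(2) CC_Suc0_nth[OF f(1) one_closed]] by simp
  show "f [inv\<^bsub>G\<^esub> x] = 0" if "x \<in> carrier G" "f [x] = 0"
    using f(2)[of "inv\<^bsub>G\<^esub> x" x] that 1 by (simp add: gmodD[OF assms(2)])
qed

context central_ext
begin

abbreviation "cone_d act \<equiv> dK (dB G act) ((\<circ>) (tw act t))"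

lemma gmod_G: "gmod E N act \<Longrightarrow> gmod G N act"
  unfolding G_def by (rule gmod_subset[OF _ H_subset])

lemma decompose: "x \<in> carrier E \<Longrightarrow> subgroup K E \<Longrightarrow> t \<in> K \<Longrightarrow> H \<subseteq> K \<Longrightarrow> x \<in> K"
  using rr_pp[of x] pp_H[of x] subgroup_int_pow_closed[of K t "\<rho> x"] subgroup.m_closed[of K E]
  unfolding rr_def by (metis subsetD)

text \<open>\<open>H\<close> and \<open>t\<close> generate \<open>E\<close>, so the invariants of
  \<open>E\<close> are the invariants of \<open>G\<close> that are killed by t - 1, which are the
  0-cocycles of the cone.\<close>

lemma hiso_cone_0:
  assumes M: "gmod E N act"
  shows "hiso (CC E N) (dB E act) 0 (KK (CC G N)) (cone_d act) 0"
proof -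
  have CC0: "CC E N 0 = CC G N 0" by (auto simp: CC_def)
  have inv: "(\<forall>x\<in>carrier E. act x m = m) \<longleftrightarrow> (\<forall>x\<in>H. act x m = m) \<and> act t m = m" if m: "m \<in> N" for m
  proof (intro iffI conjI ballI)
    assume as: "(\<forall>x\<in>H. act x m = m) \<and> act t m = m"
    have "subgroup {x \<in> carrier E. act x m = m} E"
    proof (rule subgroupI)
      fix x assume "x \<in> {x \<in> carrier E. act x m = m}"
      then have x: "x \<in> carrier E" "act x m = m" by auto
      then have "act (inv x) (act x m) = m" using gmodD(4)[OF M inv_closed[OF x(1)] x(1) m] x gmodD(5)[OF M m] by simp
      then show "inv x \<in> {x \<in> carrier E. act x m = m}" using x by simp
    qed (use m M in \<open>auto simp: gmodD\<close>)
    then show "act x m = m" if "x \<in> carrier E" for x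
      using decompose[OF that, of "{x \<in> carrier E. act x m = m}"] as H_subset by auto
  qed (use H_subset in auto)
  have iff: "(\<lambda>m. (m, 0)) ` Zc (CC E N) (dB E act) 0 = Zc (KK (CC G N)) (cone_d act) 0"
  proof -
    have "(m, h) \<in> Zc (KK (CC G N)) (cone_d act) 0 \<longleftrightarrow> h = 0 \<and> m \<in> Zc (CC E N) (dB E act) 0" for m h
    proof (cases "m \<in> CC G N 0")
      case True
      have m: "m [] \<in> N" by (rule CC_0_nth[OF True])
      have "(tw act t \<circ> m = 0) \<longleftrightarrow> act t (m []) = m []"
      proof
        assume "act t (m []) = m []"
        then have "tw act t (m l) = 0" for l
          using True gmodD(9)[OF M t] by (cases l) (auto simp: tw_def CC_def)
        then show "tw act t \<circ> m = 0" by (simp add: fun_eq_iff)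
      qed (auto simp: tw_def fun_eq_iff dest: spec[of _ "[]"])
      then have "(m, h) \<in> Zc (KK (CC G N)) (cone_d act) 0 \<longleftrightarrow>
         h = 0 \<and> m \<in> Zc (CC G N) (dB G act) 0 \<and> act t (m []) = m []"
        using True by (auto simp: Zc_def[of "KK (CC G N)"] KK_def dK_def zero_prod_def Zc_def)
      then show ?thesis using True inv[OF m] by (simp add: Zc0_iff CC0 conj_ac)
    qed (simp add: Zc_def KK_def CC0)
    then show ?thesis by auto
  qed
  show ?thesis
    unfolding hiso_def
    by (rule qiso_map[OF addsub_Zc[OF cplx_bar[OF is_group M]] _ iff])
      (auto simp: add_on_def zero_prod_def)
qed

text \<open>Crossed homomorphisms are homomorphic sections of the semidirect product
  \<open>W\<close> of \<open>N\<close> and \<open>E\<close>. The values of \<open>f\<close> give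
  such a section \<open>s\<close> over \<open>H\<close>, and \<open>w = (h, t)\<close> lies over
  \<open>t\<close>. Hypothesis \<open>c\<close> says that \<open>w\<close> commutes with every
  \<open>s x\<close>, hence \<open>s (pp x)\<close> times the power of \<open>w\<close> with
  exponent \<open>\<rho> x\<close> is multiplicative on all of \<open>E\<close>.\<close>

lemma crossed_hom_extension:
  assumes M: "gmod E N act" and h: "h \<in> N"
    and fN: "\<And>x. x \<in> H \<Longrightarrow> f x \<in> N"
    and f: "\<And>x y. x \<in> H \<Longrightarrow> y \<in> H \<Longrightarrow> f (x \<otimes> y) = f x + act x (f y)"
    and c: "\<And>x. x \<in> H \<Longrightarrow> f x + act x h = h + act t (f x)"
  obtains u where "\<And>x. x \<in> carrier E \<Longrightarrow> u x \<in> N"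
    "\<And>x y. x \<in> carrier E \<Longrightarrow> y \<in> carrier E \<Longrightarrow> u (x \<otimes> y) = u x + act x (u y)"
    "\<And>x. x \<in> H \<Longrightarrow> u x = f x" "u t = h"
proof -
  note A = gmodD(1)[OF M]
  define W where "W = ext_group E N act (\<lambda>_ _. 0)"
  have W: "group W" unfolding W_def
    by (rule group_ext_group[OF is_group M]) (use A in \<open>auto simp: gmodD[OF M] addsub_zero\<close>)
  interpret W: group W by (rule W)
  have Wc: "carrier W = N \<times> carrier E" by (simp add: W_def)
  have Wm: "(m, x) \<otimes>\<^bsub>W\<^esub> (n, y) = (m + act x n, x \<otimes> y)" for m x n y by (simp add: W_def)
  have W1: "\<one>\<^bsub>W\<^esub> = (0, \<one>)" by (simp add: W_def)
  define w where "w = (h, t)"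
  define s where "s x = (f x, x)" for x
  have w: "w \<in> carrier W" by (simp add: w_def Wc h)
  have s: "s x \<in> carrier W" if "x \<in> H" for x using that fN H_subset by (auto simp: s_def Wc)
  have ss: "s (x \<otimes> y) = s x \<otimes>\<^bsub>W\<^esub> s y" if "x \<in> H" "y \<in> H" for x y
    using f that by (simp add: s_def Wm)
  have sw: "s x \<otimes>\<^bsub>W\<^esub> w [^]\<^bsub>W\<^esub> (j::int) = w [^]\<^bsub>W\<^esub> j \<otimes>\<^bsub>W\<^esub> s x" if "x \<in> H" for x j
    by (rule W.commute_int_pow)
      (use that s w c central H_subset in \<open>auto simp: s_def w_def Wm\<close>)
  have sndpow: "snd (w [^]\<^bsub>W\<^esub> (j::int)) = t [^] j" for j
  proof -
    interpret q: group_hom W E snd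
      by (simp add: group_hom_def group_hom_axioms_def W is_group hom_def Wc Pi_def)
        (auto simp: Wm)
    show ?thesis using q.hom_int_pow[OF w, of j] by (simp add: w_def)
  qed
  define \<sigma> where "\<sigma> x = s (pp x) \<otimes>\<^bsub>W\<^esub> w [^]\<^bsub>W\<^esub> \<rho> x" for x
  have \<sigma>: "\<sigma> x \<in> carrier W" if "x \<in> carrier E" for x
    using that by (simp add: \<sigma>_def s pp_H w)
  have pp_mult: "pp (x \<otimes> y) = pp x \<otimes> pp y" if "x \<in> carrier E" "y \<in> carrier E" for x y
  proof -
    have "pp (x \<otimes> y) = inv (t [^] \<rho> y) \<otimes> inv (t [^] \<rho> x) \<otimes> (x \<otimes> y)"
      using that by (simp add: pp_def rho_mult int_pow_mult inv_mult_group)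
    also have "\<dots> = t [^] (- \<rho> y) \<otimes> (pp x \<otimes> y)"
      using that by (simp add: pp_def m_assoc int_pow_neg)
    also have "\<dots> = (t [^] (- \<rho> y) \<otimes> pp x) \<otimes> y"
      using that pp_H[of x] H_subset by (auto simp: m_assoc)
    also have "\<dots> = (pp x \<otimes> t [^] (- \<rho> y)) \<otimes> y"
      using central_pow[of "pp x"] that pp_H[of x] H_subset by (simp add: subset_iff)
    also have "\<dots> = pp x \<otimes> pp y"
      using that pp_H[of x] H_subset by (auto simp: m_assoc pp_def[of y] int_pow_neg)
    finally show ?thesis .
  qed
  have \<sigma>m: "\<sigma> (x \<otimes> y) = \<sigma> x \<otimes>\<^bsub>W\<^esub> \<sigma> y" if xy: "x \<in> carrier E" "y \<in> carrier E" for x y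
  proof -
    have cl: "s (pp x) \<in> carrier W" "s (pp y) \<in> carrier W" "w [^]\<^bsub>W\<^esub> \<rho> x \<in> carrier W"
      "w [^]\<^bsub>W\<^esub> \<rho> y \<in> carrier W" using xy by (auto simp: s pp_H w)
    have "\<sigma> x \<otimes>\<^bsub>W\<^esub> \<sigma> y = s (pp x) \<otimes>\<^bsub>W\<^esub> ((w [^]\<^bsub>W\<^esub> \<rho> x \<otimes>\<^bsub>W\<^esub> s (pp y)) \<otimes>\<^bsub>W\<^esub> w [^]\<^bsub>W\<^esub> \<rho> y)"
      using cl by (simp add: \<sigma>_def W.m_assoc)
    also have "\<dots> = s (pp x) \<otimes>\<^bsub>W\<^esub> ((s (pp y) \<otimes>\<^bsub>W\<^esub> w [^]\<^bsub>W\<^esub> \<rho> x) \<otimes>\<^bsub>W\<^esub> w [^]\<^bsub>W\<^esub> \<rho> y)"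
      using sw[OF pp_H[OF xy(2)]] by simp
    also have "\<dots> = (s (pp x) \<otimes>\<^bsub>W\<^esub> s (pp y)) \<otimes>\<^bsub>W\<^esub> (w [^]\<^bsub>W\<^esub> \<rho> x \<otimes>\<^bsub>W\<^esub> w [^]\<^bsub>W\<^esub> \<rho> y)"
      using cl by (simp add: W.m_assoc)
    also have "\<dots> = \<sigma> (x \<otimes> y)"
      using xy by (simp add: \<sigma>_def pp_mult ss pp_H rho_mult W.int_pow_mult w)
    finally show ?thesis by simp
  qed
  have snd\<sigma>: "snd (\<sigma> x) = x" if "x \<in> carrier E" for x
  proof -
    have "snd (\<sigma> x) = pp x \<otimes> t [^] \<rho> x"
      using sndpow[of "\<rho> x"] by (cases "w [^]\<^bsub>W\<^esub> \<rho> x") (simp add: \<sigma>_def s_def Wm)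
    also have "\<dots> = x"
      using central_pow[of "pp x" "\<rho> x"] rr_pp[OF that] pp_H[OF that] H_subset
      by (auto simp: rr_def)
    finally show ?thesis .
  qed
  show ?thesis
  proof (rule that[of "\<lambda>x. fst (\<sigma> x)"])
    show "fst (\<sigma> x) \<in> N" if "x \<in> carrier E" for x
      using \<sigma>[OF that] by (auto simp: Wc)
    show "fst (\<sigma> (x \<otimes> y)) = fst (\<sigma> x) + act x (fst (\<sigma> y))"
      if "x \<in> carrier E" "y \<in> carrier E" for x y
      using snd\<sigma>[OF that(1)] unfolding \<sigma>m[OF that]
      by (cases "\<sigma> x"; cases "\<sigma> y") (simp add: Wm)
    show "fst (\<sigma> x) = f x" if x: "x \<in> H" for x
    proof -
      have "\<rho> x = 0" "pp x = x" using x by (auto simp: H_def pp_def)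
      then have "\<sigma> x = s x" using s[OF x] by (simp add: \<sigma>_def)
      then show ?thesis by (simp add: s_def)
    qed
    show "fst (\<sigma> t) = h"
    proof -
      have p1: "pp t = \<one>" using rho_t by (simp add: pp_def)
      have oH: "\<one> \<in> H" by (rule subgroup.one_closed[OF subgroup_H])
      have "s \<one> \<otimes>\<^bsub>W\<^esub> s \<one> = s \<one> \<otimes>\<^bsub>W\<^esub> \<one>\<^bsub>W\<^esub>" using ss[OF oH oH] s[OF oH] by simp
      then have "s \<one> = \<one>\<^bsub>W\<^esub>" using s[OF oH] by simp
      then show ?thesis using w by (simp add: \<sigma>_def p1 rho_t) (simp add: w_def)
    qed
  qed
qed

text \<open>A crossed homomorphism on \<open>E\<close> corresponds to its restriction to
  \<open>G\<close> together with its value at \<open>t\<close>. The cocycle condition of the cone is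
  exactly the compatibility needed to extend such a pair by
  \<open>crossed_hom_extension\<close>.\<close>

lemma hiso_cone_1:
  fixes N :: "'n::ab_group_add set"
  assumes M: "gmod E N act"
  shows "hiso (CC E N) (dB E act) (Suc 0) (KK (CC G N)) (cone_d act) (Suc 0)"
proof -
  note A = gmodD(1)[OF M]
  note MG = gmod_G[OF M]
  define \<phi> :: "('e list \<Rightarrow> 'n) \<Rightarrow> ('e list \<Rightarrow> 'n) \<times> ('e list \<Rightarrow> 'n)"
    where "\<phi> c = ((\<lambda>l. if l \<in> tuples G (Suc 0) then c l else 0), (\<lambda>l. if l = [] then c [t] else 0))" for c
  have HE: "x \<in> H \<Longrightarrow> x \<in> carrier E" for x using H_subset by auto
  have cond: "(f, h) \<in> Zc (KK (CC G N)) (cone_d act) (Suc 0) \<longleftrightarrow>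
      f \<in> Zc (CC G N) (dB G act) (Suc 0) \<and> h \<in> CC G N 0 \<and>
      (\<forall>x\<in>H. act t (f [x]) - f [x] = act x (h []) - h [])" for f h
  proof (cases "f \<in> CC G N (Suc 0) \<and> h \<in> CC G N 0")
    case True
    have "(tw act t \<circ> f) - dB G act 0 h = 0 \<longleftrightarrow>
      (\<forall>x\<in>H. act t (f [x]) - f [x] = act x (h []) - h [])"
    proof
      assume "(tw act t \<circ> f) - dB G act 0 h = 0"
      then have "tw act t (f [x]) - dB G act 0 h [x] = 0" for x by (simp add: fun_eq_iff)
      then show "\<forall>x\<in>H. act t (f [x]) - f [x] = act x (h []) - h []"
        by (simp add: tw_def dB0_nth)
    next
      assume as: "\<forall>x\<in>H. act t (f [x]) - f [x] = act x (h []) - h []"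
      have "tw act t (f l) - dB G act 0 h l = 0" for l
      proof (cases "l \<in> tuples G (Suc 0)")
        case True
        then show ?thesis using as by (auto simp: tuples_1 tw_def dB0_nth)
      next
        case False
        then show ?thesis using True gmodD(9)[OF M t] by (simp add: tw_def dB_def CC_def)
      qed
      then show "(tw act t \<circ> f) - dB G act 0 h = 0" by (simp add: fun_eq_iff)
    qed
    then show ?thesis using True
      by (auto simp: Zc_def[of "KK (CC G N)"] KK_def dK_def zero_prod_def Zc_def)
  qed (auto simp: Zc_def KK_def)
  show ?thesis
    unfolding hiso_def
  proof (rule qiso_map[OF addsub_Zc[OF cplx_bar[OF is_group M]], where f = \<phi>])
    show "add_on (Zc (CC E N) (dB E act) (Suc 0)) \<phi>"
      by (rule add_onI) (auto simp: \<phi>_def fun_eq_iff)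
    have \<phi>c: "\<phi> c \<in> Zc (KK (CC G N)) (cone_d act) (Suc 0)" if "c \<in> Zc (CC E N) (dB E act) (Suc 0)" for c
    proof -
      have c: "c \<in> CC E N (Suc 0)" "\<And>x y. x \<in> carrier E \<Longrightarrow> y \<in> carrier E \<Longrightarrow> c [x \<otimes> y] = c [x] + act x (c [y])"
        using that by (auto simp: Zc1_iff[OF is_group])
      have 1: "(\<lambda>l. if l \<in> tuples G (Suc 0) then c l else 0) \<in> Zc (CC G N) (dB G act) (Suc 0)"
        unfolding Zc1_iff[OF group_G]
        using c subgroup.m_closed[OF subgroup_H] by (auto simp: HE tuples_1 CC_def)
      have "act t (c [x]) - c [x] = act x (c [t]) - c [t]" if "x \<in> H" for x
        using c(2)[of x t] c(2)[of t x] central[of x] HE[OF that] by (simp add: algebra_simps)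
      then show ?thesis
        unfolding \<phi>_def cond using 1 CC_Suc0_nth[OF c(1) t] by (auto simp: CC_def)
    qed
    show "\<phi> ` Zc (CC E N) (dB E act) (Suc 0) = Zc (KK (CC G N)) (cone_d act) (Suc 0)"
    proof
      show "Zc (KK (CC G N)) (cone_d act) (Suc 0) \<subseteq> \<phi> ` Zc (CC E N) (dB E act) (Suc 0)"
      proof
        fix fh assume fh: "fh \<in> Zc (KK (CC G N)) (cone_d act) (Suc 0)"
        obtain f h where e: "fh = (f, h)" by (cases fh)
        have f: "f \<in> CC G N (Suc 0)" "\<And>x y. x \<in> H \<Longrightarrow> y \<in> H \<Longrightarrow> f [x \<otimes> y] = f [x] + act x (f [y])"
          and h: "h \<in> CC G N 0" and cc: "\<And>x. x \<in> H \<Longrightarrow> act t (f [x]) - f [x] = act x (h []) - h []"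
          using fh unfolding e cond Zc1_iff[OF group_G] by auto
        have c: "f [x] + act x (h []) = h [] + act t (f [x])" if "x \<in> H" for x
          using cc[OF that] by (simp add: algebra_simps)
        obtain u where u: "\<And>x. x \<in> carrier E \<Longrightarrow> u x \<in> N"
          "\<And>x y. x \<in> carrier E \<Longrightarrow> y \<in> carrier E \<Longrightarrow> u (x \<otimes> y) = u x + act x (u y)"
          "\<And>x. x \<in> H \<Longrightarrow> u x = f [x]" "u t = h []"
          by (rule crossed_hom_extension[OF M CC_0_nth[OF h], of "\<lambda>x. f [x]"])
            (use CC_Suc0_nth[OF f(1)] f(2) c in auto)
        let ?c = "\<lambda>l. if l \<in> tuples E (Suc 0) then u (hd l) else 0"
        have cZ: "?c \<in> Zc (CC E N) (dB E act) (Suc 0)"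
          unfolding Zc1_iff[OF is_group] using u by (auto simp: CC_def tuples_1)
        have "\<phi> ?c = fh"
        proof -
          have "f = (\<lambda>l. if l \<in> tuples G (Suc 0) then ?c l else 0)"
            by (rule CC1_eqI[OF f(1), of _ N]) (use u HE CC_Suc0_nth[OF f(1)] in \<open>auto simp: CC_def tuples_1\<close>)
          moreover have "h = (\<lambda>l. if l = [] then ?c [t] else 0)"
            by (rule CC0_eqI[OF h, of _ E N]) (use u CC_0_nth[OF h] in \<open>auto simp: CC_def\<close>)
          ultimately show ?thesis by (simp add: \<phi>_def e)
        qed
        then show "fh \<in> \<phi> ` Zc (CC E N) (dB E act) (Suc 0)" using cZ by blast
      qed
    qed (use \<phi>c in blast)
    show "\<phi> c \<in> Bc (KK (CC G N)) (cone_d act) (Suc 0) \<longleftrightarrow> c \<in> Bc (CC E N) (dB E act) (Suc 0)"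
      if cZ: "c \<in> Zc (CC E N) (dB E act) (Suc 0)" for c
    proof
      assume "c \<in> Bc (CC E N) (dB E act) (Suc 0)"
      then obtain m where m: "m \<in> CC E N 0" "c = dB E act 0 m" by auto
      have "cone_d act 0 (m, 0) = \<phi> c"
      proof -
        have "tw act t (m l) = (if l = [] then c [t] else 0)" for l
          using m gmodD(9)[OF M t] by (cases l) (auto simp: dB_def tw_def CC_def)
        moreover have "dB G act 0 m l = (if l \<in> tuples G (Suc 0) then c l else 0)" for l
          using m HE by (auto simp: dB_def tuples_1)
        ultimately show ?thesis by (simp add: dK_def \<phi>_def fun_eq_iff)
      qed
      moreover have "(m, 0) \<in> KK (CC G N) 0" using m by (auto simp: KK_def CC_def)
      ultimately show "\<phi> c \<in> Bc (KK (CC G N)) (cone_d act) (Suc 0)" by force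
    next
      assume "\<phi> c \<in> Bc (KK (CC G N)) (cone_d act) (Suc 0)"
      then obtain m where m: "m \<in> CC G N 0" "\<phi> c = (dB G act 0 m, tw act t \<circ> m)"
        by (auto simp: KK_def dK_def)
      have mE: "m \<in> CC E N 0" using m by (auto simp: CC_def)
      let ?c = "c - dB E act 0 m"
      note cx = cplx_bar[OF is_group M]
      have dZ: "dB E act 0 m \<in> Zc (CC E N) (dB E act) (Suc 0)"
        using Bc_subset_Zc[OF cx, of "Suc 0"] mE by auto
      have cc: "?c \<in> Zc (CC E N) (dB E act) (Suc 0)"
        by (rule addsub_diff[OF addsub_Zc[OF cx] cZ dZ])
      \<comment> \<open>The zeros of a crossed homomorphism form a subgroup; this one contains
        \<open>H\<close> and \<open>t\<close>, hence is everything.\<close>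
      have "subgroup {x \<in> carrier E. ?c [x] = 0} E"
      proof (rule subgroupI)
        show "{x \<in> carrier E. ?c [x] = 0} \<noteq> {}"
          using crossed_one_inv(1)[OF is_group M cc] by blast
        show "inv x \<in> {x \<in> carrier E. ?c [x] = 0}" if "x \<in> {x \<in> carrier E. ?c [x] = 0}" for x
          using crossed_one_inv(2)[OF is_group M cc, of x] that by auto
        show "x \<otimes> y \<in> {x \<in> carrier E. ?c [x] = 0}"
          if "x \<in> {x \<in> carrier E. ?c [x] = 0}" "y \<in> {x \<in> carrier E. ?c [x] = 0}" for x y
        proof -
          have "?c [x \<otimes> y] = ?c [x] + act x (?c [y])"
            using cc that unfolding Zc1_iff[OF is_group] by blast
          then show ?thesis using that by (simp add: gmodD(9)[OF M])
        qed
      qed auto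
      moreover have "t \<in> {x \<in> carrier E. ?c [x] = 0}"
      proof -
        have "(tw act t \<circ> m) [] = snd (\<phi> c) []" using m by simp
        then show ?thesis by (simp add: \<phi>_def tw_def dB0_nth)
      qed
      moreover have "H \<subseteq> {x \<in> carrier E. ?c [x] = 0}"
      proof
        fix x assume x: "x \<in> H"
        have "dB G act 0 m [x] = fst (\<phi> c) [x]" using m by simp
        then show "x \<in> {x \<in> carrier E. ?c [x] = 0}" using x by (simp add: \<phi>_def dB0_nth HE)
      qed
      ultimately have "?c [x] = 0" if "x \<in> carrier E" for x using decompose[OF that] by blast
      then have "c = dB E act 0 m"
        using cZ dZ by (intro CC1_eqI[of _ E N _ N]) (auto simp: Zc_def)
      then show "c \<in> Bc (CC E N) (dB E act) (Suc 0)" using mE by simp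
    qed
  qed
qed

end

section \<open>From low degrees to all degrees\<close>

lemma transversal_self: "group E \<Longrightarrow> transversal E (carrier E) (\<lambda>_. \<one>\<^bsub>E\<^esub>) (\<lambda>x. x)"
  by (simp add: transversal_def group.subgroup_self group.is_monoid)

lemma shift_self:
  assumes "group E" "gmod E N act" "k > 0"
  shows "hiso (CC E (QM E N)) (dB E (qact E act)) k (CC E N) (dB E act) (Suc k)"
proof -
  interpret gmodule E N act by (simp add: gmodule_def gmodule_axioms_def assms)
  show ?thesis using shift_bar[OF transversal_self[OF assms(1)] assms(3)] by simp
qed

text \<open>The assumption ranges over all modules in the packed type, so it also covers the
  cokernels \<open>QM\<close>, and dimension shifting propagates the vanishing upwards.\<close>

lemma vanish_shift:
  fixes G :: "('e, 'c) monoid_scheme"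
  assumes G: "group G"
    and base: "\<And>(N :: ('e list \<Rightarrow> 'n::ab_group_add) set) act. gmod G N act \<Longrightarrow>
       Zc (CC G N) (dB G act) 2 \<subseteq> Bc (CC G N) (dB G act) 2"
    and M: "gmod G (N :: ('e list \<Rightarrow> 'n) set) act" and k: "k \<ge> 2"
  shows "Zc (CC G N) (dB G act) k \<subseteq> Bc (CC G N) (dB G act) k"
  using k M
proof (induction k arbitrary: N act rule: dec_induct)
  case base
  then show ?case using assms(2) by blast
next
  case (step k)
  interpret gmodule G N act by (simp add: gmodule_def gmodule_axioms_def G step.prems)
  have "k > 0" using step.hyps by simp
  from shift_self[OF G step.prems this] show ?case
    unfolding hiso_def using qiso_trivial[OF qiso_sym step.IH[OF gmod_QM]] by blast
qed

lemma cone_vanish: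
  assumes X: "cplx X d" and \<tau>: "chain_endo X d \<tau>"
    and van: "Zc X d (Suc (Suc k)) \<subseteq> Bc X d (Suc (Suc k))" "Zc X d (Suc k) \<subseteq> Bc X d (Suc k)"
  shows "Zc (KK X) (dK d \<tau>) (Suc (Suc k)) \<subseteq> Bc (KK X) (dK d \<tau>) (Suc (Suc k))"
proof
  fix fh assume fh: "fh \<in> Zc (KK X) (dK d \<tau>) (Suc (Suc k))"
  obtain f h where e: "fh = (f, h)" by (cases fh)
  have f: "f \<in> Zc X d (Suc (Suc k))" and h: "h \<in> X (Suc k)" "\<tau> f = d (Suc k) h"
    using fh by (auto simp: e Zc_def KK_def dK_def zero_prod_def)
  then obtain u where u: "u \<in> X (Suc k)" "f = d (Suc k) u" using van(1) by auto
  note tu = chain_endoD[OF \<tau>]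
  have "h - \<tau> u \<in> Zc X d (Suc k)"
    using h u tu(2,3)[OF u(1)] by (simp add: Zc_def cplxD[OF X])
  then obtain w where w: "w \<in> X k" "h - \<tau> u = d k w" using van(2) by auto
  have "dK d \<tau> (Suc k) (u, - w) = fh"
    using u w e by (simp add: dK_def cplxD[OF X] algebra_simps)
  moreover have "(u, - w) \<in> KK X (Suc k)" using u w cplxD[OF X] by (simp add: KK_def)
  ultimately show "fh \<in> Bc (KK X) (dK d \<tau>) (Suc (Suc k))" by force
qed

context central_ext
begin

text \<open>A G-invariant element of the coinduced module depends only on \<open>\<rho> x\<close>,
  and t - 1 becomes the forward difference operator on functions of that integer, which is
  onto.\<close>

lemma Coind_antiderivative:
  fixes N :: "('e list \<Rightarrow> 'n::ab_group_add) set"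
  assumes M: "gmod E N act" and h: "h \<in> Zc (CC G (Coind E N)) (dB G (cact E)) 0"
  shows "\<exists>u\<in>Zc (CC G (Coind E N)) (dB G (cact E)) 0. tw (cact E) t \<circ> u = h"
proof -
  interpret m: gmodule E N act by (simp add: gmodule_def gmodule_axioms_def is_group M)
  note A = gmodD(1)[OF M]
  have hC: "h \<in> CC G (Coind E N) 0" and hinv: "\<And>g. g \<in> H \<Longrightarrow> cact E g (h []) = h []"
    using h by (auto simp: Zc0_iff)
  have h0: "h [] \<in> Coind E N" by (rule CC_0_nth[OF hC])
  obtain S :: "int \<Rightarrow> 'e list \<Rightarrow> 'n" where S: "\<And>j. S (j + 1) - S j = unp (h []) (t [^] j)" "\<And>j. S j \<in> N"
    by (rule int_antiderivative[OF A, of "\<lambda>j. unp (h []) (t [^] (j::int))"])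
      (use m.CoindD[OF h0] in auto)
  define \<phi> where "\<phi> = pk (\<lambda>x. if x \<in> carrier E then S (\<rho> x) else 0)"
  have \<phi>: "\<phi> \<in> Coind E N" using S by (simp add: \<phi>_def Coind_def zero_fun_def)
  have g\<phi>: "cact E g \<phi> = \<phi>" if "g \<in> H" for g
    by (rule unp_eqI) (use that in \<open>auto simp: \<phi>_def cact_def H_def rho_mult\<close>)
  have hx: "unp (h []) x = unp (h []) (t [^] \<rho> x)" if "x \<in> carrier E" for x
  proof -
    have "unp (cact E (pp x) (h [])) (rr x) = unp (h []) (rr x \<otimes> pp x)"
      using that by (simp add: cact_def rr_def)
    then show ?thesis using hinv[OF pp_H[OF that]] rr_pp[OF that] by (simp add: rr_def)
  qed
  have t\<phi>: "cact E t \<phi> - \<phi> = h []"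
  proof (rule unp_eqI)
    show "(cact E t \<phi> - \<phi>) [] = h [] []" using h0 by (simp add: cact_def \<phi>_def Coind_def)
    fix x
    show "unp (cact E t \<phi> - \<phi>) x = unp (h []) x"
    proof (cases "x \<in> carrier E")
      case True
      then show ?thesis
        using S(1)[of "\<rho> x"] hx[OF True] by (simp add: cact_def \<phi>_def rho_mult rho_t)
    qed (use h0 in \<open>simp add: cact_def \<phi>_def Coind_def\<close>)
  qed
  define u where "u l = (if l = [] then \<phi> else 0)" for l :: "'e list"
  have "u \<in> CC G (Coind E N) 0" using \<phi> by (simp add: CC_def u_def)
  moreover have "tw (cact E) t \<circ> u = h"
  proof
    fix l
    show "(tw (cact E) t \<circ> u) l = h l"
      using t\<phi> hC gmodD(9)[OF m.gmod_Coind t] by (cases l) (auto simp: u_def tw_def CC_def)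
  qed
  ultimately show ?thesis using g\<phi> by (intro bexI[of _ u]) (auto simp: Zc0_iff u_def)
qed

text \<open>The Wang sequence of \<open>1 \<rightarrow> G \<rightarrow> E \<rightarrow> \<int> \<rightarrow> 1\<close>, in the form of a mapping cone.\<close>

lemma hiso_cone:
  fixes N :: "('e list \<Rightarrow> 'n::ab_group_add) set"
  assumes "gmod E N act"
  shows "hiso (CC E N) (dB E act) k (KK (CC G N)) (cone_d act) k"
proof (cases k)
  case 0
  then show ?thesis using hiso_cone_0[OF assms] by simp
next
  case (Suc j)
  have "hiso (CC E N) (dB E act) (Suc j) (KK (CC G N)) (cone_d act) (Suc j)"
    using assms
  proof (induction j arbitrary: N act)
    case 0
    then show ?case by (rule hiso_cone_1)
  next
    case (Suc j)
    interpret m: gmodule E N act by (simp add: gmodule_def gmodule_axioms_def is_group Suc.prems)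
    have 1: "hiso (CC E N) (dB E act) (Suc (Suc j)) (CC E (QM E N)) (dB E (qact E act)) (Suc j)"
      by (rule hiso_sym[OF shift_self[OF is_group Suc.prems]]) simp
    have 2: "hiso (KK (CC G (QM E N))) (cone_d (qact E act)) (Suc j)
        (KK (CC G N)) (cone_d act) (Suc (Suc j))"
      using m.shift_cone[OF transversal _ t central, folded G_def, of "Suc j"]
        Coind_antiderivative[OF Suc.prems] by simp
    show ?case by (rule hiso_trans[OF 1 hiso_trans[OF Suc.IH[OF m.gmod_QM] 2]])
  qed
  then show ?thesis using Suc by simp
qed

text \<open>The cone raises the cohomological dimension by one: vanishing for \<open>G\<close> from
  degree 2 on gives vanishing for \<open>E\<close> from degree 3 on.\<close>

lemma vanish_E:
  fixes N :: "('e list \<Rightarrow> 'n::ab_group_add) set"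
  assumes base: "\<And>(N :: ('e list \<Rightarrow> 'n) set) act. gmod G N act \<Longrightarrow>
       Zc (CC G N) (dB G act) 2 \<subseteq> Bc (CC G N) (dB G act) 2"
    and M: "gmod E N act" and k: "k \<ge> 3"
  shows "Zc (CC E N) (dB E act) k \<subseteq> Bc (CC E N) (dB E act) k"
proof -
  obtain i where i: "k = Suc (Suc i)" "Suc i \<ge> 2" using k by (metis Suc_le_D Suc_le_mono numeral_2_eq_2 numeral_3_eq_3)
  have "Zc (CC G N) (dB G act) j \<subseteq> Bc (CC G N) (dB G act) j" if "j \<ge> 2" for j
    by (rule vanish_shift[OF group_G base gmod_G[OF M] that])
  note van = this[of "Suc (Suc i)"] this[of "Suc i"]
  have "Zc (KK (CC G N)) (cone_d act) (Suc (Suc i)) \<subseteq> Bc (KK (CC G N)) (cone_d act) (Suc (Suc i))"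
    by (rule cone_vanish[OF cplx_bar[OF group_G gmod_G[OF M]]
          chain_endo_tw[OF is_group M t central subgroup_H, folded G_def] van]) (use i in simp_all)
  then show ?thesis
    using qiso_trivial[OF hiso_cone[OF M, unfolded hiso_def], of k] i by simp
qed

text \<open>With t - 1 = 0 the cone is the direct sum of the bar complex of \<open>G\<close> and its
  shift, so cocycles and coboundaries both split as products.\<close>

lemma qiso_trivial_t:
  fixes N :: "('e list \<Rightarrow> 'n::ab_group_add) set"
  assumes M: "gmod E N act" and tt: "\<And>n. n \<in> N \<Longrightarrow> act t n = n"
  shows "qiso (Zc (CC E N) (dB E act) (Suc k)) (Bc (CC E N) (dB E act) (Suc k))
    (Zc (CC G N) (dB G act) (Suc k) \<times> Zc (CC G N) (dB G act) k)
    (Bc (CC G N) (dB G act) (Suc k) \<times> Bc (CC G N) (dB G act) k)"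
proof -
  note cx = cplx_bar[OF group_G gmod_G[OF M]]
  have tw0: "tw act t \<circ> f = 0" if "f \<in> CC G N j" for f j
  proof
    fix l
    show "(tw act t \<circ> f) l = 0 l" using tt CC_nth[OF that gmodD(1)[OF M]] by (simp add: tw_def)
  qed
  have Z: "Zc (KK (CC G N)) (cone_d act) (Suc k) = Zc (CC G N) (dB G act) (Suc k) \<times> Zc (CC G N) (dB G act) k"
    using tw0 by (auto simp: Zc_def KK_def dK_def zero_prod_def)
  \<comment> \<open>The shifted copy carries the differential -d, whose image is the same subgroup
    as that of d.\<close>
  have im: "dB G act j ` CC G N j = (\<lambda>h. - dB G act j h) ` CC G N j" for j
  proof -
    have "dB G act j h = - dB G act j (- h)" "- h \<in> CC G N j" if "h \<in> CC G N j" for h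
      using that by (auto simp: cplxD[OF cx])
    moreover have "- dB G act j h = dB G act j (- h)" if "h \<in> CC G N j" for h
      using that by (auto simp: cplxD[OF cx])
    ultimately show ?thesis by (metis (no_types, lifting) image_cong image_eqI subset_antisym image_subsetI)
  qed
  have B: "Bc (KK (CC G N)) (cone_d act) (Suc k) = Bc (CC G N) (dB G act) (Suc k) \<times> Bc (CC G N) (dB G act) k"
  proof (cases k)
    case 0
    then show ?thesis using tw0 by (force simp: KK_def dK_def zero_prod_def)
  next
    case (Suc j)
    have "cone_d act k ` (CC G N k \<times> CC G N j) =
       map_prod (dB G act k) (\<lambda>h. - dB G act j h) ` (CC G N k \<times> CC G N j)"
      by (rule image_cong[OF HOL.refl]) (use tw0 in \<open>auto simp: dK_def Suc\<close>)
    also have "\<dots> = (dB G act k ` CC G N k) \<times> ((\<lambda>h. - dB G act j h) ` CC G N j)"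
      by (rule map_prod_surj_on[OF HOL.refl HOL.refl])
    finally show ?thesis by (simp add: KK_def Suc im[of j])
  qed
  show ?thesis using hiso_cone[OF M, of "Suc k", unfolded hiso_def Z B] .
qed

end

section \<open>Transporting modules\<close>

text \<open>Puts an arbitrary coefficient type inside the packed type, as functions supported at the
  empty list. Theorems proved by dimension shifting thereby reach coefficients such as
  polynomials.\<close>

definition emb0 :: "'n \<Rightarrow> 'e list \<Rightarrow> 'n::ab_group_add" where
  "emb0 m = (\<lambda>l. if l = [] then m else 0)"

definition act0 :: "('e \<Rightarrow> 'n \<Rightarrow> 'n) \<Rightarrow> 'e \<Rightarrow> ('e list \<Rightarrow> 'n) \<Rightarrow> 'e list \<Rightarrow> 'n::ab_group_add" where
  "act0 act g \<psi> = emb0 (act g (\<psi> []))"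

lemma emb0_simps [simp]: "emb0 m [] = m" "emb0 0 = 0" "emb0 m = emb0 m' \<longleftrightarrow> m = m'"
  "emb0 (m - m') = emb0 m - emb0 m'"
  by (auto simp: emb0_def fun_eq_iff)

lemma gmod_emb0:
  assumes M: "gmod G N act"
  shows "gmod G (emb0 ` N) (act0 act)"
  unfolding gmod_def
proof (intro conjI ballI)
  show "addsub (emb0 ` N)"
    by (rule addsub_image[OF gmodD(1)[OF M]]) (simp add: add_on_def)
qed (auto simp: act0_def gmodD[OF M] add_on_def)

lemma hiso_emb0:
  fixes G :: "('e, 'c) monoid_scheme" and N :: "'n::ab_group_add set"
  assumes G: "group G" and M: "gmod G N act"
  shows "hiso (CC G N) (dB G act) k (CC G (emb0 ` N)) (dB G (act0 act)) k"
proof (rule hiso_chain_map[OF cplx_bar[OF G M], where e = "\<lambda>_. (\<circ>) emb0"])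
  let ?N0 = "emb0 ` N :: ('e list \<Rightarrow> 'n) set"
  have ad: "add_on N emb0" by (simp add: add_on_def)
  show "add_on (CC G N k) ((\<circ>) emb0)" for k by (rule add_on_CC_map[OF ad gmodD(1)[OF M]])
  show "bij_betw ((\<circ>) emb0) (CC G N k) (CC G ?N0 k)" for k
  proof (rule bij_betwI[where g = "(\<circ>) (\<lambda>\<psi>. \<psi> [])"])
    show "(\<circ>) emb0 \<in> CC G N k \<rightarrow> CC G ?N0 k" by (auto simp: CC_def)
    show "(\<circ>) (\<lambda>\<psi>. \<psi> []) \<in> CC G ?N0 k \<rightarrow> CC G N k" by (force simp: CC_def)
    fix f assume f: "f \<in> CC G ?N0 k"
    have "f l \<in> ?N0" for l by (rule CC_nth[OF f gmodD(1)[OF gmod_emb0[OF M]]])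
    then have "emb0 (f l []) = f l" for l by (metis emb0_simps(1) imageE)
    then show "emb0 \<circ> ((\<lambda>\<psi>. \<psi> []) \<circ> f) = f" by (simp add: fun_eq_iff)
  qed (auto simp: fun_eq_iff)
  show "dB G (act0 act) k (emb0 \<circ> x) = emb0 \<circ> dB G act k x" if "x \<in> CC G N k" for k x
    by (rule dB_map[OF G M _ that]) (simp add: equivar_def ad act0_def)
qed

lemma hiso_group_iso:
  fixes G :: "('e, 'c) monoid_scheme" and G' :: "('f, 'd) monoid_scheme"
    and N :: "'n::ab_group_add set"
  assumes G: "group G" and G': "group G'" and j: "j \<in> iso G G'"
    and M: "gmod G' N act"
  shows "hiso (CC G' N) (dB G' act) k (CC G N) (dB G (\<lambda>x. act (j x))) k"
proof (rule hiso_chain_map[OF cplx_bar[OF G' M],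
      where e = "\<lambda>k f l. if l \<in> tuples G k then f (map j l) else 0"])
  have jb: "bij_betw j (carrier G) (carrier G')" using j by (simp add: iso_def)
  have jm: "j (x \<otimes>\<^bsub>G\<^esub> y) = j x \<otimes>\<^bsub>G'\<^esub> j y" if "x \<in> carrier G" "y \<in> carrier G" for x y
    using j that by (simp add: iso_def hom_def)
  have jt: "map j l \<in> tuples G' k" if "l \<in> tuples G k" for l k
    using that bij_betw_apply[OF jb] by (auto simp: tuples_def)
  let ?i = "inv_into (carrier G) j"
  have it: "map ?i l \<in> tuples G k" "map j (map ?i l) = l" if "l \<in> tuples G' k" for l k
    using that bij_betw_inv_into[OF jb, THEN bij_betw_apply] bij_betw_inv_into_right[OF jb]
    by (auto simp: tuples_def subset_iff map_idI)
  have ji: "map ?i (map j l) = l" if "l \<in> tuples G k" for l k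
    using that bij_betw_inv_into_left[OF jb] by (auto simp: tuples_def subset_iff map_idI)
  show "add_on (CC G' N k) (\<lambda>f l. if l \<in> tuples G k then f (map j l) else 0)" for k
    by (rule add_onI) (auto simp: fun_eq_iff)
  show "bij_betw (\<lambda>f l. if l \<in> tuples G k then f (map j l) else 0) (CC G' N k) (CC G N k)" for k
    by (rule bij_betwI[where g = "\<lambda>f l. if l \<in> tuples G' k then f (map ?i l) else 0"])
      (use jt it ji in \<open>auto simp: CC_def fun_eq_iff simp del: map_map\<close>)
  show "dB G (\<lambda>x. act (j x)) k (\<lambda>l. if l \<in> tuples G k then f (map j l) else 0) =
     (\<lambda>l. if l \<in> tuples G (Suc k) then dB G' act k f (map j l) else 0)"
    if "f \<in> CC G' N k" for k f
  proof
    have bar_map: "bar G (\<lambda>l. f (map j l)) l = bar G' f (map j l)" if "l \<in> tuples G k"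
      for f :: "'f list \<Rightarrow> 'n" and k l
      using that
    proof (induction l arbitrary: f k rule: induct_list012)
      case (3 x y l)
      then obtain k' where "y # l \<in> tuples G k'" and xy: "x \<in> carrier G" "y \<in> carrier G" by auto
      then show ?case using "3.IH"(2)[of k' "\<lambda>l. f (j x # l)"] jm[OF xy] by simp
    qed auto
    fix l
    show "dB G (\<lambda>x. act (j x)) k (\<lambda>l. if l \<in> tuples G k then f (map j l) else 0) l =
      (if l \<in> tuples G (Suc k) then dB G' act k f (map j l) else 0)"
    proof (cases "l \<in> tuples G (Suc k)")
      case True
      have "bar G (\<lambda>l. if l \<in> tuples G k then f (map j l) else 0) l = bar G (\<lambda>l. f (map j l)) l"
        by (rule bar_cong[OF G True]) simp
      then show ?thesis
        using True jt[OF True] bar_map[OF True] by (auto simp: dB_def elim!: tuples_SucE)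
    qed (simp add: dB_def)
  qed
qed

section \<open>Tensor products with cyclic groups\<close>

lemma free_Abelian_group_addgrp: "free_Abelian_group S = addgrp {c. Poly_Mapping.keys c \<subseteq> S}"
  by (simp add: free_Abelian_group_def addgrp_def)

lemma Quot_hom_props:
  assumes "group_hom (addgrp Z) T q" "addsub Z" "x \<in> Z" "y \<in> Z" "z \<in> Z" "q (x - y - z) = \<one>\<^bsub>T\<^esub>"
  shows "q x = q y \<otimes>\<^bsub>T\<^esub> q z"
proof -
  interpret q: group_hom "addgrp Z" T q by (rule assms(1))
  have m: "x - y - z \<in> Z" "y + z \<in> Z" using assms by (simp_all add: addsub_diff addsub_add)
  have "q ((x - y - z) + (y + z)) = q (x - y - z) \<otimes>\<^bsub>T\<^esub> q (y + z)"
    using q.hom_mult[of "x - y - z" "y + z"] m by simp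
  also have "\<dots> = q (y + z)" using assms(6) m q.hom_closed[of "y + z"] by simp
  also have "\<dots> = q y \<otimes>\<^bsub>T\<^esub> q z" using q.hom_mult[of y z] assms by simp
  finally show ?thesis by simp
qed

text \<open>For \<open>B\<close> cyclic of order \<open>q\<close>, with q = 0 meaning infinite
  order, the map sending a to the class of (a, b0) is onto. Its kernel is bounded by mapping back to
  A / qA: a pair (a, b) goes to a raised to the discrete logarithm of b, which respects the bilinear
  relations modulo q.\<close>

lemma tensor_group_cyclic:
  assumes A: "comm_group A" and B: "comm_group B" and b0: "b0 \<in> carrier B"
    and gen: "carrier B = range (\<lambda>k::int. b0 [^]\<^bsub>B\<^esub> k)"
    and ord: "\<And>k::int. b0 [^]\<^bsub>B\<^esub> k = \<one>\<^bsub>B\<^esub> \<longleftrightarrow> q dvd k"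
  shows "A Mod ((\<lambda>a. a [^]\<^bsub>A\<^esub> q) ` carrier A) \<cong> tensor_group A B"
    and "comm_group (tensor_group A B)"
proof -
  interpret A: comm_group A by (rule A)
  interpret B: comm_group B by (rule B)
  define S where "S = carrier A \<times> carrier B"
  define Z where "Z = {c :: 'a \<times> 'c \<Rightarrow>\<^sub>0 int. Poly_Mapping.keys c \<subseteq> S}"
  define R where "R = generate (addgrp Z) (bilinear_relations A B)"
  have Zadd: "addsub Z"
    unfolding Z_def by (rule addsubI) (auto dest: keys_diff[THEN subsetD])
  interpret F: comm_group "addgrp Z" by (rule comm_group_addgrp[OF Zadd])
  have fr: "frag_of (a, b) \<in> Z" if "a \<in> carrier A" "b \<in> carrier B" for a b
    using that by (simp add: Z_def S_def)
  have relZ: "bilinear_relations A B \<subseteq> Z"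
    unfolding bilinear_relations_def using fr
    by (auto intro!: addsub_diff[OF Zadd])
  have sR: "subgroup R (addgrp Z)"
    unfolding R_def by (rule F.generate_is_subgroup) (use relZ in simp)
  have RZ: "R \<subseteq> Z" using subgroup.subset[OF sR] by simp
  have Radd: "addsub R"
  proof (rule addsubI)
    show "0 \<in> R" using subgroup.one_closed[OF sR] by simp
    show "x - y \<in> R" if "x \<in> R" "y \<in> R" for x y
      using subgroup.m_closed[OF sR that(1) subgroup.m_inv_closed[OF sR that(2)]] that RZ
      by (auto simp: inv_addgrp[OF Zadd] subset_iff)
  qed
  have T: "tensor_group A B = Quot Z R"
    by (simp add: tensor_group_def Quot_def R_def Z_def S_def free_Abelian_group_addgrp Let_def)
  show cT: "comm_group (tensor_group A B)"
    unfolding T by (rule comm_group_Quot[OF Zadd Radd RZ])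
  let ?T = "Quot Z R"
  interpret T: comm_group ?T using cT T by simp
  obtain p where p: "p \<in> hom (addgrp Z) ?T" "p ` Z = carrier ?T"
    "\<And>x. x \<in> Z \<Longrightarrow> p x = \<one>\<^bsub>?T\<^esub> \<longleftrightarrow> x \<in> R"
    using Quot_proj[OF Zadd Radd RZ] by blast
  interpret p: group_hom "addgrp Z" ?T p
    by (simp add: group_hom_def group_hom_axioms_def p T.is_group F.is_group)
  define \<tau> where "\<tau> a b = p (frag_of (a, b))" for a b
  have \<tau>c: "\<tau> a b \<in> carrier ?T" if "a \<in> carrier A" "b \<in> carrier B" for a b
    using p.hom_closed[of "frag_of (a, b)"] fr[OF that] by (simp add: \<tau>_def)
  have \<tau>A: "\<tau> (a \<otimes>\<^bsub>A\<^esub> a') b = \<tau> a b \<otimes>\<^bsub>?T\<^esub> \<tau> a' b"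
    if "a \<in> carrier A" "a' \<in> carrier A" "b \<in> carrier B" for a a' b
    unfolding \<tau>_def
  proof (rule Quot_hom_props[OF p.group_hom_axioms Zadd])
    have r: "frag_of (a \<otimes>\<^bsub>A\<^esub> a', b) - frag_of (a, b) - frag_of (a', b) \<in> bilinear_relations A B"
      using that unfolding bilinear_relations_def by blast
    then have "frag_of (a \<otimes>\<^bsub>A\<^esub> a', b) - frag_of (a, b) - frag_of (a', b) \<in> R"
      unfolding R_def by (rule generate.incl)
    then show "p (frag_of (a \<otimes>\<^bsub>A\<^esub> a', b) - frag_of (a, b) - frag_of (a', b)) = \<one>\<^bsub>?T\<^esub>"
      using p(3) RZ by blast
  qed (use that fr in auto)
  have \<tau>B: "\<tau> a (b \<otimes>\<^bsub>B\<^esub> b') = \<tau> a b \<otimes>\<^bsub>?T\<^esub> \<tau> a b'"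
    if "a \<in> carrier A" "b \<in> carrier B" "b' \<in> carrier B" for a b b'
    unfolding \<tau>_def
  proof (rule Quot_hom_props[OF p.group_hom_axioms Zadd])
    have r: "frag_of (a, b \<otimes>\<^bsub>B\<^esub> b') - frag_of (a, b) - frag_of (a, b') \<in> bilinear_relations A B"
      using that unfolding bilinear_relations_def by blast
    then have "frag_of (a, b \<otimes>\<^bsub>B\<^esub> b') - frag_of (a, b) - frag_of (a, b') \<in> R"
      unfolding R_def by (rule generate.incl)
    then show "p (frag_of (a, b \<otimes>\<^bsub>B\<^esub> b') - frag_of (a, b) - frag_of (a, b')) = \<one>\<^bsub>?T\<^esub>"
      using p(3) RZ by blast
  qed (use that fr in auto)
  interpret \<theta>: group_hom A ?T "\<lambda>a. \<tau> a b0"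
    by (simp add: group_hom_def group_hom_axioms_def A.is_group T.is_group hom_def \<tau>c b0 \<tau>A Pi_def)
  have \<tau>pow: "\<tau> a (b0 [^]\<^bsub>B\<^esub> (k::int)) = \<tau> (a [^]\<^bsub>A\<^esub> k) b0" if "a \<in> carrier A" for a k
  proof -
    interpret h: group_hom B ?T "\<tau> a"
      by (simp add: group_hom_def group_hom_axioms_def B.is_group T.is_group hom_def \<tau>c \<tau>B that Pi_def)
    show ?thesis using h.hom_int_pow[OF b0, of k] \<theta>.hom_int_pow[OF that, of k] by simp
  qed
  let ?qA = "(\<lambda>a. a [^]\<^bsub>A\<^esub> q) ` carrier A"
  have onto: "(\<lambda>a. \<tau> a b0) ` carrier A = carrier ?T"
  proof
    have "p x \<in> (\<lambda>a. \<tau> a b0) ` carrier A" if "Poly_Mapping.keys x \<subseteq> S" for x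
    proof (rule free_Abelian_group_induct[OF that])
      show "p 0 \<in> (\<lambda>a. \<tau> a b0) ` carrier A"
        by (rule rev_image_eqI[OF A.one_closed]) (use \<theta>.hom_one p.hom_one in simp)
    next
      fix x y
      assume 2: "Poly_Mapping.keys x \<subseteq> S" "Poly_Mapping.keys y \<subseteq> S"
        "p x \<in> (\<lambda>a. \<tau> a b0) ` carrier A" "p y \<in> (\<lambda>a. \<tau> a b0) ` carrier A"
      then obtain a a' where a: "a \<in> carrier A" "p x = \<tau> a b0" "a' \<in> carrier A" "p y = \<tau> a' b0" by blast
      have xy: "x \<in> Z" "y \<in> Z" using 2 by (auto simp: Z_def)
      have "p (x - y) = p x \<otimes>\<^bsub>?T\<^esub> inv\<^bsub>?T\<^esub> p y"
        using p.hom_mult[of x "- y"] p.hom_inv[of y] xy addsub_neg[OF Zadd xy(2)]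
        by (simp add: inv_addgrp[OF Zadd])
      also have "\<dots> = \<tau> (a \<otimes>\<^bsub>A\<^esub> inv\<^bsub>A\<^esub> a') b0"
        using a \<theta>.hom_mult[of a "inv\<^bsub>A\<^esub> a'"] by simp
      finally show "p (x - y) \<in> (\<lambda>a. \<tau> a b0) ` carrier A" using a by blast
    next
      fix ab assume "ab \<in> S"
      then obtain a b where ab: "ab = (a, b)" "a \<in> carrier A" "b \<in> carrier B" by (auto simp: S_def)
      then obtain k :: int where "b = b0 [^]\<^bsub>B\<^esub> k" using gen by auto
      then have "p (frag_of ab) = \<tau> (a [^]\<^bsub>A\<^esub> k) b0" using \<tau>pow[OF ab(2)] ab by (simp add: \<tau>_def)
      then show "p (frag_of ab) \<in> (\<lambda>a. \<tau> a b0) ` carrier A" using ab by blast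
    qed
    then have "p ` Z \<subseteq> (\<lambda>a. \<tau> a b0) ` carrier A" by (auto simp: Z_def)
    then show "carrier ?T \<subseteq> (\<lambda>a. \<tau> a b0) ` carrier A" by (simp only: p(2))
  qed (use \<tau>c b0 in auto)
  have "kernel A ?T (\<lambda>a. \<tau> a b0) = ?qA"
  proof
    show "?qA \<subseteq> kernel A ?T (\<lambda>a. \<tau> a b0)"
    proof
      fix x assume "x \<in> ?qA"
      then obtain c where c: "c \<in> carrier A" "x = c [^]\<^bsub>A\<^esub> q" by blast
      interpret h: group_hom B ?T "\<tau> c"
        by (simp add: group_hom_def group_hom_axioms_def B.is_group T.is_group hom_def \<tau>c \<tau>B c Pi_def)
      have "\<tau> x b0 = \<tau> c \<one>\<^bsub>B\<^esub>" using \<tau>pow[OF c(1), of q] ord[of q] c(2) by simp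
      then show "x \<in> kernel A ?T (\<lambda>a. \<tau> a b0)" using c by (simp add: kernel_def)
    qed
    show "kernel A ?T (\<lambda>a. \<tau> a b0) \<subseteq> ?qA"
    proof
      fix a assume "a \<in> kernel A ?T (\<lambda>a. \<tau> a b0)"
      then have a: "a \<in> carrier A" "frag_of (a, b0) \<in> R"
        using p(3) fr[OF _ b0] by (auto simp: kernel_def \<tau>_def)
      have sub: "subgroup ?qA A"
      proof -
        interpret h: group_hom A A "\<lambda>a. a [^]\<^bsub>A\<^esub> q"
          by (simp add: group_hom_def group_hom_axioms_def A.is_group hom_def A.int_pow_distrib Pi_def)
        show ?thesis by (rule h.img_is_subgroup)
      qed
      interpret N: normal ?qA A by (rule A.subgroup_imp_normal[OF sub])
      interpret Q: comm_group "A Mod ?qA" by (rule A.abelian_FactGroup[OF sub])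
      \<comment> \<open>A discrete logarithm to base \<open>b0\<close>. It is determined only modulo
        \<open>q\<close> and need not be additive; \<open>cosk\<close> shows that the ambiguity
        disappears modulo q-th powers.\<close>
      define \<kappa> where "\<kappa> b = (SOME k::int. b = b0 [^]\<^bsub>B\<^esub> k)" for b
      have \<kappa>: "b = b0 [^]\<^bsub>B\<^esub> \<kappa> b" if "b \<in> carrier B" for b
        unfolding \<kappa>_def by (rule someI_ex) (use that gen in auto)
      let ?f = "\<lambda>(a, b). ?qA #>\<^bsub>A\<^esub> (a [^]\<^bsub>A\<^esub> \<kappa> b)"
      have rm: "(?qA #>\<^bsub>A\<^esub> x) \<otimes>\<^bsub>A Mod ?qA\<^esub> (?qA #>\<^bsub>A\<^esub> y) = ?qA #>\<^bsub>A\<^esub> (x \<otimes>\<^bsub>A\<^esub> y)"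
        if "x \<in> carrier A" "y \<in> carrier A" for x y using N.rcos_sum[OF that] by simp
      have cl: "?qA #>\<^bsub>A\<^esub> x \<in> carrier (A Mod ?qA)" if "x \<in> carrier A" for x
        using that by (auto simp: carrier_FactGroup)
      have qk: "a [^]\<^bsub>A\<^esub> (q * k) \<in> ?qA" if "a \<in> carrier A" for a and k :: int
        by (rule rev_image_eqI[OF A.int_pow_closed[OF that, of k]])
          (use A.int_pow_pow[OF that, of k q] in \<open>simp add: mult.commute\<close>)
      have cosk: "?qA #>\<^bsub>A\<^esub> (a [^]\<^bsub>A\<^esub> k) = ?qA #>\<^bsub>A\<^esub> (a [^]\<^bsub>A\<^esub> l)"
        if "a \<in> carrier A" "q dvd k - l" for a k l
      proof -
        from that(2) obtain j where "k - l = q * j" by (rule dvdE)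
        then have "k = q * j + l" by simp
        then have "a [^]\<^bsub>A\<^esub> k = a [^]\<^bsub>A\<^esub> (q * j) \<otimes>\<^bsub>A\<^esub> a [^]\<^bsub>A\<^esub> l" using A.int_pow_mult[OF that(1)] by simp
        then have "?qA #>\<^bsub>A\<^esub> (a [^]\<^bsub>A\<^esub> k) = (?qA #>\<^bsub>A\<^esub> (a [^]\<^bsub>A\<^esub> (q * j))) \<otimes>\<^bsub>A Mod ?qA\<^esub> (?qA #>\<^bsub>A\<^esub> (a [^]\<^bsub>A\<^esub> l))"
          using rm that by simp
        also have "?qA #>\<^bsub>A\<^esub> (a [^]\<^bsub>A\<^esub> (q * j)) = \<one>\<^bsub>A Mod ?qA\<^esub>"
          using A.coset_join2[OF _ sub qk[OF that(1)]] that by simp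
        finally show ?thesis using Q.l_one[OF cl] that by simp
      qed
      have f: "?f ` S \<subseteq> carrier (A Mod ?qA)" by (auto simp: S_def cl)
      obtain h where h: "h \<in> hom (free_Abelian_group S) (A Mod ?qA)"
        "\<And>x. x \<in> S \<Longrightarrow> h (frag_of x) = ?f x"
        using Q.free_Abelian_group_universal[OF f] by blast
      have hZ: "h \<in> hom (addgrp Z) (A Mod ?qA)"
        using h(1) by (simp only: free_Abelian_group_addgrp Z_def)
      interpret h: group_hom "addgrp Z" "A Mod ?qA" h
        by (simp add: group_hom_def group_hom_axioms_def F.is_group Q.is_group hZ)
      have hd: "h (x - y - z) = \<one>\<^bsub>A Mod ?qA\<^esub>"
        if "x \<in> Z" "y \<in> Z" "z \<in> Z" "h x = h y \<otimes>\<^bsub>A Mod ?qA\<^esub> h z" for x y z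
      proof -
        have m: "x - y - z \<in> Z" "y + z \<in> Z" using that Zadd by (simp_all add: addsub_diff addsub_add)
        have "h x = h (x - y - z) \<otimes>\<^bsub>A Mod ?qA\<^esub> h (y + z)"
          using h.hom_mult[of "x - y - z" "y + z"] m by simp
        moreover have "h (y + z) = h x" using h.hom_mult[of y z] that by simp
        ultimately have "h x = h (x - y - z) \<otimes>\<^bsub>A Mod ?qA\<^esub> h x" by (simp only:)
        moreover have "h x \<in> carrier (A Mod ?qA)" "h (x - y - z) \<in> carrier (A Mod ?qA)"
          using h.hom_closed[of x] h.hom_closed[of "x - y - z"] m that by (simp_all only: addgrp_simps)
        ultimately show ?thesis using Q.r_cancel_one' by blast
      qed
      have "bilinear_relations A B \<subseteq> kernel (addgrp Z) (A Mod ?qA) h"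
      proof
        fix x assume xr: "x \<in> bilinear_relations A B"
        then have xZ: "x \<in> Z" using relZ by blast
        from xr consider (l) a a' b where "x = frag_of (a \<otimes>\<^bsub>A\<^esub> a', b) - frag_of (a, b) - frag_of (a', b)"
            "a \<in> carrier A" "a' \<in> carrier A" "b \<in> carrier B"
          | (r) a b b' where "x = frag_of (a, b \<otimes>\<^bsub>B\<^esub> b') - frag_of (a, b) - frag_of (a, b')"
            "a \<in> carrier A" "b \<in> carrier B" "b' \<in> carrier B"
          unfolding bilinear_relations_def by blast
        then have "h x = \<one>\<^bsub>A Mod ?qA\<^esub>"
        proof cases
          case l
          show ?thesis
            unfolding l(1) by (rule hd)
              (use l fr in \<open>simp_all add: h(2) S_def rm A.int_pow_distrib del: mult_FactGroup\<close>)
        next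
          case r
          have "b0 [^]\<^bsub>B\<^esub> (\<kappa> (b \<otimes>\<^bsub>B\<^esub> b') - (\<kappa> b + \<kappa> b')) = \<one>\<^bsub>B\<^esub>"
            using r \<kappa>[of b] \<kappa>[of b'] \<kappa>[of "b \<otimes>\<^bsub>B\<^esub> b'"] b0 by (simp add: B.int_pow_diff B.int_pow_mult)
          then have "q dvd \<kappa> (b \<otimes>\<^bsub>B\<^esub> b') - (\<kappa> b + \<kappa> b')" using ord by simp
          from cosk[OF r(2) this] show ?thesis
            unfolding r(1) by (intro hd)
              (use r fr in \<open>simp_all add: h(2) S_def rm A.int_pow_mult del: mult_FactGroup\<close>)
        qed
        then show "x \<in> kernel (addgrp Z) (A Mod ?qA) h" using xZ by (simp add: kernel_def)
      qed
      then have "R \<subseteq> kernel (addgrp Z) (A Mod ?qA) h"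
        unfolding R_def by (rule F.generate_subgroup_incl) (rule h.subgroup_kernel)
      then have "h (frag_of (a, b0)) = \<one>\<^bsub>A Mod ?qA\<^esub>" using a(2) by (auto simp: kernel_def)
      then have h1: "?qA #>\<^bsub>A\<^esub> (a [^]\<^bsub>A\<^esub> \<kappa> b0) = ?qA" using h(2)[of "(a, b0)"] a b0 by (simp add: S_def)
      have "b0 [^]\<^bsub>B\<^esub> (\<kappa> b0 - 1) = \<one>\<^bsub>B\<^esub>"
        using \<kappa>[OF b0] b0 by (simp add: B.int_pow_diff)
      then have "q dvd \<kappa> b0 - 1" using ord by simp
      then have "?qA #>\<^bsub>A\<^esub> a = ?qA" using cosk[OF a(1), of "\<kappa> b0" 1] h1 a by simp
      then show "a \<in> ?qA" using A.coset_join1[OF _ a(1) sub] by simp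
    qed
  qed
  then show "A Mod ?qA \<cong> tensor_group A B" using \<theta>.FactGroup_iso[OF onto] T by simp
qed

lemma group_is_isoI: "f \<in> hom G H \<Longrightarrow> inj_on f (carrier G) \<Longrightarrow> f ` carrier G = carrier H \<Longrightarrow> G \<cong> H"
  unfolding is_iso_def iso_def bij_betw_def by blast

lemma Mod_one_iso: "group A \<Longrightarrow> A Mod {\<one>\<^bsub>A\<^esub>} \<cong> A"
proof -
  assume A: "group A"
  interpret group_hom A A id by (simp add: group_hom_def group_hom_axioms_def A hom_def)
  have "kernel A A id = {\<one>\<^bsub>A\<^esub>}" by (auto simp: kernel_def)
  then show ?thesis using FactGroup_iso by simp
qed

lemma tensor_group_integers:
  assumes A: "comm_group A" and B: "B \<cong> integer_group" and gB: "group B"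
  shows "tensor_group A B \<cong> A"
proof -
  interpret A: comm_group A by (rule A)
  have sB: "integer_group \<cong> B" using group.iso_sym[OF gB B] .
  then obtain \<phi> where \<phi>: "\<phi> \<in> iso integer_group B" by (auto simp: is_iso_def)
  interpret \<phi>: group_hom integer_group B \<phi>
    using \<phi> gB by (simp add: group_hom_def group_hom_axioms_def iso_def)
  have cB: "comm_group B" by (rule comm_group.iso_imp_comm_group[OF abelian_integer_group sB]) (rule group.is_monoid[OF gB])
  have pow: "\<phi> 1 [^]\<^bsub>B\<^esub> (k::int) = \<phi> k" for k using \<phi>.hom_int_pow[of 1 k] by simp
  have bij: "bij_betw \<phi> UNIV (carrier B)" using \<phi> by (simp add: iso_def)
  have "A Mod ((\<lambda>a. a [^]\<^bsub>A\<^esub> (0::int)) ` carrier A) \<cong> tensor_group A B"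
  proof (rule tensor_group_cyclic(1)[OF A cB, of "\<phi> 1"])
    show "carrier B = range (\<lambda>k::int. \<phi> 1 [^]\<^bsub>B\<^esub> k)" unfolding pow using bij by (simp add: bij_betw_def)
    show "\<phi> 1 [^]\<^bsub>B\<^esub> k = \<one>\<^bsub>B\<^esub> \<longleftrightarrow> 0 dvd k" for k :: int
      unfolding pow using bij \<phi>.hom_one by (auto simp: bij_betw_def inj_on_def)
  qed simp
  moreover have "(\<lambda>a. a [^]\<^bsub>A\<^esub> (0::int)) ` carrier A = {\<one>\<^bsub>A\<^esub>}" using A.one_closed by auto
  ultimately have "A Mod {\<one>\<^bsub>A\<^esub>} \<cong> tensor_group A B" by simp
  moreover have "group (A Mod {\<one>\<^bsub>A\<^esub>})"
    by (rule normal.factorgroup_is_group[OF A.one_is_normal])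
  ultimately show ?thesis using Mod_one_iso[OF A.is_group] by (metis group.iso_sym iso_trans)
qed

lemma tensor_group_trivial:
  assumes A: "comm_group A" and B: "trivial_group B"
  shows "trivial_group (tensor_group A B)"
proof -
  interpret A: comm_group A by (rule A)
  have gB: "group B" and cB: "carrier B = {\<one>\<^bsub>B\<^esub>}" using B by (auto simp: trivial_group_def)
  interpret B: group B by (rule gB)
  have B': "comm_group B" by (rule B.group_comm_groupI) (use cB in auto)
  have "A Mod ((\<lambda>a. a [^]\<^bsub>A\<^esub> (1::int)) ` carrier A) \<cong> tensor_group A B"
    and g: "comm_group (tensor_group A B)"
    \<comment> \<open>A trivial group is cyclic of order 1, so the tensor product is A modulo all of
      A.\<close>
    by (rule tensor_group_cyclic[OF A B', of "\<one>\<^bsub>B\<^esub>" 1]; use cB in auto)+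
  moreover have "(\<lambda>a. a [^]\<^bsub>A\<^esub> (1::int)) ` carrier A = carrier A" by (auto simp: image_iff)
  ultimately have "A Mod carrier A \<cong> tensor_group A B" by simp
  moreover have "trivial_group (A Mod carrier A)"
  proof -
    have "carrier A #>\<^bsub>A\<^esub> x = carrier A" if "x \<in> carrier A" for x
      using A.coset_join2[OF that A.subgroup_self that] .
    then have "carrier (A Mod carrier A) = {carrier A}" using A.one_closed by (auto simp: carrier_FactGroup)
    moreover have "group (A Mod carrier A)"
      by (rule normal.factorgroup_is_group) (rule A.subgroup_imp_normal[OF A.subgroup_self])
    ultimately show ?thesis by (simp add: trivial_group_def)
  qed
  ultimately show ?thesis
    using g by (metis comm_group.axioms(2) isomorphic_group_triviality trivial_group_def)
qed

lemma tensor_group_mod_2: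
  assumes M: "addsub M"
  shows "Quot M ((\<lambda>x. x + x) ` M) \<cong> tensor_group (addgrp M) (integer_mod_group 2)"
proof -
  interpret A: comm_group "addgrp M" by (rule comm_group_addgrp[OF M])
  have pow2: "x [^]\<^bsub>addgrp M\<^esub> (2::int) = x + x" if "x \<in> M" for x
    using A.int_pow_mult[of x 1 1] that by simp
  have "carrier (integer_mod_group 2) = range (\<lambda>k::int. 1 [^]\<^bsub>integer_mod_group 2\<^esub> k)"
  proof -
    have "x \<in> range (\<lambda>k. k mod 2)" if "x \<in> {0..<2}" for x :: int
      using that by (intro rev_image_eqI[of x]) auto
    then show ?thesis by (auto simp: int_pow_integer_mod_group carrier_integer_mod_group)
  qed
  note car = this
  have ord: "1 [^]\<^bsub>integer_mod_group 2\<^esub> k = \<one>\<^bsub>integer_mod_group 2\<^esub> \<longleftrightarrow> 2 dvd k" for k :: int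
    by (simp add: int_pow_integer_mod_group mod_eq_0_iff_dvd)
  have one: "1 \<in> carrier (integer_mod_group 2)" by simp
  have "Quot M ((\<lambda>x. x [^]\<^bsub>addgrp M\<^esub> (2::int)) ` M) \<cong> tensor_group (addgrp M) (integer_mod_group 2)"
    using tensor_group_cyclic(1)[OF comm_group_addgrp[OF M] abelian_integer_mod_group one car ord]
    by (simp add: Quot_def)
  moreover have "(\<lambda>x. x [^]\<^bsub>addgrp M\<^esub> (2::int)) ` M = (\<lambda>x. x + x) ` M"
    by (rule image_cong) (simp_all add: pow2)
  ultimately show ?thesis by simp
qed

section \<open>Graded tensor products\<close>

text \<open>Outside the finite set \<open>J\<close> the identity is the only possible component, so
  the finite-support condition of the direct sum holds automatically.\<close>

lemma sum_group_iso:
  assumes g: "\<And>i. i \<in> I \<Longrightarrow> group (G i)" and J: "J \<subseteq> I" "finite J"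
    and triv: "\<And>i. i \<in> I - J \<Longrightarrow> trivial_group (G i)"
  shows "x \<in> carrier (sum_group I G) \<longleftrightarrow> x \<in> (\<Pi>\<^sub>E i\<in>I. carrier (G i)) \<and> (\<forall>i\<in>I - J. x i = \<one>\<^bsub>G i\<^esub>)"
proof -
  have "x i = \<one>\<^bsub>G i\<^esub>" if "x \<in> (\<Pi>\<^sub>E i\<in>I. carrier (G i))" "i \<in> I - J" for i
    using that triv[OF that(2)] by (auto simp: trivial_group_def PiE_iff)
  moreover have "finite {i \<in> I. x i \<noteq> \<one>\<^bsub>G i\<^esub>}" if "\<forall>i\<in>I - J. x i = \<one>\<^bsub>G i\<^esub>"
    by (rule finite_subset[OF _ J(2)]) (use that in auto)
  ultimately show ?thesis by (auto simp: carrier_sum_group[OF g])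
qed

lemma sum_group_one:
  assumes g: "\<And>i. i \<in> I \<Longrightarrow> group (G i)" and i: "i0 \<in> I"
    and triv: "\<And>i. i \<in> I - {i0} \<Longrightarrow> trivial_group (G i)"
  shows "sum_group I G \<cong> G i0"
proof (rule group_is_isoI[of "\<lambda>x. x i0"])
  have J: "{i0} \<subseteq> I" "finite {i0}" using i by auto
  have c: "x \<in> carrier (sum_group I G) \<longleftrightarrow> x \<in> (\<Pi>\<^sub>E i\<in>I. carrier (G i)) \<and> (\<forall>i\<in>I - {i0}. x i = \<one>\<^bsub>G i\<^esub>)" for x
    by (rule sum_group_iso[OF g J triv])
  show "(\<lambda>x. x i0) \<in> hom (sum_group I G) (G i0)"
    using i by (auto simp: hom_def c)
  show "inj_on (\<lambda>x. x i0) (carrier (sum_group I G))"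
  proof (rule inj_onI, rule ext)
    fix x y j assume "x \<in> carrier (sum_group I G)" "y \<in> carrier (sum_group I G)" and e: "x i0 = y i0"
    then have x: "x \<in> (\<Pi>\<^sub>E i\<in>I. carrier (G i))" "\<forall>i\<in>I - {i0}. x i = \<one>\<^bsub>G i\<^esub>"
      and y: "y \<in> (\<Pi>\<^sub>E i\<in>I. carrier (G i))" "\<forall>i\<in>I - {i0}. y i = \<one>\<^bsub>G i\<^esub>"
      using c by blast+
    consider "j \<notin> I" | "j = i0" | "j \<in> I - {i0}" by blast
    then show "x j = y j"
      using PiE_arb[OF x(1), of j] PiE_arb[OF y(1), of j] x(2) y(2) e by cases simp_all
  qed
  show "(\<lambda>x. x i0) ` carrier (sum_group I G) = carrier (G i0)"
  proof
    show "carrier (G i0) \<subseteq> (\<lambda>x. x i0) ` carrier (sum_group I G)"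
    proof
      fix a assume a: "a \<in> carrier (G i0)"
      let ?x = "\<lambda>i\<in>I. if i = i0 then a else \<one>\<^bsub>G i\<^esub>"
      have "?x \<in> carrier (sum_group I G)"
        using a i g by (auto simp: c group.is_monoid)
      moreover have "a = ?x i0" using i by simp
      ultimately show "a \<in> (\<lambda>x. x i0) ` carrier (sum_group I G)" by blast
    qed
  qed (use i in \<open>auto simp: c\<close>)
qed

lemma sum_group_two:
  assumes g: "\<And>i. i \<in> I \<Longrightarrow> group (G i)" and i: "i0 \<in> I" "i1 \<in> I" "i0 \<noteq> i1"
    and triv: "\<And>i. i \<in> I - {i0, i1} \<Longrightarrow> trivial_group (G i)"
  shows "sum_group I G \<cong> G i0 \<times>\<times> G i1"
proof (rule group_is_isoI[of "\<lambda>x. (x i0, x i1)"])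
  have J: "{i0, i1} \<subseteq> I" "finite {i0, i1}" using i by auto
  have c: "x \<in> carrier (sum_group I G) \<longleftrightarrow> x \<in> (\<Pi>\<^sub>E i\<in>I. carrier (G i)) \<and> (\<forall>i\<in>I - {i0, i1}. x i = \<one>\<^bsub>G i\<^esub>)" for x
    by (rule sum_group_iso[OF g J triv])
  show "(\<lambda>x. (x i0, x i1)) \<in> hom (sum_group I G) (G i0 \<times>\<times> G i1)"
    using i by (auto simp: hom_def c)
  show "inj_on (\<lambda>x. (x i0, x i1)) (carrier (sum_group I G))"
  proof (rule inj_onI, rule ext)
    fix x y j assume "x \<in> carrier (sum_group I G)" "y \<in> carrier (sum_group I G)"
      and e: "(x i0, x i1) = (y i0, y i1)"
    then have x: "x \<in> (\<Pi>\<^sub>E i\<in>I. carrier (G i))" "\<forall>i\<in>I - {i0, i1}. x i = \<one>\<^bsub>G i\<^esub>"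
      and y: "y \<in> (\<Pi>\<^sub>E i\<in>I. carrier (G i))" "\<forall>i\<in>I - {i0, i1}. y i = \<one>\<^bsub>G i\<^esub>"
      using c by blast+
    consider "j \<notin> I" | "j = i0" | "j = i1" | "j \<in> I - {i0, i1}" by blast
    then show "x j = y j"
      using PiE_arb[OF x(1), of j] PiE_arb[OF y(1), of j] x(2) y(2) e by cases simp_all
  qed
  show "(\<lambda>x. (x i0, x i1)) ` carrier (sum_group I G) = carrier (G i0 \<times>\<times> G i1)"
  proof
    show "carrier (G i0 \<times>\<times> G i1) \<subseteq> (\<lambda>x. (x i0, x i1)) ` carrier (sum_group I G)"
    proof
      fix ab assume ab: "ab \<in> carrier (G i0 \<times>\<times> G i1)"
      let ?x = "\<lambda>i\<in>I. if i = i0 then fst ab else if i = i1 then snd ab else \<one>\<^bsub>G i\<^esub>"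
      have "?x \<in> carrier (sum_group I G)"
        using ab i g by (auto simp: c group.is_monoid)
      moreover have "ab = (?x i0, ?x i1)" using i by simp
      ultimately show "ab \<in> (\<lambda>x. (x i0, x i1)) ` carrier (sum_group I G)" by blast
    qed
  qed (use i in \<open>auto simp: c\<close>)
qed

text \<open>\<open>B\<close> looks like the cohomology of a circle: in total degree k only the
  summands with j = 0 and j = 1 survive, and tensoring with the integers changes nothing.\<close>

lemma graded_tensor_exterior:
  assumes A: "\<And>i. comm_group (A i)" and B: "\<And>i. comm_group (B i)"
    and B0: "B 0 \<cong> integer_group" and B1: "B 1 \<cong> integer_group"
    and B2: "\<And>i. i \<ge> 2 \<Longrightarrow> trivial_group (B i)"
  shows "graded_tensor A B 0 \<cong> A 0" "graded_tensor A B (Suc k) \<cong> A (Suc k) \<times>\<times> A k"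
    "group (graded_tensor A B k)"
proof -
  let ?T = "\<lambda>(i, j). tensor_group (A i) (B j)"
  have T0: "tensor_group (A i) (B 0) \<cong> A i" and T1: "tensor_group (A i) (B 1) \<cong> A i" for i
    using tensor_group_integers[OF A] B0 B1 B comm_group.axioms(2) by blast+
  have T2: "trivial_group (tensor_group (A i) (B j))" if "j \<ge> 2" for i j
    by (rule tensor_group_trivial[OF A B2[OF that]])
  have g01: "group (tensor_group (A i) (B j))" if "j < 2" for i j
  proof -
    have Bj: "B j \<cong> integer_group" using that B0 B1 by (cases j) auto
    then obtain \<phi> where \<phi>: "\<phi> \<in> iso integer_group (B j)"
      using group.iso_sym[OF comm_group.axioms(2)[OF B] Bj] by (auto simp: is_iso_def)
    interpret \<phi>: group_hom integer_group "B j" \<phi>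
      using \<phi> comm_group.axioms(2)[OF B] by (simp add: group_hom_def group_hom_axioms_def iso_def)
    have pow: "\<phi> 1 [^]\<^bsub>B j\<^esub> (k::int) = \<phi> k" for k using \<phi>.hom_int_pow[of 1 k] by simp
    have bij: "bij_betw \<phi> UNIV (carrier (B j))" using \<phi> by (simp add: iso_def)
    have "comm_group (tensor_group (A i) (B j))"
    proof (rule tensor_group_cyclic(2)[OF A B, of "\<phi> 1" j 0])
      show "carrier (B j) = range (\<lambda>k::int. \<phi> 1 [^]\<^bsub>B j\<^esub> k)" unfolding pow using bij by (simp add: bij_betw_def)
      show "\<phi> 1 [^]\<^bsub>B j\<^esub> k = \<one>\<^bsub>B j\<^esub> \<longleftrightarrow> 0 dvd k" for k :: int
        unfolding pow using bij \<phi>.hom_one by (auto simp: bij_betw_def inj_on_def)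
    qed simp
    then show ?thesis by (rule comm_group.axioms(2))
  qed
  have g: "group (tensor_group (A i) (B j))" for i j
    using g01 T2 by (cases "j < 2") (auto simp: trivial_group_def)
  show "group (graded_tensor A B k)"
    unfolding graded_tensor_def by (rule sum_group) (use g in auto)
  have "sum_group {(i, j). i + j = 0} ?T \<cong> ?T (0, 0)"
    by (rule sum_group_one) (use g in auto)
  then show "graded_tensor A B 0 \<cong> A 0" using T0 unfolding graded_tensor_def by (auto intro: iso_trans)
  have "sum_group {(i, j). i + j = Suc k} ?T \<cong> ?T (Suc k, 0) \<times>\<times> ?T (k, 1)"
  proof (rule sum_group_two)
    fix x assume "x \<in> {(i, j). i + j = Suc k} - {(Suc k, 0), (k, 1)}"
    moreover obtain i j where x: "x = (i, j)" by (cases x)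
    ultimately have "i + j = Suc k" "(i, j) \<noteq> (Suc k, 0)" "(i, j) \<noteq> (k, 1)" by auto
    then have "j \<ge> 2" by (cases "j = 0"; cases "j = 1") auto
    then show "trivial_group (?T x)" using T2[of j i] x by simp
  qed (use g in auto)
  moreover have "?T (Suc k, 0) \<times>\<times> ?T (k, 1) \<cong> A (Suc k) \<times>\<times> A k"
    using T0[of "Suc k"] T1[of k] by (auto intro: group.DirProd_iso_trans simp: g)
  ultimately show "graded_tensor A B (Suc k) \<cong> A (Suc k) \<times>\<times> A k"
    unfolding graded_tensor_def by (rule iso_trans)
qed

section \<open>The braid group on three strands\<close>

interpretation B3: group B3 by (rule group_B3)

declare B3_simps(2,3) [simp del]

abbreviation bmul :: "braid3 \<Rightarrow> braid3 \<Rightarrow> braid3" (infixr "\<star>" 70) where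
  "x \<star> y \<equiv> x \<otimes>\<^bsub>B3\<^esub> y"

definition sg :: "artin_gen \<Rightarrow> braid3" where "sg g = abs_braid3 [(g, True)]"

text \<open>\<open>bA\<close> is the Garside half twist and \<open>bz\<close> the full twist. In
  terms of \<open>bA\<close> and \<open>bB\<close> the braid relation becomes bA^2 = bB^3, both
  sides being the central element \<open>bz\<close>.\<close>

definition bA :: braid3 where "bA = sg Sigma1 \<star> sg Sigma2 \<star> sg Sigma1"
definition bB :: braid3 where "bB = sg Sigma1 \<star> sg Sigma2"
definition bz :: braid3 where "bz = bA \<star> bA"

lemma abs_braid3_append: "abs_braid3 (u @ v) = abs_braid3 u \<star> abs_braid3 v"
  by (simp add: B3_simps braid_mult.abs_eq)

lemma abs_braid3_Nil: "abs_braid3 [] = \<one>\<^bsub>B3\<^esub>"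
  by (simp add: B3_simps braid_one_def)

lemma abs_braid3_inverse_letter: "abs_braid3 [(g, False)] = inv\<^bsub>B3\<^esub> (sg g)"
proof -
  have "abs_braid3 [(g, False)] \<star> sg g = \<one>\<^bsub>B3\<^esub>"
    unfolding sg_def abs_braid3_append[symmetric] abs_braid3_Nil[symmetric]
    using braid_eq.cancel[of g False] by (simp add: braid3.abs_eq_iff)
  then show ?thesis by (metis B3.inv_equality B3_simps(1))
qed

lemma subgroup_B3_full:
  assumes K: "subgroup K B3" and s: "sg Sigma1 \<in> K" "sg Sigma2 \<in> K"
  shows "x \<in> K"
proof -
  have "abs_braid3 w \<in> K" for w
  proof (induction w)
    case Nil
    then show ?case using subgroup.one_closed[OF K] by (simp add: abs_braid3_Nil)
  next
    case (Cons l w)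
    obtain g e where l: "l = (g, e)" by (cases l)
    have "sg g \<in> K" using s by (cases g) auto
    then have "abs_braid3 [l] \<in> K"
      using subgroup.m_inv_closed[OF K] by (cases e) (simp_all add: l abs_braid3_inverse_letter, simp add: sg_def)
    then show ?case
      using abs_braid3_append[of "[l]" w] subgroup.m_closed[OF K] Cons by simp
  qed
  then show ?thesis by (metis Quotient3_abs_rep Quotient3_braid3)
qed

lemma braid_relation: "sg Sigma1 \<star> sg Sigma2 \<star> sg Sigma1 = sg Sigma2 \<star> sg Sigma1 \<star> sg Sigma2"
  unfolding sg_def abs_braid3_append[symmetric]
  using braid_eq.braid by (simp add: braid3.abs_eq_iff)

lemma bB3: "bB \<star> bB \<star> bB = bz"
proof -
  have "bB \<star> bB \<star> bB = (sg Sigma1 \<star> sg Sigma2 \<star> sg Sigma1) \<star> (sg Sigma2 \<star> sg Sigma1 \<star> sg Sigma2)"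
    by (simp add: bB_def B3.m_assoc)
  then show ?thesis by (simp add: braid_relation[symmetric] bz_def bA_def)
qed

lemma sg_AB: "bB \<star> sg Sigma1 = bA" "sg Sigma2 \<star> bB = bA"
  by (simp_all add: bA_def bB_def B3.m_assoc, simp add: braid_relation)

lemma bz_commute: "bA \<star> bz = bz \<star> bA" "bB \<star> bz = bz \<star> bB"
proof -
  show "bA \<star> bz = bz \<star> bA" by (simp add: bz_def B3.m_assoc)
  show "bB \<star> bz = bz \<star> bB" by (simp add: bB3[symmetric] B3.m_assoc)
qed

lemma bz_inv_commute: "bA \<star> inv\<^bsub>B3\<^esub> bz = inv\<^bsub>B3\<^esub> bz \<star> bA" "bB \<star> inv\<^bsub>B3\<^esub> bz = inv\<^bsub>B3\<^esub> bz \<star> bB"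
  using B3.commute_int_pow[of bA bz "-1"] B3.commute_int_pow[of bB bz "-1"]
  by (simp_all add: bz_commute B3.int_pow_neg)

text \<open>A rewriting system for right-nested products: \<open>bz\<close> and its inverse move to
  the left past \<open>bA\<close> and \<open>bB\<close>, and squares of \<open>bA\<close> and cubes
  of \<open>bB\<close> become \<open>bz\<close>. Each rule has a variant with a tail
  \<open>x\<close>.\<close>

lemma braid_rewrite:
  "bA \<star> bA = bz" "bA \<star> (bA \<star> x) = bz \<star> x" "bB \<star> (bB \<star> bB) = bz" "bB \<star> (bB \<star> (bB \<star> x)) = bz \<star> x"
  "bA \<star> bz = bz \<star> bA" "bA \<star> (bz \<star> x) = bz \<star> (bA \<star> x)" "bB \<star> bz = bz \<star> bB"
  "bB \<star> (bz \<star> x) = bz \<star> (bB \<star> x)"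
  "bA \<star> inv\<^bsub>B3\<^esub> bz = inv\<^bsub>B3\<^esub> bz \<star> bA" "bA \<star> (inv\<^bsub>B3\<^esub> bz \<star> x) = inv\<^bsub>B3\<^esub> bz \<star> (bA \<star> x)"
  "bB \<star> inv\<^bsub>B3\<^esub> bz = inv\<^bsub>B3\<^esub> bz \<star> bB" "bB \<star> (inv\<^bsub>B3\<^esub> bz \<star> x) = inv\<^bsub>B3\<^esub> bz \<star> (bB \<star> x)"
  "bz \<star> (inv\<^bsub>B3\<^esub> bz \<star> x) = x" "inv\<^bsub>B3\<^esub> bz \<star> (bz \<star> x) = x"
proof -
  have r: "u \<star> v = w \<Longrightarrow> u \<star> (v \<star> x) = w \<star> x" for u v w x
    using B3.m_assoc[of u v x] by simp
  have r': "u \<star> v = w \<star> y \<Longrightarrow> u \<star> (v \<star> x) = w \<star> (y \<star> x)" for u v w x y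
    using B3.m_assoc[of u v x] B3.m_assoc[of w y x] by simp
  show "bA \<star> bA = bz" by (simp add: bz_def)
  then show "bA \<star> (bA \<star> x) = bz \<star> x" by (rule r)
  show "bB \<star> (bB \<star> bB) = bz" by (rule bB3)
  then show "bB \<star> (bB \<star> (bB \<star> x)) = bz \<star> x" by (simp add: bB3[symmetric] B3.m_assoc)
  show "bA \<star> bz = bz \<star> bA" "bB \<star> bz = bz \<star> bB" by (rule bz_commute)+
  then show "bA \<star> (bz \<star> x) = bz \<star> (bA \<star> x)" "bB \<star> (bz \<star> x) = bz \<star> (bB \<star> x)"
    by (auto intro: r')
  show "bA \<star> inv\<^bsub>B3\<^esub> bz = inv\<^bsub>B3\<^esub> bz \<star> bA" "bB \<star> inv\<^bsub>B3\<^esub> bz = inv\<^bsub>B3\<^esub> bz \<star> bB"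
    by (rule bz_inv_commute)+
  then show "bA \<star> (inv\<^bsub>B3\<^esub> bz \<star> x) = inv\<^bsub>B3\<^esub> bz \<star> (bA \<star> x)"
    "bB \<star> (inv\<^bsub>B3\<^esub> bz \<star> x) = inv\<^bsub>B3\<^esub> bz \<star> (bB \<star> x)"
    by (auto intro: r')
  show "bz \<star> (inv\<^bsub>B3\<^esub> bz \<star> x) = x" "inv\<^bsub>B3\<^esub> bz \<star> (bz \<star> x) = x"
    using B3.m_assoc[of bz "inv\<^bsub>B3\<^esub> bz" x] B3.m_assoc[of "inv\<^bsub>B3\<^esub> bz" bz x] by simp_all
qed

lemma subgroup_B3_full_AB:
  assumes K: "subgroup K B3" and s: "bA \<in> K" "bB \<in> K"
  shows "x \<in> K"
proof (rule subgroup_B3_full[OF K])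
  have "sg Sigma1 = inv\<^bsub>B3\<^esub> bB \<star> bA" using sg_AB(1) by (metis B3.inv_solve_left B3_simps(1))
  then show "sg Sigma1 \<in> K" using s subgroup.m_closed[OF K] subgroup.m_inv_closed[OF K] by simp
  have "sg Sigma2 = bA \<star> inv\<^bsub>B3\<^esub> bB" using sg_AB(2) by (metis B3.inv_solve_right B3_simps(1))
  then show "sg Sigma2 \<in> K" using s subgroup.m_closed[OF K] subgroup.m_inv_closed[OF K] by simp
qed

lemma bz_central: "x \<star> bz = bz \<star> x"
proof -
  have "subgroup {x. x \<star> bz = bz \<star> x} B3"
  proof (rule B3.subgroupI)
    show "inv\<^bsub>B3\<^esub> x \<in> {x. x \<star> bz = bz \<star> x}" if "x \<in> {x. x \<star> bz = bz \<star> x}" for x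
      using that B3.commute_int_pow[of bz x "-1"] by (simp add: B3.int_pow_neg)
    show "x \<star> y \<in> {x. x \<star> bz = bz \<star> x}" if "x \<in> {x. x \<star> bz = bz \<star> x}" "y \<in> {x. x \<star> bz = bz \<star> x}" for x y
      using that by simp (metis B3.m_assoc B3_simps(1))
  qed (auto intro: exI[of _ bA] bz_commute)
  from subgroup_B3_full_AB[OF this, of x] show ?thesis by (simp add: bz_commute)
qed

lemma B3_induct_AB:
  assumes "P \<one>\<^bsub>B3\<^esub>" and A: "\<And>x. P x \<Longrightarrow> P (bA \<star> x)" and B: "\<And>x. P x \<Longrightarrow> P (bB \<star> x)"
    and z: "\<And>x. P x \<Longrightarrow> P (inv\<^bsub>B3\<^esub> bz \<star> x)"
  shows "P x"
proof -
  let ?K = "{g. \<forall>x. P x \<longrightarrow> P (g \<star> x) \<and> P (inv\<^bsub>B3\<^esub> g \<star> x)}"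
  have K: "subgroup ?K B3"
  proof (rule B3.subgroupI)
    show "?K \<noteq> {}" by (auto intro!: exI[of _ "\<one>\<^bsub>B3\<^esub>"])
    show "g \<star> h \<in> ?K" if "g \<in> ?K" "h \<in> ?K" for g h
      using that by (auto simp: B3.m_assoc B3.inv_mult_group)
  qed auto
  have iA: "inv\<^bsub>B3\<^esub> bA \<star> x = inv\<^bsub>B3\<^esub> bz \<star> (bA \<star> x)" for x
  proof -
    have "inv\<^bsub>B3\<^esub> bA = inv\<^bsub>B3\<^esub> bz \<star> bA"
      by (rule B3.inv_equality) (simp_all add: B3.m_assoc braid_rewrite)
    then show ?thesis by (simp add: B3.m_assoc)
  qed
  have iB: "inv\<^bsub>B3\<^esub> bB \<star> x = inv\<^bsub>B3\<^esub> bz \<star> (bB \<star> (bB \<star> x))" for x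
  proof -
    have "inv\<^bsub>B3\<^esub> bB = inv\<^bsub>B3\<^esub> bz \<star> (bB \<star> bB)"
      by (rule B3.inv_equality) (simp_all add: B3.m_assoc braid_rewrite)
    then show ?thesis by (simp add: B3.m_assoc)
  qed
  have "bA \<in> ?K" "bB \<in> ?K" by (simp_all add: iA iB A B z)
  then have "x \<in> ?K" by (rule subgroup_B3_full_AB[OF K])
  then have "P (x \<star> \<one>\<^bsub>B3\<^esub>)" using assms(1) by blast
  then show ?thesis by simp
qed

text \<open>In a group with a^2 = b^3, the elements b^(-1) a and a b^(-1) play the role of the Artin
  generators: the first identity says that their product is b, the others recover a from b and one
  generator on either side.\<close>

lemma (in group) conj_cube:
  assumes a: "a \<in> carrier G" and b: "b \<in> carrier G" and ab: "a \<otimes> a = b \<otimes> b \<otimes> b"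
  shows "inv b \<otimes> a \<otimes> (a \<otimes> inv b) = b" "b \<otimes> (inv b \<otimes> a) = a" "a \<otimes> inv b \<otimes> b = a"
proof -
  have "inv b \<otimes> a \<otimes> (a \<otimes> inv b) = inv b \<otimes> (a \<otimes> a) \<otimes> inv b" using a b by (simp add: m_assoc)
  also have "\<dots> = inv b \<otimes> (b \<otimes> (b \<otimes> (b \<otimes> inv b)))" unfolding ab using a b by (simp add: m_assoc)
  also have "\<dots> = b" using b by (simp add: m_assoc[symmetric])
  finally show "inv b \<otimes> a \<otimes> (a \<otimes> inv b) = b" .
  show "b \<otimes> (inv b \<otimes> a) = a" using a b by (simp add: m_assoc[symmetric])
  show "a \<otimes> inv b \<otimes> b = a" using a b by (simp add: m_assoc)
qed

text \<open>The universal property of the presentation with generators a, b and the relation a^2 =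
  b^3. Words are evaluated with sigma_1 = b^(-1) a and sigma_2 = a b^(-1), for which both sides of
  the braid relation equal a.\<close>

lemma B3_universal:
  assumes W: "group W" and a: "a \<in> carrier W" and b: "b \<in> carrier W"
    and ab: "a \<otimes>\<^bsub>W\<^esub> a = b \<otimes>\<^bsub>W\<^esub> b \<otimes>\<^bsub>W\<^esub> b"
  obtains f where "f \<in> hom B3 W" "f bA = a" "f bB = b"
proof -
  interpret W: group W by (rule W)
  define gen where "gen g = (case g of Sigma1 \<Rightarrow> inv\<^bsub>W\<^esub> b \<otimes>\<^bsub>W\<^esub> a | Sigma2 \<Rightarrow> a \<otimes>\<^bsub>W\<^esub> inv\<^bsub>W\<^esub> b)" for g
  define let1 where "let1 l = (if snd l then gen (fst l) else inv\<^bsub>W\<^esub> gen (fst l))" for l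
  define wd where "wd w = foldr (\<lambda>l x. let1 l \<otimes>\<^bsub>W\<^esub> x) w \<one>\<^bsub>W\<^esub>" for w
  have gen: "gen g \<in> carrier W" for g using a b by (cases g) (auto simp: gen_def)
  have let1: "let1 l \<in> carrier W" for l by (simp add: let1_def gen)
  have wd: "wd w \<in> carrier W" for w by (induction w) (simp_all add: wd_def let1)
  have app: "wd (u @ v) = wd u \<otimes>\<^bsub>W\<^esub> wd v" for u v
    by (induction u) (use wd let1 in \<open>simp_all add: wd_def W.m_assoc\<close>)
  note cc = W.conj_cube[OF a b ab]
  have resp: "wd u = wd v" if "braid_eq u v" for u v
    using that
  proof induction
    case (cancel g e)
    show ?case by (cases e) (simp_all add: wd_def let1_def gen)
  next
    case braid
    have "gen Sigma1 \<otimes>\<^bsub>W\<^esub> gen Sigma2 = b" using cc by (simp add: gen_def)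
    then have 1: "gen Sigma1 \<otimes>\<^bsub>W\<^esub> gen Sigma2 \<otimes>\<^bsub>W\<^esub> gen Sigma1 = a"
      and 2: "gen Sigma2 \<otimes>\<^bsub>W\<^esub> (gen Sigma1 \<otimes>\<^bsub>W\<^esub> gen Sigma2) = a"
      using cc by (simp_all add: gen_def)
    then show ?case using gen by (simp add: wd_def let1_def W.m_assoc)
  qed (simp_all add: app)
  define f where "f x = wd (rep_braid3 x)" for x
  have fabs: "f (abs_braid3 w) = wd w" for w
    unfolding f_def by (rule resp) (metis braid3.abs_eq_iff Quotient3_abs_rep Quotient3_braid3)
  have hom: "f (x \<star> y) = f x \<otimes>\<^bsub>W\<^esub> f y" for x y
  proof -
    obtain u v where "x = abs_braid3 u" "y = abs_braid3 v" by (metis Quotient3_abs_rep Quotient3_braid3)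
    then show ?thesis by (simp add: abs_braid3_append[symmetric] fabs app)
  qed
  have fsg: "f (sg g) = gen g" for g
    by (simp add: sg_def fabs) (simp add: wd_def let1_def gen)
  have fB: "f bB = b" using cc by (simp add: bB_def hom fsg gen_def)
  have fA: "f bA = a" using cc fB hom[of bB "sg Sigma1"] by (simp add: sg_AB fsg gen_def)
  show ?thesis
    by (rule that[OF _ fA fB]) (unfold hom_def, auto simp: hom, simp add: f_def wd)
qed

section \<open>The homomorphism to the modular group\<close>

interpretation SL2: group SL2Z by (rule group_SL2Z)

interpretation lam: group_hom B3 SL2Z lam
  by (simp add: group_hom_def group_hom_axioms_def lam_hom group_B3 group_SL2Z)

lemma lam_mult [simp]: "lam (x \<star> y) = lam x ** lam y"
  using lam.hom_mult[of x y] by simp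

lemma det_lam: "det (lam x) = 1"
  using lam.hom_closed[of x] by simp

lemma lam_one [simp]: "lam \<one>\<^bsub>B3\<^esub> = mat 1"
  using lam.hom_one by simp

lemma lam_sg: "lam (sg g) = gen_matrix g"
  by (simp add: sg_def lam.abs_eq)

lemma mat_1_eq: "(mat 1 :: int^2^2) = mat2 1 0 0 1"
  by (rule mat2_eqI) (simp_all add: mat_def)

lemma mat2_mult: "mat2 a b c d ** mat2 a' b' c' d' =
    mat2 (a * a' + b * c') (a * b' + b * d') (c * a' + d * c') (c * b' + d * d')"
  by (rule mat2_eqI) (simp_all add: matrix_mult_nth_2)

lemma mat2_iff: "mat2 a b c d = mat2 a' b' c' d' \<longleftrightarrow> a = a' \<and> b = b' \<and> c = c' \<and> d = d'"
  by (metis mat2_nth)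

lemma mat2_surj: "mat2 (M$1$1) (M$1$2) (M$2$1) (M$2$2) = M"
  by (rule mat2_eqI) simp_all

lemma det_mat2: "det (mat2 a b c d) = a * d - b * c"
  by (simp add: det_2)

lemma lam_AB: "lam bA = mat2 0 1 (-1) 0" "lam bB = mat2 1 1 (-1) 0" "lam bz = mat2 (-1) 0 0 (-1)"
  by (simp_all add: bA_def bB_def bz_def lam_sg mat2_mult)

lemma lam_inv_bz: "lam (inv\<^bsub>B3\<^esub> bz) = mat2 (-1) 0 0 (-1)"
proof -
  have "lam (inv\<^bsub>B3\<^esub> bz) = inv\<^bsub>SL2Z\<^esub> (lam bz)" by (rule lam.hom_inv) simp
  also have "\<dots> = mat2 (-1) 0 0 (-1)"
    by (rule SL2.inv_equality) (simp_all add: lam_AB mat2_mult mat_1_eq det_mat2)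
  finally show ?thesis .
qed

lemma lam_bz_pow: "lam (bz [^]\<^bsub>B3\<^esub> (k::int)) = (if even k then mat 1 else mat2 (-1) 0 0 (-1))"
proof (induction k rule: int_induct[where k = 0])
  case (step1 i)
  then show ?case
    using B3.int_pow_mult[of bz i 1] by (auto simp: lam_AB mat2_mult mat_1_eq)
next
  case (step2 i)
  then show ?case
    using B3.int_pow_mult[of bz i "-1"] by (auto simp: lam_inv_bz mat2_mult mat_1_eq B3.int_pow_neg)
qed simp

text \<open>
  \<open>\<sigma>\<^sub>1\<^sup>-\<^sup>1 = z\<^sup>-\<^sup>1ab\<close> and \<open>\<sigma>\<^sub>2 = ab\<^sup>-\<^sup>1\<close> are mapped to the elementary matrices with non-negative entries.
\<close>

inductive_set posb :: "braid3 set" where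
  one: "\<one>\<^bsub>B3\<^esub> \<in> posb"
| L: "p \<in> posb \<Longrightarrow> inv\<^bsub>B3\<^esub> bz \<star> bA \<star> bB \<star> p \<in> posb"
| U: "p \<in> posb \<Longrightarrow> inv\<^bsub>B3\<^esub> bz \<star> bA \<star> bB \<star> bB \<star> p \<in> posb"

text \<open>The two blocks are sent to the lower and upper elementary matrices. Multiplication by
  either keeps the diagonal at least 1 and creates a positive off-diagonal entry that never
  disappears, which separates nontrivial positive words from 1.\<close>

lemma lam_posb:
  assumes "p \<in> posb"
  shows "\<exists>a b c d. lam p = mat2 a b c d \<and> a \<ge> 1 \<and> d \<ge> 1 \<and> b \<ge> 0 \<and> c \<ge> 0 \<and> (p = \<one>\<^bsub>B3\<^esub> \<or> b + c \<ge> 1)"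
  using assms
proof induction
  case one
  then show ?case by (simp add: mat_1_eq mat2_iff)
next
  case (L p)
  then obtain a b c d where "lam p = mat2 a b c d" "a \<ge> 1" "d \<ge> 1" "b \<ge> 0" "c \<ge> 0" by blast
  then show ?case by (simp add: lam_inv_bz lam_AB mat2_mult mat2_iff)
next
  case (U p)
  then obtain a b c d where "lam p = mat2 a b c d" "a \<ge> 1" "d \<ge> 1" "b \<ge> 0" "c \<ge> 0" by blast
  then show ?case by (simp add: lam_inv_bz lam_AB mat2_mult mat2_iff)
qed

text \<open>Modulo the powers of \<open>bz\<close> an element is an alternating word in
  \<open>bA\<close> and the powers of \<open>bB\<close>. Such a word is cut into an initial power
  \<open>e\<close> of \<open>bB\<close>, blocks bA bB or bA bB^2 forming \<open>p\<close>, and a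
  possible final \<open>bA\<close>. Left multiplication by \<open>bA\<close> either opens a new
  block or cancels the \<open>bA\<close> of the first one at the cost of a
  \<open>bz\<close>.\<close>

lemma braid_normal_form:
  "\<exists>k::int. \<exists>e\<in>{\<one>\<^bsub>B3\<^esub>, bB, bB \<star> bB}. \<exists>p\<in>posb. \<exists>f\<in>{\<one>\<^bsub>B3\<^esub>, bA}. x = bz [^]\<^bsub>B3\<^esub> k \<star> e \<star> p \<star> f"
proof (induction x rule: B3_induct_AB)
  case 1
  show ?case
    by (intro exI[of _ 0] bexI[of _ "\<one>\<^bsub>B3\<^esub>"]) (auto intro: posb.intros)
next
  case (2 x)
  then obtain k :: int and e p f where x: "x = bz [^]\<^bsub>B3\<^esub> k \<star> e \<star> p \<star> f"
    and e: "e \<in> {\<one>\<^bsub>B3\<^esub>, bB, bB \<star> bB}" and p: "p \<in> posb" and f: "f \<in> {\<one>\<^bsub>B3\<^esub>, bA}" by blast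
  have zk: "bA \<star> (bz [^]\<^bsub>B3\<^esub> j \<star> y) = bz [^]\<^bsub>B3\<^esub> j \<star> (bA \<star> y)" for j :: int and y
    using B3.commute_int_pow[of bA bz j] bz_commute B3.m_assoc[of bA "bz [^]\<^bsub>B3\<^esub> j" y]
      B3.m_assoc[of "bz [^]\<^bsub>B3\<^esub> j" bA y] by simp
  have zk0: "bA \<star> bz [^]\<^bsub>B3\<^esub> j = bz [^]\<^bsub>B3\<^esub> j \<star> bA" for j :: int
    using B3.commute_int_pow[of bA bz j] bz_commute by simp
  have zs: "bz [^]\<^bsub>B3\<^esub> (j + 1) \<star> y = bz [^]\<^bsub>B3\<^esub> j \<star> (bz \<star> y)" for j :: int and y
    by (simp add: B3.int_pow_mult B3.m_assoc)
  from e consider "e = \<one>\<^bsub>B3\<^esub>" | "e = bB" | "e = bB \<star> bB" by blast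
  then show ?case
  proof cases
    case 1
    from p show ?thesis
    proof cases
      case one
      from f consider "f = \<one>\<^bsub>B3\<^esub>" | "f = bA" by blast
      then show ?thesis
      proof cases
        assume "f = \<one>\<^bsub>B3\<^esub>"
        then have "bA \<star> x = bz [^]\<^bsub>B3\<^esub> k \<star> \<one>\<^bsub>B3\<^esub> \<star> \<one>\<^bsub>B3\<^esub> \<star> bA"
          by (simp add: x 1 one zk zk0)
        then show ?thesis using posb.one by blast
      next
        assume "f = bA"
        then have "bA \<star> x = bz [^]\<^bsub>B3\<^esub> (k + 1) \<star> \<one>\<^bsub>B3\<^esub> \<star> \<one>\<^bsub>B3\<^esub> \<star> \<one>\<^bsub>B3\<^esub>"
          by (simp add: x 1 one zk zk0 B3.int_pow_mult braid_rewrite)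
        then show ?thesis using posb.one by blast
      qed
    next
      case (L p')
      have "bA \<star> x = bz [^]\<^bsub>B3\<^esub> k \<star> bB \<star> p' \<star> f"
        by (simp add: x 1 L zk braid_rewrite B3.m_assoc)
      then show ?thesis using L(2) f by blast
    next
      case (U p')
      have "bA \<star> x = bz [^]\<^bsub>B3\<^esub> k \<star> (bB \<star> bB) \<star> p' \<star> f"
        by (simp add: x 1 U zk braid_rewrite B3.m_assoc)
      then show ?thesis using U(2) f by blast
    qed
  next
    case 2
    have "bA \<star> x = bz [^]\<^bsub>B3\<^esub> (k + 1) \<star> \<one>\<^bsub>B3\<^esub> \<star> (inv\<^bsub>B3\<^esub> bz \<star> bA \<star> bB \<star> p) \<star> f"
      by (simp add: x 2 zk zs braid_rewrite B3.m_assoc)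
    then show ?thesis using posb.L[OF p] f by blast
  next
    case 3
    have "bA \<star> x = bz [^]\<^bsub>B3\<^esub> (k + 1) \<star> \<one>\<^bsub>B3\<^esub> \<star> (inv\<^bsub>B3\<^esub> bz \<star> bA \<star> bB \<star> bB \<star> p) \<star> f"
      by (simp add: x 3 zk zs braid_rewrite B3.m_assoc)
    then show ?thesis using posb.U[OF p] f by blast
  qed
next
  case (3 x)
  then obtain k :: int and e p f where x: "x = bz [^]\<^bsub>B3\<^esub> k \<star> e \<star> p \<star> f"
    and e: "e \<in> {\<one>\<^bsub>B3\<^esub>, bB, bB \<star> bB}" and p: "p \<in> posb" and f: "f \<in> {\<one>\<^bsub>B3\<^esub>, bA}" by blast
  have zk: "bB \<star> (bz [^]\<^bsub>B3\<^esub> j \<star> y) = bz [^]\<^bsub>B3\<^esub> j \<star> (bB \<star> y)" for j :: int and y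
    using B3.commute_int_pow[of bB bz j] bz_commute B3.m_assoc[of bB "bz [^]\<^bsub>B3\<^esub> j" y]
      B3.m_assoc[of "bz [^]\<^bsub>B3\<^esub> j" bB y] by simp
  from e consider "e = \<one>\<^bsub>B3\<^esub>" | "e = bB" | "e = bB \<star> bB" by blast
  then show ?case
  proof cases
    case 1
    have "bB \<star> x = bz [^]\<^bsub>B3\<^esub> k \<star> bB \<star> p \<star> f" by (simp add: x 1 zk)
    then show ?thesis using p f by blast
  next
    case 2
    have "bB \<star> x = bz [^]\<^bsub>B3\<^esub> k \<star> (bB \<star> bB) \<star> p \<star> f" by (simp add: x 2 zk B3.m_assoc)
    then show ?thesis using p f by blast
  next
    case 3
    have "bB \<star> x = bz [^]\<^bsub>B3\<^esub> (k + 1) \<star> \<one>\<^bsub>B3\<^esub> \<star> p \<star> f"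
      by (simp add: x 3 zk B3.m_assoc braid_rewrite B3.int_pow_mult)
    then show ?thesis using p f by blast
  qed
next
  case (4 x)
  then obtain k :: int and e p f where x: "x = bz [^]\<^bsub>B3\<^esub> k \<star> e \<star> p \<star> f"
    and e: "e \<in> {\<one>\<^bsub>B3\<^esub>, bB, bB \<star> bB}" and p: "p \<in> posb" and f: "f \<in> {\<one>\<^bsub>B3\<^esub>, bA}" by blast
  have "inv\<^bsub>B3\<^esub> bz \<star> x = bz [^]\<^bsub>B3\<^esub> (-1 + k) \<star> e \<star> p \<star> f"
    using B3.int_pow_mult[of bz "-1" k] by (simp add: x B3.int_pow_neg B3.m_assoc)
  then show ?case using e p f by blast
qed

section \<open>Kernel and image of \<lambda>\<close>

lemma kernel_lam:
  assumes "lam x = mat 1"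
  obtains k :: int where "x = (bz \<star> bz) [^]\<^bsub>B3\<^esub> k"
proof -
  obtain k :: int and e p f where x: "x = bz [^]\<^bsub>B3\<^esub> k \<star> e \<star> p \<star> f"
    and e: "e \<in> {\<one>\<^bsub>B3\<^esub>, bB, bB \<star> bB}" and p: "p \<in> posb" and f: "f \<in> {\<one>\<^bsub>B3\<^esub>, bA}"
    using braid_normal_form[of x] by blast
  obtain a b c d where m: "lam p = mat2 a b c d" "a \<ge> 1" "d \<ge> 1" "b \<ge> 0" "c \<ge> 0"
    "p = \<one>\<^bsub>B3\<^esub> \<or> b + c \<ge> 1" using lam_posb[OF p] by blast
  \<comment> \<open>If \<open>e\<close> or \<open>f\<close> is nontrivial, some off-diagonal entry
    of the image is, up to sign, a sum of entries of \<open>p\<close> including a diagonal one,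
    hence nonzero. Otherwise \<plusminus>\<open>lam p\<close> is the identity, which forces the sign
    and \<open>p\<close>.\<close>
  have "e = \<one>\<^bsub>B3\<^esub> \<and> f = \<one>\<^bsub>B3\<^esub> \<and> p = \<one>\<^bsub>B3\<^esub> \<and> even k"
    using e f m assms unfolding x
    by (auto simp: lam_bz_pow lam_AB mat2_mult mat_1_eq mat2_iff split: if_splits)
  then obtain j where j: "k = 2 * j" "x = bz [^]\<^bsub>B3\<^esub> k" using x by (auto elim!: evenE)
  have "bz \<star> bz = bz [^]\<^bsub>B3\<^esub> (2::int)" using B3.int_pow_mult[of bz 1 1] by simp
  then have "(bz \<star> bz) [^]\<^bsub>B3\<^esub> j = x" using B3.int_pow_pow[of bz 2 j] j by (simp add: mult.commute)
  then show ?thesis using that by blast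
qed

lemma lam_surj:
  assumes "det M = 1"
  shows "\<exists>x. lam x = M"
proof -
  have U: "lam (sg Sigma2 [^]\<^bsub>B3\<^esub> (n::int)) = mat2 1 n 0 1" for n
  proof (induction n rule: int_induct[where k = 0])
    case base
    then show ?case by (simp add: mat_1_eq)
  next
    case (step1 i)
    then show ?case using B3.int_pow_mult[of "sg Sigma2" i 1] by (simp add: lam_sg mat2_mult add.commute)
  next
    case (step2 i)
    have "lam (inv\<^bsub>B3\<^esub> sg Sigma2) = mat2 1 (-1) 0 1"
      using lam.hom_inv[of "sg Sigma2"]
      by (simp add: lam_sg, subst SL2.inv_equality[of "mat2 1 (-1) 0 1"])
        (simp_all add: mat2_mult mat_1_eq det_mat2)
    then show ?case using step2 B3.int_pow_mult[of "sg Sigma2" i "-1"]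
      by (simp add: mat2_mult B3.int_pow_neg)
  qed
  have "\<exists>x. lam x = mat2 a b c d" if "a * d - b * c = 1" for a b c d
    using that
  proof (induction "nat \<bar>c\<bar>" arbitrary: a b c d rule: less_induct)
    case less
    show ?case
    proof (cases "c = 0")
      case True
      then have "a * d = 1" using less by simp
      then consider "a = 1" "d = 1" | "a = -1" "d = -1" by (auto simp: zmult_eq_1_iff)
      then show ?thesis
      proof cases
        case 1
        then show ?thesis using U[of b] True by auto
      next
        case 2
        then have "lam (bz \<star> sg Sigma2 [^]\<^bsub>B3\<^esub> (- b)) = mat2 a b c d"
          using True by (simp only: lam_mult U lam_AB mat2_mult) simp
        then show ?thesis by blast
      qed
    next
      case False
      \<comment> \<open>A step of the Euclidean algorithm in the first column: adding n times the
        second row to the first replaces a by its remainder modulo c, and bz bA, a rotation by a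
        quarter turn, exchanges the two rows up to sign.\<close>
      define n where "n = - (a div c)"
      define r where "r = a mod c"
      have r: "a + n * c = r" by (simp add: n_def r_def minus_div_mult_eq_mod)
      have "\<bar>r\<bar> < \<bar>c\<bar>" using False by (simp add: r_def abs_mod_less)
      then have "nat \<bar>- r\<bar> < nat \<bar>c\<bar>" by simp
      moreover have "c * (- (b + n * d)) - d * (- r) = 1"
        using less.prems r by (auto simp: algebra_simps)
      ultimately obtain x where x: "lam x = mat2 c d (- r) (- (b + n * d))"
        using less.hyps[of "- r" c "- (b + n * d)" d] by auto
      have "lam (sg Sigma2 [^]\<^bsub>B3\<^esub> (- n) \<star> bz \<star> bA \<star> x) = mat2 a b c d"
        using r by (simp only: lam_mult U lam_AB mat2_mult x) (auto simp: mat2_iff algebra_simps)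
      then show ?thesis by blast
    qed
  qed
  then show ?thesis using assms mat2_surj[of M] by (metis det_2)
qed

section \<open>Congruence subgroups and their preimages\<close>

lemma mod_mult_sum:
  fixes a b x y m :: int
  shows "(a * (x mod m) + b * (y mod m)) mod m = (a * x + b * y) mod m"
    "((x mod m) * a + (y mod m) * b) mod m = (x * a + y * b) mod m"
  by (metis mod_add_eq mod_mult_right_eq, metis mod_add_eq mod_mult_left_eq)

lemma mat_mod_mult_right: "mat_mod m (A ** mat_mod m B) = mat_mod m (A ** B)"
  by (rule mat2_eqI) (simp_all add: mat_mod_def matrix_mult_nth_2 mod_mult_sum)

lemma mat_mod_mult_left: "mat_mod m (mat_mod m A ** B) = mat_mod m (A ** B)"
  by (rule mat2_eqI) (simp_all add: mat_mod_def matrix_mult_nth_2 mod_mult_sum)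

lemma mat_mod_idem [simp]: "mat_mod m (mat_mod m A) = mat_mod m A"
  by (rule mat2_eqI) (simp_all add: mat_mod_def)

lemma carrier_Gamma: "A \<in> carrier (Gamma m) \<longleftrightarrow> det A = 1 \<and> mat_mod m A = mat_mod m (mat 1)"
  by (auto simp: Gamma_def kernel_def SL2_mod_def)

lemma Gamma_ops [simp]: "A \<otimes>\<^bsub>Gamma m\<^esub> B = A ** B" "\<one>\<^bsub>Gamma m\<^esub> = mat 1"
  by (simp_all add: Gamma_def)

lemma subgroup_Gamma: "subgroup (carrier (Gamma m)) SL2Z"
proof (rule SL2.subgroupI)
  show "carrier (Gamma m) \<noteq> {}" using carrier_Gamma[of "mat 1" m] by auto
  show "inv\<^bsub>SL2Z\<^esub> A \<in> carrier (Gamma m)" if "A \<in> carrier (Gamma m)" for A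
  proof -
    have A: "det A = 1" "mat_mod m A = mat_mod m (mat 1)" using that by (auto simp: carrier_Gamma)
    have i: "det (inv\<^bsub>SL2Z\<^esub> A) = 1" "A ** inv\<^bsub>SL2Z\<^esub> A = mat 1"
      using SL2.inv_closed[of A] SL2.r_inv[of A] A by simp_all
    have "mat_mod m (inv\<^bsub>SL2Z\<^esub> A) = mat_mod m (mat_mod m A ** inv\<^bsub>SL2Z\<^esub> A)"
      unfolding A(2) mat_mod_mult_left by simp
    then show ?thesis using i by (simp add: mat_mod_mult_left carrier_Gamma)
  qed
  show "A \<otimes>\<^bsub>SL2Z\<^esub> B \<in> carrier (Gamma m)" if "A \<in> carrier (Gamma m)" "B \<in> carrier (Gamma m)" for A B
  proof -
    have "mat_mod m (A ** B) = mat_mod m (mat_mod m A ** mat_mod m B)"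
      by (simp add: mat_mod_mult_left mat_mod_mult_right)
    also have "\<dots> = mat_mod m (mat 1)" using that by (simp add: carrier_Gamma mat_mod_mult_left mat_mod_mult_right)
    finally show ?thesis using that by (simp add: carrier_Gamma det_mul)
  qed
qed (simp add: carrier_Gamma subset_iff)

lemma group_Gamma: "group (Gamma m)"
  using SL2.subgroup_imp_group[OF subgroup_Gamma] by (simp add: Gamma_def)

lemma carrier_B_Gamma: "x \<in> carrier (B_Gamma m) \<longleftrightarrow> lam x \<in> carrier (Gamma m)"
  by (simp add: B_Gamma_def)

lemma B_Gamma_ops [simp]: "x \<otimes>\<^bsub>B_Gamma m\<^esub> y = x \<star> y" "\<one>\<^bsub>B_Gamma m\<^esub> = \<one>\<^bsub>B3\<^esub>"
  by (simp_all add: B_Gamma_def)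

lemma subgroup_B_Gamma: "subgroup (carrier (B_Gamma m)) B3"
proof (rule B3.subgroupI)
  show "carrier (B_Gamma m) \<noteq> {}"
    using subgroup.one_closed[OF subgroup_Gamma, of m] carrier_B_Gamma[of "\<one>\<^bsub>B3\<^esub>" m] by auto
  show "inv\<^bsub>B3\<^esub> x \<in> carrier (B_Gamma m)" if "x \<in> carrier (B_Gamma m)" for x
    using subgroup.m_inv_closed[OF subgroup_Gamma] that lam.hom_inv[of x] by (simp add: carrier_B_Gamma)
  show "x \<star> y \<in> carrier (B_Gamma m)" if "x \<in> carrier (B_Gamma m)" "y \<in> carrier (B_Gamma m)" for x y
    using subgroup.m_closed[OF subgroup_Gamma] that by (simp add: carrier_B_Gamma)
qed auto

lemma group_B_Gamma: "group (B_Gamma m)"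
  using B3.subgroup_imp_group[OF subgroup_B_Gamma] by (simp add: B_Gamma_def)

section \<open>The retraction onto the center for level \<open>m > 2\<close>\<close>

text \<open>Used when f^2 or f^3 is already known to be a bijection h: then f or its square serves
  as an inverse of f up to h, on both sides.\<close>

lemma bij_betwI_comp:
  assumes "f \<in> S \<rightarrow> S" "g \<in> S \<rightarrow> S" "bij_betw h S S" "\<And>x. x \<in> S \<Longrightarrow> g (f x) = h x"
    "\<And>x. x \<in> S \<Longrightarrow> f (g x) = h x"
  shows "bij_betw f S S"
proof (rule bij_betw_imageI)
  show "inj_on f S"
    by (rule inj_onI) (metis assms(3,4) bij_betw_imp_inj_on inj_onD)
  show "f ` S = S"
  proof
    show "S \<subseteq> f ` S"
    proof
      fix y assume "y \<in> S"
      then obtain x where x: "x \<in> S" "h x = y" using assms(3) by (metis bij_betw_imp_surj_on imageE)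
      then show "y \<in> f ` S" using assms(2,5) by (metis PiE image_eqI)
    qed
  qed (use assms(1) in auto)
qed

text \<open>\<open>B3_universal\<close> for the group of bijections of \<open>S\<close>; it turns
  two maps satisfying one pointwise identity into an action of the whole braid group.\<close>

lemma B3_action:
  assumes a: "bij_betw fa S S" and b: "bij_betw fb S S"
    and ab: "\<And>s. s \<in> S \<Longrightarrow> fa (fa s) = fb (fb (fb s))"
  obtains act where "\<And>g s. s \<in> S \<Longrightarrow> act g s \<in> S"
    "\<And>g h s. s \<in> S \<Longrightarrow> act (g \<star> h) s = act g (act h s)" "\<And>s. s \<in> S \<Longrightarrow> act \<one>\<^bsub>B3\<^esub> s = s"
    "\<And>s. s \<in> S \<Longrightarrow> act bA s = fa s" "\<And>s. s \<in> S \<Longrightarrow> act bB s = fb s"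
proof -
  interpret W: group "BijGroup S" by (rule group_BijGroup)
  have maps: "fa s \<in> S" "fb s \<in> S" if "s \<in> S" for s
    using a b that by (auto simp: bij_betw_def)
  have ra: "restrict fa S \<in> carrier (BijGroup S)" and rb: "restrict fb S \<in> carrier (BijGroup S)"
    using a b by (auto simp: BijGroup_def Bij_def bij_betw_restrict_eq)
  have mult: "f \<otimes>\<^bsub>BijGroup S\<^esub> g = compose S f g"
    if "f \<in> carrier (BijGroup S)" "g \<in> carrier (BijGroup S)" for f g
    using that by (simp add: BijGroup_def)
  have "restrict fa S \<otimes>\<^bsub>BijGroup S\<^esub> restrict fa S =
      restrict fb S \<otimes>\<^bsub>BijGroup S\<^esub> restrict fb S \<otimes>\<^bsub>BijGroup S\<^esub> restrict fb S"
    unfolding mult[OF ra ra] mult[OF rb rb] mult[OF W.m_closed[OF rb rb, unfolded mult[OF rb rb]] rb]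
    using maps ab by (auto simp: compose_def fun_eq_iff)
  from B3_universal[OF W.is_group ra rb this]
  obtain F where F: "F \<in> hom B3 (BijGroup S)" "F bA = restrict fa S" "F bB = restrict fb S" by blast
  have Fc: "F g \<in> carrier (BijGroup S)" for g using F(1) by (simp add: hom_def Pi_def)
  then have FS: "F g s \<in> S" if "s \<in> S" for g s
    using that by (auto simp: BijGroup_def Bij_def bij_betw_def)
  show ?thesis
  proof (rule that[of F])
    show "F (g \<star> h) s = F g (F h s)" if "s \<in> S" for g h s
      using F(1) that by (simp add: hom_def mult Fc compose_def)
    show "F \<one>\<^bsub>B3\<^esub> s = s" if "s \<in> S" for s
      using hom_one[OF F(1) group_B3 W.is_group] that by (simp add: BijGroup_def)
  qed (use F FS in auto)
qed

lemma mat_mod_2x2: "mat_mod m (mat2 a b c d) = mat2 (a mod m) (b mod m) (c mod m) (d mod m)"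
  by (rule mat2_eqI) (simp_all add: mat_mod_def)

locale level_gt_2 =
  fixes m :: int
  assumes m: "m > 2"
begin

text \<open>Written as the image of reduction, so that every point has an integral lift of
  determinant 1; \<open>mul_cancel\<close> cancels such a lift.\<close>

definition "XX = mat_mod m ` {M. det M = 1}"
definition "mul g x = mat_mod m (lam g ** x)"

lemma mul_XX: "x \<in> XX \<Longrightarrow> mul g x \<in> XX"
proof -
  assume "x \<in> XX"
  then obtain M where M: "det M = 1" "x = mat_mod m M" by (auto simp: XX_def)
  have "mul g x = mat_mod m (lam g ** M)" by (simp add: mul_def M mat_mod_mult_right)
  moreover have "det (lam g ** M) = 1" by (simp add: det_mul det_lam M)
  ultimately show ?thesis by (auto simp: XX_def)
qed

lemma mul_mul: "mul g (mul h x) = mul (g \<star> h) x"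
  by (simp add: mul_def mat_mod_mult_right matrix_mul_assoc)

lemma mul_one: "x \<in> XX \<Longrightarrow> mul \<one>\<^bsub>B3\<^esub> x = x"
  by (auto simp: XX_def mul_def)

lemma mul_cancel: "x \<in> XX \<Longrightarrow> mul g x = mul h x \<Longrightarrow> mat_mod m (lam g) = mat_mod m (lam h)"
proof -
  assume x: "x \<in> XX" and e: "mul g x = mul h x"
  obtain M where M: "x = mat_mod m M" "det M = 1" using x by (auto simp: XX_def)
  have i: "M ** inv\<^bsub>SL2Z\<^esub> M = mat 1" using SL2.r_inv[of M] M by simp
  have "mat_mod m (lam g ** M) = mat_mod m (lam h ** M)"
    using e by (simp add: mul_def M mat_mod_mult_right)
  then have "mat_mod m (mat_mod m (lam g ** M) ** inv\<^bsub>SL2Z\<^esub> M) = mat_mod m (mat_mod m (lam h ** M) ** inv\<^bsub>SL2Z\<^esub> M)"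
    by simp
  then show ?thesis by (simp add: mat_mod_mult_left matrix_mul_assoc[symmetric] i)
qed

definition "orb x = (\<lambda>i. mul (bB [^]\<^bsub>B3\<^esub> i) x) ` {..<6::nat}"
definition "rep x = (SOME y. y \<in> orb x)"
text \<open>The indicator of one chosen point in each orbit of \<open>bB\<close>. The shift
  accumulated along a full orbit is therefore 1.\<close>

definition "vv x = (if x = rep x then 1 else 0 :: int)"
definition "ww x = vv x + vv (mul bB x) + vv (mul (bB \<star> bB) x)"
text \<open>A solution of u(x) + u(ax) = w(x). As a^2 acts as -1 and w(-x) = 1 - w(x), the sum of
  the two products is w(x)(1 - w(ax)) + w(ax)w(x).\<close>

definition "uu x = ww x * (1 - ww (mul bA x))"

lemma lam_bB_pow:
  "map (\<lambda>i. lam (bB [^]\<^bsub>B3\<^esub> (i::nat))) [0..<6] =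
    [mat2 1 0 0 1, mat2 1 1 (-1) 0, mat2 0 1 (-1) (-1), mat2 (-1) 0 0 (-1), mat2 (-1) (-1) 1 0, mat2 0 (-1) 1 1]"
  by (simp add: upt_rec numeral_eq_Suc lam_AB mat2_mult mat_1_eq)

lemma bB_pow_mod: "mul (bB [^]\<^bsub>B3\<^esub> (i::nat)) x = mul (bB [^]\<^bsub>B3\<^esub> (i mod 6)) x" if "x \<in> XX"
proof -
  have six: "bB [^]\<^bsub>B3\<^esub> (6::nat) = bz \<star> bz"
    by (simp add: numeral_eq_Suc B3.m_assoc braid_rewrite)
  have "lam (bz \<star> bz) = mat 1" by (simp add: lam_AB mat2_mult mat_1_eq)
  then have "lam ((bB [^]\<^bsub>B3\<^esub> (6::nat)) [^]\<^bsub>B3\<^esub> (j::nat)) = mat 1" for j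
    by (induction j) (simp_all add: six)
  then have "lam (bB [^]\<^bsub>B3\<^esub> (6 * j)) = mat 1" for j :: nat
    using B3.nat_pow_pow[of bB 6 j] by (metis B3_simps(1))
  then have "lam (bB [^]\<^bsub>B3\<^esub> (6 * (i div 6) + i mod 6)) = lam (bB [^]\<^bsub>B3\<^esub> (i mod 6))"
    using B3.nat_pow_mult[of bB "6 * (i div 6)" "i mod 6"] by (metis B3_simps(1) lam_mult matrix_mul_lid)
  then show ?thesis by (simp add: mul_def)
qed

text \<open>\<open>lam bB\<close> has order 6, and its six powers have entries 0, 1 and -1, which
  are pairwise distinct residues because m > 2. For m = 2 its cube -1 would become the
  identity.\<close>

lemma free_orbit:
  assumes "x \<in> XX" "i < 6" "j < 6" "mul (bB [^]\<^bsub>B3\<^esub> (i::nat)) x = mul (bB [^]\<^bsub>B3\<^esub> (j::nat)) x"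
  shows "i = j"
proof -
  have nth: "lam (bB [^]\<^bsub>B3\<^esub> i) = [mat2 1 0 0 1, mat2 1 1 (-1) 0, mat2 0 1 (-1) (-1),
      mat2 (-1) 0 0 (-1), mat2 (-1) (-1) 1 0, mat2 0 (-1) 1 1] ! i" if "i < 6" for i :: nat
    unfolding lam_bB_pow[symmetric] using that by simp
  have cases6: "i = 0 \<or> i = 1 \<or> i = 2 \<or> i = 3 \<or> i = 4 \<or> i = 5" if "i < 6" for i :: nat using that by auto
  have mm: "1 mod m = 1" "0 mod m = 0" "(-1) mod m = m - 1"
    using m by (simp_all add: zmod_minus1)
  have "mat_mod m (lam (bB [^]\<^bsub>B3\<^esub> i)) = mat_mod m (lam (bB [^]\<^bsub>B3\<^esub> j))"
    by (rule mul_cancel[OF assms(1,4)])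
  then show ?thesis
    unfolding nth[OF assms(2)] nth[OF assms(3)]
    using cases6[OF assms(2)] cases6[OF assms(3)] m
    by (elim disjE) (simp_all add: mat_mod_2x2 mat2_iff mm)
qed

lemma orb_mul: "x \<in> XX \<Longrightarrow> orb (mul bB x) = orb x"
proof -
  assume x: "x \<in> XX"
  have e: "mul (bB [^]\<^bsub>B3\<^esub> i) (mul bB x) = mul (bB [^]\<^bsub>B3\<^esub> (Suc i mod 6)) x" for i :: nat
    using bB_pow_mod[OF x, of "Suc i"] by (simp add: mul_mul)
  have s: "(\<lambda>i. Suc i mod 6) ` {..<6} = {..<6}"
  proof
    show "{..<6} \<subseteq> (\<lambda>i. Suc i mod 6) ` {..<6}"
    proof
      fix j :: nat assume "j \<in> {..<6}"
      then have "j = Suc ((j + 5) mod 6) mod 6" "(j + 5) mod 6 \<in> {..<6}" by (auto simp: mod_Suc_eq)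
      then show "j \<in> (\<lambda>i. Suc i mod 6) ` {..<6}" by blast
    qed
  qed auto
  have "orb (mul bB x) = (\<lambda>i. mul (bB [^]\<^bsub>B3\<^esub> i) x) ` ((\<lambda>i. Suc i mod 6) ` {..<6})"
    by (simp add: orb_def e image_image)
  then show ?thesis unfolding s by (simp add: orb_def)
qed

lemma vv_sum:
  assumes x: "x \<in> XX"
  shows "(\<Sum>i<6. vv (mul (bB [^]\<^bsub>B3\<^esub> (i::nat)) x)) = 1"
proof -
  have o: "orb (mul (bB [^]\<^bsub>B3\<^esub> i) x) = orb x" for i :: nat
  proof (induction i)
    case 0
    then show ?case by (simp add: mul_one x)
  next
    case (Suc i)
    have "mul (bB [^]\<^bsub>B3\<^esub> Suc i) x = mul bB (mul (bB [^]\<^bsub>B3\<^esub> i) x)"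
      unfolding mul_mul using B3.nat_pow_Suc2[of bB i] by simp
    then show ?case using orb_mul[OF mul_XX[OF x]] Suc by simp
  qed
  have r: "rep (mul (bB [^]\<^bsub>B3\<^esub> i) x) = rep x" for i :: nat by (simp add: rep_def o)
  have "rep x \<in> orb x" unfolding rep_def
    by (rule someI[of _ "mul (bB [^]\<^bsub>B3\<^esub> (0::nat)) x"]) (unfold orb_def, rule imageI, simp)
  then obtain i :: nat where i: "i < 6" "rep x = mul (bB [^]\<^bsub>B3\<^esub> i) x" by (auto simp: orb_def)
  have "vv (mul (bB [^]\<^bsub>B3\<^esub> j) x) = (if j = i then 1 else 0)" if "j < 6" for j
    unfolding vv_def r using i free_orbit[OF x that i(1)] by auto
  then have "(\<Sum>j<6::nat. vv (mul (bB [^]\<^bsub>B3\<^esub> j) x)) = (\<Sum>j<6::nat. if j = i then 1 else 0)"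
    by (intro sum.cong) auto
  then show ?thesis using i by simp
qed

lemma ww_antisym: "x \<in> XX \<Longrightarrow> ww x + ww (mul bz x) = 1"
  using vv_sum[of x]
  by (simp add: ww_def numeral_eq_Suc mul_mul mul_one B3.m_assoc braid_rewrite bz_central)

text \<open>
  \<open>b\<close> and \<open>a\<close> act on \<open>SL\<^sub>2(\<int>/m) \<times> \<int>\<close> over their action on the first factor, shifting the second
  one by \<open>v\<close> and \<open>u\<close>.  The two conditions \<open>v(x) + v(bx) + v(b\<^sup>2x) = w(x) = u(x) + u(ax)\<close> and
  \<open>w(x) + w(-x) = 1\<close> say that this is an action of \<open>B\<^sub>3\<close> for which the kernel of \<open>\<lambda>\<close> shifts by one.
\<close>

lemma retraction:
  obtains \<rho> where "\<rho> \<in> hom (B_Gamma m) integer_group" "\<rho> (bz \<star> bz) = 1"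
proof -
  define S where "S = XX \<times> (UNIV :: int set)"
  define fb where "fb = (\<lambda>(x, k). (mul bB x, k + vv x))"
  define fa where "fa = (\<lambda>(x, k). (mul bA x, k + uu x))"
  define sh where "sh = (\<lambda>(x, k). (mul bz x, k + ww x))"
  have u: "uu x + uu (mul bA x) = ww x" if "x \<in> XX" for x
  proof -
    have "mul bA (mul bA x) = mul bz x" by (simp add: mul_mul braid_rewrite)
    then have "uu x + uu (mul bA x) = ww x * (1 - ww (mul bA x)) + ww (mul bA x) * (1 - ww (mul bz x))"
      by (simp add: uu_def)
    also have "1 - ww (mul bz x) = ww x" using ww_antisym[OF that] by simp
    finally show ?thesis by (simp add: algebra_simps)
  qed
  have S: "fa \<in> S \<rightarrow> S" "fb \<in> S \<rightarrow> S" "sh \<in> S \<rightarrow> S"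
    by (auto simp: S_def fa_def fb_def sh_def mul_XX)
  have faa: "fa (fa s) = sh s" if "s \<in> S" for s
    using that u by (auto simp: S_def fa_def sh_def mul_mul braid_rewrite)
  have fbb: "fb (fb (fb s)) = sh s" if "s \<in> S" for s
    using that by (auto simp: S_def fb_def sh_def mul_mul braid_rewrite ww_def)
  have shsh: "sh (sh (x, k)) = (x, k + 1)" if "x \<in> XX" for x k
  proof -
    have "mul bz (mul bz x) = x"
    proof -
      have "lam (bz \<star> bz) = mat 1" by (simp add: lam_AB mat2_mult mat_1_eq)
      then show ?thesis using mul_one[OF that] unfolding mul_mul by (simp only: mul_def lam_one)
    qed
    then show ?thesis using ww_antisym[OF that] by (simp add: sh_def)
  qed
  have shb: "bij_betw sh S S"
  proof (rule bij_betwI_comp[OF S(3) S(3)])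
    show "bij_betw (\<lambda>(x, k). (x, k + 1)) S S"
      by (rule bij_betwI[where g = "\<lambda>(x, k). (x, k - 1)"]) (auto simp: S_def)
  qed (auto simp: S_def shsh)
  have ba: "bij_betw fa S S" by (rule bij_betwI_comp[OF S(1) S(1) shb faa faa])
  have bb: "bij_betw fb S S"
  proof (rule bij_betwI_comp[OF S(2) _ shb])
    show "fb \<circ> fb \<in> S \<rightarrow> S" using funcset_mem[OF S(2)] by (simp add: Pi_def)
  qed (simp_all add: fbb)
  have ab: "fa (fa s) = fb (fb (fb s))" if "s \<in> S" for s
    using that by (simp add: faa fbb)
  obtain act where act: "\<And>g s. s \<in> S \<Longrightarrow> act g s \<in> S"
    "\<And>g h s. s \<in> S \<Longrightarrow> act (g \<star> h) s = act g (act h s)" "\<And>s. s \<in> S \<Longrightarrow> act \<one>\<^bsub>B3\<^esub> s = s"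
    "\<And>s. s \<in> S \<Longrightarrow> act bA s = fa s" "\<And>s. s \<in> S \<Longrightarrow> act bB s = fb s"
    using B3_action[OF ba bb ab] by blast
  \<comment> \<open>The braids that act over \<open>mul\<close> by shifts depending on the first
    coordinate alone. They form a subgroup containing \<open>bA\<close> and \<open>bB\<close>, so
    every braid acts in this way.\<close>
  let ?K = "{g. \<forall>x\<in>XX. \<exists>c. \<forall>k. act g (x, k) = (mul g x, k + c)}"
  have "subgroup ?K B3"
  proof (rule B3.subgroupI)
    have "\<one>\<^bsub>B3\<^esub> \<in> ?K" using act(3) by (auto simp: S_def mul_one intro: exI[of _ 0])
    then show "?K \<noteq> {}" by blast
    show "g \<star> h \<in> ?K" if "g \<in> ?K" "h \<in> ?K" for g h
    proof (clarify)
      fix x assume x: "x \<in> XX"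
      obtain c where c: "\<And>k. act h (x, k) = (mul h x, k + c)" using \<open>h \<in> ?K\<close> x by blast
      obtain d where d: "\<And>k. act g (mul h x, k) = (mul g (mul h x), k + d)"
        using \<open>g \<in> ?K\<close> mul_XX[OF x] by blast
      have "act (g \<star> h) (x, k) = (mul (g \<star> h) x, k + (c + d))" for k
        using act(2)[of "(x, k)" g h] x c d by (simp add: S_def mul_mul)
      then show "\<exists>c. \<forall>k. act (g \<star> h) (x, k) = (mul (g \<star> h) x, k + c)" by blast
    qed
    show "inv\<^bsub>B3\<^esub> g \<in> ?K" if "g \<in> ?K" for g
    proof (clarify)
      fix x assume x: "x \<in> XX"
      let ?y = "mul (inv\<^bsub>B3\<^esub> g) x"
      have y: "?y \<in> XX" by (rule mul_XX[OF x])
      have gy: "mul g ?y = x" using mul_one[OF x] by (simp add: mul_mul)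
      obtain c where c: "\<And>k. act g (?y, k) = (x, k + c)" using \<open>g \<in> ?K\<close> y gy by auto
      have "act (inv\<^bsub>B3\<^esub> g) (x, k) = (?y, k + (- c))" for k
      proof -
        have s: "(?y, k - c) \<in> S" using y by (simp add: S_def)
        have "act (inv\<^bsub>B3\<^esub> g) (x, k) = act (inv\<^bsub>B3\<^esub> g) (act g (?y, k - c))" by (simp add: c)
        also have "\<dots> = (?y, k - c)" using act(2)[OF s, of "inv\<^bsub>B3\<^esub> g" g] act(3)[OF s] by simp
        finally show ?thesis by simp
      qed
      then show "\<exists>c. \<forall>k. act (inv\<^bsub>B3\<^esub> g) (x, k) = (?y, k + c)" by blast
    qed
  qed auto
  moreover have "bA \<in> ?K" "bB \<in> ?K"
    using act(4,5) by (auto simp: S_def fa_def fb_def)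
  ultimately have K: "g \<in> ?K" for g by (rule subgroup_B3_full_AB)
  define e where "e = mat_mod m (mat 1)"
  have e: "e \<in> XX" by (auto simp: e_def XX_def)
  \<comment> \<open>The preimage of \<Gamma>(m) fixes the class \<open>e\<close> of the identity
    matrix, so on the fibre over \<open>e\<close> it acts by translations; \<rho> is the translation
    length.\<close>
  define \<rho> where "\<rho> g = snd (act g (e, 0))" for g
  have mule: "mul g e = e" if "g \<in> carrier (B_Gamma m)" for g
    using that by (simp add: mul_def e_def mat_mod_mult_right carrier_B_Gamma carrier_Gamma)
  have acte: "act g (e, k) = (e, k + \<rho> g)" if "g \<in> carrier (B_Gamma m)" for g k
  proof -
    obtain c where "\<And>k. act g (e, k) = (mul g e, k + c)" using K[of g] e by blast
    then show ?thesis by (simp add: \<rho>_def mule[OF that])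
  qed
  have "\<rho> (g \<star> h) = \<rho> g + \<rho> h" if "g \<in> carrier (B_Gamma m)" "h \<in> carrier (B_Gamma m)" for g h
    using act(2)[of "(e, 0)" g h] e acte[OF that(1)] acte[OF that(2)]
    unfolding \<rho>_def[of "g \<star> h"] by (simp add: S_def)
  then have 1: "\<rho> \<in> hom (B_Gamma m) integer_group" by (simp add: hom_def)
  have actz: "act bz s = sh s" if "s \<in> S" for s
    using act(2)[OF that, of bA bA] act(4)[OF that] act(4)[OF funcset_mem[OF S(1) that]] faa[OF that]
    by (simp add: braid_rewrite)
  have e0: "(e, 0) \<in> S" using e by (simp add: S_def)
  have "act (bz \<star> bz) (e, 0) = (e, 1)"
    using act(2)[OF e0, of bz bz] actz[OF e0] actz[OF funcset_mem[OF S(3) e0]] shsh[OF e, of 0] by simp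
  then have "\<rho> (bz \<star> bz) = 1" by (simp add: \<rho>_def)
  then show ?thesis using that 1 by blast
qed

end

section \<open>The pure braid group\<close>

text \<open>\<open>ba\<close> is sigma_1^(-2) and \<open>bb\<close> is sigma_2^2: the squares of the
  two blocks of \<open>posb\<close>, written in \<open>bA\<close>, \<open>bB\<close> and
  \<open>bz\<close>.\<close>

definition ba :: braid3 where "ba = inv\<^bsub>B3\<^esub> bz \<star> inv\<^bsub>B3\<^esub> bz \<star> bA \<star> bB \<star> bA \<star> bB"
definition bb :: braid3 where "bb = inv\<^bsub>B3\<^esub> bz \<star> inv\<^bsub>B3\<^esub> bz \<star> bA \<star> bB \<star> bB \<star> bA \<star> bB \<star> bB"

lemma lam_ba_bb: "lam ba = mat2 1 0 2 1" "lam bb = mat2 1 2 0 1"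
  by (simp_all add: ba_def bb_def lam_inv_bz lam_AB mat2_mult)

lemma P3_mem: "ba \<in> carrier (B_Gamma 2)" "bb \<in> carrier (B_Gamma 2)" "bz \<in> carrier (B_Gamma 2)"
  by (simp_all add: carrier_B_Gamma carrier_Gamma lam_ba_bb lam_AB det_mat2 mat_mod_2x2 mat_1_eq)

text \<open>The products of \<open>bA\<close> with bB and bB^2, rewritten as a coset representative
  times an element of the pure braid group; \<open>ba\<close> and \<open>bb\<close> are the Schreier
  generators that appear.\<close>

lemma braid_coset_relations:
  "bA \<star> bB = bB \<star> bB \<star> bA \<star> ba" "bA \<star> bB \<star> bB = bB \<star> bA \<star> bb"
  by (simp_all add: ba_def bb_def braid_rewrite)

text \<open>Reidemeister-Schreier: the union of the cosets r K, for six representatives r and the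
  subgroup K generated by \<open>ba\<close>, \<open>bb\<close>, \<open>bz\<close>, is stable under
  left multiplication by \<open>bA\<close>, \<open>bB\<close> and the inverse of \<open>bz\<close>,
  hence is the whole braid group.\<close>

lemma P3_generate:
  assumes K: "subgroup K B3" and g: "ba \<in> K" "bb \<in> K" "bz \<in> K" and x: "x \<in> carrier (B_Gamma 2)"
  shows "x \<in> K"
proof -
  let ?K = "generate B3 {ba, bb, bz}"
  have sK: "subgroup ?K B3" by (rule B3.generate_is_subgroup) simp
  note mc = subgroup.m_closed[OF sK] and ic = subgroup.m_inv_closed[OF sK]
  have gK: "ba \<in> ?K" "bb \<in> ?K" "bz \<in> ?K" by (auto intro: generate.incl)
  have "\<exists>r\<in>{\<one>\<^bsub>B3\<^esub>, bB, bB \<star> bB, bA, bB \<star> bA, bB \<star> bB \<star> bA}. \<exists>k\<in>?K. x = r \<star> k"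
  proof (induction x rule: B3_induct_AB)
    case 1
    then show ?case using subgroup.one_closed[OF sK] by auto
  next
    case (2 x)
    have "(bA \<star> bB) \<star> inv\<^bsub>B3\<^esub> ba = bB \<star> bB \<star> bA"
      unfolding braid_coset_relations(1) by (simp add: B3.m_assoc)
    then have rev1: "bB \<star> bB \<star> bA = bA \<star> bB \<star> inv\<^bsub>B3\<^esub> ba" by (simp add: B3.m_assoc)
    have "(bA \<star> bB \<star> bB) \<star> inv\<^bsub>B3\<^esub> bb = bB \<star> bA"
      unfolding braid_coset_relations(2) by (simp add: B3.m_assoc)
    then have rev2: "bB \<star> bA = bA \<star> bB \<star> bB \<star> inv\<^bsub>B3\<^esub> bb" by (simp add: B3.m_assoc)
    from 2 obtain r k where x: "x = r \<star> k" and k: "k \<in> ?K"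
      and r: "r \<in> {\<one>\<^bsub>B3\<^esub>, bB, bB \<star> bB, bA, bB \<star> bA, bB \<star> bB \<star> bA}" by blast
    from r consider "r = \<one>\<^bsub>B3\<^esub>" | "r = bB" | "r = bB \<star> bB" | "r = bA" | "r = bB \<star> bA" | "r = bB \<star> bB \<star> bA" by blast
    then show ?case
    proof cases
      case 1
      then have "bA \<star> x = bA \<star> k" by (simp add: x)
      then show ?thesis using k by blast
    next
      case 2
      then have "bA \<star> x = (bA \<star> bB) \<star> k" by (simp add: x B3.m_assoc)
      then have "bA \<star> x = (bB \<star> bB \<star> bA) \<star> (ba \<star> k)"
        unfolding braid_coset_relations by (simp add: B3.m_assoc)
      then show ?thesis using mc[OF gK(1) k] by blast
    next
      case 3
      then have "bA \<star> x = (bA \<star> bB \<star> bB) \<star> k" by (simp add: x B3.m_assoc)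
      then have "bA \<star> x = (bB \<star> bA) \<star> (bb \<star> k)"
        unfolding braid_coset_relations by (simp add: B3.m_assoc)
      then show ?thesis using mc[OF gK(2) k] by blast
    next
      case 4
      then have "bA \<star> x = \<one>\<^bsub>B3\<^esub> \<star> (bz \<star> k)" by (simp add: x B3.m_assoc braid_rewrite)
      then show ?thesis using mc[OF gK(3) k] by blast
    next
      case 5
      then have "bA \<star> x = bA \<star> (bA \<star> bB \<star> bB \<star> inv\<^bsub>B3\<^esub> bb) \<star> k" unfolding rev2[symmetric] by (simp add: x B3.m_assoc)
      also have "\<dots> = (bB \<star> bB) \<star> (bz \<star> inv\<^bsub>B3\<^esub> bb \<star> k)" by (simp add: B3.m_assoc braid_rewrite)
      finally show ?thesis using mc[OF gK(3) mc[OF ic[OF gK(2)] k]] by blast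
    next
      case 6
      then have "bA \<star> x = bA \<star> (bA \<star> bB \<star> inv\<^bsub>B3\<^esub> ba) \<star> k" unfolding rev1[symmetric] by (simp add: x B3.m_assoc)
      also have "\<dots> = bB \<star> (bz \<star> inv\<^bsub>B3\<^esub> ba \<star> k)" by (simp add: B3.m_assoc braid_rewrite)
      finally show ?thesis using mc[OF gK(3) mc[OF ic[OF gK(1)] k]] by blast
    qed
  next
    case (3 x)
    then obtain r k where x: "x = r \<star> k" and k: "k \<in> ?K"
      and r: "r \<in> {\<one>\<^bsub>B3\<^esub>, bB, bB \<star> bB, bA, bB \<star> bA, bB \<star> bB \<star> bA}" by blast
    have zk: "bz \<star> k \<in> ?K" by (rule mc[OF gK(3) k])
    from r consider "r = \<one>\<^bsub>B3\<^esub>" | "r = bB" | "r = bB \<star> bB" | "r = bA" | "r = bB \<star> bA" | "r = bB \<star> bB \<star> bA" by blast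
    then show ?case
    proof cases
      case 1
      then have "bB \<star> x = bB \<star> k" by (simp add: x)
      then show ?thesis using k by blast
    next
      case 2
      then have "bB \<star> x = (bB \<star> bB) \<star> k" by (simp add: x B3.m_assoc)
      then show ?thesis using k by blast
    next
      case 3
      then have "bB \<star> x = \<one>\<^bsub>B3\<^esub> \<star> (bz \<star> k)" by (simp add: x B3.m_assoc braid_rewrite)
      then show ?thesis using zk by blast
    next
      case 4
      then have "bB \<star> x = (bB \<star> bA) \<star> k" by (simp add: x B3.m_assoc)
      then show ?thesis using k by blast
    next
      case 5
      then have "bB \<star> x = (bB \<star> bB \<star> bA) \<star> k" by (simp add: x B3.m_assoc)
      then show ?thesis using k by blast
    next
      case 6
      then have "bB \<star> x = bA \<star> (bz \<star> k)" by (simp add: x B3.m_assoc braid_rewrite)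
      then show ?thesis using zk by blast
    qed
  next
    case (4 x)
    then obtain r k where x: "x = r \<star> k" and k: "k \<in> ?K"
      and r: "r \<in> {\<one>\<^bsub>B3\<^esub>, bB, bB \<star> bB, bA, bB \<star> bA, bB \<star> bB \<star> bA}" by blast
    have "inv\<^bsub>B3\<^esub> bz \<star> x = r \<star> (inv\<^bsub>B3\<^esub> bz \<star> k)"
      using B3.commute_int_pow[of r bz "-1"] B3.m_assoc[of r "inv\<^bsub>B3\<^esub> bz" k] B3.m_assoc[of "inv\<^bsub>B3\<^esub> bz" r k]
      by (simp add: bz_central B3.int_pow_neg x)
    then show ?case using mc[OF ic[OF gK(3)] k] r by blast
  qed
  then obtain r k where r: "r \<in> {\<one>\<^bsub>B3\<^esub>, bB, bB \<star> bB, bA, bB \<star> bA, bB \<star> bB \<star> bA}"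
    and k: "k \<in> ?K" and xr: "x = r \<star> k" by blast
  have KP: "?K \<subseteq> carrier (B_Gamma 2)"
    by (rule B3.generate_subgroup_incl[OF _ subgroup_B_Gamma]) (use P3_mem in auto)
  have "r = x \<star> inv\<^bsub>B3\<^esub> k" using xr by (simp add: B3.m_assoc)
  then have "r \<in> carrier (B_Gamma 2)"
    using subgroup.m_closed[OF subgroup_B_Gamma x] subgroup.m_inv_closed[OF subgroup_B_Gamma] k KP by auto
  \<comment> \<open>The five other representatives have matrices different from the identity modulo
    2.\<close>
  then have "r = \<one>\<^bsub>B3\<^esub>"
    using r by (auto simp: carrier_B_Gamma carrier_Gamma lam_AB mat2_mult mat_mod_2x2 mat_1_eq mat2_iff)
  then have "x \<in> ?K" using xr k by simp
  moreover have "?K \<subseteq> K" by (rule B3.generate_subgroup_incl[OF _ K]) (use g in auto)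
  ultimately show ?thesis by blast
qed

text \<open>
  \<open>P\<^sub>3 = F\<^sub>2 \<times> \<langle>z\<rangle>\<close>: the hom is read off an action of \<open>B\<^sub>3\<close> on \<open>B\<^sub>3 / P\<^sub>3 \<times> H\<close>, where the coset
  \<open>i\<close> is \<open>b\<^sup>i\<close> for \<open>i < 3\<close> and \<open>b\<^bsup>i-3\<^esup>a\<close> otherwise.
\<close>

lemma P3_universal:
  fixes H :: "('h, 'x) monoid_scheme"
  assumes H: "group H" and h: "h1 \<in> carrier H" "h2 \<in> carrier H" "h0 \<in> carrier H"
    and c: "h0 \<otimes>\<^bsub>H\<^esub> h1 = h1 \<otimes>\<^bsub>H\<^esub> h0" "h0 \<otimes>\<^bsub>H\<^esub> h2 = h2 \<otimes>\<^bsub>H\<^esub> h0"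
  obtains f where "f \<in> hom (B_Gamma 2) H" "f ba = h1" "f bb = h2" "f bz = h0"
proof -
  interpret H: group H by (rule H)
  let ?m = "\<lambda>x y. x \<otimes>\<^bsub>H\<^esub> y"
  define S where "S = {..<6::nat} \<times> carrier H"
  \<comment> \<open>\<open>fb\<close> and \<open>fa\<close> copy left multiplication by
    \<open>bB\<close> and \<open>bA\<close> on the six cosets, with \<open>h1\<close>,
    \<open>h2\<close>, \<open>h0\<close> in place of \<open>ba\<close>, \<open>bb\<close>,
    \<open>bz\<close>. Each 3-cycle of \<open>fb\<close> closes with the factor \<open>h0\<close>
    since bB^3 = bz; the entries with inverses are forced by \<open>fa\<close> applied twice being
    multiplication by \<open>h0\<close>.\<close>
  define fb :: "nat \<times> 'h \<Rightarrow> nat \<times> 'h" where "fb = (\<lambda>(i, h). if i = 0 then (1, h) else if i = 1 then (2, h)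
     else if i = 2 then (0, ?m h0 h) else if i = 3 then (4, h) else if i = 4 then (5, h) else (3, ?m h0 h))"
  define fa :: "nat \<times> 'h \<Rightarrow> nat \<times> 'h" where "fa = (\<lambda>(i, h). if i = 0 then (3, h) else if i = 3 then (0, ?m h0 h)
     else if i = 1 then (5, ?m h1 h) else if i = 5 then (1, ?m (inv\<^bsub>H\<^esub> h1) (?m h0 h))
     else if i = 2 then (4, ?m h2 h) else (2, ?m (inv\<^bsub>H\<^esub> h2) (?m h0 h)))"
  define sh :: "nat \<times> 'h \<Rightarrow> nat \<times> 'h" where "sh = (\<lambda>(i, h). (i, ?m h0 h))"
  have six: "i = 0 \<or> i = 1 \<or> i = 2 \<or> i = 3 \<or> i = 4 \<or> i = 5" if "i < 6" for i :: nat using that by auto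
  have cc: "?m h0 (?m h1 x) = ?m h1 (?m h0 x)" "?m h0 (?m h2 x) = ?m h2 (?m h0 x)" if "x \<in> carrier H" for x
    using c h that by (metis H.m_assoc)+
  have can: "?m (inv\<^bsub>H\<^esub> y) (?m y x) = x" "?m y (?m (inv\<^bsub>H\<^esub> y) x) = x"
    if "x \<in> carrier H" "y \<in> carrier H" for x y
    using that by (simp_all add: H.m_assoc[symmetric])
  have S: "fa \<in> S \<rightarrow> S" "fb \<in> S \<rightarrow> S"
    using h by (auto simp: S_def fa_def fb_def)
  have faa: "fa (fa s) = sh s" if sS: "s \<in> S" for s
  proof -
    obtain i x where s: "s = (i, x)" "i < 6" "x \<in> carrier H" using sS by (auto simp: S_def)
    show ?thesis using six[OF s(2)] s(3) h
      by (elim disjE) (simp_all add: s(1) fa_def sh_def cc can)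
  qed
  have fbb: "fb (fb (fb s)) = sh s" if sS: "s \<in> S" for s
  proof -
    obtain i x where s: "s = (i, x)" "i < 6" "x \<in> carrier H" using sS by (auto simp: S_def)
    show ?thesis using six[OF s(2)] s(3) h
      by (elim disjE) (simp_all add: s(1) fb_def sh_def)
  qed
  have shb: "bij_betw sh S S"
    by (rule bij_betwI[where g = "\<lambda>(i, x). (i, ?m (inv\<^bsub>H\<^esub> h0) x)"])
      (use h in \<open>auto simp: S_def sh_def can\<close>)
  have ba: "bij_betw fa S S" by (rule bij_betwI_comp[OF S(1) S(1) shb faa faa])
  have bb: "bij_betw fb S S"
  proof (rule bij_betwI_comp[OF S(2) _ shb])
    show "fb \<circ> fb \<in> S \<rightarrow> S" using funcset_mem[OF S(2)] by (simp add: Pi_def)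
  qed (simp_all add: fbb)
  have ab: "fa (fa s) = fb (fb (fb s))" if "s \<in> S" for s
    using that by (simp add: faa fbb)
  obtain act where act: "\<And>g s. s \<in> S \<Longrightarrow> act g s \<in> S"
    "\<And>g h s. s \<in> S \<Longrightarrow> act (g \<star> h) s = act g (act h s)" "\<And>s. s \<in> S \<Longrightarrow> act \<one>\<^bsub>B3\<^esub> s = s"
    "\<And>s. s \<in> S \<Longrightarrow> act bA s = fa s" "\<And>s. s \<in> S \<Longrightarrow> act bB s = fb s"
    using B3_action[OF ba bb ab] by blast
  \<comment> \<open>Coset 0 is the subgroup itself, so its elements preserve that coset and act
    there by left multiplication; the multiplier is the value of the homomorphism sought.\<close>
  define Fx where "Fx g c \<longleftrightarrow> c \<in> carrier H \<and> (\<forall>x\<in>carrier H. act g (0, x) = (0, ?m c x))" for g c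
  have S0: "(0, x) \<in> S" if "x \<in> carrier H" for x using that by (simp add: S_def)
  have Fm: "Fx (g \<star> g') (?m c c')" if "Fx g c" "Fx g' c'" for g g' c c'
    using that act(2)[OF S0] by (auto simp: Fx_def H.m_assoc)
  have Fi: "Fx (inv\<^bsub>B3\<^esub> g) (inv\<^bsub>H\<^esub> c)" if F: "Fx g c" for g c
    unfolding Fx_def
  proof (intro conjI ballI)
    show ci: "inv\<^bsub>H\<^esub> c \<in> carrier H" using F by (simp add: Fx_def)
    fix x assume x: "x \<in> carrier H"
    let ?y = "?m (inv\<^bsub>H\<^esub> c) x"
    have y: "?y \<in> carrier H" using ci x by simp
    have "act g (0, ?y) = (0, x)" using F x y by (simp add: Fx_def can)
    then have "act (inv\<^bsub>B3\<^esub> g) (0, x) = act (inv\<^bsub>B3\<^esub> g \<star> g) (0, ?y)"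
      using act(2)[OF S0[OF y], of "inv\<^bsub>B3\<^esub> g" g] by simp
    then show "act (inv\<^bsub>B3\<^esub> g) (0, x) = (0, ?y)" using act(3)[OF S0[OF y]] by simp
  qed
  have F1: "Fx \<one>\<^bsub>B3\<^esub> \<one>\<^bsub>H\<^esub>" using act(3)[OF S0] by (simp add: Fx_def)
  have Fz: "Fx bz h0"
    using act(2)[OF S0, of _ bA bA] act(4)[OF S0] act(4)[OF funcset_mem[OF S(1) S0]] faa[OF S0] h
    by (simp add: Fx_def sh_def braid_rewrite)
  have zz: "Fx (inv\<^bsub>B3\<^esub> bz \<star> inv\<^bsub>B3\<^esub> bz) (?m (inv\<^bsub>H\<^esub> h0) (inv\<^bsub>H\<^esub> h0))"
    using Fm Fi Fz by blast
  have FS: "fa s \<in> S" "fb s \<in> S" if "s \<in> S" for s using S that by auto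
  have actAB: "act (bA \<star> g) s = fa (act g s)" "act (bB \<star> g) s = fb (act g s)" if "s \<in> S" for g s
    using act(2)[OF that, of bA g] act(2)[OF that, of bB g] act(4)[OF act(1)[OF that]] act(5)[OF act(1)[OF that]]
    by auto
  have "Fx (bA \<star> bB \<star> bA \<star> bB) (?m h0 (?m h0 h1))"
    unfolding Fx_def using h act(5)[OF S0]
    by (auto simp: actAB S0 fa_def fb_def H.m_assoc)
  from Fm[OF zz this] have Fa: "Fx ba h1"
    using h by (simp add: ba_def B3.m_assoc H.m_assoc can)
  have "Fx (bA \<star> bB \<star> bB \<star> bA \<star> bB \<star> bB) (?m h0 (?m h0 h2))"
    unfolding Fx_def using h act(5)[OF S0]
    by (auto simp: actAB S0 fa_def fb_def H.m_assoc)
  from Fm[OF zz this] have Fb: "Fx bb h2"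
    using h by (simp add: bb_def B3.m_assoc H.m_assoc can)
  have K: "subgroup {g. \<exists>c. Fx g c} B3"
  proof (rule B3.subgroupI)
    show "{g. \<exists>c. Fx g c} \<noteq> {}" using F1 by blast
    show "inv\<^bsub>B3\<^esub> g \<in> {g. \<exists>c. Fx g c}" if gK: "g \<in> {g. \<exists>c. Fx g c}" for g
    proof -
      obtain c where "Fx g c" using gK by (elim CollectE exE)
      from Fi[OF this] show ?thesis by (intro CollectI exI)
    qed
    show "g \<star> g' \<in> {g. \<exists>c. Fx g c}" if g: "g \<in> {g. \<exists>c. Fx g c}" "g' \<in> {g. \<exists>c. Fx g c}" for g g'
    proof -
      obtain c c' where "Fx g c" "Fx g' c'" using g by (elim CollectE exE)
      from Fm[OF this] show ?thesis by (intro CollectI exI)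
    qed
  qed (simp add: subset_iff)
  have mem: "ba \<in> {g. \<exists>c. Fx g c}" "bb \<in> {g. \<exists>c. Fx g c}" "bz \<in> {g. \<exists>c. Fx g c}"
    by (rule CollectI, rule exI, fact Fa, rule CollectI, rule exI, fact Fb,
        rule CollectI, rule exI, fact Fz)
  have ex: "\<exists>c. Fx g c" if "g \<in> carrier (B_Gamma 2)" for g
    using P3_generate[OF K mem that] by (elim CollectE)
  define f where "f g = snd (act g (0, \<one>\<^bsub>H\<^esub>))" for g
  have fF: "f g = c" if "Fx g c" for g c using that by (simp add: f_def Fx_def)
  show ?thesis
  proof (rule that[of f])
    show "f \<in> hom (B_Gamma 2) H"
    proof (rule homI)
      show "f x \<in> carrier H" if x: "x \<in> carrier (B_Gamma 2)" for x
      proof -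
        obtain c where c: "Fx x c" using ex[OF x] by (elim exE)
        then show ?thesis using fF[OF c] by (simp add: Fx_def)
      qed
      show "f (x \<otimes>\<^bsub>B_Gamma 2\<^esub> y) = f x \<otimes>\<^bsub>H\<^esub> f y"
        if x: "x \<in> carrier (B_Gamma 2)" and y: "y \<in> carrier (B_Gamma 2)" for x y
      proof -
        obtain c d where c: "Fx x c" "Fx y d" using ex[OF x] ex[OF y] by (elim exE) blast
        then show ?thesis using fF[OF c(1)] fF[OF c(2)] fF[OF Fm[OF c]] by simp
      qed
    qed
  qed (use fF[OF Fa] fF[OF Fb] fF[OF Fz] in simp_all)
qed

section \<open>The action on polynomials\<close>

text \<open>Substitution with values in an arbitrary commutative ring. With values in polynomials it
  is the action of matrices; with real values it allows counting roots in
  \<open>Mn_invariants\<close>.\<close>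

definition ev :: "'r::comm_ring_1 \<Rightarrow> 'r \<Rightarrow> poly2 \<Rightarrow> 'r" where
  "ev p q f = (\<Sum>k\<in>Poly_Mapping.keys f. of_int (Poly_Mapping.lookup f k) * p ^ fst k * q ^ snd k)"

lemma SL2_act_ev:
  "SL2_act A f = ev (of_int (A$1$1) * poly_x + of_int (A$2$1) * poly_y)
     (of_int (A$1$2) * poly_x + of_int (A$2$2) * poly_y) f"
  by (simp add: SL2_act_def subst2_def ev_def)

lemma ev_superset:
  assumes "finite S" "Poly_Mapping.keys f \<subseteq> S"
  shows "ev p q f = (\<Sum>k\<in>S. of_int (Poly_Mapping.lookup f k) * p ^ fst k * q ^ snd k)"
  unfolding ev_def by (rule sum.mono_neutral_left) (use assms in \<open>auto simp: in_keys_iff\<close>)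

lemma ev_add: "ev p q (f + g) = ev p q f + ev p q g"
proof -
  let ?S = "Poly_Mapping.keys f \<union> Poly_Mapping.keys g"
  have "Poly_Mapping.keys (f + g) \<subseteq> ?S" by (rule keys_add)
  then show ?thesis
    by (simp add: ev_superset[of ?S] lookup_add sum.distrib[symmetric] algebra_simps)
qed

lemma ev_zero [simp]: "ev p q 0 = 0"
  by (simp add: ev_def)

lemma ev_single: "ev p q (Poly_Mapping.single k c) = of_int c * p ^ fst k * q ^ snd k"
  by (cases "c = 0") (auto simp: ev_def)

lemma ev_minus: "ev p q (- f) = - ev p q f"
  using ev_add[of p q "- f" f] by (simp add: eq_neg_iff_add_eq_0)

lemma ev_diff: "ev p q (f - g) = ev p q f - ev p q g"
  using ev_add[of p q f "- g"] by (simp add: ev_minus)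

lemma poly2_induct [case_names single add]:
  fixes f :: poly2
  assumes "\<And>k c. P (Poly_Mapping.single k c)" "\<And>f g. P f \<Longrightarrow> P g \<Longrightarrow> P (f + g)"
  shows "P f"
proof (induction f rule: update_induct)
  case const
  then show ?case using assms(1)[of 0 0] by simp
next
  case (update f a b)
  have "Poly_Mapping.update a b f = f + Poly_Mapping.single a b"
    using update by (intro poly_mapping_eqI) (auto simp: lookup_update lookup_add lookup_single when_def in_keys_iff)
  then show ?case using assms update by metis
qed

lemma ev_mult: "ev p q (f * g) = ev p q f * ev p q g"
proof (induction f rule: poly2_induct)
  case (single k c)
  show ?case
    by (induction g rule: poly2_induct) (auto simp: mult_single ev_single power_add ev_add algebra_simps)
qed (simp add: ev_add algebra_simps)

lemma single_int: "Poly_Mapping.single (0, 0) c = (of_int c :: poly2)"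
proof -
  have "Poly_Mapping.single (0 :: nat \<times> nat) (of_int c :: int) = of_int c" by (rule single_of_int)
  then show ?thesis by (simp add: zero_prod_def)
qed

lemma ev_of_int: "ev p q (of_int c) = of_int c"
  using ev_single[of p q "(0, 0)" c] by (simp add: single_int)

lemma ev_power: "ev p q (f ^ n) = ev p q f ^ n"
  using ev_of_int[of p q 1] by (induction n) (simp_all add: ev_mult)

lemma ev_xy: "ev p q poly_x = p" "ev p q poly_y = q"
  by (simp_all add: poly_x_def poly_y_def ev_single)

lemma ev_sum: "ev p q (sum f A) = (\<Sum>a\<in>A. ev p q (f a))"
  by (induction A rule: infinite_finite_induct) (simp_all add: ev_add)

lemma ev_ev: "ev P Q (ev p q f) = ev (ev P Q p) (ev P Q q) f"
  unfolding ev_def[of p q] ev_def[of "ev P Q p"]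
  by (simp add: ev_sum ev_mult ev_power ev_of_int)

lemma single_mono: "Poly_Mapping.single (i, j) c = of_int c * poly_x ^ i * poly_y ^ j"
proof -
  have x: "poly_x ^ i = Poly_Mapping.single (i, 0) 1"
    by (induction i) (simp_all add: poly_x_def mult_single flip: zero_prod_def)
  have y: "poly_y ^ j = Poly_Mapping.single (0, j) 1"
    by (induction j) (simp_all add: poly_y_def mult_single flip: zero_prod_def)
  have "of_int c * poly_x ^ i * poly_y ^ j =
      Poly_Mapping.single (0, 0) c * Poly_Mapping.single (i, 0) 1 * Poly_Mapping.single (0, j) 1"
    unfolding x y single_int ..
  then show ?thesis by (simp add: mult_single)
qed

lemma ev_id: "ev poly_x poly_y f = f"
  by (induction f rule: poly2_induct) (auto simp: ev_single ev_add single_mono)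

lemma SL2_act_mult: "SL2_act (A ** B) f = SL2_act A (SL2_act B f)"
  unfolding SL2_act_ev ev_ev
  by (simp add: ev_add ev_mult ev_of_int ev_xy matrix_mult_nth_2 algebra_simps)

lemma SL2_act_one: "SL2_act (mat 1) f = f"
  by (simp add: SL2_act_ev mat_def ev_id)

section \<open>Homogeneous components as modules\<close>

definition Mn :: "nat \<Rightarrow> poly2 set" where
  "Mn n = {f. \<forall>(i, j)\<in>Poly_Mapping.keys f. i + j = n}"

lemma M_deg_addgrp: "M_deg n = addgrp (Mn n)"
  by (simp add: M_deg_def addgrp_def Mn_def)

lemma addsub_Mn: "addsub (Mn n)"
  by (rule addsubI) (auto simp: Mn_def dest!: keys_diff[THEN subsetD])

lemma Mn_mult: "f \<in> Mn a \<Longrightarrow> g \<in> Mn b \<Longrightarrow> f * g \<in> Mn (a + b)"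
  by (fastforce simp: Mn_def dest!: keys_mult[THEN subsetD])

lemma Mn_of_int: "of_int c \<in> Mn 0"
proof -
  have "of_int c = Poly_Mapping.single (0::nat, 0::nat) c" by (rule single_int[symmetric])
  then show ?thesis by (auto simp: Mn_def split: if_splits)
qed

lemma Mn_power: "f \<in> Mn 1 \<Longrightarrow> f ^ n \<in> Mn n"
  by (induction n) (use Mn_of_int[of 1] Mn_mult[of f 1] in auto)

lemma Mn_sum: "(\<And>k. k \<in> S \<Longrightarrow> f k \<in> Mn n) \<Longrightarrow> sum f S \<in> Mn n"
  by (induction S rule: infinite_finite_induct) (simp_all add: addsub_zero addsub_add addsub_Mn)

lemma Mn_ev:
  assumes "p \<in> Mn 1" "q \<in> Mn 1" "f \<in> Mn n"
  shows "ev p q f \<in> Mn n"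
  unfolding ev_def
proof (rule Mn_sum)
  fix k assume "k \<in> Poly_Mapping.keys f"
  then have k: "fst k + snd k = n" using assms(3) by (auto simp: Mn_def)
  have "of_int (Poly_Mapping.lookup f k) * p ^ fst k * q ^ snd k \<in> Mn (0 + fst k + snd k)"
    by (intro Mn_mult Mn_of_int Mn_power assms)
  then show "of_int (Poly_Mapping.lookup f k) * p ^ fst k * q ^ snd k \<in> Mn n" using k by simp
qed

lemma SL2_act_mem: "f \<in> Mn n \<Longrightarrow> SL2_act A f \<in> Mn n"
proof -
  have xy: "poly_x \<in> Mn 1" "poly_y \<in> Mn 1" by (auto simp: Mn_def poly_x_def poly_y_def)
  have "of_int a * poly_x + of_int b * poly_y \<in> Mn 1" for a b
    using Mn_mult[OF Mn_of_int xy(1), of a] Mn_mult[OF Mn_of_int xy(2), of b]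
    by (simp add: addsub_add[OF addsub_Mn])
  then show "f \<in> Mn n \<Longrightarrow> SL2_act A f \<in> Mn n" unfolding SL2_act_ev by (intro Mn_ev)
qed

lemma gmod_Gamma: "gmod (Gamma m) (Mn n) SL2_act"
  unfolding gmod_def
  by (auto simp: addsub_Mn SL2_act_mem SL2_act_mult SL2_act_one intro!: add_onI)
    (simp add: SL2_act_ev ev_diff)

lemma gmod_B_Gamma: "gmod (B_Gamma m) (Mn n) (\<lambda>b. SL2_act (lam b))"
  unfolding gmod_def
  by (auto simp: addsub_Mn SL2_act_mem SL2_act_mult SL2_act_one intro!: add_onI)
    (simp add: SL2_act_ev ev_diff)

lemma SL2_act_minus_one:
  assumes "f \<in> Mn n"
  shows "SL2_act (mat2 (-1) 0 0 (-1)) f = (if even n then f else - f)"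
proof -
  have "SL2_act (mat2 (-1) 0 0 (-1)) f = ev (- poly_x) (- poly_y) f"
    by (simp add: SL2_act_ev)
  also have "\<dots> = (- 1) ^ n * ev poly_x poly_y f"
    unfolding ev_def sum_distrib_left
  proof (rule sum.cong)
    fix k assume "k \<in> Poly_Mapping.keys f"
    then have k: "n = fst k + snd k" using assms by (auto simp: Mn_def)
    show "of_int (Poly_Mapping.lookup f k) * (- poly_x) ^ fst k * (- poly_y) ^ snd k =
        (- 1) ^ n * (of_int (Poly_Mapping.lookup f k) * poly_x ^ fst k * poly_y ^ snd k)"
      unfolding k power_add power_minus[of poly_x] power_minus[of poly_y] by (simp add: ac_simps)
  qed simp
  finally show ?thesis by (simp add: ev_id)
qed

section \<open>Reduction modulo 2\<close>

lemma dvd_power_diff: "(d::'r::comm_ring_1) dvd p - x \<Longrightarrow> d dvd p ^ i - x ^ i"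
proof (induction i)
  case (Suc i)
  have "p ^ Suc i - x ^ Suc i = p * (p ^ i - x ^ i) + (p - x) * x ^ i" by (simp add: algebra_simps)
  then show ?case using Suc by simp
qed simp

lemma ev_congruent:
  assumes "d dvd p - x" "d dvd q - y"
  shows "d dvd ev p q f - ev x y f"
  unfolding ev_def sum_subtractf[symmetric]
proof (rule dvd_sum)
  fix k
  let ?c = "of_int (Poly_Mapping.lookup f k)"
  have "?c * p ^ fst k * q ^ snd k - ?c * x ^ fst k * y ^ snd k =
    ?c * (p ^ fst k * (q ^ snd k - y ^ snd k) + (p ^ fst k - x ^ fst k) * y ^ snd k)"
    by (simp add: algebra_simps)
  then show "d dvd ?c * p ^ fst k * q ^ snd k - ?c * x ^ fst k * y ^ snd k"
    using dvd_power_diff[OF assms(1), of "fst k"] dvd_power_diff[OF assms(2), of "snd k"] by simp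
qed

text \<open>The linear forms substituted for x and y are congruent to x and y modulo 2, and
  substitution respects congruences.\<close>

lemma Gamma2_acts_trivially_mod_2:
  assumes A: "A \<in> carrier (Gamma 2)" and f: "f \<in> Mn n"
  shows "\<exists>g\<in>Mn n. SL2_act A f - f = g + g"
proof -
  have e: "A$i$j mod 2 = mat 1 $ i $ j mod 2" for i j
    using A by (simp add: carrier_Gamma mat_mod_def vec_eq_iff)
  have "even (A$1$1 - 1)" "even (A$1$2)" "even (A$2$1)" "even (A$2$2 - 1)"
    using e[of 1 1] e[of 1 2] e[of 2 1] e[of 2 2] by (simp_all add: mat_def) presburger+
  then obtain a b c d where abcd: "A$1$1 = 1 + 2 * a" "A$1$2 = 2 * b" "A$2$1 = 2 * c" "A$2$2 = 1 + 2 * d"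
    by (metis add.commute diff_add_cancel dvdE)
  have p: "of_int (A$1$1) * poly_x + of_int (A$2$1) * poly_y - poly_x = 2 * (of_int a * poly_x + of_int c * poly_y)"
    and q: "of_int (A$1$2) * poly_x + of_int (A$2$2) * poly_y - poly_y = 2 * (of_int b * poly_x + of_int d * poly_y)"
    unfolding abcd by (simp_all add: algebra_simps)
  have "2 dvd SL2_act A f - ev poly_x poly_y f"
    unfolding SL2_act_ev by (rule ev_congruent) (simp_all only: p q dvd_triv_left)
  then obtain g where g: "SL2_act A f - f = 2 * g" by (auto simp: ev_id)
  then have gg: "SL2_act A f - f = g + g" by simp
  \<comment> \<open>Doubling an integral polynomial does not change its support, so the half is
    homogeneous of the same degree.\<close>
  have "Poly_Mapping.keys (g + g) = Poly_Mapping.keys g"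
    by (rule Set.set_eqI) (simp only: in_keys_iff lookup_add, simp)
  moreover have "g + g \<in> Mn n"
    unfolding gg[symmetric] by (rule addsub_diff[OF addsub_Mn SL2_act_mem[OF f] f])
  ultimately have "g \<in> Mn n" by (simp add: Mn_def)
  then show ?thesis using gg by blast
qed

lemma double_eq_zero: "f + f = 0 \<Longrightarrow> f = (0::poly2)"
proof (rule poly_mapping_eqI)
  fix k assume "f + f = 0"
  then have "Poly_Mapping.lookup f k + Poly_Mapping.lookup f k = 0"
    unfolding lookup_add[symmetric] by (simp only: lookup_zero)
  then show "Poly_Mapping.lookup f k = Poly_Mapping.lookup 0 k" by simp
qed

section \<open>Invariants of the level 2 group\<close>

lemma periodic_polynomial_const:
  fixes c :: "nat \<Rightarrow> real"
  assumes per: "\<And>x. (\<Sum>i\<le>n. c i * (x + 2) ^ i) = (\<Sum>i\<le>n. c i * x ^ i)" and i: "0 < i" "i \<le> n"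
  shows "c i = 0"
proof (rule ccontr)
  assume "c i \<noteq> 0"
  let ?g = "\<lambda>x. \<Sum>i\<le>n. c i * x ^ i"
  let ?c = "\<lambda>i. if i = 0 then c 0 - ?g 0 else c i"
  have g: "(\<Sum>i\<le>n. ?c i * x ^ i) = ?g x - ?g 0" for x
  proof -
    have "(\<Sum>i\<le>n. ?c i * x ^ i) = (\<Sum>i\<le>n. c i * x ^ i - (if i = 0 then ?g 0 else 0))"
      by (rule sum.cong) auto
    then show ?thesis by (simp add: sum_subtractf)
  qed
  have "?g (2 * real k) = ?g 0" for k
  proof (induction k)
    case (Suc k)
    have "2 * real (Suc k) = 2 * real k + 2" by simp
    then show ?case using Suc per[of "2 * real k"] by (simp only:)
  qed simp
  \<comment> \<open>By periodicity every even natural number is a root of the polynomial minus its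
    value at 0; a nonzero coefficient in positive degree would leave only finitely many
    roots.\<close>
  then have "range (\<lambda>k. 2 * real k) \<subseteq> {x. (\<Sum>i\<le>n. ?c i * x ^ i) = 0}"
    unfolding g by auto
  moreover have "finite {x. (\<Sum>i\<le>n. ?c i * x ^ i) = 0}"
    by (rule polyfun_roots_finite[of _ i]) (use i \<open>c i \<noteq> 0\<close> in auto)
  moreover have "infinite (range (\<lambda>k. 2 * real k))"
    by (rule range_inj_infinite) (auto simp: inj_def)
  ultimately show False using finite_subset by blast
qed

lemma Mn_coeffs:
  assumes "f \<in> Mn n"
  shows "ev p q f = (\<Sum>i\<le>n. of_int (Poly_Mapping.lookup f (i, n - i)) * p ^ i * q ^ (n - i))"
    and "ev p q f = (\<Sum>i\<le>n. of_int (Poly_Mapping.lookup f (n - i, i)) * p ^ (n - i) * q ^ i)"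
proof -
  have k: "Poly_Mapping.keys f \<subseteq> (\<lambda>i. (i, n - i)) ` {..n}"
  proof
    fix x assume "x \<in> Poly_Mapping.keys f"
    then have "fst x + snd x = n" using assms by (auto simp: Mn_def)
    then show "x \<in> (\<lambda>i. (i, n - i)) ` {..n}" by (intro image_eqI[of _ _ "fst x"]) (auto simp: prod_eq_iff)
  qed
  have inj: "inj_on (\<lambda>i. (i, n - i)) {..n}" by (auto simp: inj_on_def)
  show 1: "ev p q f = (\<Sum>i\<le>n. of_int (Poly_Mapping.lookup f (i, n - i)) * p ^ i * q ^ (n - i))"
    by (subst ev_superset[OF _ k]) (simp_all add: sum.reindex[OF inj])
  show "ev p q f = (\<Sum>i\<le>n. of_int (Poly_Mapping.lookup f (n - i, i)) * p ^ (n - i) * q ^ i)"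
    unfolding 1 by (rule sum.reindex_bij_witness[of _ "\<lambda>i. n - i" "\<lambda>i. n - i"]) auto
qed

text \<open>Setting y = 1 in the invariance under x \<rightarrow> x + 2y gives a polynomial of
  period 2, so no monomial contains x. By the symmetric argument none contains y, and a monomial of
  positive degree contains one of them.\<close>

lemma Mn_invariants:
  assumes f: "f \<in> Mn n" and n: "n > 0"
    and 1: "SL2_act (mat2 1 0 2 1) f = f" and 2: "SL2_act (mat2 1 2 0 1) f = f"
  shows "f = 0"
proof (rule poly_mapping_eqI)
  fix k :: "nat \<times> nat"
  obtain i j where k: "k = (i, j)" by (cases k)
  have "ev (P + 2 * Q) Q f = ev P Q f" for P Q :: real
  proof -
    have "ev P Q (SL2_act (mat2 1 0 2 1) f) = ev (P + 2 * Q) Q f"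
      unfolding SL2_act_ev ev_ev by (simp add: ev_add ev_mult ev_of_int[of _ _ 2, simplified] ev_xy)
    then show ?thesis unfolding 1 by simp
  qed
  from this[of _ 1] have e1: "Poly_Mapping.lookup f (i, n - i) = 0" if "0 < i" "i \<le> n" for i
    using periodic_polynomial_const[of "\<lambda>i. of_int (Poly_Mapping.lookup f (i, n - i))" n i] that
    by (simp add: Mn_coeffs(1)[OF f])
  have "ev P (2 * P + Q) f = ev P Q f" for P Q :: real
  proof -
    have "ev P Q (SL2_act (mat2 1 2 0 1) f) = ev P (2 * P + Q) f"
      unfolding SL2_act_ev ev_ev by (simp add: ev_add ev_mult ev_of_int[of _ _ 2, simplified] ev_xy)
    then show ?thesis unfolding 2 by simp
  qed
  from this[of 1] have e2: "Poly_Mapping.lookup f (n - i, i) = 0" if "0 < i" "i \<le> n" for i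
    using periodic_polynomial_const[of "\<lambda>i. of_int (Poly_Mapping.lookup f (n - i, i))" n i] that
    by (simp add: Mn_coeffs(2)[OF f] add.commute)
  show "Poly_Mapping.lookup f k = Poly_Mapping.lookup 0 k"
  proof (cases "k \<in> Poly_Mapping.keys f")
    case True
    then have "i + j = n" using f k by (auto simp: Mn_def)
    then have "n - i = j" "n - j = i" "i \<le> n" "j \<le> n" "0 < i \<or> 0 < j" using n by auto
    then show ?thesis using e1[of i] e2[of j] k by auto
  qed (simp add: in_keys_iff)
qed

lemma Mn_0_iff: "f \<in> Mn 0 \<longleftrightarrow> f = Poly_Mapping.single (0, 0) (Poly_Mapping.lookup f (0, 0))"
proof
  assume f: "f \<in> Mn 0"
  show "f = Poly_Mapping.single (0, 0) (Poly_Mapping.lookup f (0, 0))"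
  proof (rule poly_mapping_eqI)
    fix k :: "nat \<times> nat"
    show "Poly_Mapping.lookup f k = Poly_Mapping.lookup (Poly_Mapping.single (0, 0) (Poly_Mapping.lookup f (0, 0))) k"
      using f by (cases k; cases "k \<in> Poly_Mapping.keys f") (auto simp: Mn_def lookup_single when_def in_keys_iff)
  qed
next
  assume "f = Poly_Mapping.single (0, 0) (Poly_Mapping.lookup f (0, 0))"
  then show "f \<in> Mn 0" by (metis Mn_of_int single_int)
qed

lemma SL2_act_Mn_0: "f \<in> Mn 0 \<Longrightarrow> SL2_act A f = f"
  using ev_id[of f] unfolding SL2_act_ev Mn_0_iff by (metis ev_single fst_conv power_0 snd_conv)

lemma Mn_0_iso: "addgrp (Mn 0) \<cong> integer_group"
proof (rule group_is_isoI[of "\<lambda>f. Poly_Mapping.lookup f (0, 0)"])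
  show "(\<lambda>f. Poly_Mapping.lookup f (0, 0)) \<in> hom (addgrp (Mn 0)) integer_group"
    by (simp add: hom_def lookup_add)
  show "inj_on (\<lambda>f. Poly_Mapping.lookup f (0, 0)) (carrier (addgrp (Mn 0)))"
    by (rule inj_onI) (metis Mn_0_iff addgrp_simps(1))
  have "c \<in> (\<lambda>f. Poly_Mapping.lookup f (0, 0)) ` Mn 0" for c
    by (rule image_eqI[of _ _ "Poly_Mapping.single (0, 0) c"]) (auto simp: Mn_def split: if_splits)
  then show "(\<lambda>f. Poly_Mapping.lookup f (0, 0)) ` carrier (addgrp (Mn 0)) = carrier integer_group" by auto
qed

section \<open>A central element acting by \<open>-1\<close>\<close>

text \<open>What the pure braid group and \<Gamma>(2) have in common in odd degree.
  \<open>lift\<close> provides additive maps to \<open>N\<close> that kill \<open>t\<close> and take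
  prescribed values at \<open>al\<close> and \<open>be\<close>; \<open>detect\<close> says that a
  map additive modulo 2 is even everywhere once it is even at \<open>t\<close>, \<open>al\<close>,
  \<open>be\<close>.\<close>

locale neg_central = group E for E (structure) +
  fixes N :: "'n::ab_group_add set" and act :: "'e \<Rightarrow> 'n \<Rightarrow> 'n" and t al be :: 'e
  constrains E :: "('e, 'c) monoid_scheme"
  assumes M: "gmod E N act" and mem [simp]: "t \<in> carrier E" "al \<in> carrier E" "be \<in> carrier E"
    and central: "\<And>x. x \<in> carrier E \<Longrightarrow> x \<otimes> t = t \<otimes> x"
    and neg: "\<And>n. n \<in> N \<Longrightarrow> act t n = - n"
    and torsion_free: "\<And>n. n \<in> N \<Longrightarrow> n + n = 0 \<Longrightarrow> n = 0"
    and mod2: "\<And>x n. x \<in> carrier E \<Longrightarrow> n \<in> N \<Longrightarrow> \<exists>h\<in>N. act x n - n = h + h"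
    and lift: "\<And>m1 m2. m1 \<in> N \<Longrightarrow> m2 \<in> N \<Longrightarrow> \<exists>u. (\<forall>x\<in>carrier E. u x \<in> N) \<and>
       (\<forall>x\<in>carrier E. \<forall>y\<in>carrier E. u (x \<otimes> y) = u x + u y) \<and> u t = 0 \<and> u al = m1 \<and> u be = m2"
    and detect: "\<And>k x. (\<forall>x\<in>carrier E. k x \<in> N) \<Longrightarrow>
       (\<forall>x\<in>carrier E. \<forall>y\<in>carrier E. \<exists>h\<in>N. k (x \<otimes> y) - k x - k y = h + h) \<Longrightarrow>
       \<exists>h\<in>N. k t = h + h \<Longrightarrow> \<exists>h\<in>N. k al = h + h \<Longrightarrow> \<exists>h\<in>N. k be = h + h \<Longrightarrow>
       x \<in> carrier E \<Longrightarrow> \<exists>h\<in>N. k x = h + h"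
begin

abbreviation "dbl \<equiv> (\<lambda>n::'n. n + n)"
abbreviation "C \<equiv> CC E N"
abbreviation "d \<equiv> dB E act"

lemmas A = gmodD(1)[OF M]
lemmas cx = cplx_bar[OF is_group M]
lemmas cl = addsub_diff[OF A] addsub_add[OF A] addsub_neg[OF A] gmodD(3)[OF M]

lemma dbl_eq: "x \<in> N \<Longrightarrow> y \<in> N \<Longrightarrow> x + x = y + y \<Longrightarrow> x = y"
  using torsion_free[of "x - y"] cl(1)[of x y] by (simp add: algebra_simps)

lemma addsub_dbl: "addsub (dbl ` N)"
  by (rule addsub_image[OF A]) (simp add: add_on_def)

lemma H0_trivial: "Zc C d 0 \<subseteq> Bc C d 0"
proof
  fix f assume "f \<in> Zc C d 0"
  then have f: "f \<in> C 0" "act t (f []) = f []" by (auto simp: Zc0_iff)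
  have "f [] + f [] = 0" using f(2) neg[OF CC_0_nth[OF f(1)]] by (simp add: neg_eq_iff_add_eq_0)
  then have "f [] = 0" by (rule torsion_free[OF CC_0_nth[OF f(1)]])
  then have "f = 0" by (intro CC0_eqI[OF f(1), of 0 E N]) (auto simp: CC_def addsub_zero[OF A])
  then show "f \<in> Bc C d 0" by simp
qed

text \<open>Comparing c(xt) with c(tx) gives 2c(x) = c(t) - x c(t), so a cocycle is determined by
  c(t). Every value of c(t) occurs, and the coboundary of m has c(t) = -2m.\<close>

lemma H1: "qiso (Zc C d (Suc 0)) (Bc C d (Suc 0)) N (dbl ` N)"
proof (rule qiso_map[OF addsub_Zc[OF cx], where f = "\<lambda>c. c [t]"])
  have eq: "c [x] + c [x] = c [t] - act x (c [t])" if "c \<in> Zc C d (Suc 0)" "x \<in> carrier E" for c x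
  proof -
    have c: "c \<in> C (Suc 0)" "c [x \<otimes> t] = c [x] + act x (c [t])" "c [t \<otimes> x] = c [t] + act t (c [x])"
      using that by (auto simp: Zc1_iff[OF is_group])
    then show ?thesis
      using central[OF that(2)] neg[OF CC_Suc0_nth[OF c(1) that(2)]] by (simp add: algebra_simps)
  qed
  show "add_on (Zc C d (Suc 0)) (\<lambda>c. c [t])" by (simp add: add_on_def)
  show "(\<lambda>c. c [t]) ` Zc C d (Suc 0) = N"
  proof
    show "(\<lambda>c. c [t]) ` Zc C d (Suc 0) \<subseteq> N" by (auto simp: Zc_def intro: CC_Suc0_nth[OF _ mem(1)])
    show "N \<subseteq> (\<lambda>c. c [t]) ` Zc C d (Suc 0)"
    proof
      fix h assume h: "h \<in> N"
      have "\<exists>w\<in>N. h - act x h = w + w" if x: "x \<in> carrier E" for x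
      proof -
        obtain w where "w \<in> N" "act x h - h = w + w" using mod2[OF x h] by blast
        then show ?thesis by (intro bexI[of _ "- w"]) (auto simp: cl algebra_simps)
      qed
      \<comment> \<open>Half of h - xh exists because the action is trivial modulo 2; it is the only
        candidate for a cocycle with value \<open>h\<close> at \<open>t\<close>.\<close>
      then obtain w where w: "\<And>x. x \<in> carrier E \<Longrightarrow> w x \<in> N" "\<And>x. x \<in> carrier E \<Longrightarrow> h - act x h = w x + w x"
        by metis
      let ?c = "\<lambda>l. if l \<in> tuples E (Suc 0) then w (hd l) else 0"
      have "w (x \<otimes> y) = w x + act x (w y)" if xy: "x \<in> carrier E" "y \<in> carrier E" for x y
      proof (rule dbl_eq)
        have "w (x \<otimes> y) + w (x \<otimes> y) = (h - act x h) + (act x h - act x (act y h))"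
          using w(2)[of "x \<otimes> y"] gmodD(4)[OF M xy h] xy by simp
        also have "act x h - act x (act y h) = act x (w y) + act x (w y)"
          using w xy gmodD(6,7)[OF M xy(1)] h by (metis gmodD(3)[OF M])
        also have "h - act x h = w x + w x" by (rule w(2)[OF xy(1)])
        finally show "w (x \<otimes> y) + w (x \<otimes> y) = w x + act x (w y) + (w x + act x (w y))"
          by (simp add: algebra_simps)
      qed (use w xy cl in auto)
      then have "?c \<in> Zc C d (Suc 0)"
        unfolding Zc1_iff[OF is_group] using w by (auto simp: CC_def tuples_1)
      moreover have "w t = h"
        by (rule dbl_eq) (use w(1,2)[of t] neg[OF h] h in simp_all)
      ultimately show "h \<in> (\<lambda>c. c [t]) ` Zc C d (Suc 0)"
        by (intro image_eqI[of _ _ ?c]) auto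
    qed
  qed
  show "c [t] \<in> dbl ` N \<longleftrightarrow> c \<in> Bc C d (Suc 0)" if cZ: "c \<in> Zc C d (Suc 0)" for c
  proof
    assume "c \<in> Bc C d (Suc 0)"
    then obtain m where m: "m \<in> C 0" "c = d 0 m" by auto
    have "c [t] = (- m []) + (- m [])" using m neg[OF CC_0_nth[OF m(1)]] by (simp add: dB0_nth)
    then show "c [t] \<in> dbl ` N" using cl(3)[OF CC_0_nth[OF m(1)]] by blast
  next
    assume "c [t] \<in> dbl ` N"
    then obtain m where m: "m \<in> N" "c [t] = m + m" by blast
    let ?m = "\<lambda>l. if l = [] then - m else 0"
    have mC: "?m \<in> C 0" using cl(3)[OF m(1)] by (auto simp: CC_def)
    have cC: "c \<in> C (Suc 0)" using cZ by (simp add: Zc_def)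
    have "c = d 0 ?m"
    proof (rule CC1_eqI[OF cC])
      show "d 0 ?m \<in> C (Suc 0)" by (rule cplxD(3)[OF cx mC])
      fix x assume x: "x \<in> carrier E"
      show "c [x] = d 0 ?m [x]"
      proof (rule dbl_eq)
        show "c [x] + c [x] = d 0 ?m [x] + d 0 ?m [x]"
          using eq[OF cZ x] x m by (simp add: dB0_nth gmodD[OF M])
      qed (use x m cl CC_Suc0_nth[OF cC x] in \<open>simp_all add: dB0_nth\<close>)
    qed
    then show "c \<in> Bc C d (Suc 0)" using mC by simp
  qed
qed

end

section \<open>Cocycles in degree 2\<close>

lemma dB1_nth: "x \<in> carrier G \<Longrightarrow> y \<in> carrier G \<Longrightarrow>
    dB G act (Suc 0) f [x, y] = act x (f [y]) - f [x \<otimes>\<^bsub>G\<^esub> y] + f [x]"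
  by (simp add: dB_def)

lemma CC_2_nth: "f \<in> CC G N (Suc (Suc 0)) \<Longrightarrow> x \<in> carrier G \<Longrightarrow> y \<in> carrier G \<Longrightarrow> f [x, y] \<in> N"
  by (simp add: CC_def)

lemma CC2_eqI:
  assumes "f \<in> CC G N (Suc (Suc 0))" "g \<in> CC G N' (Suc (Suc 0))"
    and "\<And>x y. x \<in> carrier G \<Longrightarrow> y \<in> carrier G \<Longrightarrow> f [x, y] = g [x, y]"
  shows "f = g"
proof
  fix l show "f l = g l"
    using assms by (cases "l \<in> tuples G (Suc (Suc 0))") (auto simp: CC_def elim!: tuples_SucE)
qed

lemma Zc2_iff:
  "f \<in> Zc (CC G N) (dB G act) (Suc (Suc 0)) \<longleftrightarrow> f \<in> CC G N (Suc (Suc 0)) \<and>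
     (\<forall>x\<in>carrier G. \<forall>y\<in>carrier G. \<forall>z\<in>carrier G.
        act x (f [y, z]) + f [x, y \<otimes>\<^bsub>G\<^esub> z] = f [x \<otimes>\<^bsub>G\<^esub> y, z] + f [x, y])"
proof -
  have "dB G act (Suc (Suc 0)) f = 0 \<longleftrightarrow> (\<forall>x\<in>carrier G. \<forall>y\<in>carrier G. \<forall>z\<in>carrier G.
      act x (f [y, z]) - (f [x \<otimes>\<^bsub>G\<^esub> y, z] - (f [x, y \<otimes>\<^bsub>G\<^esub> z] - f [x, y])) = 0)"
  proof
    assume d0: "dB G act (Suc (Suc 0)) f = 0"
    show "\<forall>x\<in>carrier G. \<forall>y\<in>carrier G. \<forall>z\<in>carrier G.
      act x (f [y, z]) - (f [x \<otimes>\<^bsub>G\<^esub> y, z] - (f [x, y \<otimes>\<^bsub>G\<^esub> z] - f [x, y])) = 0"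
    proof (intro ballI)
      fix x y z assume "x \<in> carrier G" "y \<in> carrier G" "z \<in> carrier G"
      then show "act x (f [y, z]) - (f [x \<otimes>\<^bsub>G\<^esub> y, z] - (f [x, y \<otimes>\<^bsub>G\<^esub> z] - f [x, y])) = 0"
        using fun_cong[OF d0, of "[x, y, z]"] by (simp add: dB_def)
    qed
  qed (auto simp: dB_def fun_eq_iff elim!: tuples_SucE)
  then show ?thesis by (auto simp: Zc_def algebra_simps)
qed

context neg_central
begin

text \<open>\<kappa> contracts a 2-cocycle with \<open>t\<close>, and its coboundary is 2F. Hence
  \<kappa> is additive modulo 2, and F is a coboundary exactly when \<kappa> is even. As \<kappa>
  vanishes at \<open>t\<close>, only its classes at \<open>al\<close> and \<open>be\<close> matter,
  and \<open>lift\<close> realises all of them.\<close>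

lemma H2: "qiso (Zc C d (Suc (Suc 0))) (Bc C d (Suc (Suc 0))) (N \<times> N) (dbl ` N \<times> dbl ` N)"
proof -
  define \<kappa> where "\<kappa> F x = F [x, t] - F [t, x]" for F :: "'e list \<Rightarrow> 'n" and x
  have \<kappa>N: "\<kappa> F x \<in> N" if "F \<in> C (Suc (Suc 0))" "x \<in> carrier E" for F x
    using CC_2_nth[OF that(1)] that(2) by (simp add: \<kappa>_def cl)
  \<comment> \<open>Three cocycle identities, with \<open>t\<close> inserted in each of the three
    positions. The sign with which \<open>t\<close> acts turns what would cancel into 2F.\<close>
  have d\<kappa>: "act x (\<kappa> F y) - \<kappa> F (x \<otimes> y) + \<kappa> F x = F [x, y] + F [x, y]"
    if F: "F \<in> Zc C d (Suc (Suc 0))" and xy: "x \<in> carrier E" "y \<in> carrier E" for F x y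
  proof -
    have FC: "F \<in> C (Suc (Suc 0))" and coc: "\<And>x y z. x \<in> carrier E \<Longrightarrow> y \<in> carrier E \<Longrightarrow> z \<in> carrier E \<Longrightarrow>
        act x (F [y, z]) + F [x, y \<otimes> z] = F [x \<otimes> y, z] + F [x, y]"
      using F by (auto simp: Zc2_iff)
    note FN = CC_2_nth[OF FC]
    have 1: "- F [x, y] + F [t, x \<otimes> y] = F [t \<otimes> x, y] + F [t, x]"
      using coc[of t x y] xy neg[OF FN[OF xy]] by simp
    have 2: "act x (F [t, y]) + F [x, t \<otimes> y] = F [t \<otimes> x, y] + F [x, t]"
      using coc[of x t y] xy central by simp
    have 3: "act x (F [y, t]) + F [x, t \<otimes> y] = F [x \<otimes> y, t] + F [x, y]"
      using coc[of x y t] xy central by simp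
    have "act x (\<kappa> F y) = act x (F [y, t]) - act x (F [t, y])"
      using gmodD(6)[OF M xy(1)] FN xy by (simp add: \<kappa>_def)
    also have "\<dots> = (F [x \<otimes> y, t] + F [x, y]) - (F [t \<otimes> x, y] + F [x, t])"
      using 2 3 by (metis add_diff_cancel_right)
    also have "F [t \<otimes> x, y] = - F [x, y] + F [t, x \<otimes> y] - F [t, x]" using 1 by (simp add: algebra_simps)
    finally show ?thesis by (simp add: \<kappa>_def algebra_simps)
  qed
  have \<kappa>B: "\<exists>h\<in>N. \<kappa> (d (Suc 0) u) x = h + h" if u: "u \<in> C (Suc 0)" and x: "x \<in> carrier E" for u x
  proof -
    note uN = CC_Suc0_nth[OF u]
    obtain h where h: "h \<in> N" "act x (u [t]) - u [t] = h + h" using mod2[OF x uN[of t]] by auto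
    have "\<kappa> (d (Suc 0) u) x = (act x (u [t]) - u [t]) + (u [x] + u [x])"
      using x central[OF x] neg[OF uN[OF x]] by (simp add: \<kappa>_def dB1_nth)
    also have "\<dots> = (h + u [x]) + (h + u [x])" unfolding h(2) by (simp add: algebra_simps)
    finally show ?thesis using cl(2)[OF h(1) uN[OF x]] by blast
  qed
  show ?thesis
  proof (rule qiso_map[OF addsub_Zc[OF cx], where f = "\<lambda>F. (\<kappa> F al, \<kappa> F be)"])
    show "add_on (Zc C d (Suc (Suc 0))) (\<lambda>F. (\<kappa> F al, \<kappa> F be))"
      by (rule add_onI) (simp add: \<kappa>_def algebra_simps)
    show "(\<lambda>F. (\<kappa> F al, \<kappa> F be)) ` Zc C d (Suc (Suc 0)) = N \<times> N"
    proof
      show "(\<lambda>F. (\<kappa> F al, \<kappa> F be)) ` Zc C d (Suc (Suc 0)) \<subseteq> N \<times> N"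
        using \<kappa>N by (auto simp: Zc_def)
      show "N \<times> N \<subseteq> (\<lambda>F. (\<kappa> F al, \<kappa> F be)) ` Zc C d (Suc (Suc 0))"
      proof clarify
        fix m1 m2 assume m: "m1 \<in> N" "m2 \<in> N"
        obtain u where u: "\<And>x. x \<in> carrier E \<Longrightarrow> u x \<in> N"
          "\<And>x y. x \<in> carrier E \<Longrightarrow> y \<in> carrier E \<Longrightarrow> u (x \<otimes> y) = u x + u y" "u t = 0" "u al = m1" "u be = m2"
          using lift[OF m] by blast
        define c where "c = (\<lambda>l. if l \<in> tuples E (Suc 0) then u (hd l) else 0)"
        have cC: "c \<in> C (Suc 0)" using u(1) by (auto simp: c_def CC_def tuples_1)
        have c1: "c [x] = u x" if "x \<in> carrier E" for x using that by (simp add: c_def)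
        have "\<exists>h\<in>N. d (Suc 0) c l = h + h" for l
        proof (cases "l \<in> tuples E (Suc (Suc 0))")
          case True
          then obtain x y where l: "l = [x, y]" "x \<in> carrier E" "y \<in> carrier E" by (auto elim!: tuples_SucE)
          have "d (Suc 0) c l = act x (u y) - u y" using l u(2) by (simp add: dB1_nth c1)
          then show ?thesis using mod2[OF l(2) u(1)[OF l(3)]] by simp
        qed (use addsub_zero[OF A] in \<open>auto simp: dB_def intro!: bexI[of _ 0]\<close>)
        \<comment> \<open>The coboundary of an additive map u sends (x, y) to x u(y) - u(y), which
          is even. Its half F is again a cocycle, need not be a coboundary, and has \<kappa> equal
          to u.\<close>
        then obtain F where F: "\<And>l. F l \<in> N" "\<And>l. d (Suc 0) c l = F l + F l" by metis
        have FC: "F \<in> C (Suc (Suc 0))"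
        proof -
          have "F l = 0" if "l \<notin> tuples E (Suc (Suc 0))" for l
            using torsion_free[OF F(1)] F(2)[of l] that by (simp add: dB_def)
          then show ?thesis using F(1) by (simp add: CC_def)
        qed
        have "d (Suc (Suc 0)) F l = 0" for l
        proof -
          have dF: "d (Suc (Suc 0)) F l \<in> N"
            by (rule CC_nth[OF cplxD(3)[OF cx FC] A])
          have "d (Suc 0) c = F + F" using F(2) by (simp add: fun_eq_iff)
          then have "d (Suc (Suc 0)) (F + F) = 0" using cplxD(4)[OF cx cC] by simp
          then have "d (Suc (Suc 0)) F l + d (Suc (Suc 0)) F l = 0"
            unfolding cplxD(6)[OF cx FC FC] by (simp add: fun_eq_iff)
          then show ?thesis by (rule torsion_free[OF dF])
        qed
        then have FZ: "F \<in> Zc C d (Suc (Suc 0))" using FC by (simp add: Zc_def fun_eq_iff)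
        have "\<kappa> F x = u x" if x: "x \<in> carrier E" for x
        proof (rule dbl_eq[OF \<kappa>N[OF FC x] u(1)[OF x]])
          have "\<kappa> F x + \<kappa> F x = d (Suc 0) c [x, t] - d (Suc 0) c [t, x]"
            unfolding F(2) by (simp add: \<kappa>_def)
          also have "\<dots> = u x + u x"
            using x central[OF x] neg[OF u(1)[OF x]] u(2,3) gmodD(9)[OF M x] by (simp add: dB1_nth c1)
          finally show "\<kappa> F x + \<kappa> F x = u x + u x" .
        qed
        then have "(m1, m2) = (\<kappa> F al, \<kappa> F be)" using u by simp
        then show "(m1, m2) \<in> (\<lambda>F. (\<kappa> F al, \<kappa> F be)) ` Zc C d (Suc (Suc 0))" using FZ by blast
      qed
    qed
    show "(\<kappa> F al, \<kappa> F be) \<in> dbl ` N \<times> dbl ` N \<longleftrightarrow> F \<in> Bc C d (Suc (Suc 0))"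
      if FZ: "F \<in> Zc C d (Suc (Suc 0))" for F
    proof
      assume "F \<in> Bc C d (Suc (Suc 0))"
      then show "(\<kappa> F al, \<kappa> F be) \<in> dbl ` N \<times> dbl ` N" using \<kappa>B[of _ al] \<kappa>B[of _ be] by auto
    next
      assume k: "(\<kappa> F al, \<kappa> F be) \<in> dbl ` N \<times> dbl ` N"
      have FC: "F \<in> C (Suc (Suc 0))" using FZ by (simp add: Zc_def)
      have "\<exists>h\<in>N. \<kappa> F x = h + h" if x: "x \<in> carrier E" for x
      proof (rule detect[OF _ _ _ _ _ x])
        show "\<forall>x\<in>carrier E. \<kappa> F x \<in> N" using \<kappa>N[OF FC] by blast
        show "\<forall>x\<in>carrier E. \<forall>y\<in>carrier E. \<exists>h\<in>N. \<kappa> F (x \<otimes> y) - \<kappa> F x - \<kappa> F y = h + h"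
        proof (intro ballI)
          fix x y assume xy: "x \<in> carrier E" "y \<in> carrier E"
          obtain h where h: "h \<in> N" "act x (\<kappa> F y) - \<kappa> F y = h + h" using mod2[OF xy(1) \<kappa>N[OF FC xy(2)]] by blast
          have "\<kappa> F (x \<otimes> y) - \<kappa> F x - \<kappa> F y = (act x (\<kappa> F y) - \<kappa> F y) - (F [x, y] + F [x, y])"
            unfolding d\<kappa>[OF FZ xy, symmetric] by (simp add: algebra_simps)
          also have "\<dots> = (h - F [x, y]) + (h - F [x, y])" unfolding h(2) by (simp add: algebra_simps)
          finally show "\<exists>h\<in>N. \<kappa> F (x \<otimes> y) - \<kappa> F x - \<kappa> F y = h + h"
            using cl(1)[OF h(1) CC_2_nth[OF FC xy]] by blast
        qed
        show "\<exists>h\<in>N. \<kappa> F t = h + h" using addsub_zero[OF A] by (auto simp: \<kappa>_def intro!: bexI[of _ 0])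
      qed (use k in auto)
      then obtain w where w: "\<And>x. x \<in> carrier E \<Longrightarrow> w x \<in> N" "\<And>x. x \<in> carrier E \<Longrightarrow> \<kappa> F x = w x + w x"
        by metis
      \<comment> \<open>With \<kappa> = 2w, the identity for the coboundary of \<kappa> reads 2 dw =
        2F, and \<open>N\<close> has no 2-torsion.\<close>
      define c where "c = (\<lambda>l. if l \<in> tuples E (Suc 0) then w (hd l) else 0)"
      have cC: "c \<in> C (Suc 0)" using w(1) by (auto simp: c_def CC_def tuples_1)
      have "F = d (Suc 0) c"
      proof (rule CC2_eqI[OF FC cplxD(3)[OF cx cC]])
        fix x y assume xy: "x \<in> carrier E" "y \<in> carrier E"
        have dc: "d (Suc 0) c [x, y] = act x (w y) - w (x \<otimes> y) + w x"
          using xy by (simp add: dB1_nth c_def)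
        show "F [x, y] = d (Suc 0) c [x, y]"
        proof (rule dbl_eq[OF CC_2_nth[OF FC xy]])
          show "d (Suc 0) c [x, y] \<in> N" unfolding dc using xy w(1) by (simp add: cl)
          have "act x (w y + w y) = act x (w y) + act x (w y)" using gmodD(7)[OF M xy(1)] w(1)[OF xy(2)] by simp
          then show "F [x, y] + F [x, y] = d (Suc 0) c [x, y] + d (Suc 0) c [x, y]"
            unfolding d\<kappa>[OF FZ xy, symmetric] dc using w(2) xy by (simp add: algebra_simps)
        qed
      qed
      then show "F \<in> Bc C d (Suc (Suc 0))" using cC by simp
    qed
  qed
qed

end

section \<open>Comparison of \<open>B\<^sub>\<Gamma>\<close> and \<open>\<Gamma>\<close>\<close>

abbreviation "actB \<equiv> \<lambda>b. SL2_act (lam b)"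

lemma H_Gamma_iso: "H_Gamma m n i \<cong> HH (CC (Gamma m) (Mn n)) (dB (Gamma m) SL2_act) i"
    "group (H_Gamma m n i)"
  unfolding H_Gamma_def M_deg_addgrp
  by (rule group_cohomology_iso[OF group_Gamma gmod_Gamma])+

lemma H_B_Gamma_iso: "H_B_Gamma m n i \<cong> HH (CC (B_Gamma m) (Mn n)) (dB (B_Gamma m) actB) i"
    "group (H_B_Gamma m n i)"
  unfolding H_B_Gamma_def M_deg_addgrp
  by (rule group_cohomology_iso[OF group_B_Gamma gmod_B_Gamma])+

lemma cplx_Gamma: "cplx (CC (Gamma m) (Mn n)) (dB (Gamma m) SL2_act)"
  by (rule cplx_bar[OF group_Gamma gmod_Gamma])

lemma cplx_B_Gamma: "cplx (CC (B_Gamma m) (Mn n)) (dB (B_Gamma m) actB)"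
  by (rule cplx_bar[OF group_B_Gamma gmod_B_Gamma])

lemma H_B_Gamma_isoI:
  assumes "hiso (CC (B_Gamma m) (Mn n)) (dB (B_Gamma m) actB) i (CC (Gamma m) (Mn n)) (dB (Gamma m) SL2_act) j"
  shows "H_B_Gamma m n i \<cong> H_Gamma m n j"
  using iso_trans[OF H_B_Gamma_iso(1) iso_trans[OF hiso_HH[OF assms cplx_B_Gamma cplx_Gamma]
      group.iso_sym[OF H_Gamma_iso(2) H_Gamma_iso(1)]]] .

lemma trivial_H_B_Gamma:
  assumes "Zc (CC (B_Gamma m) (Mn n)) (dB (B_Gamma m) actB) i \<subseteq> Bc (CC (B_Gamma m) (Mn n)) (dB (B_Gamma m) actB) i"
  shows "trivial_group (H_B_Gamma m n i)"
proof -
  have "trivial_group (HH (CC (B_Gamma m) (Mn n)) (dB (B_Gamma m) actB) i)"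
    unfolding HH_def using trivial_Quot[OF addsub_Zc addsub_Bc Bc_subset_Zc, OF cplx_B_Gamma cplx_B_Gamma cplx_B_Gamma assms] .
  then show ?thesis
    using isomorphic_group_triviality[OF H_B_Gamma_iso(1) H_B_Gamma_iso(2) group_HH[OF cplx_B_Gamma]] by simp
qed

lemma Gamma_lift:
  assumes "A \<in> carrier (Gamma m)"
  obtains x where "x \<in> carrier (B_Gamma m)" "lam x = A"
  using lam_surj[of A] assms by (metis carrier_B_Gamma carrier_Gamma)

text \<open>\<lambda> maps the braid subgroup onto \<Gamma>(m), so both groups have the same
  invariants in M_n.\<close>

lemma hiso_degree_0: "hiso (CC (B_Gamma m) (Mn n)) (dB (B_Gamma m) actB) 0 (CC (Gamma m) (Mn n)) (dB (Gamma m) SL2_act) 0"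
  unfolding hiso_def
proof (rule qiso_map[OF addsub_Zc[OF cplx_B_Gamma], where f = "\<lambda>f l. if l = [] then f [] else 0"])
  have inv: "(\<forall>x\<in>carrier (B_Gamma m). actB x f = f) \<longleftrightarrow> (\<forall>A\<in>carrier (Gamma m). SL2_act A f = f)" for f
    by (metis Gamma_lift carrier_B_Gamma)
  show "(\<lambda>f l. if l = [] then f [] else 0) ` Zc (CC (B_Gamma m) (Mn n)) (dB (B_Gamma m) actB) 0 =
    Zc (CC (Gamma m) (Mn n)) (dB (Gamma m) SL2_act) 0"
  proof
    show "Zc (CC (Gamma m) (Mn n)) (dB (Gamma m) SL2_act) 0 \<subseteq>
      (\<lambda>f l. if l = [] then f [] else 0) ` Zc (CC (B_Gamma m) (Mn n)) (dB (B_Gamma m) actB) 0"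
    proof
      fix f assume f: "f \<in> Zc (CC (Gamma m) (Mn n)) (dB (Gamma m) SL2_act) 0"
      let ?g = "\<lambda>l :: braid3 list. if l = [] then f [] else 0"
      have "?g \<in> Zc (CC (B_Gamma m) (Mn n)) (dB (B_Gamma m) actB) 0"
        using f inv unfolding Zc0_iff by (auto simp: CC_def)
      moreover have "f = (\<lambda>l. if l = [] then ?g [] else 0)"
        using f by (auto simp: Zc0_iff CC_def)
      ultimately show "f \<in> (\<lambda>f l. if l = [] then f [] else 0) ` Zc (CC (B_Gamma m) (Mn n)) (dB (B_Gamma m) actB) 0"
        by (intro image_eqI[of _ _ ?g])
    qed
    show "(\<lambda>f l. if l = [] then f [] else 0) ` Zc (CC (B_Gamma m) (Mn n)) (dB (B_Gamma m) actB) 0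
      \<subseteq> Zc (CC (Gamma m) (Mn n)) (dB (Gamma m) SL2_act) 0"
      using inv by (auto simp: Zc0_iff CC_def)
  qed
  show "(\<lambda>l. if l = [] then f [] else 0) \<in> Bc (CC (Gamma m) (Mn n)) (dB (Gamma m) SL2_act) 0 \<longleftrightarrow>
    f \<in> Bc (CC (B_Gamma m) (Mn n)) (dB (B_Gamma m) actB) 0"
    if "f \<in> Zc (CC (B_Gamma m) (Mn n)) (dB (B_Gamma m) actB) 0" for f
  proof -
    have "f l = 0" if "l \<noteq> []" for l
      using \<open>f \<in> Zc _ _ 0\<close> that by (simp add: Zc0_iff CC_def)
    then have "(\<lambda>l. if l = [] then f [] else 0 :: poly2) = 0 \<longleftrightarrow> f = 0"
      unfolding fun_eq_iff by (metis zero_fun_apply)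
    then show ?thesis unfolding Bc.simps singleton_iff fun_eq_iff zero_fun_apply by metis
  qed
qed (auto simp: add_on_def fun_eq_iff)

context central_ext
begin

lemma hiso_emb0_G:
  assumes "gmod E N act"
  shows "hiso (CC G (emb0 ` N)) (dB G (act0 act)) k (CC G N) (dB G act) k"
  by (rule hiso_sym[OF hiso_emb0[OF group_G gmod_G[OF assms]]])

text \<open>Dimension shifting proved \<open>qiso_trivial_t\<close> for the packed coefficient type;
  \<open>emb0\<close> transports it to any additive type.\<close>

lemma qiso_trivial_t':
  assumes M: "gmod E N act" and tt: "\<And>n. n \<in> N \<Longrightarrow> act t n = n"
  shows "qiso (Zc (CC E N) (dB E act) (Suc k)) (Bc (CC E N) (dB E act) (Suc k))
    (Zc (CC G N) (dB G act) (Suc k) \<times> Zc (CC G N) (dB G act) k)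
    (Bc (CC G N) (dB G act) (Suc k) \<times> Bc (CC G N) (dB G act) k)"
proof -
  have "act0 act t n = n" if "n \<in> emb0 ` N" for n
    using that tt by (auto simp: act0_def)
  then have 1: "qiso (Zc (CC E (emb0 ` N)) (dB E (act0 act)) (Suc k)) (Bc (CC E (emb0 ` N)) (dB E (act0 act)) (Suc k))
    (Zc (CC G (emb0 ` N)) (dB G (act0 act)) (Suc k) \<times> Zc (CC G (emb0 ` N)) (dB G (act0 act)) k)
    (Bc (CC G (emb0 ` N)) (dB G (act0 act)) (Suc k) \<times> Bc (CC G (emb0 ` N)) (dB G (act0 act)) k)"
    by (rule qiso_trivial_t[OF gmod_emb0[OF M]])
  show ?thesis
    by (rule qiso_trans[OF hiso_emb0[OF is_group M, unfolded hiso_def]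
          qiso_trans[OF 1 qiso_Times[OF hiso_emb0_G[OF M, unfolded hiso_def] hiso_emb0_G[OF M, unfolded hiso_def]]]])
qed

lemma vanish_E':
  fixes N :: "'n::ab_group_add set"
  assumes base: "\<And>(N :: ('e list \<Rightarrow> 'n) set) act. gmod G N act \<Longrightarrow>
       Zc (CC G N) (dB G act) 2 \<subseteq> Bc (CC G N) (dB G act) 2"
    and M: "gmod E N act" and k: "k \<ge> 3"
  shows "Zc (CC E N) (dB E act) k \<subseteq> Bc (CC E N) (dB E act) k"
  using qiso_trivial[OF hiso_emb0[OF is_group M, unfolded hiso_def] vanish_E[OF base gmod_emb0[OF M] k]] by blast

lemma pp_mult:
  assumes "x \<in> carrier E" "y \<in> carrier E"
  shows "pp (x \<otimes> y) = pp x \<otimes> pp y"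
proof -
  have "pp (x \<otimes> y) = inv (t [^] \<rho> y) \<otimes> inv (t [^] \<rho> x) \<otimes> (x \<otimes> y)"
    using assms by (simp add: pp_def rho_mult int_pow_mult inv_mult_group)
  also have "\<dots> = t [^] (- \<rho> y) \<otimes> (pp x \<otimes> y)"
    using assms by (simp add: pp_def m_assoc int_pow_neg)
  also have "\<dots> = (t [^] (- \<rho> y) \<otimes> pp x) \<otimes> y"
    using assms pp_H[of x] H_subset by (auto simp: m_assoc)
  also have "\<dots> = (pp x \<otimes> t [^] (- \<rho> y)) \<otimes> y"
    using central_pow[of "pp x"] assms pp_H[of x] H_subset by (simp add: subset_iff)
  also have "\<dots> = pp x \<otimes> pp y"
    using assms pp_H[of x] H_subset by (auto simp: m_assoc pp_def[of y] int_pow_neg)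
  finally show ?thesis .
qed

end

section \<open>The cohomology of the infinite cyclic group\<close>

text \<open>Prepending the identity to a tuple is a contracting homotopy when the group has no other
  element.\<close>

lemma trivial_group_acyclic:
  assumes G: "group G" and t: "carrier G = {\<one>\<^bsub>G\<^esub>}" and M: "gmod G N act" and k: "k > 0"
  shows "Zc (CC G N) (dB G act) k \<subseteq> Bc (CC G N) (dB G act) k"
proof
  interpret group G by (rule G)
  fix f assume f: "f \<in> Zc (CC G N) (dB G act) k"
  obtain j where j: "k = Suc j" using k by (cases k) auto
  have fC: "f \<in> CC G N (Suc j)" and df: "\<And>l. dB G act (Suc j) f l = 0"
    using f by (auto simp: Zc_def j fun_eq_iff)
  let ?e = "\<one>\<^bsub>G\<^esub>"
  define u where "u l = (if l \<in> tuples G j then f (?e # l) else 0)" for l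
  have u: "u \<in> CC G N j" using fC by (auto simp: u_def CC_def)
  have "dB G act j u = f"
  proof
    fix l
    show "dB G act j u l = f l"
    proof (cases "l \<in> tuples G (Suc j)")
      case True
      then obtain l' where l: "l = ?e # l'" "l' \<in> tuples G j" using t by (auto elim!: tuples_SucE)
      have fN: "f l \<in> N" using fC True by (simp add: CC_def)
      have "bar G u l = bar G (\<lambda>l. f (?e # l)) l"
        by (rule bar_cong[OF G True]) (simp add: u_def)
      moreover have "act ?e (f l) - (f l - bar G (\<lambda>l. f (?e # l)) l) = 0"
        using df[of "?e # l"] True l by (simp add: dB_def)
      moreover have "dB G act j u l = f l - bar G u l"
        using True l fN gmodD(5)[OF M] by (simp add: dB_def u_def)
      ultimately show ?thesis using gmodD(5)[OF M fN] by simp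
    qed (use fC in \<open>simp add: dB_def CC_def\<close>)
  qed
  then show "f \<in> Bc (CC G N) (dB G act) k" using u j by auto
qed

lemma HH_0_trivial_action:
  assumes G: "group G" and M: "gmod G N act" and tr: "\<And>x n. x \<in> carrier G \<Longrightarrow> n \<in> N \<Longrightarrow> act x n = n"
  shows "HH (CC G N) (dB G act) 0 \<cong> addgrp N"
  unfolding HH_def
proof (rule Quot_iso_hom[OF addsub_Zc[OF cplx_bar[OF G M]] group_addgrp[OF gmodD(1)[OF M]], where f = "\<lambda>f. f []"])
  have m: "(\<lambda>l. if l = [] then n else 0) \<in> Zc (CC G N) (dB G act) 0" if "n \<in> N" for n
    using that tr by (auto simp: Zc0_iff CC_def)
  show "(\<lambda>f. f []) ` Zc (CC G N) (dB G act) 0 = carrier (addgrp N)"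
  proof
    show "carrier (addgrp N) \<subseteq> (\<lambda>f. f []) ` Zc (CC G N) (dB G act) 0"
      using m by (force intro: image_eqI[of _ _ "\<lambda>l. if l = [] then _ else 0"])
  qed (auto simp: Zc0_iff CC_0_nth)
  show "f [] = \<one>\<^bsub>addgrp N\<^esub> \<longleftrightarrow> f \<in> Bc (CC G N) (dB G act) 0" if "f \<in> Zc (CC G N) (dB G act) 0" for f
    using that by (auto simp: Zc0_iff intro!: CC0_eqI[of f G N 0 G N]) (simp add: CC_def addsub_zero[OF gmodD(1)[OF M]])
qed (use cplxD(9)[OF cplx_bar[OF G M]] in \<open>auto simp: hom_def Zc0_iff CC_0_nth gmodD(9)[OF M]\<close>)

lemma Bc_1_trivial_action:
  assumes M: "gmod G N act" and tr: "\<And>x n. x \<in> carrier G \<Longrightarrow> n \<in> N \<Longrightarrow> act x n = n"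
  shows "Bc (CC G N) (dB G act) (Suc 0) = {0}"
proof -
  have "dB G act 0 m = 0" if "m \<in> CC G N 0" for m
  proof
    fix l show "dB G act 0 m l = 0 l"
      using tr CC_0_nth[OF that] by (cases "l \<in> tuples G (Suc 0)") (auto simp: tuples_1 dB0_nth, simp add: dB_def tuples_1)
  qed
  moreover have "0 \<in> CC G N 0" using addsub_zero[OF gmodD(1)[OF M]] by (simp add: CC_def)
  ultimately show ?thesis by (auto intro!: image_eqI[of _ _ 0])
qed

lemma gmod_Z: "gmod integer_group (UNIV :: int set) (\<lambda>_ z. z)"
  by (auto simp: gmod_def addsub_UNIV add_on_def)

lemma H_Z_iso: "H_Z i \<cong> HH (CC integer_group (UNIV :: int set)) (dB integer_group (\<lambda>_ z. z)) i" "group (H_Z i)"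
  using group_cohomology_iso[OF group_integer_group gmod_Z, of i] by (simp_all add: H_Z_def flip: integer_group_eq)

lemma H_Z_0: "H_Z 0 \<cong> integer_group"
  using iso_trans[OF H_Z_iso(1) HH_0_trivial_action[OF group_integer_group gmod_Z]] by (simp add: integer_group_eq)

lemma H_Z_1: "H_Z 1 \<cong> integer_group"
proof -
  let ?C = "CC integer_group (UNIV :: int set)" and ?d = "dB integer_group (\<lambda>_ z::int. z)"
  note cx = cplx_bar[OF group_integer_group gmod_Z]
  have add: "c [x + y] = c [x] + c [y]" if "c \<in> Zc ?C ?d (Suc 0)" for c and x y :: int
    using that by (simp add: Zc1_iff)
  have lin: "c [x] = x * c [1]" if c: "c \<in> Zc ?C ?d (Suc 0)" for c and x :: int
  proof (induction x rule: int_induct[where k = 0])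
    case base
    then show ?case using add[OF c, of 0 0] by simp
  next
    case (step1 i)
    then show ?case using add[OF c, of i 1] by (simp add: algebra_simps)
  next
    case (step2 i)
    then show ?case using add[OF c, of "i - 1" 1] by (simp add: algebra_simps)
  qed
  have "Quot (Zc ?C ?d (Suc 0)) (Bc ?C ?d (Suc 0)) \<cong> integer_group"
  proof (rule Quot_iso_hom[OF addsub_Zc[OF cx], where f = "\<lambda>c. c [1]"])
    show "(\<lambda>c. c [1]) ` Zc ?C ?d (Suc 0) = carrier integer_group"
    proof -
      have "a \<in> (\<lambda>c. c [1]) ` Zc ?C ?d (Suc 0)" for a
      proof (rule image_eqI[of _ _ "\<lambda>l. if l \<in> tuples integer_group (Suc 0) then hd l * a else 0"])
        show "(\<lambda>l. if l \<in> tuples integer_group (Suc 0) then hd l * a else 0) \<in> Zc ?C ?d (Suc 0)"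
          by (auto simp: Zc1_iff CC_def algebra_simps)
      qed simp
      then show ?thesis by auto
    qed
    have B: "Bc ?C ?d (Suc 0) = {0}" by (rule Bc_1_trivial_action[OF gmod_Z]) simp
    show "c [1] = \<one>\<^bsub>integer_group\<^esub> \<longleftrightarrow> c \<in> Bc ?C ?d (Suc 0)" if c: "c \<in> Zc ?C ?d (Suc 0)" for c
    proof -
      have cC: "c \<in> ?C (Suc 0)" using c by (simp add: Zc_def)
      have "c = 0" if "c [1] = 0"
        by (rule CC1_eqI[OF cC, of 0 UNIV]) (use lin[OF c] that in \<open>auto simp: CC_def\<close>)
      then show ?thesis unfolding B by auto
    qed
  qed (use Bc_subset_Zc[OF cx, of "Suc 0"] in \<open>auto simp: hom_def simp del: Bc.simps\<close>)
  then show ?thesis using iso_trans[OF H_Z_iso(1)[of 1]] by (simp add: HH_def)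
qed

lemma H_Z_trivial:
  assumes "i \<ge> 2"
  shows "trivial_group (H_Z i)"
proof -
  \<comment> \<open>The integers are a central extension with trivial kernel: \<rho> is the identity
    and t = 1. The cone over the trivial group then has cohomology only in degrees 0 and 1.\<close>
  interpret Z: central_ext integer_group id 1
    by (simp add: central_ext_def central_ext_axioms_def hom_def)
  have c: "carrier Z.G = {\<one>\<^bsub>Z.G\<^esub>}" by (simp add: Z.H_def)
  obtain k where k: "i = Suc (Suc k)" using assms by (metis Suc_le_D numeral_2_eq_2 Suc_le_mono)
  note q = Z.qiso_trivial_t'[OF gmod_Z, of "Suc k"]
  have v: "Zc (CC Z.G (UNIV :: int set)) (dB Z.G (\<lambda>_ z. z)) (Suc j) \<subseteq> Bc (CC Z.G UNIV) (dB Z.G (\<lambda>_ z. z)) (Suc j)" for j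
    by (rule trivial_group_acyclic[OF Z.group_G c Z.gmod_G[OF gmod_Z]]) simp
  note cx = cplx_bar[OF group_integer_group gmod_Z]
  have "Zc (CC integer_group (UNIV :: int set)) (dB integer_group (\<lambda>_ z. z)) i \<subseteq>
      Bc (CC integer_group UNIV) (dB integer_group (\<lambda>_ z. z)) i"
    unfolding k by (rule qiso_trivial[OF q]) (use v[of "Suc k"] v[of k] in blast)+
  from trivial_Quot[OF addsub_Zc[OF cx] addsub_Bc[OF cx] Bc_subset_Zc[OF cx] this]
  show ?thesis
    using isomorphic_group_triviality[OF H_Z_iso(1) H_Z_iso(2) group_HH[OF cx]] by (simp add: HH_def)
qed

lemma comm_group_H_Gamma: "comm_group (H_Gamma m n i)"
proof -
  have "HH (CC (Gamma m) (Mn n)) (dB (Gamma m) SL2_act) i \<cong> H_Gamma m n i"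
    by (rule group.iso_sym[OF H_Gamma_iso(2) H_Gamma_iso(1)])
  then show ?thesis
    by (rule comm_group.iso_imp_comm_group[OF comm_group_HH[OF cplx_Gamma]])
      (rule group.is_monoid[OF H_Gamma_iso(2)])
qed

lemma comm_group_H_Z: "comm_group (H_Z i)"
proof -
  have "HH (CC integer_group (UNIV :: int set)) (dB integer_group (\<lambda>_ z. z)) i \<cong> H_Z i"
    by (rule group.iso_sym[OF H_Z_iso(2) H_Z_iso(1)])
  then show ?thesis
    by (rule comm_group.iso_imp_comm_group[OF comm_group_HH[OF cplx_bar[OF group_integer_group gmod_Z]]])
      (rule group.is_monoid[OF H_Z_iso(2)])
qed

section \<open>Level \<open>m > 2\<close>\<close>

lemma B_Gamma_pow:
  assumes "x \<in> carrier (B_Gamma m)"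
  shows "x [^]\<^bsub>B_Gamma m\<^esub> (k::int) = x [^]\<^bsub>B3\<^esub> k"
proof -
  have "B_Gamma m = B3\<lparr>carrier := carrier (B_Gamma m)\<rparr>" by (simp add: B_Gamma_def)
  then show ?thesis using B3.int_pow_consistent[OF subgroup_B_Gamma assms, of k] by simp
qed

lemma HH_Times_H_Gamma:
  "Quot (Zc (CC (Gamma m) (Mn n)) (dB (Gamma m) SL2_act) i \<times> Zc (CC (Gamma m) (Mn n)) (dB (Gamma m) SL2_act) j)
     (Bc (CC (Gamma m) (Mn n)) (dB (Gamma m) SL2_act) i \<times> Bc (CC (Gamma m) (Mn n)) (dB (Gamma m) SL2_act) j)
   \<cong> H_Gamma m n i \<times>\<times> H_Gamma m n j"
proof -
  note cx = cplx_Gamma[of m n]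
  have s: "HH (CC (Gamma m) (Mn n)) (dB (Gamma m) SL2_act) i \<cong> H_Gamma m n i" for i
    by (rule group.iso_sym[OF H_Gamma_iso(2) H_Gamma_iso(1)])
  show ?thesis
    using iso_trans[OF Quot_Times[OF addsub_Zc[OF cx] addsub_Bc[OF cx] Bc_subset_Zc[OF cx]
          addsub_Zc[OF cx] addsub_Bc[OF cx] Bc_subset_Zc[OF cx]]
        group.DirProd_iso_trans[OF group_HH[OF cx] s[of i] s[of j], unfolded HH_def]] .
qed

text \<open>Restricted to ker \<rho>, the map \<lambda> is injective because its kernel is generated
  by z^2, on whose powers \<rho> is faithful; it stays onto \<Gamma>(m) because a power of z^2 can
  be split off without changing the matrix.\<close>

lemma H_B_Gamma_gt_2:
  assumes m: "m > 2"
  shows "H_B_Gamma m n k \<cong> graded_tensor (H_Gamma m n) H_Z k"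
proof -
  note gt = graded_tensor_exterior[of "H_Gamma m n" H_Z, OF comm_group_H_Gamma comm_group_H_Z H_Z_0 H_Z_1 H_Z_trivial]
  have gs: "X \<cong> graded_tensor (H_Gamma m n) H_Z i" if "graded_tensor (H_Gamma m n) H_Z i \<cong> X" for i and X :: "'x monoid"
    using group.iso_sym[OF gt(3) that] .
  interpret L: level_gt_2 m by unfold_locales (rule m)
  obtain \<rho> where \<rho>: "\<rho> \<in> hom (B_Gamma m) integer_group" "\<rho> (bz \<star> bz) = 1"
    by (rule L.retraction)
  have lzz: "lam (bz \<star> bz) = mat 1" by (simp add: lam_AB mat2_mult mat_1_eq)
  have zzc: "bz \<star> bz \<in> carrier (B_Gamma m)" using carrier_B_Gamma[of "bz \<star> bz" m] lzz by (simp add: carrier_Gamma)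
  have cen: "x \<star> bz \<star> bz = (bz \<star> bz) \<star> x" for x
  proof -
    have "x \<star> bz \<star> bz = (bz \<star> x) \<star> bz" by (simp only: B3.m_assoc[symmetric] B3_simps(1) bz_central[of x])
    also have "\<dots> = bz \<star> (bz \<star> x)" by (simp only: B3.m_assoc B3_simps(1) bz_central[of x])
    finally show ?thesis by (simp only: B3.m_assoc B3_simps(1))
  qed
  interpret E: central_ext "B_Gamma m" \<rho> "bz \<star> bz"
    by (simp add: central_ext_def central_ext_axioms_def group_B_Gamma \<rho> zzc cen)
  have lpow: "lam ((bz \<star> bz) [^]\<^bsub>B3\<^esub> (j::int)) = mat 1" for j
  proof -
    have "lam ((bz \<star> bz) [^]\<^bsub>B3\<^esub> j) = \<one>\<^bsub>SL2Z\<^esub> [^]\<^bsub>SL2Z\<^esub> j"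
      using lam.hom_int_pow[of "bz \<star> bz" j] lzz by simp
    then show ?thesis using SL2.int_pow_one[of j] by simp
  qed
  have HB: "x \<in> carrier (B_Gamma m)" if "x \<in> E.H" for x using that E.H_subset by auto
  have iso: "lam \<in> iso E.G (Gamma m)"
    unfolding iso_def bij_betw_def
  proof (intro CollectI conjI)
    show "lam \<in> hom E.G (Gamma m)" using HB by (auto simp: hom_def carrier_B_Gamma)
    show "inj_on lam (carrier E.G)"
    proof (rule inj_onI)
      fix x y assume xy: "x \<in> carrier E.G" "y \<in> carrier E.G" "lam x = lam y"
      have "lam (x \<star> inv\<^bsub>B3\<^esub> y) = lam (y \<star> inv\<^bsub>B3\<^esub> y)" by (simp only: lam_mult xy)
      then have "lam (x \<star> inv\<^bsub>B3\<^esub> y) = mat 1" by simp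
      then obtain j :: int where j: "x \<star> inv\<^bsub>B3\<^esub> y = (bz \<star> bz) [^]\<^bsub>B3\<^esub> j" by (rule kernel_lam)
      have x: "x = (bz \<star> bz) [^]\<^bsub>B3\<^esub> j \<star> y" unfolding j[symmetric] by (simp add: B3.m_assoc)
      have t: "(bz \<star> bz) [^]\<^bsub>B3\<^esub> j \<in> carrier (B_Gamma m)" "\<rho> ((bz \<star> bz) [^]\<^bsub>B3\<^esub> j) = j"
        using E.rho_pow[of j] E.int_pow_closed[OF E.t, of j] by (simp_all add: B_Gamma_pow[OF zzc])
      have "\<rho> x = j + \<rho> y" using E.rho_mult[OF t(1), of y] HB xy t(2) unfolding x by simp
      then have "j = 0" using xy by (simp add: E.H_def)
      then show "x = y" using x by simp
    qed
    show "lam ` carrier E.G = carrier (Gamma m)"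
    proof
      show "lam ` carrier E.G \<subseteq> carrier (Gamma m)" using HB by (auto simp: carrier_B_Gamma)
      show "carrier (Gamma m) \<subseteq> lam ` carrier E.G"
      proof
        fix A assume "A \<in> carrier (Gamma m)"
        then obtain x where x: "x \<in> carrier (B_Gamma m)" "lam x = A" by (rule Gamma_lift)
        have "lam (E.rr x \<star> E.pp x) = lam (E.pp x)"
          by (simp only: lam_mult E.rr_def B_Gamma_pow[OF zzc] lpow matrix_mul_lid)
        moreover have "E.rr x \<star> E.pp x = x" using E.rr_pp[OF x(1)] by simp
        ultimately have "A = lam (E.pp x)" using x(2) by (simp only:)
        then show "A \<in> lam ` carrier E.G" using E.pp_H[OF x(1)] by simp
      qed
    qed
  qed
  have GG: "hiso (CC E.G (Mn n)) (dB E.G actB) i (CC (Gamma m) (Mn n)) (dB (Gamma m) SL2_act) i" for i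
    by (rule hiso_sym[OF hiso_group_iso[OF E.group_G group_Gamma iso gmod_Gamma]])
  show ?thesis
  proof (cases k)
    case 0
    show ?thesis
      unfolding 0 by (rule iso_trans[OF H_B_Gamma_isoI[OF hiso_degree_0] gs[OF gt(1)]])
  next
    case (Suc j)
    have tr: "actB (bz \<star> bz) f = f" for f unfolding lzz by (rule SL2_act_one)
    note q = qiso_trans[OF E.qiso_trivial_t'[OF gmod_B_Gamma tr, of n j]
        qiso_Times[OF GG[unfolded hiso_def] GG[unfolded hiso_def]]]
    note cB = cplx_B_Gamma[of m n] and cG = cplx_Gamma[of m n]
    have "HH (CC (B_Gamma m) (Mn n)) (dB (B_Gamma m) actB) (Suc j) \<cong> H_Gamma m n (Suc j) \<times>\<times> H_Gamma m n j"
      unfolding HH_def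
      by (rule iso_trans[OF qiso_Quot[OF q] HH_Times_H_Gamma])
        (simp_all add: addsub_Zc[OF cB] Bc_subset_Zc[OF cB] addsub_Times addsub_Zc[OF cG] addsub_Bc[OF cG]
          Sigma_mono Bc_subset_Zc[OF cG] del: Bc.simps)
    then show ?thesis
      unfolding Suc by (rule iso_trans[OF H_B_Gamma_iso(1) iso_trans[OF _ gs[OF gt(2)]]])
  qed
qed

section \<open>Level 2\<close>

text \<open>Fixed once as a constant, since the interpretation of \<open>central_ext\<close> for the
  pure braid group is global and needs a named retraction.\<close>

definition rho2 :: "braid3 \<Rightarrow> int" where
  "rho2 = (SOME \<rho>. \<rho> \<in> hom (B_Gamma 2) integer_group \<and> \<rho> ba = 0 \<and> \<rho> bb = 0 \<and> \<rho> bz = 1)"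

lemma rho2: "rho2 \<in> hom (B_Gamma 2) integer_group" "rho2 ba = 0" "rho2 bb = 0" "rho2 bz = 1"
proof -
  have "\<exists>\<rho>. \<rho> \<in> hom (B_Gamma 2) integer_group \<and> \<rho> ba = 0 \<and> \<rho> bb = 0 \<and> \<rho> bz = 1"
    by (rule P3_universal[OF group_integer_group, of 0 0 1]) auto
  from someI_ex[OF this] show "rho2 \<in> hom (B_Gamma 2) integer_group" "rho2 ba = 0" "rho2 bb = 0" "rho2 bz = 1"
    unfolding rho2_def by auto
qed

interpretation P3: central_ext "B_Gamma 2" rho2 bz
  using bz_central
  by (simp add: central_ext_def central_ext_axioms_def group_B_Gamma rho2 P3_mem)

lemma ba_bb_H: "ba \<in> P3.H" "bb \<in> P3.H"
  by (simp_all add: P3.H_def P3_mem rho2)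

lemma inv_B_Gamma: "x \<in> carrier (B_Gamma m) \<Longrightarrow> inv\<^bsub>B_Gamma m\<^esub> x = inv\<^bsub>B3\<^esub> x"
  using B3.m_inv_consistent[OF subgroup_B_Gamma, of x m] by (simp add: B_Gamma_def)

lemma inv_B_Gamma_one [simp]: "inv\<^bsub>B_Gamma m\<^esub> \<one>\<^bsub>B3\<^esub> = \<one>\<^bsub>B3\<^esub>"
  by (simp add: inv_B_Gamma subgroup.one_closed[OF subgroup_B_Gamma])

lemma P3_hom_eq:
  assumes W: "group W" and \<phi>: "\<phi> \<in> hom (B_Gamma 2) W" and \<psi>: "\<psi> \<in> hom (B_Gamma 2) W"
    and eq: "\<phi> ba = \<psi> ba" "\<phi> bb = \<psi> bb" "\<phi> bz = \<psi> bz" and x: "x \<in> carrier (B_Gamma 2)"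
  shows "\<phi> x = \<psi> x"
proof -
  interpret \<phi>: group_hom "B_Gamma 2" W \<phi> by (simp add: group_hom_def group_hom_axioms_def group_B_Gamma W \<phi>)
  interpret \<psi>: group_hom "B_Gamma 2" W \<psi> by (simp add: group_hom_def group_hom_axioms_def group_B_Gamma W \<psi>)
  let ?K = "{x \<in> carrier (B_Gamma 2). \<phi> x = \<psi> x}"
  have "subgroup ?K B3"
  proof (rule B3.subgroupI)
    show "?K \<noteq> {}" using P3_mem eq by blast
    show "inv\<^bsub>B3\<^esub> x \<in> ?K" if "x \<in> ?K" for x
      using that \<phi>.hom_inv[of x] \<psi>.hom_inv[of x] subgroup.m_inv_closed[OF subgroup_B_Gamma, of x]
      by (simp add: inv_B_Gamma)
    show "x \<star> y \<in> ?K" if "x \<in> ?K" "y \<in> ?K" for x y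
      using that \<phi>.hom_mult[of x y] \<psi>.hom_mult[of x y] P3.m_closed[of x y] by simp
  qed (simp add: subset_iff)
  from P3_generate[OF this _ _ _ x] show ?thesis using P3_mem eq by simp
qed

lemma pp_hom: "P3.pp \<in> hom (B_Gamma 2) P3.G"
  using P3.pp_H P3.pp_mult by (simp add: hom_def)

lemma pp_gens: "P3.pp ba = ba" "P3.pp bb = bb" "P3.pp bz = \<one>\<^bsub>B3\<^esub>"
  using P3_mem P3.l_inv[OF P3_mem(3)] by (simp_all add: P3.pp_def rho2)

lemma pp_id: "x \<in> P3.H \<Longrightarrow> P3.pp x = x"
  by (simp add: P3.pp_def P3.H_def)

text \<open>The kernel of \<open>rho2\<close> is free on \<open>ba\<close> and \<open>bb\<close>; hence every extension of it splits.\<close>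

lemma two_cocycle_splits:
  assumes M: "gmod P3.G N act" and F: "F \<in> Zc (CC P3.G N) (dB P3.G act) (Suc (Suc 0))"
    and m: "m1 \<in> N" "m2 \<in> N"
  shows "\<exists>c\<in>CC P3.G N (Suc 0). dB P3.G act (Suc 0) c = F \<and> c [ba] = m1 \<and> c [bb] = m2"
proof -
  note A = gmodD(1)[OF M]
  have FC: "F \<in> CC P3.G N (Suc (Suc 0))"
    and coc: "\<And>x y z. x \<in> P3.H \<Longrightarrow> y \<in> P3.H \<Longrightarrow> z \<in> P3.H \<Longrightarrow>
        act x (F [y, z]) + F [x, y \<star> z] = F [x \<star> y, z] + F [x, y]"
    using F unfolding Zc2_iff by auto
  have FN: "F [x, y] \<in> N" if "x \<in> P3.H" "y \<in> P3.H" for x y using CC_2_nth[OF FC] that by simp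
  \<comment> \<open>The factor set is -F, so that a section x \<rightarrow> (c x, x) is
    multiplicative exactly when the coboundary of c is F.\<close>
  define W where "W = ext_group P3.G N act (\<lambda>x y. - F [x, y])"
  have W: "group W"
    unfolding W_def
  proof (rule group_ext_group[OF P3.group_G M])
    fix x y z assume xyz: "x \<in> carrier P3.G" "y \<in> carrier P3.G" "z \<in> carrier P3.G"
    show "act x (- F [y, z]) + - F [x, y \<otimes>\<^bsub>P3.G\<^esub> z] = - F [x \<otimes>\<^bsub>P3.G\<^esub> y, z] + - F [x, y]"
      using coc[of x y z] gmodD(8)[OF M xyz(1), of "F [y, z]"] FN xyz
      by (simp add: algebra_simps flip: minus_add_distrib)
  qed (use FN addsub_neg[OF A] in simp)
  interpret W: group W by (rule W)
  have Wc: "carrier W = N \<times> P3.H" by (simp add: W_def)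
  have Wm: "(m, x) \<otimes>\<^bsub>W\<^esub> (n, y) = (m + act x n + - F [x, y], x \<star> y)" for m x n y
    by (simp add: W_def)
  have g: "(m1, ba) \<in> carrier W" "(m2, bb) \<in> carrier W" using m ba_bb_H by (simp_all add: Wc)
  obtain f where f: "f \<in> hom (B_Gamma 2) W" "f ba = (m1, ba)" "f bb = (m2, bb)" "f bz = \<one>\<^bsub>W\<^esub>"
    by (rule P3_universal[OF W g W.one_closed]) (use g in simp_all)
  have fc: "f x \<in> carrier W" if "x \<in> carrier (B_Gamma 2)" for x using f(1) that by (auto simp: hom_def)
  have "snd \<in> hom W P3.G" by (auto simp: hom_def Wc Wm)
  then have sf: "(\<lambda>x. snd (f x)) \<in> hom (B_Gamma 2) P3.G" using hom_compose[OF f(1)] by (simp add: comp_def)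
  have snd_f: "snd (f x) = x" if "x \<in> P3.H" for x
  proof -
    \<comment> \<open>\<open>f\<close> kills \<open>bz\<close>, so composed with the projection it
      agrees with \<open>P3.pp\<close> on all three generators; on the kernel of \<open>rho2\<close>
      it is therefore a section.\<close>
    have "snd (f x) = P3.pp x"
      by (rule P3_hom_eq[OF P3.group_G sf pp_hom])
        (use that P3.H_subset in \<open>auto simp: f pp_gens W_def\<close>)
    then show ?thesis using pp_id[OF that] by simp
  qed
  have HE: "x \<in> P3.H \<Longrightarrow> x \<in> carrier (B_Gamma 2)" for x using P3.H_subset by auto
  define c where "c l = (if l \<in> tuples P3.G (Suc 0) then fst (f (hd l)) else 0)" for l
  have cC: "c \<in> CC P3.G N (Suc 0)"
    using fc HE by (force simp: CC_def c_def tuples_1 Wc)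
  have c1: "c [x] = fst (f x)" if "x \<in> P3.H" for x using that by (simp add: c_def)
  have "dB P3.G act (Suc 0) c = F"
  proof (rule CC2_eqI[OF cplxD(3)[OF cplx_bar[OF P3.group_G M] cC] FC])
    fix x y assume "x \<in> carrier P3.G" "y \<in> carrier P3.G"
    then have xy: "x \<in> P3.H" "y \<in> P3.H" by auto
    have xyH: "x \<star> y \<in> P3.H" using subgroup.m_closed[OF P3.subgroup_H xy] by simp
    have fx: "f x = (c [x], x)" "f y = (c [y], y)" "f (x \<star> y) = (c [x \<star> y], x \<star> y)"
      using snd_f xy xyH by (simp_all add: c1 prod_eq_iff)
    have "f (x \<star> y) = f x \<otimes>\<^bsub>W\<^esub> f y" using f(1) HE xy by (simp add: hom_def)
    then have "c [x \<star> y] = c [x] + act x (c [y]) - F [x, y]" by (simp add: fx Wm)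
    then show "dB P3.G act (Suc 0) c [x, y] = F [x, y]"
      using xy by (simp add: dB1_nth)
  qed
  then show ?thesis using cC c1[OF ba_bb_H(1)] c1[OF ba_bb_H(2)] f by auto
qed

lemma H2_free:
  assumes M: "gmod P3.G N act"
  shows "Zc (CC P3.G N) (dB P3.G act) 2 \<subseteq> Bc (CC P3.G N) (dB P3.G act) 2"
proof
  fix F assume F: "F \<in> Zc (CC P3.G N) (dB P3.G act) 2"
  have z: "0 \<in> N" by (rule addsub_zero[OF gmodD(1)[OF M]])
  show "F \<in> Bc (CC P3.G N) (dB P3.G act) 2"
    using two_cocycle_splits[OF M F[unfolded numeral_2_eq_2] z z] by (auto simp: numeral_2_eq_2)
qed

text \<open>A crossed homomorphism and the zero one give two homomorphisms to the semidirect product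
  of \<open>N\<close> and \<open>P3.G\<close>, precomposed with \<open>P3.pp\<close>; these agree on
  the generators of the pure braid group.\<close>

lemma crossed_unique:
  assumes M: "gmod P3.G N act" and c: "c \<in> Zc (CC P3.G N) (dB P3.G act) (Suc 0)"
    and z: "c [ba] = 0" "c [bb] = 0"
  shows "c = 0"
proof -
  note A = gmodD(1)[OF M]
  have cC: "c \<in> CC P3.G N (Suc 0)"
    and cm: "\<And>x y. x \<in> P3.H \<Longrightarrow> y \<in> P3.H \<Longrightarrow> c [x \<star> y] = c [x] + act x (c [y])"
    using c unfolding Zc1_iff[OF P3.group_G] by auto
  have c1: "c [\<one>\<^bsub>B3\<^esub>] = 0" using crossed_one_inv(1)[OF P3.group_G M c] by simp
  define W where "W = ext_group P3.G N act (\<lambda>_ _. 0)"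
  have W: "group W"
    unfolding W_def by (rule group_ext_group[OF P3.group_G M]) (use addsub_zero[OF A] in \<open>simp_all add: gmodD(9)[OF M]\<close>)
  have cN: "c [x] \<in> N" if "x \<in> P3.H" for x using CC_Suc0_nth[OF cC] that by simp
  have h1: "(\<lambda>x. (c [P3.pp x], P3.pp x)) \<in> hom (B_Gamma 2) W"
    using P3.pp_H P3.pp_mult cN by (auto simp: hom_def W_def cm)
  have h2: "(\<lambda>x. (0, P3.pp x)) \<in> hom (B_Gamma 2) W"
    using P3.pp_H P3.pp_mult addsub_zero[OF A] by (auto simp: hom_def W_def gmodD(9)[OF M])
  have "c [x] = 0" if "x \<in> P3.H" for x
  proof -
    have "(c [P3.pp x], P3.pp x) = (0, P3.pp x)"
      by (rule P3_hom_eq[OF W h1 h2]) (use that P3.H_subset in \<open>auto simp: pp_gens z c1\<close>)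
    then show ?thesis by (simp add: pp_id that)
  qed
  then show "c = 0"
    by (intro CC1_eqI[OF cC, of 0 N]) (simp_all add: CC_def addsub_zero[OF A])
qed

lemma vanish_P3:
  assumes "k \<ge> 3"
  shows "trivial_group (H_B_Gamma 2 n k)"
  by (rule trivial_H_B_Gamma, rule P3.vanish_E'[OF H2_free gmod_B_Gamma assms])

lemma act_bz: "f \<in> Mn n \<Longrightarrow> actB bz f = (if even n then f else - f)"
  by (simp add: lam_AB SL2_act_minus_one)

lemma qiso_drop_trivial:
  assumes "Z1 \<subseteq> B1" "addsub Z1" "addsub Z2"
  shows "qiso (Z1 \<times> Z2) (B1 \<times> B2) Z2 B2" "qiso (Z2 \<times> Z1) (B2 \<times> B1) Z2 B2"
proof -
  note z = addsub_zero[OF assms(2)]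
  show "qiso (Z1 \<times> Z2) (B1 \<times> B2) Z2 B2"
    by (rule qiso_map[where f = snd]) (use assms z in \<open>auto simp: addsub_Times add_on_def\<close>)
  show "qiso (Z2 \<times> Z1) (B2 \<times> B1) Z2 B2"
    by (rule qiso_map[where f = fst]) (use assms z in \<open>auto simp: addsub_Times add_on_def\<close>)
qed

abbreviation "CP n \<equiv> CC (B_Gamma 2) (Mn n)"
abbreviation "dP \<equiv> dB (B_Gamma 2) actB"
abbreviation "CG n \<equiv> CC P3.G (Mn n)"
abbreviation "dG \<equiv> dB P3.G actB"
abbreviation "CM n \<equiv> CC (Gamma 2) (Mn n)"
abbreviation "dM \<equiv> dB (Gamma 2) SL2_act"

lemmas gmod_PG = P3.gmod_G[OF gmod_B_Gamma]
lemmas cplx_PG = cplx_bar[OF P3.group_G gmod_PG]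

text \<open>In even degree z acts trivially, so H^2 is the sum of H^2 and H^1 of the free group, and
  the former vanishes.\<close>

lemma H2_even:
  assumes "even n"
  shows "qiso (Zc (CP n) dP (Suc (Suc 0))) (Bc (CP n) dP (Suc (Suc 0)))
    (Zc (CG n) dG (Suc 0)) (Bc (CG n) dG (Suc 0))"
proof (rule qiso_trans[OF P3.qiso_trivial_t'[OF gmod_B_Gamma]])
  show "actB bz f = f" if "f \<in> Mn n" for f using act_bz[OF that] assms by simp
  show "qiso (Zc (CG n) dG (Suc (Suc 0)) \<times> Zc (CG n) dG (Suc 0)) (Bc (CG n) dG (Suc (Suc 0)) \<times> Bc (CG n) dG (Suc 0))
     (Zc (CG n) dG (Suc 0)) (Bc (CG n) dG (Suc 0))"
    using H2_free[OF gmod_PG] by (intro qiso_drop_trivial addsub_Zc[OF cplx_PG]) (simp add: numeral_2_eq_2)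
qed

subsection \<open>Trivial coefficients\<close>

text \<open>With trivial action H^1 is the group of homomorphisms, given by free values at
  \<open>ba\<close>, \<open>bb\<close>, \<open>bz\<close> for the pure braid group and at
  \<open>ba\<close>, \<open>bb\<close> for the free group; H^2 is the latter by
  \<open>H2_even\<close>. The constant coefficient \<phi> identifies M_0 with the integers.\<close>

lemma case_a:
  "H_B_Gamma 2 0 0 \<cong> integer_group"
  "H_B_Gamma 2 0 1 \<cong> integer_group \<times>\<times> integer_group \<times>\<times> integer_group"
  "H_B_Gamma 2 0 2 \<cong> integer_group \<times>\<times> integer_group"
proof -
  have tr: "actB x f = f" if "f \<in> Mn 0" for x f by (rule SL2_act_Mn_0[OF that])
  note cP = cplx_B_Gamma[of 2 0] and gP = gmod_B_Gamma[of 2 0]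
  have "HH (CP 0) dP 0 \<cong> addgrp (Mn 0)" by (rule HH_0_trivial_action[OF group_B_Gamma gP tr])
  then show "H_B_Gamma 2 0 0 \<cong> integer_group"
    using iso_trans[OF H_B_Gamma_iso(1) iso_trans[OF _ Mn_0_iso]] by blast
  define \<phi> where "\<phi> f = Poly_Mapping.lookup f (0, 0)" for f :: poly2
  have \<phi>d: "\<phi> (f + g) = \<phi> f + \<phi> g" for f g by (simp add: \<phi>_def lookup_add)
  have \<phi>0: "\<phi> f = 0 \<longleftrightarrow> f = 0" if "f \<in> Mn 0" for f
    using that unfolding Mn_0_iff \<phi>_def by (metis lookup_zero single_zero)
  have \<phi>s: "\<phi> (Poly_Mapping.single (0, 0) a) = a" "Poly_Mapping.single (0, 0) a \<in> Mn 0" for a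
    by (auto simp: \<phi>_def Mn_def split: if_splits)
  have "Quot (Zc (CP 0) dP (Suc 0)) (Bc (CP 0) dP (Suc 0)) \<cong> integer_group \<times>\<times> integer_group \<times>\<times> integer_group"
  proof (rule Quot_iso_hom[OF addsub_Zc[OF cP], where f = "\<lambda>c. (\<phi> (c [ba]), \<phi> (c [bb]), \<phi> (c [bz]))"])
    show "group (integer_group \<times>\<times> integer_group \<times>\<times> integer_group)" by (intro DirProd_group group_integer_group)
    show "(\<lambda>c. (\<phi> (c [ba]), \<phi> (c [bb]), \<phi> (c [bz]))) \<in>
        hom (addgrp (Zc (CP 0) dP (Suc 0))) (integer_group \<times>\<times> integer_group \<times>\<times> integer_group)"
      by (rule hom_addgrpI) (simp_all add: \<phi>d)
    show "(\<lambda>c. (\<phi> (c [ba]), \<phi> (c [bb]), \<phi> (c [bz]))) ` Zc (CP 0) dP (Suc 0) =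
        carrier (integer_group \<times>\<times> integer_group \<times>\<times> integer_group)"
    proof -
      have "(a1, a2, a3) \<in> (\<lambda>c. (\<phi> (c [ba]), \<phi> (c [bb]), \<phi> (c [bz]))) ` Zc (CP 0) dP (Suc 0)" for a1 a2 a3
      proof -
        let ?s = "\<lambda>a. Poly_Mapping.single (0::nat, 0::nat) a"
        obtain f where f: "f \<in> hom (B_Gamma 2) (addgrp (Mn 0))" "f ba = ?s a1" "f bb = ?s a2" "f bz = ?s a3"
          by (rule P3_universal[OF group_addgrp[OF addsub_Mn], of "?s a1" 0 "?s a2" "?s a3"])
            (simp_all add: \<phi>s add.commute)
        let ?c = "\<lambda>l. if l \<in> tuples (B_Gamma 2) (Suc 0) then f (hd l) else 0"
        have "?c \<in> Zc (CP 0) dP (Suc 0)"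
          unfolding Zc1_iff[OF group_B_Gamma] using f(1) P3.m_closed
          by (auto simp: CC_def tuples_1 hom_def tr Pi_def)
        moreover have "(a1, a2, a3) = (\<phi> (?c [ba]), \<phi> (?c [bb]), \<phi> (?c [bz]))"
          using P3_mem by (simp add: f \<phi>s)
        ultimately show ?thesis by (intro image_eqI[of _ _ ?c])
      qed
      then show ?thesis by auto
    qed
    have B: "Bc (CP 0) dP (Suc 0) = {0}" by (rule Bc_1_trivial_action[OF gP tr])
    show "(\<phi> (c [ba]), \<phi> (c [bb]), \<phi> (c [bz])) = \<one>\<^bsub>integer_group \<times>\<times> integer_group \<times>\<times> integer_group\<^esub>
        \<longleftrightarrow> c \<in> Bc (CP 0) dP (Suc 0)" if c: "c \<in> Zc (CP 0) dP (Suc 0)" for c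
    proof
      assume z: "(\<phi> (c [ba]), \<phi> (c [bb]), \<phi> (c [bz])) = \<one>\<^bsub>integer_group \<times>\<times> integer_group \<times>\<times> integer_group\<^esub>"
      have cC: "c \<in> CP 0 (Suc 0)" and cm: "\<And>x y. x \<in> carrier (B_Gamma 2) \<Longrightarrow> y \<in> carrier (B_Gamma 2) \<Longrightarrow>
          c [x \<star> y] = c [x] + actB x (c [y])"
        using c unfolding Zc1_iff[OF group_B_Gamma] by auto
      have cN: "c [x] \<in> Mn 0" if "x \<in> carrier (B_Gamma 2)" for x using CC_Suc0_nth[OF cC that] .
      have c0: "c [ba] = 0" "c [bb] = 0" "c [bz] = 0"
        using z \<phi>0 cN[OF P3_mem(1)] cN[OF P3_mem(2)] cN[OF P3_mem(3)] by auto
      have h1: "(\<lambda>x. c [x]) \<in> hom (B_Gamma 2) (addgrp (Mn 0))" using cN cm tr by (auto simp: hom_def)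
      have h2: "(\<lambda>x. 0) \<in> hom (B_Gamma 2) (addgrp (Mn 0))" by (simp add: hom_def addsub_zero[OF addsub_Mn])
      have "c [x] = 0" if "x \<in> carrier (B_Gamma 2)" for x
        by (rule P3_hom_eq[OF group_addgrp[OF addsub_Mn] h1 h2 c0 that])
      then have "c = 0" by (intro CC1_eqI[OF cC, of 0 "Mn 0"]) (simp_all add: CC_def addsub_zero[OF addsub_Mn])
      then show "c \<in> Bc (CP 0) dP (Suc 0)" by (simp only: B singleton_iff)
    next
      assume "c \<in> Bc (CP 0) dP (Suc 0)"
      then have "c = 0" by (simp only: B singleton_iff)
      then show "(\<phi> (c [ba]), \<phi> (c [bb]), \<phi> (c [bz])) = \<one>\<^bsub>integer_group \<times>\<times> integer_group \<times>\<times> integer_group\<^esub>"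
        by (simp add: \<phi>_def)
    qed
  qed (rule Bc_subset_Zc[OF cP])
  then show "H_B_Gamma 2 0 1 \<cong> integer_group \<times>\<times> integer_group \<times>\<times> integer_group"
    using iso_trans[OF H_B_Gamma_iso(1)[of 2 0 1]] by (simp add: HH_def)
  have "Quot (Zc (CG 0) dG (Suc 0)) (Bc (CG 0) dG (Suc 0)) \<cong> integer_group \<times>\<times> integer_group"
  proof (rule Quot_iso_hom[OF addsub_Zc[OF cplx_PG], where f = "\<lambda>c. (\<phi> (c [ba]), \<phi> (c [bb]))"])
    show "group (integer_group \<times>\<times> integer_group)" by (intro DirProd_group group_integer_group)
    show "(\<lambda>c. (\<phi> (c [ba]), \<phi> (c [bb]))) \<in> hom (addgrp (Zc (CG 0) dG (Suc 0))) (integer_group \<times>\<times> integer_group)"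
      by (rule hom_addgrpI) (simp_all add: \<phi>d)
    show "(\<lambda>c. (\<phi> (c [ba]), \<phi> (c [bb]))) ` Zc (CG 0) dG (Suc 0) = carrier (integer_group \<times>\<times> integer_group)"
    proof -
      have "(a1, a2) \<in> (\<lambda>c. (\<phi> (c [ba]), \<phi> (c [bb]))) ` Zc (CG 0) dG (Suc 0)" for a1 a2
      proof -
        \<comment> \<open>A splitting of the zero 2-cocycle with prescribed values at
          \<open>ba\<close> and \<open>bb\<close> is a 1-cocycle with these values.\<close>
        have "0 \<in> Zc (CG 0) dG (Suc (Suc 0))" by (rule addsub_zero[OF addsub_Zc[OF cplx_PG]])
        from two_cocycle_splits[OF gmod_PG this \<phi>s(2) \<phi>s(2), of a1 a2]
        obtain c where "c \<in> Zc (CG 0) dG (Suc 0)" "c [ba] = Poly_Mapping.single (0, 0) a1" "c [bb] = Poly_Mapping.single (0, 0) a2"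
          by (auto simp: Zc_def)
        then show ?thesis by (intro image_eqI[of _ _ c]) (simp_all add: \<phi>s)
      qed
      then show ?thesis by auto
    qed
    have B: "Bc (CG 0) dG (Suc 0) = {0}" by (rule Bc_1_trivial_action[OF gmod_PG tr])
    show "(\<phi> (c [ba]), \<phi> (c [bb])) = \<one>\<^bsub>integer_group \<times>\<times> integer_group\<^esub> \<longleftrightarrow> c \<in> Bc (CG 0) dG (Suc 0)"
      if c: "c \<in> Zc (CG 0) dG (Suc 0)" for c
    proof
      assume z: "(\<phi> (c [ba]), \<phi> (c [bb])) = \<one>\<^bsub>integer_group \<times>\<times> integer_group\<^esub>"
      have cC: "c \<in> CG 0 (Suc 0)" using c by (simp add: Zc_def)
      have "c [ba] = 0" "c [bb] = 0"
        using z \<phi>0 CC_Suc0_nth[OF cC, of ba] CC_Suc0_nth[OF cC, of bb] ba_bb_H by auto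
      then have "c = 0" by (rule crossed_unique[OF gmod_PG c])
      then show "c \<in> Bc (CG 0) dG (Suc 0)" by (simp only: B singleton_iff)
    next
      assume "c \<in> Bc (CG 0) dG (Suc 0)"
      then have "c = 0" by (simp only: B singleton_iff)
      then show "(\<phi> (c [ba]), \<phi> (c [bb])) = \<one>\<^bsub>integer_group \<times>\<times> integer_group\<^esub>" by (simp add: \<phi>_def)
    qed
  qed (rule Bc_subset_Zc[OF cplx_PG])
  moreover have "HH (CP 0) dP (Suc (Suc 0)) \<cong> HH (CG 0) dG (Suc 0)"
    by (rule hiso_HH[OF _ cP cplx_PG]) (simp only: hiso_def H2_even even_zero)
  ultimately show "H_B_Gamma 2 0 2 \<cong> integer_group \<times>\<times> integer_group"
    using iso_trans[OF H_B_Gamma_iso(1)[of 2 0 2] iso_trans] by (simp add: HH_def numeral_2_eq_2)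
qed

subsection \<open>Even degree\<close>

lemma P3_invariants:
  assumes f: "f \<in> Mn n" and n: "n > 0" and i: "actB ba f = f" "actB bb f = f"
  shows "f = 0"
  using Mn_invariants[OF f n] i by (simp add: lam_ba_bb)

lemma kernel_lam_P3:
  assumes "x \<in> carrier (B_Gamma 2)" "y \<in> carrier (B_Gamma 2)" "lam x = lam y"
  obtains k :: int where "x = bz [^]\<^bsub>B3\<^esub> k \<star> y" "bz [^]\<^bsub>B3\<^esub> k \<in> carrier (B_Gamma 2)"
proof -
  have "lam (x \<star> inv\<^bsub>B3\<^esub> y) = lam (y \<star> inv\<^bsub>B3\<^esub> y)" by (simp only: lam_mult assms)
  then have "lam (x \<star> inv\<^bsub>B3\<^esub> y) = mat 1" by simp
  then obtain j :: int where j: "x \<star> inv\<^bsub>B3\<^esub> y = (bz \<star> bz) [^]\<^bsub>B3\<^esub> j" by (rule kernel_lam)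
  have "bz \<star> bz = bz [^]\<^bsub>B3\<^esub> (2::int)" using B3.int_pow_mult[of bz 1 1] by simp
  then have "(bz \<star> bz) [^]\<^bsub>B3\<^esub> j = bz [^]\<^bsub>B3\<^esub> (j * 2)" using B3.int_pow_pow[of bz 2 j] by (simp add: mult.commute)
  then have "x = bz [^]\<^bsub>B3\<^esub> (j * 2) \<star> y" using j by (metis B3.inv_solve_right B3_simps(1))
  moreover have "bz [^]\<^bsub>B3\<^esub> (j * 2) \<in> carrier (B_Gamma 2)"
    using P3.int_pow_closed[OF P3_mem(3)] by (simp add: B_Gamma_pow[OF P3_mem(3)])
  ultimately show ?thesis using that by blast
qed

text \<open>Inflation along \<lambda> is onto: comparing c(xz) with c(zx), where z acts trivially,
  shows that c(z) is invariant, hence 0 as n > 0. So c vanishes on all powers of z, among them the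
  kernel of \<lambda>, and depends only on the matrix.\<close>

lemma H1_inflation:
  assumes n: "even n" "n > 0"
  shows "hiso (CM n) dM (Suc 0) (CP n) dP (Suc 0)"
  unfolding hiso_def
proof (rule qiso_map[OF addsub_Zc[OF cplx_Gamma],
      where f = "\<lambda>c l. if l \<in> tuples (B_Gamma 2) (Suc 0) then c [lam (hd l)] else 0"])
  let ?e = "\<lambda>c l. if l \<in> tuples (B_Gamma 2) (Suc 0) then c [lam (hd l)] else 0"
  have lG: "lam x \<in> carrier (Gamma 2)" if "x \<in> carrier (B_Gamma 2)" for x using that by (simp add: carrier_B_Gamma)
  show "add_on (Zc (CM n) dM (Suc 0)) ?e" by (rule add_onI) (auto simp: fun_eq_iff)
  show "?e ` Zc (CM n) dM (Suc 0) = Zc (CP n) dP (Suc 0)"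
  proof
    show "?e ` Zc (CM n) dM (Suc 0) \<subseteq> Zc (CP n) dP (Suc 0)"
      using lG P3.m_closed by (auto simp: Zc1_iff[OF group_Gamma] Zc1_iff[OF group_B_Gamma] CC_def tuples_1)
    show "Zc (CP n) dP (Suc 0) \<subseteq> ?e ` Zc (CM n) dM (Suc 0)"
    proof
      fix c assume c: "c \<in> Zc (CP n) dP (Suc 0)"
      have cC: "c \<in> CP n (Suc 0)" and cm: "\<And>x y. x \<in> carrier (B_Gamma 2) \<Longrightarrow> y \<in> carrier (B_Gamma 2) \<Longrightarrow>
          c [x \<star> y] = c [x] + actB x (c [y])"
        using c unfolding Zc1_iff[OF group_B_Gamma] by auto
      note cN = CC_Suc0_nth[OF cC]
      have inv: "actB x (c [bz]) = c [bz]" if x: "x \<in> carrier (B_Gamma 2)" for x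
        using cm[OF x P3_mem(3)] cm[OF P3_mem(3) x] bz_central[of x] act_bz[OF cN[OF x]] n by simp
      have z0: "c [bz] = 0"
        by (rule P3_invariants[OF cN[OF P3_mem(3)] n(2) inv[OF P3_mem(1)] inv[OF P3_mem(2)]])
      have zk: "c [bz [^]\<^bsub>B3\<^esub> (k::int)] = 0" for k
      proof -
        have "subgroup {x \<in> carrier (B_Gamma 2). c [x] = 0} (B_Gamma 2)"
        proof (rule P3.subgroupI)
          show "{x \<in> carrier (B_Gamma 2). c [x] = 0} \<noteq> {}" using z0 P3_mem by blast
          show "inv\<^bsub>B_Gamma 2\<^esub> x \<in> {x \<in> carrier (B_Gamma 2). c [x] = 0}"
            if "x \<in> {x \<in> carrier (B_Gamma 2). c [x] = 0}" for x
            using crossed_one_inv(2)[OF group_B_Gamma gmod_B_Gamma c, of x] that by auto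
          show "x \<otimes>\<^bsub>B_Gamma 2\<^esub> y \<in> {x \<in> carrier (B_Gamma 2). c [x] = 0}"
            if "x \<in> {x \<in> carrier (B_Gamma 2). c [x] = 0}" "y \<in> {x \<in> carrier (B_Gamma 2). c [x] = 0}" for x y
            using that cm[of x y] P3.m_closed[of x y] gmodD(9)[OF gmod_B_Gamma[of 2 n], of x] by simp
        qed simp
        from P3.subgroup_int_pow_closed[OF this, of bz k] z0 P3_mem(3)
        show ?thesis by (simp add: B_Gamma_pow[OF P3_mem(3)])
      qed
      have fac: "c [x] = c [y]" if xy: "x \<in> carrier (B_Gamma 2)" "y \<in> carrier (B_Gamma 2)" "lam x = lam y" for x y
      proof -
        obtain k :: int where k: "x = bz [^]\<^bsub>B3\<^esub> k \<star> y" "bz [^]\<^bsub>B3\<^esub> k \<in> carrier (B_Gamma 2)"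
          by (rule kernel_lam_P3[OF xy])
        have "lam (bz [^]\<^bsub>B3\<^esub> k) = mat 1 \<or> lam (bz [^]\<^bsub>B3\<^esub> k) = lam bz"
          by (simp add: lam_bz_pow lam_AB)
        then have "actB (bz [^]\<^bsub>B3\<^esub> k) (c [y]) = c [y]"
          using act_bz[OF cN[OF xy(2)]] n SL2_act_one by auto
        then show ?thesis unfolding k(1) cm[OF k(2) xy(2)] zk by simp
      qed
      define s where "s A = (SOME x. x \<in> carrier (B_Gamma 2) \<and> lam x = A)" for A
      have s: "s A \<in> carrier (B_Gamma 2) \<and> lam (s A) = A" if "A \<in> carrier (Gamma 2)" for A
        unfolding s_def by (rule someI_ex) (metis Gamma_lift that)
      define c' where "c' l = (if l \<in> tuples (Gamma 2) (Suc 0) then c [s (hd l)] else 0)" for l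
      have c'1: "c' [lam x] = c [x]" if x: "x \<in> carrier (B_Gamma 2)" for x
        using fac[of "s (lam x)" x] s[OF lG[OF x]] x lG[OF x] by (simp add: c'_def)
      have c'Z: "c' \<in> Zc (CM n) dM (Suc 0)"
        unfolding Zc1_iff[OF group_Gamma]
      proof (intro conjI ballI)
        show "c' \<in> CM n (Suc 0)" using cN s by (auto simp: CC_def c'_def tuples_1)
        fix A B assume "A \<in> carrier (Gamma 2)" "B \<in> carrier (Gamma 2)"
        then obtain x y where xy: "x \<in> carrier (B_Gamma 2)" "lam x = A" "y \<in> carrier (B_Gamma 2)" "lam y = B"
          by (metis Gamma_lift)
        have "c' [lam (x \<star> y)] = c' [lam x] + SL2_act (lam x) (c' [lam y])"
          using cm[OF xy(1,3)] c'1[OF xy(1)] c'1[OF xy(3)] c'1[of "x \<star> y"] P3.m_closed[OF xy(1,3)] by simp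
        then show "c' [A \<otimes>\<^bsub>Gamma 2\<^esub> B] = c' [A] + SL2_act A (c' [B])" by (simp add: xy)
      qed
      have "c = ?e c'"
      proof
        fix l show "c l = ?e c' l"
          using c'1 cC by (cases "l \<in> tuples (B_Gamma 2) (Suc 0)") (auto simp: tuples_1 CC_def)
      qed
      then show "c \<in> ?e ` Zc (CM n) dM (Suc 0)" using c'Z by (rule image_eqI)
    qed
  qed
  show "?e c \<in> Bc (CP n) dP (Suc 0) \<longleftrightarrow> c \<in> Bc (CM n) dM (Suc 0)" if c: "c \<in> Zc (CM n) dM (Suc 0)" for c
  proof
    assume "?e c \<in> Bc (CP n) dP (Suc 0)"
    then obtain m where m: "m \<in> CP n 0" "?e c = dP 0 m" by auto
    let ?m = "\<lambda>l. if l = [] then m [] else 0"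
    have mC: "?m \<in> CM n 0" using CC_0_nth[OF m(1)] by (simp add: CC_def)
    have "c = dM 0 ?m"
    proof (rule CC1_eqI)
      show "c \<in> CM n (Suc 0)" using c by (simp add: Zc_def)
      show "dM 0 ?m \<in> CM n (Suc 0)" by (rule cplxD(3)[OF cplx_Gamma mC])
      fix A assume "A \<in> carrier (Gamma 2)"
      then obtain x where x: "x \<in> carrier (B_Gamma 2)" "lam x = A" by (rule Gamma_lift)
      have "c [A] = ?e c [x]" using x by simp
      also have "\<dots> = dP 0 m [x]" by (rule fun_cong[OF m(2)])
      also have "\<dots> = dM 0 ?m [A]" using x lG[OF x(1)] by (simp add: dB0_nth)
      finally show "c [A] = dM 0 ?m [A]" .
    qed
    then show "c \<in> Bc (CM n) dM (Suc 0)" using mC by simp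
  next
    assume "c \<in> Bc (CM n) dM (Suc 0)"
    then obtain m where m: "m \<in> CM n 0" "c = dM 0 m" by auto
    let ?m = "\<lambda>l. if l = [] then m [] else 0"
    have mC: "?m \<in> CP n 0" using CC_0_nth[OF m(1)] by (simp add: CC_def)
    have "?e c = dP 0 ?m"
    proof
      fix l show "?e c l = dP 0 ?m l"
        using lG by (cases "l \<in> tuples (B_Gamma 2) (Suc 0)") (auto simp: tuples_1 m(2) dB0_nth, simp add: dB_def tuples_1)
    qed
    then show "?e c \<in> Bc (CP n) dP (Suc 0)" using mC by simp
  qed
qed

lemma case_b:
  assumes n: "even n" "n > 0"
  shows "H_B_Gamma 2 n 0 \<cong> H_Gamma 2 n 0" "H_B_Gamma 2 n 1 \<cong> H_Gamma 2 n 1"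
    "H_B_Gamma 2 n 2 \<cong> H_Gamma 2 n 1"
proof -
  show "H_B_Gamma 2 n 0 \<cong> H_Gamma 2 n 0" by (rule H_B_Gamma_isoI[OF hiso_degree_0])
  have inf: "hiso (CP n) dP (Suc 0) (CM n) dM (Suc 0)" by (rule hiso_sym[OF H1_inflation[OF n]])
  show "H_B_Gamma 2 n 1 \<cong> H_Gamma 2 n 1" using H_B_Gamma_isoI[OF inf] by simp
  \<comment> \<open>The free group has no invariants in M_n, so H^1 of the pure braid group reduces
    to H^1 of the free group. By \<open>H2_even\<close> its H^2 is that same group, and H^1 also
    matches \<Gamma>(2) by inflation.\<close>
  have "Zc (CG n) dG 0 \<subseteq> Bc (CG n) dG 0"
  proof
    fix f assume "f \<in> Zc (CG n) dG 0"
    then have f: "f \<in> CG n 0" "\<And>x. x \<in> P3.H \<Longrightarrow> actB x (f []) = f []" by (auto simp: Zc0_iff)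
    have "f [] = 0" by (rule P3_invariants[OF CC_0_nth[OF f(1)] n(2)]) (use f(2) ba_bb_H in auto)
    then have "f = 0" by (intro CC0_eqI[OF f(1), of 0 P3.G "Mn n"]) (simp_all add: CC_def addsub_zero[OF addsub_Mn])
    then show "f \<in> Bc (CG n) dG 0" by simp
  qed
  then have "qiso (Zc (CG n) dG (Suc 0) \<times> Zc (CG n) dG 0) (Bc (CG n) dG (Suc 0) \<times> Bc (CG n) dG 0)
      (Zc (CG n) dG (Suc 0)) (Bc (CG n) dG (Suc 0))"
    by (intro qiso_drop_trivial(2) addsub_Zc[OF cplx_PG])
  moreover have "actB bz f = f" if "f \<in> Mn n" for f using act_bz[OF that] n by simp
  ultimately have "hiso (CP n) dP (Suc 0) (CG n) dG (Suc 0)"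
    unfolding hiso_def by (rule qiso_trans[OF P3.qiso_trivial_t'[OF gmod_B_Gamma], rotated])
  then have "hiso (CG n) dG (Suc 0) (CM n) dM (Suc 0)" by (rule hiso_trans[OF hiso_sym inf])
  moreover have "hiso (CP n) dP (Suc (Suc 0)) (CG n) dG (Suc 0)"
    unfolding hiso_def by (rule H2_even[OF n(1)])
  ultimately have "hiso (CP n) dP (Suc (Suc 0)) (CM n) dM (Suc 0)" by (rule hiso_trans[rotated])
  from H_B_Gamma_isoI[OF this] show "H_B_Gamma 2 n 2 \<cong> H_Gamma 2 n 1" by (simp add: numeral_2_eq_2)
qed

subsection \<open>Odd degree\<close>

text \<open>\<open>k\<close> is a homomorphism modulo doubles, so the elements with even value form
  a subgroup, which contains the three generators.\<close>

lemma even_subgroup: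
  assumes N: "addsub N" and k: "\<And>x. x \<in> carrier (B_Gamma 2) \<Longrightarrow> k x \<in> (N :: 'n::ab_group_add set)"
    and q: "\<And>x y. x \<in> carrier (B_Gamma 2) \<Longrightarrow> y \<in> carrier (B_Gamma 2) \<Longrightarrow> \<exists>h\<in>N. k (x \<star> y) - k x - k y = h + h"
    and g: "\<exists>h\<in>N. k bz = h + h" "\<exists>h\<in>N. k ba = h + h" "\<exists>h\<in>N. k bb = h + h"
    and x: "x \<in> carrier (B_Gamma 2)"
  shows "\<exists>h\<in>N. k x = h + h"
proof -
  have oc: "\<one>\<^bsub>B3\<^esub> \<in> carrier (B_Gamma 2)" by (rule subgroup.one_closed[OF subgroup_B_Gamma])
  \<comment> \<open>Evenness at the identity follows from near-additivity at (1, 1), where the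
    defect is -k(1).\<close>
  obtain h0 where h0: "h0 \<in> N" "k \<one>\<^bsub>B3\<^esub> = h0 + h0"
  proof -
    obtain h where "h \<in> N" "k (\<one>\<^bsub>B3\<^esub> \<star> \<one>\<^bsub>B3\<^esub>) - k \<one>\<^bsub>B3\<^esub> - k \<one>\<^bsub>B3\<^esub> = h + h" using q[OF oc oc] by blast
    then have "- h \<in> N" "- k \<one>\<^bsub>B3\<^esub> = h + h" using addsub_neg[OF N] by simp_all
    then have "- h \<in> N" "k \<one>\<^bsub>B3\<^esub> = - h + - h" by (simp_all add: minus_equation_iff[of "k _"])
    then show ?thesis using that by blast
  qed
  let ?K = "{x \<in> carrier (B_Gamma 2). \<exists>h\<in>N. k x = h + h}"
  have "subgroup ?K B3"
  proof (rule B3.subgroupI)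
    show "?K \<noteq> {}" using P3_mem g by blast
    show "inv\<^bsub>B3\<^esub> x \<in> ?K" if xK: "x \<in> ?K" for x
    proof -
      obtain h where x: "x \<in> carrier (B_Gamma 2)" and h: "h \<in> N" "k x = h + h" using xK by blast
      have ix: "inv\<^bsub>B3\<^esub> x \<in> carrier (B_Gamma 2)" by (rule subgroup.m_inv_closed[OF subgroup_B_Gamma x])
      obtain h' where h': "h' \<in> N" "k (x \<star> inv\<^bsub>B3\<^esub> x) - k x - k (inv\<^bsub>B3\<^esub> x) = h' + h'"
        using q[OF x ix] by blast
      have "k (inv\<^bsub>B3\<^esub> x) = (h0 - h - h') + (h0 - h - h')"
        using h'(2) h h0 by (simp add: algebra_simps)
      moreover have "h0 - h - h' \<in> N" using h h' h0 by (simp add: addsub_diff[OF N])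
      ultimately show ?thesis using ix by blast
    qed
    show "x \<star> y \<in> ?K" if xyK: "x \<in> ?K" "y \<in> ?K" for x y
    proof -
      obtain h h1 where x: "x \<in> carrier (B_Gamma 2)" "y \<in> carrier (B_Gamma 2)"
        and h: "h \<in> N" "k x = h + h" "h1 \<in> N" "k y = h1 + h1" using xyK by blast
      obtain h' where h': "h' \<in> N" "k (x \<star> y) - k x - k y = h' + h'" using q[OF x] by blast
      have "k (x \<star> y) = (h + h1 + h') + (h + h1 + h')" using h h'(2) by (simp add: algebra_simps)
      moreover have "h + h1 + h' \<in> N" using h h' by (simp add: addsub_add[OF N])
      moreover have "x \<star> y \<in> carrier (B_Gamma 2)" by (rule subgroup.m_closed[OF subgroup_B_Gamma x])
      ultimately show ?thesis by blast
    qed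
  qed (simp add: subset_iff)
  from P3_generate[OF this _ _ _ x] show ?thesis using P3_mem g by blast
qed

lemma P3_hom_lift:
  assumes m: "m1 \<in> Mn n" "m2 \<in> Mn n"
  shows "\<exists>u. (\<forall>x\<in>carrier (B_Gamma 2). u x \<in> Mn n) \<and>
    (\<forall>x\<in>carrier (B_Gamma 2). \<forall>y\<in>carrier (B_Gamma 2). u (x \<star> y) = u x + u y) \<and>
    u bz = 0 \<and> u ba = m1 \<and> u bb = m2"
proof -
  obtain f where f: "f \<in> hom (B_Gamma 2) (addgrp (Mn n))" "f ba = m1" "f bb = m2" "f bz = 0"
    by (rule P3_universal[OF group_addgrp[OF addsub_Mn], of m1 n m2 0])
      (simp_all add: m addsub_zero[OF addsub_Mn])
  show ?thesis by (intro exI[of _ f]) (use f in \<open>auto simp: hom_def\<close>)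
qed

lemma neg_central_P3:
  assumes n: "odd n"
  shows "neg_central (B_Gamma 2) (Mn n) actB bz ba bb"
  unfolding neg_central_def neg_central_axioms_def
proof (intro conjI allI impI group_B_Gamma gmod_B_Gamma P3_mem)
  show "x \<otimes>\<^bsub>B_Gamma 2\<^esub> bz = bz \<otimes>\<^bsub>B_Gamma 2\<^esub> x" for x by (simp add: bz_central)
  show "actB bz f = - f" if "f \<in> Mn n" for f using act_bz[OF that] n by simp
  show "f = 0" if "f + f = 0" for f :: poly2 using double_eq_zero[OF that] .
  show "\<exists>h\<in>Mn n. actB x f - f = h + h" if "x \<in> carrier (B_Gamma 2)" "f \<in> Mn n" for x f
    using Gamma2_acts_trivially_mod_2[OF _ that(2)] that(1) by (simp add: carrier_B_Gamma)
  show "\<exists>u. (\<forall>x\<in>carrier (B_Gamma 2). u x \<in> Mn n) \<and>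
      (\<forall>x\<in>carrier (B_Gamma 2). \<forall>y\<in>carrier (B_Gamma 2). u (x \<otimes>\<^bsub>B_Gamma 2\<^esub> y) = u x + u y) \<and>
      u bz = 0 \<and> u ba = m1 \<and> u bb = m2" if m: "m1 \<in> Mn n" "m2 \<in> Mn n" for m1 m2
    using P3_hom_lift[OF m] by simp
  show "\<exists>h\<in>Mn n. k x = h + h"
    if "\<forall>x\<in>carrier (B_Gamma 2). k x \<in> Mn n"
      "\<forall>x\<in>carrier (B_Gamma 2). \<forall>y\<in>carrier (B_Gamma 2). \<exists>h\<in>Mn n. k (x \<otimes>\<^bsub>B_Gamma 2\<^esub> y) - k x - k y = h + h"
      "\<exists>h\<in>Mn n. k bz = h + h" "\<exists>h\<in>Mn n. k ba = h + h" "\<exists>h\<in>Mn n. k bb = h + h"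
      "x \<in> carrier (B_Gamma 2)" for k x
    by (rule even_subgroup[OF addsub_Mn _ _ that(3-6)]) (use that(1,2) in auto)
qed

lemma lam_Gamma2: "x \<in> carrier (B_Gamma 2) \<Longrightarrow> lam x \<in> carrier (Gamma 2)"
  by (simp add: carrier_B_Gamma)

text \<open>The hypotheses descend from the pure braid group: an additive map killing z kills the
  kernel of \<lambda>, so it factors through \<Gamma>(2), while evenness of a map on \<Gamma>(2) is
  tested after pulling back along \<lambda>.\<close>

lemma neg_central_Gamma2:
  assumes n: "odd n"
  shows "neg_central (Gamma 2) (Mn n) SL2_act (lam bz) (lam ba) (lam bb)"
  unfolding neg_central_def neg_central_axioms_def
proof (intro conjI allI impI group_Gamma gmod_Gamma lam_Gamma2 P3_mem)
  show "A \<otimes>\<^bsub>Gamma 2\<^esub> lam bz = lam bz \<otimes>\<^bsub>Gamma 2\<^esub> A" if A: "A \<in> carrier (Gamma 2)" for A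
  proof -
    obtain x where "lam x = A" using A by (rule Gamma_lift)
    then show ?thesis using bz_central[of x] by (metis Gamma_ops(1) lam_mult)
  qed
  show "SL2_act (lam bz) f = - f" if "f \<in> Mn n" for f using act_bz[OF that] n by simp
  show "f = 0" if "f + f = 0" for f :: poly2 using double_eq_zero[OF that] .
  show "\<exists>h\<in>Mn n. SL2_act A f - f = h + h" if "A \<in> carrier (Gamma 2)" "f \<in> Mn n" for A f
    using Gamma2_acts_trivially_mod_2[OF that] .
  show "\<exists>u. (\<forall>x\<in>carrier (Gamma 2). u x \<in> Mn n) \<and>
      (\<forall>x\<in>carrier (Gamma 2). \<forall>y\<in>carrier (Gamma 2). u (x \<otimes>\<^bsub>Gamma 2\<^esub> y) = u x + u y) \<and>
      u (lam bz) = 0 \<and> u (lam ba) = m1 \<and> u (lam bb) = m2" if m: "m1 \<in> Mn n" "m2 \<in> Mn n" for m1 m2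
  proof -
    obtain u where u: "\<And>x. x \<in> carrier (B_Gamma 2) \<Longrightarrow> u x \<in> Mn n"
      "\<And>x y. x \<in> carrier (B_Gamma 2) \<Longrightarrow> y \<in> carrier (B_Gamma 2) \<Longrightarrow> u (x \<star> y) = u x + u y"
      "u bz = 0" "u ba = m1" "u bb = m2" using P3_hom_lift[OF m] by metis
    have uh: "u \<in> hom (B_Gamma 2) (addgrp (Mn n))" using u by (auto simp: hom_def)
    interpret h: group_hom "B_Gamma 2" "addgrp (Mn n)" u
      by (simp add: group_hom_def group_hom_axioms_def group_B_Gamma group_addgrp addsub_Mn uh)
    have uz: "u (bz [^]\<^bsub>B3\<^esub> (k::int)) = 0" for k
    proof -
      have "u (bz [^]\<^bsub>B3\<^esub> k) = \<one>\<^bsub>addgrp (Mn n)\<^esub> [^]\<^bsub>addgrp (Mn n)\<^esub> k"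
        using h.hom_int_pow[OF P3_mem(3), of k] by (simp add: u B_Gamma_pow[OF P3_mem(3)])
      then show ?thesis using h.H.int_pow_one[of k] by simp
    qed
    have fac: "u x = u y" if xy: "x \<in> carrier (B_Gamma 2)" "y \<in> carrier (B_Gamma 2)" "lam x = lam y" for x y
    proof -
      obtain k :: int where k: "x = bz [^]\<^bsub>B3\<^esub> k \<star> y" "bz [^]\<^bsub>B3\<^esub> k \<in> carrier (B_Gamma 2)"
        by (rule kernel_lam_P3[OF xy])
      show ?thesis unfolding k(1) u(2)[OF k(2) xy(2)] uz by simp
    qed
    define s where "s A = (SOME x. x \<in> carrier (B_Gamma 2) \<and> lam x = A)" for A
    have s: "s A \<in> carrier (B_Gamma 2) \<and> lam (s A) = A" if "A \<in> carrier (Gamma 2)" for A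
      unfolding s_def by (rule someI_ex) (metis Gamma_lift that)
    have us: "u (s (lam x)) = u x" if "x \<in> carrier (B_Gamma 2)" for x
      using fac[of "s (lam x)" x] s[OF lam_Gamma2[OF that]] that by blast
    have "u (s (A ** B)) = u (s A) + u (s B)" if AB: "A \<in> carrier (Gamma 2)" "B \<in> carrier (Gamma 2)" for A B
    proof -
      have "u (s (lam (s A \<star> s B))) = u (s A) + u (s B)"
        using us[of "s A \<star> s B"] u(2)[of "s A" "s B"] s[OF AB(1)] s[OF AB(2)]
          P3.m_closed[of "s A" "s B"] by simp
      then show ?thesis using s[OF AB(1)] s[OF AB(2)] by simp
    qed
    then show ?thesis
      using u us P3_mem s by (intro exI[of _ "\<lambda>A. u (s A)"]) auto
  qed
  show "\<exists>h\<in>Mn n. k A = h + h"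
    if "\<forall>x\<in>carrier (Gamma 2). k x \<in> Mn n"
      "\<forall>x\<in>carrier (Gamma 2). \<forall>y\<in>carrier (Gamma 2). \<exists>h\<in>Mn n. k (x \<otimes>\<^bsub>Gamma 2\<^esub> y) - k x - k y = h + h"
      "\<exists>h\<in>Mn n. k (lam bz) = h + h" "\<exists>h\<in>Mn n. k (lam ba) = h + h" "\<exists>h\<in>Mn n. k (lam bb) = h + h"
      and A: "A \<in> carrier (Gamma 2)" for k A
  proof -
    obtain x where x: "x \<in> carrier (B_Gamma 2)" "lam x = A" using A by (rule Gamma_lift)
    have "\<exists>h\<in>Mn n. k (lam x) = h + h"
      by (rule even_subgroup[OF addsub_Mn, of "\<lambda>x. k (lam x)"]) (use that(1-5) lam_Gamma2 x in auto)
    then show ?thesis by (simp add: x)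
  qed
qed

lemma case_c:
  assumes n: "odd n"
  shows "H_B_Gamma 2 n 1 \<cong> H_Gamma 2 n 1"
    "H_Gamma 2 n 1 \<cong> tensor_group (M_deg n) (integer_mod_group 2)"
    "H_B_Gamma 2 n 2 \<cong> H_Gamma 2 n 2"
    "H_Gamma 2 n 2 \<cong> tensor_group (M_deg n \<times>\<times> M_deg n) (integer_mod_group 2)"
    "trivial_group (H_B_Gamma 2 n 0)"
proof -
  interpret P: neg_central "B_Gamma 2" "Mn n" actB bz ba bb by (rule neg_central_P3[OF n])
  interpret Q: neg_central "Gamma 2" "Mn n" SL2_act "lam bz" "lam ba" "lam bb" by (rule neg_central_Gamma2[OF n])
  \<comment> \<open>Both groups satisfy \<open>neg_central\<close> with the same module, so their
    cohomology is compared through the common quotient of M_n by doubles; in degree 2 two copies of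
    it appear.\<close>
  have "hiso (CP n) dP (Suc 0) (CM n) dM (Suc 0)"
    unfolding hiso_def by (rule qiso_trans[OF P.H1 qiso_sym[OF Q.H1]])
  then show "H_B_Gamma 2 n 1 \<cong> H_Gamma 2 n 1" using H_B_Gamma_isoI by fastforce
  have "hiso (CP n) dP (Suc (Suc 0)) (CM n) dM (Suc (Suc 0))"
    unfolding hiso_def by (rule qiso_trans[OF P.H2 qiso_sym[OF Q.H2]])
  from H_B_Gamma_isoI[OF this] show "H_B_Gamma 2 n 2 \<cong> H_Gamma 2 n 2" by (simp add: numeral_2_eq_2)
  show "trivial_group (H_B_Gamma 2 n 0)" by (rule trivial_H_B_Gamma[OF P.H0_trivial])
  let ?D = "(\<lambda>x. x + x) ` Mn n"
  have D: "addsub ?D" "?D \<subseteq> Mn n"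
    by (rule P.addsub_dbl) (intro image_subsetI addsub_add[OF addsub_Mn])
  note cM = cplx_Gamma[of 2 n]
  have "HH (CM n) dM (Suc 0) \<cong> Quot (Mn n) ?D"
    unfolding HH_def
    by (rule qiso_Quot[OF Q.H1 addsub_Zc[OF cM] Bc_subset_Zc[OF cM] addsub_Mn D])
  then have "H_Gamma 2 n 1 \<cong> Quot (Mn n) ?D" using iso_trans[OF H_Gamma_iso(1)[of 2 n 1]] by simp
  from iso_trans[OF this tensor_group_mod_2[OF addsub_Mn]]
  show "H_Gamma 2 n 1 \<cong> tensor_group (M_deg n) (integer_mod_group 2)" by (simp only: M_deg_addgrp)
  have MM: "M_deg n \<times>\<times> M_deg n = addgrp (Mn n \<times> Mn n)"
    by (auto simp: M_deg_addgrp DirProd_def addgrp_def zero_prod_def fun_eq_iff)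
  have "HH (CM n) dM (Suc (Suc 0)) \<cong> Quot (Mn n \<times> Mn n) (?D \<times> ?D)"
    unfolding HH_def
    by (rule qiso_Quot[OF Q.H2 addsub_Zc[OF cM] Bc_subset_Zc[OF cM] addsub_Times[OF addsub_Mn addsub_Mn]
          addsub_Times[OF D(1) D(1)] Sigma_mono[OF D(2) D(2)]])
  moreover have "?D \<times> ?D = (\<lambda>x. x + x) ` (Mn n \<times> Mn n)" by force
  ultimately have "HH (CM n) dM 2 \<cong> tensor_group (addgrp (Mn n \<times> Mn n)) (integer_mod_group 2)"
    using iso_trans tensor_group_mod_2[OF addsub_Times[OF addsub_Mn addsub_Mn]] by (simp only: numeral_2_eq_2) blast
  then show "H_Gamma 2 n 2 \<cong> tensor_group (M_deg n \<times>\<times> M_deg n) (integer_mod_group 2)"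
    unfolding MM by (rule iso_trans[OF H_Gamma_iso(1)])
qed

section \<open>The theorem\<close>

theorem theorem2p17:
  fixes m :: int and n :: nat
  assumes "m \<ge> 2"
  shows
    "(m = 2 \<and> n = 0 \<longrightarrow>
        H_B_Gamma m n 0 \<cong> integer_group \<and>
        H_B_Gamma m n 1 \<cong> integer_group \<times>\<times> integer_group \<times>\<times> integer_group \<and>
        H_B_Gamma m n 2 \<cong> integer_group \<times>\<times> integer_group \<and>
        (\<forall>i. i \<notin> {0, 1, 2} \<longrightarrow> trivial_group (H_B_Gamma m n i))) \<and>
     (m = 2 \<and> even n \<and> n > 0 \<longrightarrow>
        H_B_Gamma m n 0 \<cong> H_Gamma m n 0 \<and>
        H_B_Gamma m n 1 \<cong> H_Gamma m n 1 \<and>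
        H_B_Gamma m n 2 \<cong> H_Gamma m n 1 \<and>
        (\<forall>i. i \<notin> {0, 1, 2} \<longrightarrow> trivial_group (H_B_Gamma m n i))) \<and>
     (m = 2 \<and> odd n \<longrightarrow>
        H_B_Gamma m n 1 \<cong> H_Gamma m n 1 \<and>
        H_Gamma m n 1 \<cong> tensor_group (M_deg n) (integer_mod_group 2) \<and>
        H_B_Gamma m n 2 \<cong> H_Gamma m n 2 \<and>
        H_Gamma m n 2 \<cong> tensor_group (M_deg n \<times>\<times> M_deg n) (integer_mod_group 2) \<and>
        (\<forall>i. i \<notin> {1, 2} \<longrightarrow> trivial_group (H_B_Gamma m n i))) \<and>
     (m > 2 \<longrightarrow>
        (\<forall>k. H_B_Gamma m n k \<cong> graded_tensor (H_Gamma m n) H_Z k))"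
proof (intro conjI impI allI)
  fix i :: nat
  assume "m = 2 \<and> odd n" "i \<notin> {1, 2}"
  then show "trivial_group (H_B_Gamma m n i)"
    using case_c(5) vanish_P3[of i n] by (cases "i = 0") auto
qed (use case_a case_b case_c vanish_P3 H_B_Gamma_gt_2 in auto)

end
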